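(* Let $p$ be a prime and let $l \geq 1$. Let $P_1(t), \ldots, P_l(t) \in \mathbb{Z}_p[t]$ be monic polynomials whose reductions modulo $p$ in $\mathbb{F}_p[t]$ are distinct and irreducible, and let $H_j$ be a finite module over $R_j := \mathbb{Z}_p[t]/(P_j(t))$ for each $1 \leq j \leq l$. Then $$ \lim_{n \rightarrow \infty} \operatorname{Prob}_{A \in \mathrm{M}_n(\mathbb{Z}_p)} \bigl( \operatorname{cok}(P_j(A)) \cong H_j \text{ for all } 1 \leq j \leq l \bigr) = \prod_{j=1}^{l} \left( \frac{1}{|\operatorname{Aut}_{R_j}(H_j)|} \prod_{i=1}^{\infty} \bigl(1 - p^{-i \deg(P_j)}\bigr) \right), $$ where the isomorphisms $\operatorname{cok}(P_j(A)) \cong H_j$ are isomorphisms of $R_j$-modules.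
   Context: $\mathrm{M}_n(\mathbb{Z}_p)$ is the set of $n \times n$ matrices over the $p$-adic integers $\mathbb{Z}_p$, and $\operatorname{Prob}_{A \in \mathrm{M}_n(\mathbb{Z}_p)}$ denotes probability with respect to the Haar probability measure on $\mathrm{M}_n(\mathbb{Z}_p)$. For $M \in \mathrm{M}_n(\mathbb{Z}_p)$, $\operatorname{cok}(M) = \mathbb{Z}_p^n / M\mathbb{Z}_p^n$. The cokernel $\operatorname{cok}(P_j(A))$ has a natural $R_j$-module structure defined by $t \cdot x := Ax$. $\operatorname{Aut}_{R_j}(H_j)$ is the group of $R_j$-module automorphisms of $H_j$. *)

theory Defs
  imports
    "HOL-Probability.Probability"
    "HOL-Algebra.Bij"
    "HOL-Algebra.QuotRing"
    "Jordan_Normal_Form.VS_Connect"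
    "Berlekamp_Zassenhaus.Finite_Field"
begin

section \<open>The ring of p-adic integers\<close>

text \<open>
  The prime is \<open>p = CARD('p)\<close>, and the ring of p-adic integers is the inverse limit of the rings
  \<open>\<int>/p\<^sup>k\<close>: an element is a compatible sequence of residues, the one modulo \<open>p\<^sup>k\<close> being
  represented in \<open>{0..<p\<^sup>k}\<close>.
\<close>

typedef (overloaded) ('p::prime_card) padic_int =
  "{x :: nat \<Rightarrow> int. \<forall>k. 0 \<le> x k \<and> x k < int CARD('p) ^ k \<and> x (Suc k) mod int CARD('p) ^ k = x k}"
  morphisms residue Abs_padic_int
  by (rule exI[of _ "\<lambda>_. 0"]) (auto simp: prime_card prime_gt_0_nat)

setup_lifting type_definition_padic_int

lemma card_pos [simp]: "0 < int CARD('p::prime_card)"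
  using prime_card[where 'a='p] prime_gt_0_nat by auto

lemma mod_pow_Suc_mod: "(a mod q ^ Suc k) mod q ^ k = a mod (q::int) ^ k"
  by (rule mod_mod_cancel) (simp add: le_imp_power_dvd)

instantiation padic_int :: (prime_card) comm_ring_1
begin

lift_definition zero_padic_int :: "'a padic_int" is "\<lambda>_. 0" by simp

lift_definition one_padic_int :: "'a padic_int" is "\<lambda>k. 1 mod int CARD('a) ^ k"
  by (simp only: mod_pow_Suc_mod) simp

lift_definition plus_padic_int :: "'a padic_int \<Rightarrow> 'a padic_int \<Rightarrow> 'a padic_int" is
  "\<lambda>x y k. (x k + y k) mod int CARD('a) ^ k"
  by (simp only: mod_pow_Suc_mod) (simp, metis mod_add_eq)

lift_definition uminus_padic_int :: "'a padic_int \<Rightarrow> 'a padic_int" is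
  "\<lambda>x k. (- x k) mod int CARD('a) ^ k"
  by (simp only: mod_pow_Suc_mod) (simp, metis mod_minus_eq)

lift_definition minus_padic_int :: "'a padic_int \<Rightarrow> 'a padic_int \<Rightarrow> 'a padic_int" is
  "\<lambda>x y k. (x k - y k) mod int CARD('a) ^ k"
  by (simp only: mod_pow_Suc_mod) (simp, metis mod_diff_eq)

lift_definition times_padic_int :: "'a padic_int \<Rightarrow> 'a padic_int \<Rightarrow> 'a padic_int" is
  "\<lambda>x y k. (x k * y k) mod int CARD('a) ^ k"
  by (simp only: mod_pow_Suc_mod) (simp, metis mod_mult_eq)

instance
proof
  fix a b c :: "'a padic_int"
  show "a + b + c = a + (b + c)" by transfer (auto simp: fun_eq_iff mod_simps ac_simps)
  show "a + b = b + a" by transfer (auto simp: fun_eq_iff ac_simps)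
  show "0 + a = a" by transfer (auto simp: fun_eq_iff)
  show "- a + a = 0" by transfer (auto simp: fun_eq_iff mod_simps)
  show "a - b = a + - b" by transfer (auto simp: fun_eq_iff mod_simps)
  show "a * b * c = a * (b * c)" by transfer (auto simp: fun_eq_iff mod_simps ac_simps)
  show "a * b = b * a" by transfer (auto simp: fun_eq_iff ac_simps)
  show "1 * a = a" by transfer (auto simp: fun_eq_iff mod_simps)
  show "(a + b) * c = a * c + b * c"
    by transfer (auto simp: fun_eq_iff mod_simps algebra_simps)
  have "residue (0::'a padic_int) 1 \<noteq> residue (1::'a padic_int) 1"
    using prime_card[where 'a='a] prime_gt_1_nat[of "CARD('a)"]
    by (simp add: zero_padic_int.rep_eq one_padic_int.rep_eq)
  then show "(0::'a padic_int) \<noteq> 1" by metis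
qed

end

lemma residue_nonneg: "0 \<le> residue (x::'p::prime_card padic_int) k"
  and residue_less: "residue x k < int CARD('p) ^ k"
  and residue_Suc_mod: "residue x (Suc k) mod int CARD('p) ^ k = residue x k"
  using residue[of x] by auto

lemma residue_mod:
  fixes z :: "'p::prime_card padic_int"
  assumes "l \<le> k"
  shows "residue z k mod int CARD('p) ^ l = residue z l"
  using assms
proof (induction k rule: dec_induct)
  case base
  show ?case using residue[of z] by simp
next
  case (step m)
  have "residue z (Suc m) mod int CARD('p) ^ l
      = residue z (Suc m) mod int CARD('p) ^ m mod int CARD('p) ^ l"
    using step by (simp add: mod_mod_cancel le_imp_power_dvd)
  then show ?case using step by (simp add: residue_Suc_mod)
qed

lemma residue_mono_eq:
  fixes x y :: "'p::prime_card padic_int"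
  assumes "residue x k = residue y k" "l \<le> k"
  shows "residue x l = residue y l"
  using residue_mod[OF assms(2), of x] residue_mod[OF assms(2), of y] assms(1) by simp

definition padic_reduce :: "'p::prime_card padic_int \<Rightarrow> 'p mod_ring" where
  "padic_reduce x = of_int_mod_ring (residue x 1)"

text \<open>The p-adic topology: the cosets of the ideals \<open>p\<^sup>k\<close> form a basis.\<close>

instantiation padic_int :: (prime_card) topological_space
begin

definition open_padic_int :: "'a padic_int set \<Rightarrow> bool" where
  "open_padic_int U \<longleftrightarrow> (\<forall>x\<in>U. \<exists>k. \<forall>y. residue y k = residue x k \<longrightarrow> y \<in> U)"

instance
proof
  fix S T :: "'a padic_int set"
  assume S: "open S" and T: "open T"
  show "open (S \<inter> T)"
    unfolding open_padic_int_def
  proof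
    fix x assume "x \<in> S \<inter> T"
    then obtain k l where k: "\<And>y. residue y k = residue x k \<Longrightarrow> y \<in> S"
      and l: "\<And>y. residue y l = residue x l \<Longrightarrow> y \<in> T"
      using S T unfolding open_padic_int_def by (metis IntE)
    show "\<exists>k. \<forall>y. residue y k = residue x k \<longrightarrow> y \<in> S \<inter> T"
      by (rule exI[of _ "max k l"])
        (metis IntI k l residue_mono_eq max.cobounded1 max.cobounded2)
  qed
next
  fix K :: "'a padic_int set set"
  assume "\<forall>S\<in>K. open S"
  then show "open (\<Union>K)" unfolding open_padic_int_def by (meson UnionE UnionI)
qed (simp add: open_padic_int_def)

end

section \<open>Haar measure on square matrices over the p-adic integers\<close>

definition padic_mat_topology :: "nat \<Rightarrow> 'p::prime_card padic_int mat topology" where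
  "padic_mat_topology n = pullback_topology (carrier_mat n n)
     (\<lambda>A. \<lambda>ij \<in> {..<n} \<times> {..<n}. A $$ ij)
     (product_topology (\<lambda>_. euclidean) ({..<n} \<times> {..<n}))"

text \<open>
  The Haar probability measure is the unique translation-invariant probability measure on the Borel
  sets; existence and uniqueness are \<open>is_haar_prob_iff\<close> below.
\<close>

definition is_haar_prob :: "nat \<Rightarrow> 'p::prime_card padic_int mat measure \<Rightarrow> bool" where
  "is_haar_prob n M \<longleftrightarrow> prob_space M \<and> space M = carrier_mat n n \<and>
     sets M = sigma_sets (carrier_mat n n) {U. openin (padic_mat_topology n) U} \<and>
     (\<forall>B\<in>carrier_mat n n. \<forall>S\<in>sets M. emeasure M ((\<lambda>A. B + A) ` S) = emeasure M S)"

definition haar_prob :: "nat \<Rightarrow> 'p::prime_card padic_int mat measure" where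
  "haar_prob n = (THE M. is_haar_prob n M)"

subsection \<open>Existence and uniqueness\<close>

lemma padic_cong_add:
  "residue (b + x) k = residue (b + y) k \<longleftrightarrow> residue x k = residue y k"
proof -
  have *: "residue (c + u) k = residue (c + v) k" if "residue u k = residue v k"
    for c u v :: "'a padic_int"
    using that by (simp add: plus_padic_int.rep_eq)
  show ?thesis
    using *[of x y b] *[of "b + x" "b + y" "- b"] by (auto simp: add.assoc[symmetric])
qed

lemma open_residue: "open {y :: 'p::prime_card padic_int. residue y k = r}"
  unfolding open_padic_int_def by (intro ballI exI[of _ k]) auto

definition mball :: "nat \<Rightarrow> nat \<Rightarrow> 'p::prime_card padic_int mat \<Rightarrow> 'p padic_int mat set" where
  "mball n k A =
     {B \<in> carrier_mat n n. \<forall>i<n. \<forall>j<n. residue (B $$ (i,j)) k = residue (A $$ (i,j)) k}"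

lemma mball_self: "A \<in> carrier_mat n n \<Longrightarrow> A \<in> mball n k A"
  by (simp add: mball_def)

lemma mball_sub: "mball n k A \<subseteq> carrier_mat n n"
  by (auto simp: mball_def)

lemma mball_mono: "l \<le> k \<Longrightarrow> mball n k A \<subseteq> mball n l A"
  unfolding mball_def using residue_mono_eq by blast

lemma mball_eq: "B \<in> mball n k A \<Longrightarrow> mball n k B = mball n k A"
  unfolding mball_def by auto

lemma mball_0: "mball n 0 A = carrier_mat n n"
proof -
  have "residue x 0 = 0" for x :: "'a padic_int"
    using residue_nonneg[of x 0] residue_less[of x 0] by simp
  then show ?thesis by (auto simp: mball_def)
qed

lemma openin_padic_mat_topology:
  "openin (padic_mat_topology n) U \<longleftrightarrow>
     U \<subseteq> carrier_mat n n \<and> (\<forall>A\<in>U. \<exists>k. mball n k A \<subseteq> (U :: 'p::prime_card padic_int mat set))"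
  (is "?L = ?R")
proof
  let ?I = "{..<n} \<times> {..<n}"
  let ?e = "\<lambda>A::'p padic_int mat. \<lambda>ij \<in> ?I. A $$ ij"
  assume ?L
  then obtain V where V: "openin (product_topology (\<lambda>_. euclidean) ?I) V"
    and U: "U = ?e -` V \<inter> carrier_mat n n"
    unfolding padic_mat_topology_def openin_pullback_topology by blast
  have "\<exists>k. mball n k A \<subseteq> U" if "A \<in> U" for A
  proof -
    from that have "?e A \<in> V" by (simp add: U)
    with V[unfolded openin_product_topology_alt, rule_format]
    obtain W where "\<forall>i\<in>?I. openin euclidean (W i)"
      and W: "?e A \<in> Pi\<^sub>E ?I W" "Pi\<^sub>E ?I W \<subseteq> V"
      by meson
    then have opW: "open (W i)" if "i \<in> ?I" for i
      using that by (metis open_openin)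
    have "\<exists>k. \<forall>y. residue y k = residue (A $$ i) k \<longrightarrow> y \<in> W i" if "i \<in> ?I" for i
      using opW[OF that] PiE_mem[OF W(1) that] that unfolding open_padic_int_def by auto
    then obtain k where k: "\<And>i y. i \<in> ?I \<Longrightarrow> residue y (k i) = residue (A $$ i) (k i) \<Longrightarrow> y \<in> W i"
      by metis
    define m where "m = Max (insert 0 (k ` ?I))"
    have m: "k i \<le> m" if "i \<in> ?I" for i
      unfolding m_def using that by (intro Max_ge) auto
    have "B \<in> U" if B: "B \<in> mball n m A" for B
    proof -
      have "B $$ i \<in> W i" if i: "i \<in> ?I" for i
        using B i residue_mono_eq[OF _ m[OF i]] by (intro k[OF i]) (auto simp: mball_def)
      then have "?e B \<in> Pi\<^sub>E ?I W" by auto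
      then have "?e B \<in> V" using W(2) by blast
      then show ?thesis using B by (simp add: U mball_def)
    qed
    then show ?thesis by blast
  qed
  then show ?R by (auto simp: U)
next
  let ?I = "{..<n} \<times> {..<n}"
  let ?e = "\<lambda>A::'p padic_int mat. \<lambda>ij \<in> ?I. A $$ ij"
  assume R: ?R
  define Q where "Q k A = Pi\<^sub>E ?I (\<lambda>ij. {y :: 'p padic_int. residue y k = residue (A $$ ij) k})"
    for k and A :: "'p padic_int mat"
  have opn: "openin (product_topology (\<lambda>_. euclidean) ?I) (Q k A)" for k A
    unfolding Q_def by (subst openin_PiE) (simp_all add: open_residue)
  have Qb: "?e -` Q k A \<inter> carrier_mat n n = mball n k A" for k A
  proof (rule Set.set_eqI)
    fix B :: "'p padic_int mat"
    have "?e B \<in> Q k A \<longleftrightarrow> (\<forall>i<n. \<forall>j<n. residue (B $$ (i,j)) k = residue (A $$ (i,j)) k)"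
      unfolding Q_def restrict_PiE_iff mem_Collect_eq by blast
    then show "B \<in> ?e -` Q k A \<inter> carrier_mat n n \<longleftrightarrow> B \<in> mball n k A"
      unfolding mball_def vimage_eq Int_iff mem_Collect_eq by blast
  qed
  from R obtain k where k: "\<And>A. A \<in> U \<Longrightarrow> mball n (k A) A \<subseteq> U" by metis
  define V where "V = (\<Union>A\<in>U. Q (k A) A)"
  have "openin (product_topology (\<lambda>_. euclidean) ?I) V"
    unfolding V_def using opn by (intro openin_Union) auto
  moreover have "U = ?e -` V \<inter> carrier_mat n n"
  proof -
    have "?e -` V \<inter> carrier_mat n n = (\<Union>A\<in>U. ?e -` Q (k A) A \<inter> carrier_mat n n)"
      unfolding V_def by (simp only: vimage_UN UN_simps)
    also have "\<dots> = (\<Union>A\<in>U. mball n (k A) A)" by (simp only: Qb)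
    also have "\<dots> = U" using k R mball_self by blast
    finally show ?thesis by simp
  qed
  ultimately show ?L unfolding padic_mat_topology_def openin_pullback_topology by blast
qed

definition mballs :: "nat \<Rightarrow> 'p::prime_card padic_int mat set set" where
  "mballs n = insert {} {mball n k A | k A. A \<in> carrier_mat n n}"

lemma finite_mball:
  "finite {mball n k A | A. A \<in> (carrier_mat n n :: 'p::prime_card padic_int mat set)}"
proof -
  let ?I = "{..<n} \<times> {..<n}"
  define g where "g r = {B \<in> carrier_mat n n :: 'p padic_int mat set. \<forall>i<n. \<forall>j<n. residue (B $$ (i,j)) k = r (i,j)}"
    for r
  let ?r = "\<lambda>A::'p padic_int mat. \<lambda>ij\<in>?I. residue (A $$ ij) k"
  have "?r A \<in> (\<Pi>\<^sub>E ij\<in>?I. {0..<int CARD('p) ^ k})" for A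
    by (rule restrict_PiE_iff[THEN iffD2]) (simp add: residue_nonneg residue_less)
  moreover have "mball n k A = g (?r A)" for A
    unfolding mball_def g_def by (rule Collect_cong) simp
  ultimately have "mball n k A \<in> g ` (\<Pi>\<^sub>E ij\<in>?I. {0..<int CARD('p) ^ k})" for A
    by (metis image_eqI)
  then have "{mball n k A | A. A \<in> carrier_mat n n} \<subseteq> g ` (\<Pi>\<^sub>E ij\<in>?I. {0..<int CARD('p) ^ k})"
    by blast
  moreover have "finite (\<Pi>\<^sub>E ij\<in>?I. {0..<int CARD('p) ^ k})" by (intro finite_PiE) auto
  ultimately show ?thesis by (meson finite_imageI finite_subset)
qed

lemma countable_mballs: "countable (mballs n :: 'p::prime_card padic_int mat set set)"
proof -
  have "mballs n = insert {} (\<Union>k. {mball n k A | A. A \<in> (carrier_mat n n :: 'p padic_int mat set)})"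
    unfolding mballs_def by blast
  moreover have "countable (\<Union>k. {mball n k A | A. A \<in> (carrier_mat n n :: 'p padic_int mat set)})"
    by (rule countable_UN) (auto intro: countable_finite[OF finite_mball])
  ultimately show ?thesis by simp
qed

lemma mballs_open:
  assumes "b \<in> mballs n"
  shows "openin (padic_mat_topology n) b"
proof -
  from assms consider "b = {}" | k A where "b = mball n k A" unfolding mballs_def by blast
  then show ?thesis
  proof cases
    case 2
    have "mball n k B \<subseteq> b" if "B \<in> b" for B using mball_eq[of B n k A] that 2 by simp
    then show ?thesis unfolding openin_padic_mat_topology using 2 mball_sub by blast
  qed simp
qed

lemma borel_eq_mballs:
  "sigma_sets (carrier_mat n n) {U. openin (padic_mat_topology n) U}
     = (sigma_sets (carrier_mat n n) (mballs n) :: 'p::prime_card padic_int mat set set)"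
proof (rule antisym)
  show "sigma_sets (carrier_mat n n) {U. openin (padic_mat_topology n) U}
      \<subseteq> sigma_sets (carrier_mat n n) (mballs n :: 'p padic_int mat set set)"
  proof (rule sigma_sets_mono, safe)
    fix U :: "'p padic_int mat set"
    assume U: "openin (padic_mat_topology n) U"
    let ?C = "{b \<in> mballs n. b \<subseteq> U}"
    have "U \<subseteq> \<Union>?C"
    proof
      fix A assume A: "A \<in> U"
      then obtain k where "mball n k A \<subseteq> U" "A \<in> carrier_mat n n"
        using U unfolding openin_padic_mat_topology by blast
      then show "A \<in> \<Union>?C" using mball_self[of A n k] unfolding mballs_def by blast
    qed
    then have "U = \<Union>?C" by blast
    moreover have "\<Union>?C \<in> sigma_sets (carrier_mat n n) (mballs n)"
    proof (rule sigma_sets_UNION)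
      show "countable ?C" by (rule countable_subset[OF _ countable_mballs]) auto
    qed (auto intro: sigma_sets.Basic)
    ultimately show "U \<in> sigma_sets (carrier_mat n n) (mballs n)" by simp
  qed
next
  show "sigma_sets (carrier_mat n n) (mballs n)
      \<subseteq> sigma_sets (carrier_mat n n) {U. openin (padic_mat_topology n) U}"
    by (rule sigma_sets_mono) (auto intro: sigma_sets.Basic mballs_open)
qed

lemma mballs_Pow: "mballs n \<subseteq> Pow (carrier_mat n n)"
  unfolding mballs_def using mball_sub by auto

lemma Int_stable_mballs: "Int_stable (mballs n :: 'p::prime_card padic_int mat set set)"
proof -
  have *: "mball n k A \<inter> mball n l B \<in> mballs n" if "l \<le> k" for k l and A B :: "'p padic_int mat"
  proof (cases "mball n k A \<inter> mball n l B = {}")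
    case True
    then show ?thesis by (simp add: mballs_def)
  next
    case False
    then obtain C where C: "C \<in> mball n k A" "C \<in> mball n l B" by blast
    have "mball n k A \<inter> mball n l B = mball n k C"
      using mball_eq[OF C(1)] mball_eq[OF C(2)] mball_mono[OF that, of n C] by blast
    moreover have "C \<in> carrier_mat n n" using C mball_sub by blast
    ultimately show ?thesis unfolding mballs_def by blast
  qed
  have "mball n k A \<inter> mball n l B \<in> mballs n" for k l and A B :: "'p padic_int mat"
    using *[of l k A B] *[of k l B A] by (metis Int_commute nle_le)
  note ** = this
  show ?thesis
    unfolding Int_stable_def
  proof (intro ballI)
    fix a b :: "'p padic_int mat set"
    assume "a \<in> mballs n" "b \<in> mballs n"
    then consider "a = {} \<or> b = {}" | k l A B where "a = mball n k A" "b = mball n l B"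
      unfolding mballs_def by blast
    then show "a \<inter> b \<in> mballs n"
    proof cases
      case 1
      then show ?thesis by (auto simp: mballs_def)
    qed (simp add: **)
  qed
qed

lemma translate_image_eq:
  fixes B :: "'p::prime_card padic_int mat"
  assumes "B \<in> carrier_mat n n" "S \<subseteq> carrier_mat n n"
  shows "(\<lambda>Z. B + Z) ` S = (\<lambda>Z. - B + Z) -` S \<inter> carrier_mat n n"
proof (intro equalityI subsetI)
  fix Y assume "Y \<in> (\<lambda>Z. B + Z) ` S"
  then obtain Z where Z: "Y = B + Z" "Z \<in> S" by blast
  then have "Z \<in> carrier_mat n n" using assms by blast
  moreover from this have "- B + (B + Z) = Z" using assms(1) by (intro eq_matI) auto
  ultimately show "Y \<in> (\<lambda>Z. - B + Z) -` S \<inter> carrier_mat n n" using Z assms(1) by simp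
next
  fix Y assume "Y \<in> (\<lambda>Z. - B + Z) -` S \<inter> carrier_mat n n"
  then have Y: "- B + Y \<in> S" "Y \<in> carrier_mat n n" by auto
  then have "Y = B + (- B + Y)" using assms(1) by (intro eq_matI) auto
  with Y show "Y \<in> (\<lambda>Z. B + Z) ` S" by blast
qed

lemma mball_translate:
  assumes B: "B \<in> carrier_mat n n" and A: "A \<in> carrier_mat n n"
  shows "(\<lambda>Z. B + Z) ` mball n k A = mball n k (B + A)"
proof -
  have "residue ((- B + Y) $$ (i,j)) k = residue (A $$ (i,j)) k
      \<longleftrightarrow> residue (Y $$ (i,j)) k = residue ((B + A) $$ (i,j)) k"
    if "i < n" "j < n" "Y \<in> carrier_mat n n" for i j Y
    using padic_cong_add[of "B $$ (i,j)" "(- B + Y) $$ (i,j)" k "A $$ (i,j)"] that A B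
    by (simp add: add.assoc[symmetric])
  note * = this
  have "- B + Y \<in> mball n k A \<longleftrightarrow> Y \<in> mball n k (B + A)" if Y: "Y \<in> carrier_mat n n" for Y
  proof -
    have "- B + Y \<in> carrier_mat n n" using B Y by simp
    then show ?thesis unfolding mball_def mem_Collect_eq using Y *[OF _ _ Y] by blast
  qed
  then show ?thesis
    unfolding translate_image_eq[OF B mball_sub] using mball_sub[of n k "B + A"] by blast
qed

lemma haar_prob_mball:
  fixes M :: "'p::prime_card padic_int mat measure"
  assumes M: "is_haar_prob n M" and A: "A \<in> carrier_mat n n"
  shows "emeasure M (mball n k A) * of_nat (card {mball n k A | A. A \<in> (carrier_mat n n :: 'p padic_int mat set)}) = 1"
proof -
  let ?P = "{mball n k A | A. A \<in> (carrier_mat n n :: 'p padic_int mat set)}"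
  have setsM: "sets M = sigma_sets (carrier_mat n n) (mballs n)"
    using M by (simp add: is_haar_prob_def borel_eq_mballs)
  have ball_sets: "b \<in> sets M" if "b \<in> ?P" for b
    unfolding setsM using that by (intro sigma_sets.Basic) (auto simp: mballs_def)
  have eq: "emeasure M b = emeasure M (mball n k A)" if "b \<in> ?P" for b
  proof -
    from that obtain C where C: "b = mball n k C" "C \<in> carrier_mat n n" by blast
    have "(\<lambda>Z. (C + - A) + Z) ` mball n k A = mball n k (C + - A + A)"
      using C A by (intro mball_translate) auto
    also have "C + - A + A = C" using C A by (intro eq_matI) auto
    finally have "b = (\<lambda>Z. (C + - A) + Z) ` mball n k A" using C by simp
    moreover have "C + - A \<in> carrier_mat n n" using C A by simp
    moreover have "mball n k A \<in> sets M" using A by (intro ball_sets) blast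
    ultimately show ?thesis using M unfolding is_haar_prob_def by simp
  qed
  have "(\<lambda>b. b) ` ?P \<subseteq> sets M" using ball_sets by blast
  moreover have "disjoint_family_on (\<lambda>b. b) ?P"
    unfolding disjoint_family_on_def using mball_eq by blast
  ultimately have "emeasure M (\<Union>b\<in>?P. b) = (\<Sum>b\<in>?P. emeasure M b)"
    by (intro sum_emeasure[symmetric] finite_mball)
  also have "\<dots> = (\<Sum>b\<in>?P. emeasure M (mball n k A))" by (rule sum.cong[OF refl], rule eq)
  also have "\<dots> = emeasure M (mball n k A) * of_nat (card ?P)" by (simp add: mult.commute)
  also have "(\<Union>b\<in>?P. b) = carrier_mat n n" using mball_self mball_sub by blast
  finally have "emeasure M (carrier_mat n n) = emeasure M (mball n k A) * of_nat (card ?P)" .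
  moreover have "emeasure M (carrier_mat n n) = 1"
    using M prob_space.emeasure_space_1[of M] by (simp add: is_haar_prob_def)
  ultimately show ?thesis by simp
qed

lemma carrier_in_mballs: "carrier_mat n n \<in> (mballs n :: 'p::prime_card padic_int mat set set)"
proof -
  have "mball n 0 (0\<^sub>m n n :: 'p padic_int mat) = carrier_mat n n" by (rule mball_0)
  then have "carrier_mat n n \<in> {mball n k A | k A. A \<in> (carrier_mat n n :: 'p padic_int mat set)}"
    by (intro CollectI exI[of _ 0] exI[of _ "0\<^sub>m n n"] conjI zero_carrier_mat) (rule sym)
  then show ?thesis unfolding mballs_def by (rule insertI2)
qed

lemma measure_eq_mballs:
  fixes M N :: "'p::prime_card padic_int mat measure"
  assumes M: "sets M = sigma_sets (carrier_mat n n) (mballs n)"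
    and N: "sets N = sigma_sets (carrier_mat n n) (mballs n)"
    and fin: "emeasure M (carrier_mat n n) \<noteq> \<infinity>"
    and eq: "\<And>k A. A \<in> carrier_mat n n \<Longrightarrow> emeasure M (mball n k A) = emeasure N (mball n k A)"
  shows "M = N"
proof (rule measure_eqI_generator_eq)
  show "Int_stable (mballs n :: 'p padic_int mat set set)" by (rule Int_stable_mballs)
  show "mballs n \<subseteq> Pow (carrier_mat n n :: 'p padic_int mat set)" by (rule mballs_Pow)
  show "range (\<lambda>_::nat. carrier_mat n n) \<subseteq> (mballs n :: 'p padic_int mat set set)"
    by (rule image_subsetI) (rule carrier_in_mballs)
  show "(\<Union>i::nat. carrier_mat n n) = (carrier_mat n n :: 'p padic_int mat set)" by simp
  show "emeasure M (carrier_mat n n) \<noteq> \<infinity>" for i :: nat by (rule fin)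
  fix b :: "'p padic_int mat set"
  assume "b \<in> mballs n"
  then consider "b = {}" | k A where "b = mball n k A" "A \<in> carrier_mat n n"
    unfolding mballs_def by blast
  then show "emeasure M b = emeasure N b"
  proof cases
    case 1
    then show ?thesis by simp
  next
    case 2
    show ?thesis unfolding 2(1) by (rule eq[OF 2(2)])
  qed
qed (rule M, rule N)

lemma haar_prob_uniqueness:
  fixes M N :: "'p::prime_card padic_int mat measure"
  assumes M: "is_haar_prob n M" and N: "is_haar_prob n N"
  shows "M = N"
proof (rule measure_eq_mballs)
  have "prob_space M" "space M = carrier_mat n n"
    using M unfolding is_haar_prob_def by blast+
  then show "emeasure M (carrier_mat n n) \<noteq> \<infinity>"
    using prob_space.emeasure_space_1[of M] by simp
  show "sets M = sigma_sets (carrier_mat n n) (mballs n)"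
    using M unfolding is_haar_prob_def borel_eq_mballs by blast
  show "sets N = sigma_sets (carrier_mat n n) (mballs n)"
    using N unfolding is_haar_prob_def borel_eq_mballs by blast
next
  fix k and A :: "'p padic_int mat"
  assume A: "A \<in> carrier_mat n n"
  define c where
    "c = (of_nat (card {mball n k A | A. A \<in> (carrier_mat n n :: 'p padic_int mat set)}) :: ennreal)"
  have m: "emeasure M (mball n k A) * c = 1" and m': "emeasure N (mball n k A) * c = 1"
    unfolding c_def by (rule haar_prob_mball[OF M A], rule haar_prob_mball[OF N A])
  have "emeasure M (mball n k A) = emeasure M (mball n k A) * (emeasure N (mball n k A) * c)"
    unfolding m' by simp
  also have "\<dots> = emeasure N (mball n k A) * (emeasure M (mball n k A) * c)"
    by (rule mult.left_commute)
  also have "\<dots> = emeasure N (mball n k A)" unfolding m by simp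
  finally show "emeasure M (mball n k A) = emeasure N (mball n k A)" .
qed

definition padic_digit :: "nat \<Rightarrow> 'p::prime_card padic_int \<Rightarrow> int" where
  "padic_digit m x = residue x (Suc m) div int CARD('p) ^ m"

lift_definition of_digits :: "(nat \<Rightarrow> int) \<Rightarrow> 'p::prime_card padic_int" is
  "\<lambda>d k. \<Sum>m<k. d m mod int CARD('p) * int CARD('p) ^ m"
proof safe
  fix d :: "nat \<Rightarrow> int" and k
  let ?p = "int CARD('p)"
  let ?s = "\<lambda>k. \<Sum>m<k. d m mod ?p * ?p ^ m"
  have le: "0 \<le> ?s k" for k by (intro sum_nonneg mult_nonneg_nonneg) auto
  have less: "?s k < ?p ^ k" for k
  proof (induction k)
    case (Suc k)
    have "d k mod ?p \<le> ?p - 1" by (simp add: zle_diff1_eq)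
    then have "d k mod ?p * ?p ^ k \<le> (?p - 1) * ?p ^ k" by (intro mult_right_mono) auto
    with Suc show ?case by (simp add: algebra_simps)
  qed simp
  show "0 \<le> ?s k" "?s k < ?p ^ k" by (fact le, fact less)
  show "?s (Suc k) mod ?p ^ k = ?s k" using le less[of k] by simp
qed

lemma padic_digit_of_digits: "padic_digit m (of_digits d :: 'p::prime_card padic_int) = d m mod int CARD('p)"
proof -
  let ?x = "of_digits d :: 'p padic_int"
  have "residue ?x (Suc m) = residue ?x m + d m mod int CARD('p) * int CARD('p) ^ m"
    by (simp add: of_digits.rep_eq)
  then show ?thesis
    using residue_nonneg[of ?x m] residue_less[of ?x m] by (simp add: padic_digit_def)
qed

lemma residue_Suc_digit:
  "residue x (Suc m) = residue x m + int CARD('p) ^ m * padic_digit m (x :: 'p::prime_card padic_int)"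
  unfolding padic_digit_def using residue_Suc_mod[of x m] mod_mult_div_eq by metis

lemma residue_eq_iff_digits:
  fixes x y :: "'p::prime_card padic_int"
  shows "residue x k = residue y k \<longleftrightarrow> (\<forall>m<k. padic_digit m x = padic_digit m y)"
proof
  assume *: "residue x k = residue y k"
  show "\<forall>m<k. padic_digit m x = padic_digit m y"
    unfolding padic_digit_def using residue_mono_eq[OF *, of "Suc _"] by (simp add: Suc_le_eq)
next
  assume "\<forall>m<k. padic_digit m x = padic_digit m y"
  then show "residue x k = residue y k"
  proof (induction k)
    case 0
    show ?case
      using residue_nonneg[of x 0] residue_less[of x 0] residue_nonneg[of y 0] residue_less[of y 0]
      by simp
  qed (simp add: residue_Suc_digit)
qed

lemma padic_digit_range: "padic_digit m x \<in> {0..<int CARD('p)}" for x :: "'p::prime_card padic_int"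
proof -
  have "int CARD('p) ^ m * padic_digit m x \<le> residue x (Suc m)"
    using residue_nonneg[of x m] residue_Suc_digit[of x m] by simp
  then have "int CARD('p) ^ m * padic_digit m x < int CARD('p) ^ m * int CARD('p)"
    using residue_less[of x "Suc m"] unfolding power_Suc2 by (rule le_less_trans)
  then have "padic_digit m x < int CARD('p)"
    by (rule mult_less_cancel_left_pos[THEN iffD1, rotated]) (rule zero_less_power[OF card_pos])
  then show ?thesis
    using residue_nonneg[of x "Suc m"] by (simp add: padic_digit_def pos_imp_zdiv_nonneg_iff)
qed

lemma padic_digit_mod:
  "padic_digit m x mod int CARD('p) = padic_digit m x" for x :: "'p::prime_card padic_int"
  using padic_digit_range[of m x] by simp

lemma haar_prob_exists: "\<exists>M. is_haar_prob n (M :: 'p::prime_card padic_int mat measure)"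
proof -
  let ?C = "carrier_mat n n :: 'p padic_int mat set"
  define U where "U = uniform_count_measure {0..<int CARD('p)}"
  define D where "D = PiM (UNIV :: (nat \<times> nat \<times> nat) set) (\<lambda>_. U)"
  define f where "f \<omega> = mat n n (\<lambda>(i,j). of_digits (\<lambda>m. \<omega> (i,j,m)) :: 'p padic_int)"
    for \<omega> :: "nat \<times> nat \<times> nat \<Rightarrow> int"
  define N where "N = sigma ?C (mballs n)"
  define M where "M = distr D N f"
  have U: "prob_space U" "space U = {0..<int CARD('p)}" "sets U = Pow {0..<int CARD('p)}"
    unfolding U_def by (auto intro!: prob_space_uniform_count_measure
      simp: space_uniform_count_measure sets_uniform_count_measure)
  interpret prob_space U by (fact U)
  interpret product_prob_space "\<lambda>_. U" "UNIV :: (nat \<times> nat \<times> nat) set" ..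
  have D: "prob_space D" unfolding D_def by (rule prob_space_PiM) (rule U)
  have spaceN: "space N = ?C" and setsN: "sets N = sigma_sets ?C (mballs n)"
    unfolding N_def by (simp_all add: space_measure_of_conv sets_measure_of[OF mballs_Pow])
  have f_ball: "f -` mball n k A \<inter> space D
      = {\<omega> \<in> space D. \<forall>q \<in> {..<n} \<times> {..<n} \<times> {..<k}.
           \<omega> q \<in> {case q of (i,j,m) \<Rightarrow> padic_digit m (A $$ (i,j))}}" for k A
  proof -
    have "\<omega> q mod int CARD('p) = \<omega> q" if "\<omega> \<in> space D" for \<omega> q
    proof -
      have "\<omega> q \<in> space U" using that unfolding D_def by (auto simp: space_PiM)
      then show ?thesis by (simp add: U)
    qed
    then show ?thesis
      by (auto simp: f_def mball_def residue_eq_iff_digits padic_digit_of_digits padic_digit_mod)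
  qed
  have f_meas: "f \<in> measurable D N"
    unfolding N_def
  proof (rule measurable_measure_of[OF mballs_Pow])
    show "f \<in> space D \<rightarrow> ?C" by (auto simp: f_def)
    fix b :: "'p padic_int mat set"
    assume "b \<in> mballs n"
    then consider "b = {}" | k A where "b = mball n k A" unfolding mballs_def by blast
    then show "f -` b \<inter> space D \<in> sets D"
    proof cases
      case 2
      have "{\<omega> \<in> space D. \<omega> q \<in> {c}} \<in> sets D" for q c
      proof -
        have "(\<lambda>\<omega>. \<omega> q) -` ({c} \<inter> space U) \<inter> space D \<in> sets D"
          unfolding D_def by (rule measurable_sets[OF measurable_component_singleton]) (auto simp: U)
        also have "(\<lambda>\<omega>. \<omega> q) -` ({c} \<inter> space U) \<inter> space D = {\<omega> \<in> space D. \<omega> q \<in> {c}}"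
          by (auto simp: D_def space_PiM)
        finally show ?thesis .
      qed
      then show ?thesis unfolding 2 f_ball by (intro sets.sets_Collect_finite_All) auto
    qed simp
  qed
  have M_ball: "emeasure M (mball n k A)
      = (\<Prod>q \<in> {..<n} \<times> {..<n} \<times> {..<k}. ennreal (1 / real CARD('p)))"
    if "A \<in> ?C" for k A
  proof -
    have "mball n k A \<in> sets N"
      unfolding setsN using that by (intro sigma_sets.Basic) (auto simp: mballs_def)
    then have "emeasure M (mball n k A) = emeasure D (f -` mball n k A \<inter> space D)"
      unfolding M_def by (rule emeasure_distr[OF f_meas])
    also have "\<dots> = (\<Prod>q \<in> {..<n} \<times> {..<n} \<times> {..<k}.
        emeasure U {case q of (i,j,m) \<Rightarrow> padic_digit m (A $$ (i,j))})"
      unfolding f_ball unfolding D_def using padic_digit_range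
      by (intro emeasure_PiM_Collect) (auto simp: U)
    also have "\<dots> = (\<Prod>q \<in> {..<n} \<times> {..<n} \<times> {..<k}. ennreal (1 / real CARD('p)))"
      unfolding U_def using padic_digit_range
      by (intro prod.cong refl, subst emeasure_uniform_count_measure) (auto split: prod.splits)
    finally show ?thesis .
  qed
  have M: "prob_space M" "space M = ?C" "sets M = sigma_sets ?C (mballs n)"
    unfolding M_def using prob_space.prob_space_distr[OF D f_meas] spaceN setsN by auto
  have "emeasure M ((\<lambda>Z. B + Z) ` S) = emeasure M S" if B: "B \<in> ?C" and S: "S \<in> sets M" for B S
  proof -
    let ?t = "\<lambda>Z. - B + Z"
    have SC: "S \<subseteq> ?C" using sets.sets_into_space[OF S] M by simp
    have pre: "?t -` mball n k A \<inter> ?C = mball n k (B + A)" if "A \<in> ?C" for k A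
      using translate_image_eq[OF B mball_sub] mball_translate[OF B that] by metis
    have t_meas: "?t \<in> measurable M M"
    proof (rule measurable_sigma_sets[OF M(3) mballs_Pow])
      show "?t \<in> space M \<rightarrow> ?C" using B by (auto simp: M)
      fix b :: "'p padic_int mat set"
      assume "b \<in> mballs n"
      then consider "b = {}" | k A where "b = mball n k A" "A \<in> ?C" unfolding mballs_def by blast
      then show "?t -` b \<inter> space M \<in> sets M"
      proof cases
        case 2
        have "B + A \<in> ?C" using 2 B by simp
        then have "mball n k (B + A) \<in> mballs n" unfolding mballs_def by blast
        then show ?thesis unfolding M 2(1) pre[OF 2(2)] by (rule sigma_sets.Basic)
      qed simp
    qed
    have "distr M M ?t = M"
    proof (rule measure_eq_mballs)
      have "emeasure (distr M M ?t) ?C = emeasure M (?t -` ?C \<inter> space M)"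
        using sets.top[of M] by (intro emeasure_distr t_meas) (simp add: M)
      also have "\<dots> \<le> 1" by (rule prob_space.emeasure_le_1[OF M(1)])
      finally show "emeasure (distr M M ?t) ?C \<noteq> \<infinity>" by (auto simp: top_unique)
    next
      fix k and A :: "'p padic_int mat"
      assume A: "A \<in> ?C"
      then have "mball n k A \<in> mballs n" unfolding mballs_def by blast
      then have bs: "mball n k A \<in> sets M" unfolding M by (rule sigma_sets.Basic)
      have BA: "B + A \<in> ?C" using A B by simp
      have "emeasure (distr M M ?t) (mball n k A) = emeasure M (?t -` mball n k A \<inter> space M)"
        by (rule emeasure_distr[OF t_meas bs])
      also have "\<dots> = emeasure M (mball n k A)"
        unfolding M(2) pre[OF A] M_ball[OF A] M_ball[OF BA] ..
      finally show "emeasure (distr M M ?t) (mball n k A) = emeasure M (mball n k A)" .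
    qed (simp_all add: M)
    then have "emeasure M S = emeasure (distr M M ?t) S" by simp
    also have "\<dots> = emeasure M (?t -` S \<inter> space M)" by (rule emeasure_distr[OF t_meas S])
    also have "?t -` S \<inter> space M = (\<lambda>Z. B + Z) ` S"
      using translate_image_eq[OF B SC] by (simp add: M)
    finally show ?thesis by simp
  qed
  then have "is_haar_prob n M"
    unfolding is_haar_prob_def borel_eq_mballs using M by auto
  then show ?thesis ..
qed

theorem is_haar_prob_iff: "is_haar_prob n M \<longleftrightarrow> M = haar_prob n"
proof -
  have "\<exists>!M. is_haar_prob n (M :: 'p::prime_card padic_int mat measure)"
    using haar_prob_exists haar_prob_uniqueness by blast
  from theI'[OF this] show ?thesis unfolding haar_prob_def using haar_prob_uniqueness by blast
qed

section \<open>Cokernels of polynomials in a matrix\<close>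

text \<open>
  The ring \<open>\<int>\<^sub>p[t]/(P)\<close> is the library's quotient \<open>Quot\<close> of the polynomial ring (turned into a
  ring record by \<open>class_ring\<close>) by the principal ideal of \<open>P\<close>; its elements are residue classes,
  that is, sets of polynomials.
\<close>

definition poly_quot :: "'a::comm_ring_1 poly \<Rightarrow> 'a poly set ring" where
  "poly_quot P = class_ring Quot (PIdl\<^bsub>class_ring\<^esub> P)"

definition poly_mat_eval :: "'a::comm_ring_1 poly \<Rightarrow> 'a mat \<Rightarrow> 'a mat" where
  "poly_mat_eval f A =
     finsum (ring_mat TYPE('a) (dim_row A) ()) (\<lambda>i. Polynomial.coeff f i \<cdot>\<^sub>m (A ^\<^sub>m i)) {..Polynomial.degree f}"

definition mat_range :: "'a::comm_ring_1 mat \<Rightarrow> 'a vec set" where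
  "mat_range M = (\<lambda>v. M *\<^sub>v v) ` carrier_vec (dim_col M)"

definition cok :: "'a::comm_ring_1 mat \<Rightarrow> 'a vec set monoid" where
  "cok M = module_vec TYPE('a) (dim_row M) A_Mod mat_range M"

text \<open>
  The abelian group \<open>cok (P(A))\<close> as a module over \<open>R[t]/(P)\<close>, where \<open>t\<close> acts as \<open>A\<close>: the class of
  a polynomial \<open>f\<close> sends the class of \<open>x\<close> to the class of \<open>f(A) x\<close> (see \<open>cok_module_smult\<close>; all
  members of the union below are equal). The ring multiplication and unit, which are present in
  every module record, play no role.
\<close>

definition cok_module :: "'a::comm_ring_1 poly \<Rightarrow> 'a mat \<Rightarrow> ('a poly set, 'a vec set) module" where
  "cok_module P A =
    (let G = cok (poly_mat_eval P A) in
     \<lparr>carrier = carrier G, mult = undefined, one = undefined, zero = \<one>\<^bsub>G\<^esub>, add = (\<otimes>\<^bsub>G\<^esub>),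
      smult = (\<lambda>F Z. \<Union>f\<in>F. \<Union>x\<in>Z.
        mat_range (poly_mat_eval P A) +>\<^bsub>module_vec TYPE('a) (dim_row A)\<^esub> (poly_mat_eval f A *\<^sub>v x))\<rparr>)"

definition module_isomorphic ::
  "('r, 'c) ring_scheme \<Rightarrow> ('r, 'a, 'm) module_scheme \<Rightarrow> ('r, 'b, 'k) module_scheme \<Rightarrow> bool" where
  "module_isomorphic R M N \<longleftrightarrow>
     (\<exists>h \<in> LinearCombinations.module_hom R M N. bij_betw h (carrier M) (carrier N))"

text \<open>As for the library's \<open>auto\<close>, automorphisms are extensional functions, so that they can be counted.\<close>

definition module_Aut :: "('r, 'c) ring_scheme \<Rightarrow> ('r, 'a, 'm) module_scheme \<Rightarrow> ('a \<Rightarrow> 'a) set" where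
  "module_Aut R M = LinearCombinations.module_hom R M M \<inter> Bij (carrier M)"

subsection \<open>Evaluation at a matrix is a ring homomorphism\<close>

lemma finsum_ring_mat:
  fixes g :: "'i \<Rightarrow> 'a::comm_ring_1 mat"
  assumes "finite I" "\<And>i. i \<in> I \<Longrightarrow> g i \<in> carrier_mat n n"
  shows "finsum (ring_mat TYPE('a) n ()) g I = mat n n (\<lambda>ij. \<Sum>i\<in>I. g i $$ ij)"
  using assms
proof (induction I)
  interpret ring "ring_mat TYPE('a) n ()" by (rule ring_mat)
  {
    case empty
    show ?case by (simp add: ring_mat_simps) (intro eq_matI; simp)
  next
    case (insert x F)
    then have "finsum (ring_mat TYPE('a) n ()) g (insert x F)
        = g x + mat n n (\<lambda>ij. \<Sum>i\<in>F. g i $$ ij)"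
      by (subst finsum_insert) (auto simp: ring_mat_simps)
    also have "\<dots> = mat n n (\<lambda>ij. \<Sum>i\<in>insert x F. g i $$ ij)"
      using insert by (intro eq_matI) auto
    finally show ?case .
  }
qed

context
  fixes A :: "'a::comm_ring_1 mat" and n :: nat
  assumes A: "A \<in> carrier_mat n n"
begin

private abbreviation (input) "pe f \<equiv> poly_mat_eval f A"

lemma pow_carrier: "A ^\<^sub>m k \<in> carrier_mat n n"
  using A by (simp add: pow_carrier_mat)

lemma poly_mat_eval_eq:
  assumes "Polynomial.degree f \<le> N"
  shows "pe f = mat n n (\<lambda>ij. \<Sum>k\<le>N. Polynomial.coeff f k * (A ^\<^sub>m k) $$ ij)"
proof -
  have d: "dim_row A = n" using A by simp
  have "pe f = mat n n (\<lambda>ij. \<Sum>k\<le>Polynomial.degree f. (Polynomial.coeff f k \<cdot>\<^sub>m (A ^\<^sub>m k)) $$ ij)"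
    unfolding poly_mat_eval_def d
    by (rule finsum_ring_mat) (auto intro: smult_carrier_mat pow_carrier)
  also have "\<dots> = mat n n (\<lambda>ij. \<Sum>k\<le>N. Polynomial.coeff f k * (A ^\<^sub>m k) $$ ij)"
  proof (rule eq_matI)
    fix i j assume ij: "i < dim_row (mat n n (\<lambda>ij. \<Sum>k\<le>N. Polynomial.coeff f k * (A ^\<^sub>m k) $$ ij))"
      "j < dim_col (mat n n (\<lambda>ij. \<Sum>k\<le>N. Polynomial.coeff f k * (A ^\<^sub>m k) $$ ij))"
    have "(\<Sum>k\<le>Polynomial.degree f. (Polynomial.coeff f k \<cdot>\<^sub>m (A ^\<^sub>m k)) $$ (i,j))
        = (\<Sum>k\<le>Polynomial.degree f. Polynomial.coeff f k * (A ^\<^sub>m k) $$ (i,j))"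
      using ij carrier_matD[OF pow_carrier] by (intro sum.cong) auto
    also have "\<dots> = (\<Sum>k\<le>N. Polynomial.coeff f k * (A ^\<^sub>m k) $$ (i,j))"
      using assms by (intro sum.mono_neutral_left) (auto simp: coeff_eq_0)
    finally show "mat n n (\<lambda>ij. \<Sum>k\<le>Polynomial.degree f. (Polynomial.coeff f k \<cdot>\<^sub>m (A ^\<^sub>m k)) $$ ij) $$ (i,j)
        = mat n n (\<lambda>ij. \<Sum>k\<le>N. Polynomial.coeff f k * (A ^\<^sub>m k) $$ ij) $$ (i,j)"
      using ij by simp
  qed simp_all
  finally show ?thesis .
qed

lemma poly_mat_eval_carrier: "pe f \<in> carrier_mat n n"
  by (subst poly_mat_eval_eq[OF order.refl]) simp

lemma poly_mat_eval_0: "pe 0 = 0\<^sub>m n n"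
  by (subst poly_mat_eval_eq[OF order.refl]) (intro eq_matI; simp)

lemma poly_mat_eval_1: "pe 1 = 1\<^sub>m n"
  using A by (subst poly_mat_eval_eq[OF order.refl]) (intro eq_matI; simp)

lemma poly_mat_eval_add: "pe (f + g) = pe f + pe g"
proof -
  let ?N = "max (Polynomial.degree f) (Polynomial.degree g)"
  have d: "Polynomial.degree (f + g) \<le> ?N" "Polynomial.degree f \<le> ?N" "Polynomial.degree g \<le> ?N"
    by (auto intro: degree_add_le)
  show ?thesis
    unfolding poly_mat_eval_eq[OF d(1)] poly_mat_eval_eq[OF d(2)] poly_mat_eval_eq[OF d(3)]
    by (intro eq_matI) (simp_all add: sum.distrib algebra_simps)
qed

lemma poly_mat_eval_smult: "pe (Polynomial.smult c f) = c \<cdot>\<^sub>m pe f"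
proof -
  have d: "Polynomial.degree (Polynomial.smult c f) \<le> Polynomial.degree f" by (rule degree_smult_le)
  show ?thesis
    unfolding poly_mat_eval_eq[OF d] poly_mat_eval_eq[OF order.refl, of f]
    by (intro eq_matI) (simp_all add: sum_distrib_left algebra_simps)
qed

lemma poly_mat_eval_pCons_0: "pe (pCons 0 f) = pe f * A"
proof (rule eq_matI)
  have c: "pe f * A \<in> carrier_mat n n" by (rule mult_carrier_mat[OF poly_mat_eval_carrier A])
  have d: "Polynomial.degree (pCons 0 f) \<le> Suc (Polynomial.degree f)" by (rule degree_pCons_le)
  show "dim_row (pe (pCons 0 f)) = dim_row (pe f * A)"
    and "dim_col (pe (pCons 0 f)) = dim_col (pe f * A)"
    using c poly_mat_eval_carrier[of "pCons 0 f"] by auto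
  fix i j assume "i < dim_row (pe f * A)" "j < dim_col (pe f * A)"
  then have ij: "i < n" "j < n" using c by auto
  have pk: "(A ^\<^sub>m Suc k) $$ (i,j) = (\<Sum>l<n. (A ^\<^sub>m k) $$ (i,l) * A $$ (l,j))" for k
    using ij A carrier_matD[OF pow_carrier[of k]] by (simp add: scalar_prod_def atLeast0LessThan)
  have "pe (pCons 0 f) $$ (i,j) = (\<Sum>k\<le>Suc (Polynomial.degree f). Polynomial.coeff (pCons 0 f) k * (A ^\<^sub>m k) $$ (i,j))"
    unfolding poly_mat_eval_eq[OF d] using ij by simp
  also have "\<dots> = (\<Sum>k\<le>Polynomial.degree f. Polynomial.coeff f k * (A ^\<^sub>m Suc k) $$ (i,j))"
    by (subst sum.atMost_Suc_shift) simp
  also have "\<dots> = (\<Sum>k\<le>Polynomial.degree f. \<Sum>l<n. Polynomial.coeff f k * (A ^\<^sub>m k) $$ (i,l) * A $$ (l,j))"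
    unfolding pk by (simp add: sum_distrib_left mult.assoc)
  also have "\<dots> = (\<Sum>l<n. (\<Sum>k\<le>Polynomial.degree f. Polynomial.coeff f k * (A ^\<^sub>m k) $$ (i,l)) * A $$ (l,j))"
    by (subst sum.swap) (simp add: sum_distrib_right)
  also have "\<dots> = (\<Sum>l<n. pe f $$ (i,l) * A $$ (l,j))"
    unfolding poly_mat_eval_eq[OF order.refl, of f] using ij by (intro sum.cong) auto
  also have "\<dots> = (pe f * A) $$ (i,j)"
    using ij A carrier_matD[OF poly_mat_eval_carrier[of f]]
    by (simp add: scalar_prod_def atLeast0LessThan)
  finally show "pe (pCons 0 f) $$ (i,j) = (pe f * A) $$ (i,j)" .
qed

lemma poly_mat_eval_X: "pe [:0, 1:] = A"
  using poly_mat_eval_pCons_0[of 1] A unfolding poly_mat_eval_1 by (simp add: one_pCons)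

lemma poly_mat_eval_mult: "pe (f * g) = pe f * pe g"
proof -
  have "pe (f * g) = pe g * pe f" for f g
  proof (induction f)
    case 0
    show ?case using poly_mat_eval_carrier[of g] by (simp add: poly_mat_eval_0)
  next
    case (pCons a f)
    have "pCons a f = Polynomial.smult a 1 + pCons 0 f" by simp
    then have "pe (pCons a f) = a \<cdot>\<^sub>m 1\<^sub>m n + pe f * A"
      by (simp only: poly_mat_eval_add poly_mat_eval_smult poly_mat_eval_1 poly_mat_eval_pCons_0)
    moreover have "pe (pCons a f * g) = a \<cdot>\<^sub>m pe g + pe g * pe f * A"
      by (simp only: mult_pCons_left poly_mat_eval_add poly_mat_eval_smult poly_mat_eval_pCons_0
        pCons.IH)
    moreover have "pe g * (a \<cdot>\<^sub>m 1\<^sub>m n + pe f * A) = a \<cdot>\<^sub>m pe g + pe g * pe f * A"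
    proof -
      have "pe g * (a \<cdot>\<^sub>m 1\<^sub>m n + pe f * A) = pe g * (a \<cdot>\<^sub>m 1\<^sub>m n) + pe g * (pe f * A)"
        by (intro mult_add_distrib_mat[of _ n n _ n] poly_mat_eval_carrier
          mult_carrier_mat[OF poly_mat_eval_carrier A] smult_carrier_mat one_carrier_mat)
      also have "pe g * (a \<cdot>\<^sub>m 1\<^sub>m n) = a \<cdot>\<^sub>m pe g"
        using mult_smult_distrib[OF poly_mat_eval_carrier[of g] one_carrier_mat, of a]
          right_mult_one_mat[OF poly_mat_eval_carrier[of g]] by simp
      also have "pe g * (pe f * A) = pe g * pe f * A"
        using assoc_mult_mat[OF poly_mat_eval_carrier[of g] poly_mat_eval_carrier[of f] A] by simp
      finally show ?thesis .
    qed
    ultimately show ?case by simp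
  qed
  from this[of g f] show ?thesis by (simp add: mult.commute)
qed

end

subsection \<open>The cokernel is a module over the quotient ring\<close>

lemma abelian_subgroup_mat_range:
  fixes M :: "'a::comm_ring_1 mat"
  assumes M: "M \<in> carrier_mat n n"
  shows "abelian_subgroup (mat_range M) (module_vec TYPE('a) n)"
proof (rule abelian_subgroupI3)
  let ?V = "module_vec TYPE('a) n"
  interpret v: vec_module "TYPE('a)" n .
  show ab: "abelian_group ?V" by (rule v.M.abelian_group_axioms)
  show "additive_subgroup (mat_range M) ?V"
  proof (intro additive_subgroupI subgroup.intro)
    show "mat_range M \<subseteq> carrier (add_monoid ?V)"
      using M by (auto simp: mat_range_def module_vec_simps)
    show "x \<otimes>\<^bsub>add_monoid ?V\<^esub> y \<in> mat_range M" if "x \<in> mat_range M" "y \<in> mat_range M" for x y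
    proof -
      from that M obtain u w where uw: "u \<in> carrier_vec n" "w \<in> carrier_vec n"
        "x = M *\<^sub>v u" "y = M *\<^sub>v w" by (auto simp: mat_range_def)
      then have "x + y = M *\<^sub>v (u + w)" using M by (simp add: mult_add_distrib_mat_vec)
      then show ?thesis using uw M by (auto simp: mat_range_def module_vec_simps)
    qed
    have "M *\<^sub>v 0\<^sub>v n = 0\<^sub>v n" using M by auto
    then show "\<one>\<^bsub>add_monoid ?V\<^esub> \<in> mat_range M"
      using M by (auto simp: mat_range_def module_vec_simps intro!: image_eqI[of _ _ "0\<^sub>v n"])
    show "inv\<^bsub>add_monoid ?V\<^esub> x \<in> mat_range M" if "x \<in> mat_range M" for x
    proof -
      from that M obtain u where u: "u \<in> carrier_vec n" "x = M *\<^sub>v u" by (auto simp: mat_range_def)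
      have "M *\<^sub>v (- u) + x = M *\<^sub>v (- u + u)"
        using u by (subst mult_add_distrib_mat_vec[OF M]) auto
      also have "\<dots> = 0\<^sub>v n" using u M by auto
      finally have "M *\<^sub>v (- u) + x = 0\<^sub>v n" .
      then have "\<ominus>\<^bsub>?V\<^esub> x = M *\<^sub>v (- u)"
        using abelian_group.minus_equality[OF ab, of "M *\<^sub>v (- u)" x] u M
        by (auto simp: module_vec_simps)
      then show ?thesis using u M by (auto simp: mat_range_def a_inv_def)
    qed
  qed
qed

text \<open>The defining property of the module structure; with \<open>f = t\<close> it reads \<open>t \<cdot> x = A x\<close>.\<close>

theorem cok_module_smult:
  fixes A :: "'a::comm_ring_1 mat"
  assumes A: "A \<in> carrier_mat n n" and x: "x \<in> carrier_vec n"
  shows "(PIdl\<^bsub>class_ring\<^esub> P +>\<^bsub>class_ring\<^esub> f) \<odot>\<^bsub>cok_module P A\<^esub>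
      (mat_range (poly_mat_eval P A) +>\<^bsub>module_vec TYPE('a) n\<^esub> x)
    = mat_range (poly_mat_eval P A) +>\<^bsub>module_vec TYPE('a) n\<^esub> (poly_mat_eval f A *\<^sub>v x)"
proof -
  let ?E = "\<lambda>f. poly_mat_eval f A"
  let ?V = "module_vec TYPE('a) n"
  let ?I = "mat_range (?E P)"
  let ?F = "PIdl\<^bsub>class_ring\<^esub> P +>\<^bsub>class_ring\<^esub> f"
  note ec = poly_mat_eval_carrier[OF A]
  note mvc = mult_mat_vec_carrier
  interpret I: abelian_subgroup ?I ?V by (rule abelian_subgroup_mat_range[OF ec])
  have F: "?F = {q * P + f | q. True}"
    by (auto simp: a_r_coset_def r_coset_def cgenideal_def)
  have Zeq: "?I +>\<^bsub>?V\<^esub> x = {?E P *\<^sub>v u + x | u. u \<in> carrier_vec n}"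
    using ec[of P] by (auto simp: a_r_coset_def r_coset_def mat_range_def module_vec_simps)
  have eq: "?I +>\<^bsub>?V\<^esub> (?E g *\<^sub>v z) = ?I +>\<^bsub>?V\<^esub> (?E f *\<^sub>v x)"
    if "g \<in> ?F" "z \<in> ?I +>\<^bsub>?V\<^esub> x" for g z
  proof -
    from that obtain q u where g: "g = P * q + f" and z: "z = ?E P *\<^sub>v u + x"
      and u: "u \<in> carrier_vec n"
      unfolding F Zeq by (auto simp: mult.commute)
    have zc: "z \<in> carrier_vec n" using mvc[OF ec u] x by (simp add: z)
    have "?E g *\<^sub>v z = (?E P * ?E q + ?E f) *\<^sub>v z"
      unfolding g poly_mat_eval_add[OF A] poly_mat_eval_mult[OF A] ..
    also have "\<dots> = ?E P * ?E q *\<^sub>v z + ?E f *\<^sub>v z"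
      by (rule add_mult_distrib_mat_vec[OF mult_carrier_mat[OF ec ec] ec zc])
    also have "?E f *\<^sub>v z = ?E f *\<^sub>v (?E P *\<^sub>v u) + ?E f *\<^sub>v x"
      unfolding z by (rule mult_add_distrib_mat_vec[OF ec mvc[OF ec u] x])
    also have "?E f *\<^sub>v (?E P *\<^sub>v u) = ?E P *\<^sub>v (?E f *\<^sub>v u)"
    proof -
      have "?E f * ?E P = ?E P * ?E f"
        unfolding poly_mat_eval_mult[OF A, symmetric] by (simp add: mult.commute)
      then show ?thesis
        using assoc_mult_mat_vec[OF ec[of f] ec[of P] u] assoc_mult_mat_vec[OF ec[of P] ec[of f] u]
        by simp
    qed
    also have "?E P * ?E q *\<^sub>v z = ?E P *\<^sub>v (?E q *\<^sub>v z)"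
      by (rule assoc_mult_mat_vec[OF ec ec zc])
    also have "?E P *\<^sub>v (?E q *\<^sub>v z) + (?E P *\<^sub>v (?E f *\<^sub>v u) + ?E f *\<^sub>v x)
        = ?E P *\<^sub>v (?E q *\<^sub>v z + ?E f *\<^sub>v u) + ?E f *\<^sub>v x"
      unfolding mult_add_distrib_mat_vec[OF ec mvc[OF ec zc] mvc[OF ec u]]
      by (rule assoc_add_vec[of _ n, symmetric]) (intro mvc[OF ec] zc u x)+
    finally have e: "?E g *\<^sub>v z = ?E P *\<^sub>v (?E q *\<^sub>v z + ?E f *\<^sub>v u) + ?E f *\<^sub>v x" .
    have "?E q *\<^sub>v z + ?E f *\<^sub>v u \<in> carrier_vec n"
      using mvc[OF ec zc] mvc[OF ec u] by simp
    then have "?E g *\<^sub>v z \<in> ?I +>\<^bsub>?V\<^esub> (?E f *\<^sub>v x)"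
      unfolding e using ec[of P]
      by (auto simp: a_r_coset_def r_coset_def mat_range_def module_vec_simps)
    then show ?thesis
      using I.a_repr_independence[OF _ _ I.a_subgroup, of "?E g *\<^sub>v z" "?E f *\<^sub>v x"] mvc[OF ec x]
      by (simp add: module_vec_simps)
  qed
  have fF: "f \<in> ?F" unfolding F by (auto intro: exI[of _ 0])
  have xZ: "x \<in> ?I +>\<^bsub>?V\<^esub> x"
    by (rule I.a_rcos_self) (simp add: module_vec_simps x)
  have "?F \<odot>\<^bsub>cok_module P A\<^esub> (?I +>\<^bsub>?V\<^esub> x)
      = (\<Union>g\<in>?F. \<Union>z\<in>?I +>\<^bsub>?V\<^esub> x. ?I +>\<^bsub>?V\<^esub> (?E g *\<^sub>v z))"
    unfolding cok_module_def Let_def using A by simp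
  also have "\<dots> = (\<Union>g\<in>?F. \<Union>z\<in>?I +>\<^bsub>?V\<^esub> x. ?I +>\<^bsub>?V\<^esub> (?E f *\<^sub>v x))"
    using eq by (intro SUP_cong refl) blast
  also have "\<dots> = ?I +>\<^bsub>?V\<^esub> (?E f *\<^sub>v x)" using fF xZ by blast
  finally show ?thesis .
qed

lemma cring_poly_quot: "cring (poly_quot P)"
  unfolding poly_quot_def
  by (rule ideal.quotient_is_cring[OF cring.cgenideal_ideal]) (simp_all add: class_cring.cring_axioms)

theorem module_cok_module:
  fixes A :: "'a::comm_ring_1 mat"
  assumes A: "A \<in> carrier_mat n n"
  shows "Module.module (poly_quot P) (cok_module P A)"
proof -
  let ?E = "\<lambda>f. poly_mat_eval f A"
  let ?V = "module_vec TYPE('a) n"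
  let ?I = "mat_range (?E P)"
  let ?J = "PIdl\<^bsub>class_ring\<^esub> P"
  let ?M = "cok_module P A"
  let ?R = "poly_quot P"
  let ?cl = "\<lambda>x. ?I +>\<^bsub>?V\<^esub> x"
  let ?q = "\<lambda>f. ?J +>\<^bsub>class_ring\<^esub> f"
  note ec = poly_mat_eval_carrier[OF A]
  note mvc = mult_mat_vec_carrier[OF ec]
  interpret I: abelian_subgroup ?I ?V by (rule abelian_subgroup_mat_range[OF ec])
  interpret J: ideal ?J "class_ring :: 'a poly ring"
    by (rule cring.cgenideal_ideal) (simp_all add: class_cring.cring_axioms)
  have d: "dim_row (?E P) = n" "dim_row A = n" using ec[of P] A by auto
  have carM: "carrier ?M = ?cl ` carrier_vec n" and zeroM: "\<zero>\<^bsub>?M\<^esub> = ?cl (0\<^sub>v n)"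
    and addM0: "add ?M = set_add ?V"
    using I.a_rcos_const[OF additive_subgroup.zero_closed[OF I.additive_subgroup_axioms]]
    by (auto simp: cok_module_def Let_def cok_def d A_FactGroup_def FactGroup_def RCOSETS_def
      a_r_coset_def set_add_def module_vec_simps)
  have addM: "?cl x \<oplus>\<^bsub>?M\<^esub> ?cl y = ?cl (x + y)" if "x \<in> carrier_vec n" "y \<in> carrier_vec n" for x y
    using I.a_rcos_sum[of x y] that unfolding addM0 by (simp add: module_vec_simps)
  have carR: "carrier ?R = range ?q" and oneR: "\<one>\<^bsub>?R\<^esub> = ?q 1"
    and addR: "?q f \<oplus>\<^bsub>?R\<^esub> ?q g = ?q (f + g)" and multR: "?q f \<otimes>\<^bsub>?R\<^esub> ?q g = ?q (f * g)" for f g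
    using J.a_rcos_sum[of f g] J.rcoset_mult_add[of f g]
    by (auto simp: poly_quot_def FactRing_def A_RCOSETS_def RCOSETS_def a_r_coset_def)
  have smult: "?q f \<odot>\<^bsub>?M\<^esub> ?cl x = ?cl (?E f *\<^sub>v x)" if "x \<in> carrier_vec n" for f x
    by (rule cok_module_smult[OF A that])
  have pM: "(\<forall>Z \<in> carrier ?M. Q Z) \<longleftrightarrow> (\<forall>x \<in> carrier_vec n. Q (?cl x))" for Q
    unfolding carM by blast
  have pR: "(\<forall>F \<in> carrier ?R. Q F) \<longleftrightarrow> (\<forall>f. Q (?q f))" for Q
    unfolding carR by blast
  have ab: "abelian_group ?M"
  proof (rule abelian_groupI)
    fix Z1 Z2 Z3 assume "Z1 \<in> carrier ?M" "Z2 \<in> carrier ?M" "Z3 \<in> carrier ?M"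
    then obtain x y z where *: "Z1 = ?cl x" "Z2 = ?cl y" "Z3 = ?cl z"
      and c: "x \<in> carrier_vec n" "y \<in> carrier_vec n" "z \<in> carrier_vec n" unfolding carM by blast
    show "Z1 \<oplus>\<^bsub>?M\<^esub> Z2 \<in> carrier ?M" unfolding * addM[OF c(1,2)] carM
      by (rule imageI) (simp add: c)
    show "Z1 \<oplus>\<^bsub>?M\<^esub> Z2 \<oplus>\<^bsub>?M\<^esub> Z3 = Z1 \<oplus>\<^bsub>?M\<^esub> (Z2 \<oplus>\<^bsub>?M\<^esub> Z3)"
      unfolding * using c by (simp add: addM assoc_add_vec[of _ n])
    show "Z1 \<oplus>\<^bsub>?M\<^esub> Z2 = Z2 \<oplus>\<^bsub>?M\<^esub> Z1"
      unfolding * using c by (simp add: addM comm_add_vec[of _ n])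
    show "\<zero>\<^bsub>?M\<^esub> \<oplus>\<^bsub>?M\<^esub> Z1 = Z1" unfolding * zeroM using c by (simp add: addM)
    have "?cl (- x) \<oplus>\<^bsub>?M\<^esub> Z1 = \<zero>\<^bsub>?M\<^esub>" unfolding * zeroM using c by (simp add: addM)
    moreover have "?cl (- x) \<in> carrier ?M" unfolding carM by (rule imageI) (simp add: c)
    ultimately show "\<exists>Z \<in> carrier ?M. Z \<oplus>\<^bsub>?M\<^esub> Z1 = \<zero>\<^bsub>?M\<^esub>" by (rule bexI)
  next
    show "\<zero>\<^bsub>?M\<^esub> \<in> carrier ?M" unfolding zeroM carM by (rule imageI) simp
  qed
  have sc: "\<forall>F\<in>carrier ?R. \<forall>Z\<in>carrier ?M. F \<odot>\<^bsub>?M\<^esub> Z \<in> carrier ?M"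
    unfolding pM pR using mvc by (simp add: smult) (simp add: carM imageI)
  have sl: "\<forall>F\<in>carrier ?R. \<forall>G\<in>carrier ?R. \<forall>Z\<in>carrier ?M.
      (F \<oplus>\<^bsub>?R\<^esub> G) \<odot>\<^bsub>?M\<^esub> Z = F \<odot>\<^bsub>?M\<^esub> Z \<oplus>\<^bsub>?M\<^esub> G \<odot>\<^bsub>?M\<^esub> Z"
    unfolding pM pR addR
    by (simp add: smult addM mvc poly_mat_eval_add[OF A] add_mult_distrib_mat_vec[OF ec ec])
  have sr: "\<forall>F\<in>carrier ?R. \<forall>Z\<in>carrier ?M. \<forall>Y\<in>carrier ?M.
      F \<odot>\<^bsub>?M\<^esub> (Z \<oplus>\<^bsub>?M\<^esub> Y) = F \<odot>\<^bsub>?M\<^esub> Z \<oplus>\<^bsub>?M\<^esub> F \<odot>\<^bsub>?M\<^esub> Y"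
    unfolding pM pR by (simp add: smult addM mvc mult_add_distrib_mat_vec[OF ec])
  have sa: "\<forall>F\<in>carrier ?R. \<forall>G\<in>carrier ?R. \<forall>Z\<in>carrier ?M.
      (F \<otimes>\<^bsub>?R\<^esub> G) \<odot>\<^bsub>?M\<^esub> Z = F \<odot>\<^bsub>?M\<^esub> (G \<odot>\<^bsub>?M\<^esub> Z)"
    unfolding pM pR multR
    by (simp add: smult mvc poly_mat_eval_mult[OF A] assoc_mult_mat_vec[OF ec ec])
  have s1: "\<forall>Z\<in>carrier ?M. \<one>\<^bsub>?R\<^esub> \<odot>\<^bsub>?M\<^esub> Z = Z"
    unfolding pM oneR by (simp add: smult poly_mat_eval_1[OF A])
  show ?thesis
    using sc sl sr sa s1 by (intro moduleI cring_poly_quot ab) simp_all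
qed

end

theory Submission
  imports Defs "HOL-Library.Function_Algebras" "HOL-Algebra.Multiplicative_Group"
begin

text \<open>
  A surjection \<open>cok (P\<^sub>j(A)) \<rightarrow> H\<^sub>j\<close> is given by a tuple \<open>g\<^sub>j\<close> of \<open>n\<close> elements of \<open>H\<^sub>j\<close>, that is, by a linear
  map \<open>\<lambda>\<^sub>j\<close> on \<open>L = \<int>\<^sub>p[t]\<^sup>n\<close> with kernel \<open>K\<^sub>j\<close> containing the columns of \<open>t - A\<close>; it is an isomorphism iff
  these columns generate \<open>K\<^sub>j\<close> modulo \<open>N\<^sub>j = p K\<^sub>j + P\<^sub>j L\<close>. For every \<open>A\<close> the number of tuples \<open>(g\<^sub>j)\<^sub>j\<close> giving
  isomorphisms is \<open>\<Prod>\<^sub>j |Aut H\<^sub>j|\<close> or \<open>0\<close>, so the probability is found by counting, for a fixed \<open>g\<close>, the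
  matrices \<open>A\<close> modulo \<open>p\<^sup>e\<^sup>+\<^sup>1\<close> whose columns generate. The columns fail to generate iff a nonzero
  functional on \<open>K\<^sub>j / N\<^sub>j\<close>, an \<open>n\<close>-dimensional space over the field with \<open>q\<^sub>j = p ^ deg P\<^sub>j\<close> elements,
  annihilates them. Inclusion-exclusion over linearly independent lists of functionals and the
  \<open>q\<close>-binomial theorem give the main term \<open>\<Prod>\<^sub>j \<Prod>\<^sub>k\<^sub>\<le>\<^sub>n (1 - q\<^sub>j\<^sup>-\<^sup>k)\<close>; the functionals that do not see the constant
  vectors, and the tuples \<open>g\<close> that do not map the constant vectors onto \<open>\<Prod>\<^sub>j H\<^sub>j\<close>, contribute
  errors that decay exponentially in \<open>n\<close>.
\<close>

section \<open>The \<open>q\<close>-binomial theorem\<close>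

text \<open>The exponent \<open>e + 1\<close> is chosen because \<open>p^e\<close> kills every
  \<open>H\<^sub>j\<close>, so \<open>p^(e+1) L\<close> lies in every \<open>N\<^sub>j\<close>;
  generation modulo \<open>N\<^sub>j\<close> is enough by Nakayama's lemma. The multiplicity
  \<open>|Aut H\<^sub>j|\<close> arises since the isomorphisms from a cokernel onto
  \<open>H\<^sub>j\<close> form a torsor under the automorphisms. The obstacle: only the constant
  part of a column of \<open>t - A\<close> varies, so functionals on the different
  \<open>K\<^sub>j\<close> are tested on one group \<open>B\<close>, the constants lying in all
  \<open>K\<^sub>j\<close>, where they may become dependent. Lists dependent on \<open>B\<close>
  turn out to annihilate no columns at all, so their true contribution is 0; the error comes from
  adding them to complete the q-binomial sum. The weight \<open>(-1)^i / q_fact q i\<close> is the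
  Moebius function \<open>(-1)^i q^(i choose 2)\<close> of the subspace lattice divided by the
  number \<open>q^(i choose 2) * q_fact q i\<close> of ordered bases of an
  \<open>i\<close>-dimensional space. With \<open>h\<close> the order of the product of the
  \<open>H\<^sub>j\<close>, a column has \<open>p^((e+1)n) / h\<close> candidates and there are
  \<open>h^n\<close> tuples: the orders cancel in the limit, and only the automorphism groups
  remain.\<close>

definition q_fact :: "real \<Rightarrow> nat \<Rightarrow> real" where
  "q_fact q i = (\<Prod>k<i. q ^ Suc k - 1)"

lemma q_fact_pos: "1 < q \<Longrightarrow> 0 < q_fact q i"
  unfolding q_fact_def using one_less_power[of q "Suc _"] by (intro prod_pos) (auto simp del: power_Suc)

text \<open>Pascal's rule for \<open>q^(i choose 2)\<close> times the Gaussian binomial, which is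
  the value of these quotients. Pulling a factor \<open>q\<close> out of every factor but the first
  relates the product for \<open>Suc n\<close> to the one for \<open>n\<close>.\<close>

lemma q_binomial_rec:
  fixes q :: real
  assumes "1 < q"
  shows "(\<Prod>k<Suc i. q ^ Suc n - q ^ k) / q_fact q (Suc i)
    = (\<Prod>k<Suc i. q ^ n - q ^ k) / q_fact q (Suc i) + q ^ n * ((\<Prod>k<i. q ^ n - q ^ k) / q_fact q i)"
proof -
  let ?p = "\<Prod>k<i. q ^ n - q ^ k"
  have "(\<Prod>k<Suc i. q ^ Suc n - q ^ k) = (q ^ Suc n - 1) * (\<Prod>k<i. q * (q ^ n - q ^ k))"
    by (subst prod.lessThan_Suc_shift) (simp add: algebra_simps)
  then have 1: "(\<Prod>k<Suc i. q ^ Suc n - q ^ k) = (q ^ Suc n - 1) * q ^ i * ?p"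
    by (simp add: prod.distrib)
  have 2: "q_fact q (Suc i) = q_fact q i * (q ^ Suc i - 1)" by (simp add: q_fact_def)
  have nz: "q_fact q i \<noteq> 0" "q ^ Suc i - 1 \<noteq> 0"
    using q_fact_pos[OF assms, of i] one_less_power[OF assms, of "Suc i"] by auto
  show ?thesis
    unfolding 1 2 using nz by (simp add: divide_simps del: power_Suc) (simp add: algebra_simps)
qed

text \<open>By Pascal's rule the step from \<open>n\<close> to \<open>Suc n\<close> multiplies the
  sum by \<open>1 - q ^ n * y\<close>, the new factor of the product.\<close>

lemma q_binomial:
  fixes q y :: real
  assumes "1 < q"
  shows "(\<Sum>i\<le>n. (\<Prod>k<i. q ^ n - q ^ k) / q_fact q i * (- y) ^ i) = (\<Prod>k<n. 1 - q ^ k * y)"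
proof (induction n)
  case 0
  show ?case by (simp add: q_fact_def)
next
  case (Suc n)
  define B where "B n i = (\<Prod>k<i. q ^ n - q ^ k) / q_fact q i" for n i
  have B0: "B m 0 = 1" for m by (simp add: B_def q_fact_def)
  \<comment> \<open>The factor \<open>k = n\<close> vanishes, so the sum for \<open>n\<close> may be
    extended by the index \<open>Suc n\<close>.\<close>
  have B1: "B n (Suc n) = 0" by (simp add: B_def)
  have Br: "B (Suc n) (Suc i) = B n (Suc i) + q ^ n * B n i" for i
    unfolding B_def by (rule q_binomial_rec[OF assms])
  have "(\<Sum>i\<le>Suc n. B (Suc n) i * (- y) ^ i)
      = 1 + (\<Sum>i\<le>n. (B n (Suc i) + q ^ n * B n i) * (- y) ^ Suc i)"
    by (subst sum.atMost_Suc_shift) (simp add: B0 Br)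
  also have "\<dots> = (1 + (\<Sum>i\<le>n. B n (Suc i) * (- y) ^ Suc i)) - q ^ n * y * (\<Sum>i\<le>n. B n i * (- y) ^ i)"
    by (simp only: distrib_right sum.distrib sum_distrib_left) (simp add: mult_ac flip: sum_negf)
  also have "1 + (\<Sum>i\<le>n. B n (Suc i) * (- y) ^ Suc i) = (\<Sum>i\<le>Suc n. B n i * (- y) ^ i)"
    unfolding sum.atMost_Suc_shift[of "\<lambda>i. B n i * (- y) ^ i"] by (simp add: B0)
  also have "\<dots> = (\<Sum>i\<le>n. B n i * (- y) ^ i)" by (simp add: B1)
  finally show ?case using Suc.IH unfolding B_def by (simp add: algebra_simps)
qed

text \<open>At \<open>y = 1\<close> the factor \<open>k = 0\<close> of the product vanishes unless
  the product is empty. The summation bound \<open>n\<close> is kept apart from \<open>r\<close> so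
  that the same weights serve spaces of unknown dimension.\<close>

lemma q_binomial_indicator:
  fixes q :: real
  assumes "1 < q" "r \<le> n"
  shows "(\<Sum>i\<le>n. (- 1) ^ i / q_fact q i * (\<Prod>k<i. q ^ r - q ^ k)) = of_bool (r = 0)"
proof -
  have "(\<Sum>i\<le>n. (- 1) ^ i / q_fact q i * (\<Prod>k<i. q ^ r - q ^ k))
      = (\<Sum>i\<le>r. (- 1) ^ i / q_fact q i * (\<Prod>k<i. q ^ r - q ^ k))"
    using assms(2) by (intro sum.mono_neutral_right) auto
  also have "\<dots> = (\<Prod>k<r. 1 - q ^ k * 1)"
    unfolding q_binomial[OF assms(1), symmetric] by (intro sum.cong) (auto simp: field_simps)
  also have "\<dots> = of_bool (r = 0)" by (cases r) (auto simp: prod.lessThan_Suc_shift simp del: prod.lessThan_Suc)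
  finally show ?thesis .
qed

text \<open>The choice \<open>y = q^-n\<close> gives the Euler product once the factors are
  reversed. The ratio under the sum is the proportion of independent lists among all lists of length
  \<open>i\<close> in a space with \<open>q^n\<close> elements.\<close>

lemma q_binomial_euler:
  fixes q :: real
  assumes "1 < q"
  shows "(\<Sum>i\<le>n. (- 1) ^ i / q_fact q i * ((\<Prod>k<i. q ^ n - q ^ k) / (q ^ n) ^ i)) = (\<Prod>k<n. 1 - 1 / q ^ Suc k)"
proof -
  have "(\<Sum>i\<le>n. (- 1) ^ i / q_fact q i * ((\<Prod>k<i. q ^ n - q ^ k) / (q ^ n) ^ i))
      = (\<Sum>i\<le>n. (\<Prod>k<i. q ^ n - q ^ k) / q_fact q i * (- (1 / q ^ n)) ^ i)"
    by (intro sum.cong refl) (simp add: power_minus[of "1 / q ^ n"] power_divide)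
  also have "\<dots> = (\<Prod>k<n. 1 - q ^ k * (1 / q ^ n))" by (rule q_binomial[OF assms])
  also have "\<dots> = (\<Prod>k<n. 1 - q ^ (n - Suc k) * (1 / q ^ n))" by (rule prod.nat_diff_reindex[symmetric])
  also have "\<dots> = (\<Prod>k<n. 1 - 1 / q ^ Suc k)"
  proof (rule prod.cong[OF refl])
    fix k assume "k \<in> {..<n}"
    then have "q ^ n = q ^ (n - Suc k) * q ^ Suc k" unfolding power_add[symmetric] by simp
    moreover have "q ^ (n - Suc k) \<noteq> 0" using assms by simp
    ultimately show "1 - q ^ (n - Suc k) * (1 / q ^ n) = 1 - 1 / q ^ Suc k"
      by (simp add: field_simps del: power_Suc)
  qed
  finally show ?thesis .
qed

text \<open>Consecutive terms have ratio \<open>q / (q^(i+1) - 1)\<close>. The sum of the series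
  becomes the error constant that does not depend on \<open>n\<close>.\<close>

lemma q_fact_inverse_summable:
  fixes q :: real
  assumes "2 \<le> q"
  shows "summable (\<lambda>i. q ^ i / q_fact q i)"
\<comment> \<open>From index 2 on, \<open>q^i \<ge> q^2 \<ge> 2 q\<close> keeps the ratio below 1/2;
  for \<open>q = 2\<close> the ratio at index 1 is still 2/3.\<close>
proof (rule summable_ratio_test[of "1/2" 2])
  fix i :: nat assume "2 \<le> i"
  then have "q ^ 2 \<le> q ^ i" using assms by (intro power_increasing) auto
  then have "2 * q \<le> q ^ i" using assms mult_right_mono[of 2 q q] unfolding power2_eq_square by linarith
  then have "2 * q \<le> q ^ i * q - 1" using assms mult_mono[of "2*q" "q^i" 2 q] by linarith
  then have r: "q / (q ^ Suc i - 1) \<le> 1 / 2" using assms by (simp add: divide_simps algebra_simps split: if_splits)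
  have pos: "0 < q_fact q i" using assms by (intro q_fact_pos) auto
  have "q ^ Suc i / q_fact q (Suc i) = (q / (q ^ Suc i - 1)) * (q ^ i / q_fact q i)"
    by (simp add: q_fact_def mult.commute)
  also have "\<dots> \<le> 1/2 * (q ^ i / q_fact q i)" using assms pos by (intro mult_right_mono r) auto
  finally show "norm (q ^ Suc i / q_fact q (Suc i)) \<le> 1/2 * norm (q ^ i / q_fact q i)"
    using assms pos q_fact_pos[of q "Suc i"] by simp
qed simp

lemma q_fact_inverse_sum_le:
  fixes q :: real
  assumes "2 \<le> q"
  shows "(\<Sum>i\<le>n. q ^ i / q_fact q i) \<le> (\<Sum>i. q ^ i / q_fact q i)"
  using assms q_fact_pos[of q] by (intro sum_le_suminf q_fact_inverse_summable) (auto intro: less_imp_le)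

lemma q_pochhammer_LIMSEQ:
  fixes q :: real
  assumes "1 < q"
  shows "(\<lambda>n. \<Prod>k<n. 1 - 1 / q ^ Suc k) \<longlonglongrightarrow> (\<Prod>k. 1 - 1 / q ^ Suc k)"
proof -
  have "summable (\<lambda>k. (1 / q) ^ k * (1 / q))"
    using assms by (intro summable_mult2 summable_geometric) auto
  then have "summable (\<lambda>k. norm (- (1 / q ^ Suc k)))"
    using assms by (simp add: power_divide mult.commute)
  then have "convergent_prod (\<lambda>k. 1 + - (1 / q ^ Suc k))"
    by (intro abs_convergent_prod_imp_convergent_prod summable_imp_abs_convergent_prod)
      (simp only: add_diff_cancel_left')
  then have "convergent_prod (\<lambda>k. 1 - 1 / q ^ Suc k)" by (simp only: add_uminus_conv_diff)
  then have *: "(\<lambda>n. \<Prod>k\<le>n. 1 - 1 / q ^ Suc k) \<longlonglongrightarrow> (\<Prod>k. 1 - 1 / q ^ Suc k)"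
    by (rule convergent_prod_LIMSEQ)
  have "(\<lambda>n. \<Prod>k<Suc n. 1 - 1 / q ^ Suc k) \<longlonglongrightarrow> (\<Prod>k. 1 - 1 / q ^ Suc k)"
    using * by (simp only: lessThan_Suc_atMost)
  then show ?thesis by (subst (asm) filterlim_sequentially_Suc)
qed

section \<open>Counting independent lists\<close>

text \<open>Coefficients range over the whole ring; on \<open>D\<close> only their classes modulo
  \<open>I\<close> will matter.\<close>

primrec list_span :: "('r \<Rightarrow> 'a \<Rightarrow> 'a) \<Rightarrow> 'a::ab_group_add list \<Rightarrow> 'a set" where
  "list_span act [] = {0}"
| "list_span act (x # xs) = {act f x + y | f y. y \<in> list_span act xs}"

text \<open>Testing each entry against the later ones only makes extensions easy to count: a list is
  prolonged at its head by any vector outside its span.\<close>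

primrec list_indep :: "('r \<Rightarrow> 'a \<Rightarrow> 'a) \<Rightarrow> 'a::ab_group_add list \<Rightarrow> bool" where
  "list_indep act [] \<longleftrightarrow> True"
| "list_indep act (x # xs) \<longleftrightarrow> x \<notin> list_span act xs \<and> list_indep act xs"

fun list_comb :: "('r \<Rightarrow> 'a \<Rightarrow> 'a) \<Rightarrow> 'r list \<Rightarrow> 'a::ab_group_add list \<Rightarrow> 'a" where
  "list_comb act (f # fs) (x # xs) = act f x + list_comb act fs xs"
| "list_comb act _ _ = 0"

definition indep_lists :: "('r \<Rightarrow> 'a \<Rightarrow> 'a) \<Rightarrow> 'a::ab_group_add set \<Rightarrow> nat \<Rightarrow> 'a list set" where
  "indep_lists act D i = {xs. set xs \<subseteq> D \<and> length xs = i \<and> list_indep act xs}"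

text \<open>A finite vector space over the field \<open>R/I\<close>; \<open>T\<close> is a set of representatives of this field.\<close>

locale finite_space =
  fixes act :: "'r::comm_ring_1 \<Rightarrow> 'a::ab_group_add \<Rightarrow> 'a" and D :: "'a set" and I T :: "'r set"
  assumes finite_D: "finite D"
    and zero_D: "0 \<in> D"
    and add_D: "x \<in> D \<Longrightarrow> y \<in> D \<Longrightarrow> x + y \<in> D"
    and act_D: "x \<in> D \<Longrightarrow> act f x \<in> D"
    and act_add_right: "x \<in> D \<Longrightarrow> y \<in> D \<Longrightarrow> act f (x + y) = act f x + act f y"
    and act_add_left: "x \<in> D \<Longrightarrow> act (f + g) x = act f x + act g x"
    and act_mult: "x \<in> D \<Longrightarrow> act (f * g) x = act f (act g x)"
    and act_one: "x \<in> D \<Longrightarrow> act 1 x = x"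
    and act_ideal: "x \<in> D \<Longrightarrow> f \<in> I \<Longrightarrow> act f x = 0"
    and inverse_ex: "f \<notin> I \<Longrightarrow> \<exists>a. a * f - 1 \<in> I"
    and finite_T: "finite T"
    and T_ex: "\<exists>s\<in>T. f - s \<in> I"
    and T_unique: "s \<in> T \<Longrightarrow> s' \<in> T \<Longrightarrow> s - s' \<in> I \<Longrightarrow> s = s'"
    and card_T: "2 \<le> card T"
begin

lemma act_zero_left: "x \<in> D \<Longrightarrow> act 0 x = 0"
  using act_add_left[of x 0 0] by simp

lemma act_uminus: "x \<in> D \<Longrightarrow> act (- f) x = - act f x"
  using act_add_left[of x f "- f"] act_zero_left[of x] by (simp add: minus_unique)

lemma act_diff_left: "x \<in> D \<Longrightarrow> act (f - g) x = act f x - act g x"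
  using act_add_left[of x f "- g"] by (simp add: act_uminus)

lemma act_zero_right: "act f 0 = 0"
  using act_add_right[OF zero_D zero_D, of f] by simp

lemma act_cong: "x \<in> D \<Longrightarrow> f - g \<in> I \<Longrightarrow> act f x = act g x"
  using act_ideal[of x "f - g"] by (simp add: act_diff_left)

lemma act_cancel:
  assumes "x \<in> D" "f \<notin> I"
  obtains a where "act a (act f x) = x"
proof -
  from inverse_ex[OF assms(2)] obtain a where "a * f - 1 \<in> I" by blast
  then have "act (a * f) x = act 1 x" by (rule act_cong[OF assms(1)])
  then show ?thesis using that[of a] assms(1) by (simp add: act_mult act_one)
qed

lemma list_span_subset: "set xs \<subseteq> D \<Longrightarrow> list_span act xs \<subseteq> D"
  by (induction xs) (auto intro!: zero_D add_D act_D)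

lemma list_span_zero: "set xs \<subseteq> D \<Longrightarrow> 0 \<in> list_span act xs"
proof (induction xs)
  case (Cons x xs)
  then have "0 = act 0 x + 0 \<and> 0 \<in> list_span act xs" by (simp add: act_zero_left)
  then show ?case unfolding list_span.simps by blast
qed simp

lemma list_span_add:
  assumes "set xs \<subseteq> D" "u \<in> list_span act xs" "v \<in> list_span act xs"
  shows "u + v \<in> list_span act xs"
  using assms
proof (induction xs arbitrary: u v)
  case (Cons x xs)
  then obtain f y g z where *: "u = act f x + y" "v = act g x + z"
    "y \<in> list_span act xs" "z \<in> list_span act xs" by auto
  then have "u + v = act (f + g) x + (y + z)" using Cons.prems by (simp add: act_add_left)
  moreover have "y + z \<in> list_span act xs" using Cons * by simp
  ultimately show ?case by auto
qed simp

lemma list_span_act: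
  assumes "set xs \<subseteq> D" "u \<in> list_span act xs"
  shows "act f u \<in> list_span act xs"
  using assms
proof (induction xs arbitrary: u)
  case (Cons x xs)
  then obtain g y where *: "u = act g x + y" "y \<in> list_span act xs" by auto
  then have "y \<in> D" using list_span_subset[of xs] Cons.prems by auto
  then have "act f u = act (f * g) x + act f y" using Cons.prems *
    by (simp add: act_add_right act_D act_mult)
  moreover have "act f y \<in> list_span act xs" using Cons * by simp
  ultimately show ?case by auto
qed (simp add: act_zero_right)

lemma list_span_diff:
  assumes "set xs \<subseteq> D" "u \<in> list_span act xs" "v \<in> list_span act xs"
  shows "u - v \<in> list_span act xs"
proof -
  have "v \<in> D" using assms list_span_subset by blast
  then have "act (- 1) v = - v" by (simp add: act_uminus act_one)
  then show ?thesis
    using list_span_add[OF assms(1,2) list_span_act[OF assms(1,3), of "- 1"]] by simp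
qed

lemma set_subset_list_span: "set xs \<subseteq> D \<Longrightarrow> set xs \<subseteq> list_span act xs"
proof (induction xs)
  case (Cons x xs)
  have "x = act 1 x + 0" using Cons.prems by (simp add: act_one)
  then have "x \<in> list_span act (x # xs)" using Cons.prems list_span_zero[of xs] unfolding list_span.simps by (intro CollectI exI[of _ 1] exI[of _ 0]) simp
  moreover have "y \<in> list_span act (x # xs)" if "y \<in> set xs" for y
  proof -
    have "y = act 0 x + y" using Cons.prems by (simp add: act_zero_left)
    moreover have "y \<in> list_span act xs" using Cons that by auto
    ultimately show ?thesis unfolding list_span.simps by blast
  qed
  ultimately show ?case by auto
qed simp

text \<open>Replacing a coefficient by its representative in \<open>T\<close> changes nothing on
  \<open>D\<close>; this leaves finitely many coefficient lists for the later union bound.\<close>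

lemma list_span_eq_list_comb:
  assumes "set xs \<subseteq> D"
  shows "list_span act xs = (\<lambda>fs. list_comb act fs xs) ` {fs. set fs \<subseteq> T \<and> length fs = length xs}"
  using assms
proof (induction xs)
  case (Cons x xs)
  have "\<exists>fs. u = list_comb act fs (x # xs) \<and> set fs \<subseteq> T \<and> length fs = length (x # xs)"
    if "u \<in> list_span act (x # xs)" for u
  proof -
    from that obtain f y where *: "u = act f x + y" "y \<in> list_span act xs" by auto
    with Cons obtain fs where fs: "y = list_comb act fs xs" "set fs \<subseteq> T" "length fs = length xs"
      by auto
    from T_ex obtain s where s: "s \<in> T" "f - s \<in> I" by blast
    have "u = list_comb act (s # fs) (x # xs)" using * fs act_cong[OF _ s(2), of x] Cons.prems by simp
    then show ?thesis using fs s by (intro exI[of _ "s # fs"]) auto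
  qed
  moreover have "list_comb act fs (x # xs) \<in> list_span act (x # xs)"
    if "set fs \<subseteq> T \<and> length fs = length (x # xs)" for fs
  proof -
    from that obtain s gs where fs: "fs = s # gs" "set gs \<subseteq> T" "length gs = length xs"
      by (cases fs) auto
    then have "list_comb act gs xs \<in> list_span act xs" using Cons by auto
    then show ?thesis unfolding fs by auto
  qed
  ultimately show ?case by blast
qed auto

lemma finite_list_span: "set xs \<subseteq> D \<Longrightarrow> finite (list_span act xs)"
  using finite_subset[OF list_span_subset finite_D] .

text \<open>Different coefficients of the head lead to different cosets of the span of the tail: a
  difference outside \<open>I\<close> is invertible and would put the head into that span.\<close>

lemma card_list_span:
  assumes "set xs \<subseteq> D" "list_indep act xs"
  shows "card (list_span act xs) = card T ^ length xs"
  using assms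
proof (induction xs)
  case (Cons x xs)
  let ?S = "list_span act xs"
  have xD: "x \<in> D" and xsD: "set xs \<subseteq> D" and ind: "x \<notin> ?S" using Cons.prems by auto
  have "bij_betw (\<lambda>(s, y). act s x + y) (T \<times> ?S) (list_span act (x # xs))"
  proof (rule bij_betw_imageI)
    show "inj_on (\<lambda>(s, y). act s x + y) (T \<times> ?S)"
    proof (rule inj_onI, clarify)
      fix s y s' y'
      assume *: "s \<in> T" "s' \<in> T" "y \<in> ?S" "y' \<in> ?S" "act s x + y = act s' x + y'"
      then have "act (s - s') x = y' - y" using xD by (simp add: act_diff_left algebra_simps)
      then have in_S: "act (s - s') x \<in> ?S" using list_span_diff[OF xsD] * by simp
      have "s - s' \<in> I"
      proof (rule ccontr)
        assume "s - s' \<notin> I"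
        from act_cancel[OF xD this] obtain a where "act a (act (s - s') x) = x" .
        then show False using list_span_act[OF xsD in_S, of a] ind by simp
      qed
      then have "s = s'" using T_unique * by blast
      then show "s = s' \<and> y = y'" using * by simp
    qed
    show "(\<lambda>(s, y). act s x + y) ` (T \<times> ?S) = list_span act (x # xs)"
    proof (intro equalityI subsetI)
      fix u assume "u \<in> list_span act (x # xs)"
      then obtain f y where *: "u = act f x + y" "y \<in> ?S" by auto
      from T_ex obtain s where s: "s \<in> T" "f - s \<in> I" by blast
      have "u = act s x + y" using * act_cong[OF xD s(2)] by simp
      then show "u \<in> (\<lambda>(s, y). act s x + y) ` (T \<times> ?S)" using s * by auto
    qed auto
  qed
  then have "card (list_span act (x # xs)) = card T * card ?S"
    by (simp add: bij_betw_same_card[symmetric] card_cartesian_product del: list_span.simps)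
  then show ?case using Cons by simp
qed simp

lemma finite_lists_D: "finite {xs. set xs \<subseteq> D \<and> length xs = i}"
  using finite_lists_length_eq[OF finite_D] .

lemma finite_indep_lists: "finite (indep_lists act D i)"
  unfolding indep_lists_def by (rule finite_subset[OF _ finite_lists_D[of i]]) auto

text \<open>A list of length \<open>i\<close> has \<open>card D - card T ^ i\<close> prolongations.
  Computed in the reals, the product is right beyond the dimension too, where one of its factors is
  0.\<close>

lemma card_indep_lists:
  "real (card (indep_lists act D i)) = (\<Prod>k<i. real (card D) - real (card T) ^ k)"
proof (induction i)
  case 0
  have "indep_lists act D 0 = {[]}" by (auto simp: indep_lists_def)
  then show ?case by simp
next
  case (Suc i)
  have "bij_betw (\<lambda>(xs, x). x # xs) (SIGMA xs : indep_lists act D i. D - list_span act xs)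
      (indep_lists act D (Suc i))"
    by (intro bij_betw_imageI) (force simp: inj_on_def indep_lists_def image_iff length_Suc_conv)+
  then have "card (indep_lists act D (Suc i)) = (\<Sum>xs\<in>indep_lists act D i. card (D - list_span act xs))"
    using finite_indep_lists finite_D by (simp add: bij_betw_same_card[symmetric])
  moreover have "real (card (D - list_span act xs)) = real (card D) - real (card T) ^ i"
    if "xs \<in> indep_lists act D i" for xs
  proof -
    have xs: "set xs \<subseteq> D" "list_indep act xs" "length xs = i" using that by (auto simp: indep_lists_def)
    have "card (list_span act xs) \<le> card D" by (intro card_mono finite_D list_span_subset xs)
    then show ?thesis
      using card_Diff_subset[OF finite_list_span[OF xs(1)] list_span_subset[OF xs(1)]]
        card_list_span[OF xs(1,2)] xs(3) by (simp add: of_nat_diff)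
  qed
  ultimately have "real (card (indep_lists act D (Suc i)))
      = real (card (indep_lists act D i)) * (real (card D) - real (card T) ^ i)"
    by simp
  then show ?case using Suc by simp
qed

text \<open>An independent list of maximal length spans \<open>D\<close>; a maximal length exists
  because \<open>2 ^ i \<le> card T ^ i \<le> card D\<close>.\<close>

lemma card_D_power: "\<exists>r. card D = card T ^ r"
proof -
  define P where "P i \<longleftrightarrow> indep_lists act D i \<noteq> {}" for i
  have "i \<le> card D" if "P i" for i
  proof -
    from that obtain xs where xs: "set xs \<subseteq> D" "list_indep act xs" "length xs = i"
      unfolding P_def indep_lists_def by blast
    have "card T ^ i \<le> card D"
      using card_list_span[OF xs(1,2)] card_mono[OF finite_D list_span_subset[OF xs(1)]] xs(3) by simp
    moreover have "i < 2 ^ i" by simp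
    moreover have "2 ^ i \<le> card T ^ i" using card_T by (rule power_mono) simp
    ultimately show ?thesis by linarith
  qed
  moreover have "P 0" by (simp add: P_def indep_lists_def)
  ultimately obtain i where i: "P i" "\<And>k. P k \<Longrightarrow> k \<le> i"
    using Nat.ex_has_greatest_nat[of P 0 "card D"] by blast
  from i(1) obtain xs where xs: "set xs \<subseteq> D" "list_indep act xs" "length xs = i"
    unfolding P_def indep_lists_def by blast
  have "D \<subseteq> list_span act xs"
  proof
    fix x assume "x \<in> D"
    show "x \<in> list_span act xs"
    proof (rule ccontr)
      assume "x \<notin> list_span act xs"
      then have "x # xs \<in> indep_lists act D (Suc i)" using xs \<open>x \<in> D\<close> by (auto simp: indep_lists_def)
      then show False using i(2)[of "Suc i"] by (auto simp: P_def)
    qed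
  qed
  then have "D = list_span act xs" using list_span_subset[OF xs(1)] by blast
  then show ?thesis using card_list_span[OF xs(1,2)] by metis
qed

text \<open>Moebius inversion on the lattice of subspaces of \<open>D\<close>, written with ordered
  independent lists so that no subspaces have to be enumerated. The dimension of \<open>D\<close>
  may be anything up to \<open>n\<close>.\<close>

lemma indep_lists_indicator:
  assumes "card D \<le> card T ^ n"
  shows "(\<Sum>i\<le>n. (- 1) ^ i / q_fact (card T) i * real (card (indep_lists act D i))) = of_bool (D = {0})"
proof -
  from card_D_power obtain r where r: "card D = card T ^ r" by blast
  have "r \<le> n" using assms card_T unfolding r by (simp add: power_le_imp_le_exp)
  moreover have "r = 0 \<longleftrightarrow> D = {0}"
  proof
    assume "r = 0"
    then have "card D = 1" using r by simp
    then show "D = {0}" using zero_D by (auto simp: card_1_singleton_iff)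
  next
    assume "D = {0}"
    then have "card T ^ r = 1" using r by simp
    then show "r = 0" using card_T by (metis One_nat_def nat_power_eq_Suc_0_iff not_less_eq_eq numeral_2_eq_2 order_refl)
  qed
  ultimately show ?thesis
    using q_binomial_indicator[of "real (card T)" r n] card_T unfolding card_indep_lists r by simp
qed

lemma list_comb_ideal:
  assumes "set xs \<subseteq> D" "set fs \<subseteq> I"
  shows "list_comb act fs xs = 0"
  using assms
proof (induction fs arbitrary: xs)
  case (Cons f fs)
  then show ?case by (cases xs) (auto simp: act_ideal)
qed simp

text \<open>All entries are fixed except one whose coefficient lies outside \<open>I\<close>. This
  coefficient acts injectively, so the combination takes each value at most once as the free entry
  varies. The fixed entries contribute a shift, hence the bound for every \<open>c\<close>.\<close>

lemma card_list_comb_le: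
  fixes \<kappa> :: real
  assumes R: "\<And>c. real (card {x \<in> D. R (x + c)}) \<le> \<kappa> * real (card D)"
    and "\<not> set fs \<subseteq> I"
  shows "real (card {xs. set xs \<subseteq> D \<and> length xs = length fs \<and> R (list_comb act fs xs + c)})
    \<le> \<kappa> * real (card D) ^ length fs"
  using assms(2)
proof (induction fs arbitrary: c)
  case (Cons f fs)
  let ?S = "{xs. set xs \<subseteq> D \<and> length xs = Suc (length fs) \<and> R (list_comb act (f # fs) xs + c)}"
  let ?X = "{xs. set xs \<subseteq> D \<and> length xs = length fs}"
  have cardX: "card ?X = card D ^ length fs" by (rule card_lists_length_eq[OF finite_D])
  show ?case
  \<comment> \<open>The head is the free entry if its coefficient is a unit modulo \<open>I\<close>;
    otherwise the head is fixed and absorbed into the shift.\<close>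
  proof (cases "f \<in> I")
    case False
    have inj: "inj_on (act f) D"
    proof (rule inj_onI)
      fix x y assume xy: "x \<in> D" "y \<in> D" "act f x = act f y"
      obtain a where a: "a * f - 1 \<in> I" using inverse_ex[OF False] by blast
      show "x = y" using act_cong[OF xy(1) a] act_cong[OF xy(2) a] xy by (simp add: act_mult act_one)
    qed
    have "bij_betw (\<lambda>(xs, x). x # xs) (SIGMA xs : ?X. {x \<in> D. R (act f x + (list_comb act fs xs + c))}) ?S"
    proof (rule bij_betw_imageI)
      have e: "list_comb act (f # fs) (x # xs) + c = act f x + (list_comb act fs xs + c)" for x xs
        by (simp add: add.assoc)
      show "(\<lambda>(xs, x). x # xs) ` (SIGMA xs : ?X. {x \<in> D. R (act f x + (list_comb act fs xs + c))}) = ?S"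
        by (auto simp: length_Suc_conv image_iff e simp del: list_comb.simps)
    qed (auto simp: inj_on_def)
    then have "card ?S = (\<Sum>xs\<in>?X. card {x \<in> D. R (act f x + (list_comb act fs xs + c))})"
      using finite_lists_D finite_D by (simp add: bij_betw_same_card[symmetric])
    also have "real \<dots> \<le> (\<Sum>xs\<in>?X. \<kappa> * real (card D))"
      unfolding of_nat_sum
    proof (rule sum_mono)
      fix xs
      have "card {x \<in> D. R (act f x + (list_comb act fs xs + c))}
          \<le> card {y \<in> D. R (y + (list_comb act fs xs + c))}"
        by (rule card_inj_on_le[of "act f"])
          (auto intro: inj_on_subset[OF inj] act_D finite_subset[OF _ finite_D])
      then show "real (card {x \<in> D. R (act f x + (list_comb act fs xs + c))}) \<le> \<kappa> * real (card D)"
        using R[of "list_comb act fs xs + c"] by linarith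
    qed
    finally show ?thesis by (simp add: cardX mult_ac)
  next
    case True
    then have *: "\<not> set fs \<subseteq> I" using Cons.prems by auto
    have fin: "finite {xs. set xs \<subseteq> D \<and> length xs = length fs \<and> R (list_comb act fs xs + (act f x + c))}" for x
      by (rule finite_subset[OF _ finite_lists_D[of "length fs"]]) auto
    have "bij_betw (\<lambda>(x, xs). x # xs) (SIGMA x : D. {xs. set xs \<subseteq> D \<and> length xs = length fs \<and>
        R (list_comb act fs xs + (act f x + c))}) ?S"
    proof (rule bij_betw_imageI)
      have e: "list_comb act (f # fs) (x # xs) + c = list_comb act fs xs + (act f x + c)" for x xs
        by (simp add: add_ac)
      show "(\<lambda>(x, xs). x # xs) ` (SIGMA x : D. {xs. set xs \<subseteq> D \<and> length xs = length fs \<and>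
        R (list_comb act fs xs + (act f x + c))}) = ?S"
        by (auto simp: length_Suc_conv image_iff e simp del: list_comb.simps)
    qed (auto simp: inj_on_def)
    then have "card ?S = (\<Sum>x\<in>D. card {xs. set xs \<subseteq> D \<and> length xs = length fs \<and>
        R (list_comb act fs xs + (act f x + c))})"
      using fin finite_D by (subst bij_betw_same_card[symmetric]) (assumption, subst card_SigmaI, auto)
    also have "real \<dots> \<le> (\<Sum>x\<in>D. \<kappa> * real (card D) ^ length fs)"
      unfolding of_nat_sum by (intro sum_mono Cons.IH *)
    finally show ?thesis by (simp add: mult_ac)
  qed
qed simp

end

section \<open>Characters and fibres\<close>

text \<open>A faithful additive character of the prime field; composed with functionals it turns
  counting into orthogonality of characters.\<close>

definition root_of_unity :: "'p::prime_card mod_ring \<Rightarrow> complex" where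
  "root_of_unity x = cis (2 * pi * real_of_int (to_int_mod_ring x) / real CARD('p))"

lemma root_of_unity_0 [simp]: "root_of_unity 0 = 1"
  by (simp add: root_of_unity_def)

lemma root_of_unity_of_int:
  "root_of_unity (of_int k :: 'p::prime_card mod_ring) = cis (2 * pi * real_of_int k / real CARD('p))"
proof -
  let ?p = "int CARD('p)"
  have p: "real CARD('p) \<noteq> 0" by simp
  have "to_int_mod_ring (of_int k :: 'p mod_ring) = k mod ?p"
    by (simp add: of_int_of_int_mod_ring to_int_mod_ring.rep_eq of_int_mod_ring.rep_eq)
  moreover have "real_of_int k = real_of_int (k mod ?p) + real CARD('p) * real_of_int (k div ?p)"
    by (metis mult_div_mod_eq add.commute of_int_add of_int_mult of_int_of_nat_eq)
  then have "2 * pi * real_of_int k / real CARD('p)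
      = 2 * pi * real_of_int (k mod ?p) / real CARD('p) + 2 * pi * real_of_int (k div ?p)"
    using p by (simp add: field_simps)
  then have "cis (2 * pi * real_of_int k / real CARD('p))
      = cis (2 * pi * real_of_int (k mod ?p) / real CARD('p)) * cis (2 * pi * real_of_int (k div ?p))"
    by (simp only: cis_mult)
  then have "cis (2 * pi * real_of_int k / real CARD('p))
      = cis (2 * pi * real_of_int (k mod ?p) / real CARD('p))"
    by (simp add: cis_multiple_2pi)
  ultimately show ?thesis by (simp add: root_of_unity_def)
qed

lemma mod_ring_of_int: "\<exists>k. x = (of_int k :: 'p::prime_card mod_ring)"
  by (metis of_int_of_int_mod_ring of_int_mod_ring_to_int_mod_ring)

lemma root_of_unity_add: "root_of_unity (x + y) = root_of_unity x * root_of_unity y"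
proof -
  obtain k l where "x = of_int k" "y = of_int l" using mod_ring_of_int by metis
  then show ?thesis
    by (simp only: of_int_add[symmetric] root_of_unity_of_int cis_mult)
      (simp add: field_simps)
qed

lemma root_of_unity_neq_1:
  fixes x :: "'p::prime_card mod_ring"
  assumes "x \<noteq> 0"
  shows "root_of_unity x \<noteq> 1"
proof
  assume *: "root_of_unity x = 1"
  let ?k = "to_int_mod_ring x"
  have k: "0 \<le> ?k" "?k < int CARD('p)" "?k \<noteq> 0"
    using range_to_int_mod_ring[where 'a='p] assms by auto
  from * have "cos (2 * pi * real_of_int ?k / real CARD('p)) = 1"
    by (simp add: root_of_unity_def complex_eq_iff)
  then obtain m :: int where "2 * pi * real_of_int ?k / real CARD('p) = real_of_int m * 2 * pi"
    using cos_one_2pi_int by blast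
  then have "real_of_int ?k = real_of_int (m * int CARD('p))" by (simp add: field_simps)
  then have "?k = m * int CARD('p)" by linarith
  then show False using k by (metis dvd_triv_right zdvd_not_zless less_le)
qed

text \<open>Reindexing by \<open>\<tau>\<close>, a permutation of the finite set \<open>S\<close>,
  multiplies the sum by \<open>root_of_unity c\<close>, which differs from 1.\<close>

lemma sum_root_of_unity_eq_0:
  assumes "finite S" "\<tau> ` S \<subseteq> S" "inj_on \<tau> S" "c \<noteq> 0" "\<And>s. s \<in> S \<Longrightarrow> \<phi> (\<tau> s) = \<phi> s + c"
  shows "(\<Sum>s\<in>S. root_of_unity (\<phi> s)) = 0"
proof -
  have "\<tau> ` S = S" using assms by (simp add: endo_inj_surj)
  then have "(\<Sum>s\<in>S. root_of_unity (\<phi> s)) = (\<Sum>s\<in>S. root_of_unity (\<phi> (\<tau> s)))"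
    using sum.reindex[OF assms(3), of "\<lambda>s. root_of_unity (\<phi> s)"] by simp
  also have "\<dots> = root_of_unity c * (\<Sum>s\<in>S. root_of_unity (\<phi> s))"
    using assms(5) by (simp add: root_of_unity_add sum_distrib_left mult.commute)
  finally show ?thesis using root_of_unity_neq_1[OF assms(4)]
    by (metis mult_cancel_right1)
qed

section \<open>Subgroups and systems of coset representatives\<close>

definition additive_closed :: "'a::ab_group_add set \<Rightarrow> bool" where
  "additive_closed S \<longleftrightarrow> 0 \<in> S \<and> (\<forall>x\<in>S. \<forall>y\<in>S. x - y \<in> S)"

lemma additive_closedD:
  assumes "additive_closed S"
  shows "0 \<in> S" "x \<in> S \<Longrightarrow> y \<in> S \<Longrightarrow> x - y \<in> S" "x \<in> S \<Longrightarrow> - x \<in> S"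
    "x \<in> S \<Longrightarrow> y \<in> S \<Longrightarrow> x + y \<in> S"
proof -
  show 1: "0 \<in> S" and 2: "x \<in> S \<Longrightarrow> y \<in> S \<Longrightarrow> x - y \<in> S" for x y
    using assms by (auto simp: additive_closed_def)
  show 3: "x \<in> S \<Longrightarrow> - x \<in> S" for x using 2[of 0 x] 1 by simp
  show "x \<in> S \<Longrightarrow> y \<in> S \<Longrightarrow> x + y \<in> S" using 2[of x "- y"] 3[of y] by simp
qed

text \<open>\<open>X\<close> is a finite set of representatives of \<open>L/Z\<close>, and \<open>rd\<close> maps to the representative.\<close>

locale coset_reps =
  fixes L Z X :: "'a::ab_group_add set" and rd :: "'a \<Rightarrow> 'a"
  assumes L: "additive_closed L" and Z: "additive_closed Z" "Z \<subseteq> L"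
    and finite_X: "finite X" and X_subset: "X \<subseteq> L"
    and rd: "x \<in> L \<Longrightarrow> rd x \<in> X" "x \<in> L \<Longrightarrow> x - rd x \<in> Z"
    and X_unique: "x \<in> X \<Longrightarrow> y \<in> X \<Longrightarrow> x - y \<in> Z \<Longrightarrow> x = y"
begin

lemma rd_diff: "x \<in> L \<Longrightarrow> rd x - x \<in> Z"
  using additive_closedD(3)[OF Z(1) rd(2)] by simp

lemma inj_on_translate: "b \<in> L \<Longrightarrow> inj_on (\<lambda>x. rd (x + b)) X"
proof (rule inj_onI)
  fix x y assume *: "b \<in> L" "x \<in> X" "y \<in> X" "rd (x + b) = rd (y + b)"
  then have "x + b \<in> L" "y + b \<in> L" using X_subset additive_closedD(4)[OF L] by auto
  then have "(x + b) - rd (x + b) - ((y + b) - rd (y + b)) \<in> Z"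
    by (intro additive_closedD(2)[OF Z(1)] rd(2))
  moreover have "(x + b) - rd (x + b) - ((y + b) - rd (y + b)) = x - y" unfolding *(4) by simp
  ultimately show "x = y" using X_unique[OF *(2,3)] by simp
qed

text \<open>Any two nonempty fibres are matched by a translation followed by \<open>rd\<close>;
  since \<open>Z \<subseteq> K\<close>, the reduction does not leave the fibre. Only the cosets of
  \<open>K\<close> enter, so \<open>\<phi>\<close> may take values in any type.\<close>

lemma card_fibre:
  assumes K: "additive_closed K" "Z \<subseteq> K"
    and \<phi>: "\<And>x y. x \<in> L \<Longrightarrow> y \<in> L \<Longrightarrow> \<phi> x = \<phi> y \<longleftrightarrow> x - y \<in> K"
    and c: "c \<in> \<phi> ` L"
  shows "card {x \<in> X. \<phi> x = c} * card (\<phi> ` L) = card X"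
proof -
  have \<phi>_rd: "\<phi> (rd x) = \<phi> x" if "x \<in> L" for x
    using \<phi>[OF subsetD[OF X_subset rd(1)[OF that]] that] subsetD[OF K(2) rd_diff[OF that]] by simp
  have le: "card {x \<in> X. \<phi> x = c} \<le> card {x \<in> X. \<phi> x = d}" if "c \<in> \<phi> ` L" "d \<in> \<phi> ` L" for c d
  proof -
    from that obtain u v where uv: "u \<in> L" "v \<in> L" "c = \<phi> u" "d = \<phi> v" by blast
    have b: "v - u \<in> L" using uv additive_closedD(2)[OF L] by blast
    have "rd (x + (v - u)) \<in> {x \<in> X. \<phi> x = d}" if x: "x \<in> X" "\<phi> x = c" for x
    proof -
      have xL: "x \<in> L" using x X_subset by blast
      have s: "x + (v - u) \<in> L" using additive_closedD(4)[OF L xL b] .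
      have "x - u \<in> K" using x \<phi>[OF xL uv(1)] uv by simp
      then have "\<phi> (x + (v - u)) = \<phi> v" using \<phi>[OF s uv(2)] by (simp add: algebra_simps)
      then show ?thesis using rd(1)[OF s] \<phi>_rd[OF s] uv by simp
    qed
    then have "(\<lambda>x. rd (x + (v - u))) ` {x \<in> X. \<phi> x = c} \<subseteq> {x \<in> X. \<phi> x = d}" by blast
    moreover have "inj_on (\<lambda>x. rd (x + (v - u))) {x \<in> X. \<phi> x = c}"
      by (rule inj_on_subset[OF inj_on_translate[OF b]]) auto
    ultimately show ?thesis using finite_X by (intro card_inj_on_le) auto
  qed
  have eq: "card {x \<in> X. \<phi> x = d} = card {x \<in> X. \<phi> x = c}" if "d \<in> \<phi> ` L" for d
    using le[OF that c] le[OF c that] by simp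
  have im: "\<phi> ` X = \<phi> ` L" 
  proof
    show "\<phi> ` L \<subseteq> \<phi> ` X" using \<phi>_rd rd(1) by (metis image_subsetI image_eqI)
  qed (use X_subset in auto)
  have "card X = (\<Sum>d\<in>\<phi> ` X. card {x \<in> X. \<phi> x = d})"
    using sum.image_gen[OF finite_X, of "\<lambda>_. 1 :: nat" \<phi>] by (simp only: card_eq_sum)
  also have "\<dots> = (\<Sum>d\<in>\<phi> ` L. card {x \<in> X. \<phi> x = c})" unfolding im by (intro sum.cong refl eq)
  finally show ?thesis by (simp add: mult.commute)
qed

text \<open>Translation by \<open>- b\<close> permutes the representatives of the coset and raises
  the value of \<open>\<psi>\<close> by \<open>\<psi> b\<close>; the correction made by
  \<open>rd\<close> lies in \<open>Z\<close>, where \<open>\<psi>\<close> vanishes.\<close>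

lemma sum_character_eq_0:
  fixes \<psi> :: "'a \<Rightarrow> 'p::prime_card mod_ring"
  assumes K: "additive_closed K" "Z \<subseteq> K" "K \<subseteq> L"
    and \<psi>: "\<And>x y. x \<in> K \<Longrightarrow> y \<in> K \<Longrightarrow> \<psi> (x + y) = \<psi> x + \<psi> y" "\<And>z. z \<in> Z \<Longrightarrow> \<psi> z = 0"
    and x0: "x0 \<in> L" and b: "b \<in> K" "\<psi> b \<noteq> 0"
  shows "(\<Sum>x\<in>{x \<in> X. x0 - x \<in> K}. root_of_unity (\<psi> (x0 - x))) = 0"
proof (rule sum_root_of_unity_eq_0[where \<tau> = "\<lambda>x. rd (x + - b)" and c = "\<psi> b"])
  have bL: "- b \<in> L" using b(1) K(3) additive_closedD(3)[OF L] by blast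
  have *: "x0 - rd (x + - b) \<in> K \<and> rd (x + - b) \<in> X \<and> \<psi> (x0 - rd (x + - b)) = \<psi> (x0 - x) + \<psi> b"
    if x: "x \<in> X" "x0 - x \<in> K" for x
  proof -
    have s: "x + - b \<in> L" using x X_subset additive_closedD(4)[OF L _ bL] by blast
    define z where "z = (x + - b) - rd (x + - b)"
    have z: "z \<in> Z" unfolding z_def by (rule rd(2)[OF s])
    have e: "x0 - rd (x + - b) = (x0 - x) + (b + z)" by (simp add: z_def algebra_simps)
    have bz: "b + z \<in> K" using additive_closedD(4)[OF K(1) b(1)] z K(2) by blast
    have "x0 - rd (x + - b) \<in> K" unfolding e by (rule additive_closedD(4)[OF K(1) x(2) bz])
    moreover have "\<psi> (x0 - rd (x + - b)) = \<psi> (x0 - x) + \<psi> b"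
      unfolding e \<psi>(1)[OF x(2) bz] \<psi>(1)[OF b(1) subsetD[OF K(2) z]] \<psi>(2)[OF z] by simp
    ultimately show ?thesis using rd(1)[OF s] by blast
  qed
  show "(\<lambda>x. rd (x + - b)) ` {x \<in> X. x0 - x \<in> K} \<subseteq> {x \<in> X. x0 - x \<in> K}" using * by blast
  show "inj_on (\<lambda>x. rd (x + - b)) {x \<in> X. x0 - x \<in> K}"
    by (rule inj_on_subset[OF inj_on_translate[OF bL]]) auto
  show "\<And>x. x \<in> {x \<in> X. x0 - x \<in> K} \<Longrightarrow> \<psi> (x0 - rd (x + - b)) = \<psi> (x0 - x) + \<psi> b" using * by blast
qed (use finite_X b in auto)

end

section \<open>The \<open>p\<close>-adic integers\<close>

lemmas residue_rep_eqs = plus_padic_int.rep_eq times_padic_int.rep_eq minus_padic_int.rep_eq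
  uminus_padic_int.rep_eq zero_padic_int.rep_eq one_padic_int.rep_eq

lemma padic_eqI: "(\<And>k. residue x k = residue y k) \<Longrightarrow> x = y"
  by (simp add: residue_inject[symmetric] fun_eq_iff)

lemma residue_of_nat: "residue (of_nat m :: 'p::prime_card padic_int) k = int m mod int CARD('p) ^ k"
  by (induction m) (simp_all add: residue_rep_eqs mod_simps)

lemma residue_of_int: "residue (of_int a :: 'p::prime_card padic_int) k = a mod int CARD('p) ^ k"
proof (cases a rule: int_cases2)
  case (nonneg n)
  then show ?thesis by (simp add: residue_of_nat)
next
  case (nonpos n)
  then show ?thesis by (simp add: residue_rep_eqs residue_of_nat mod_simps)
qed

lemma residue_0_right [simp]: "residue x 0 = 0"
  using residue_nonneg[of x 0] residue_less[of x 0] by simp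

abbreviation padic_p :: "'p::prime_card padic_int" where
  "padic_p \<equiv> of_nat CARD('p)"

lemma residue_p_power: "residue (padic_p ^ k :: 'p::prime_card padic_int) m = int CARD('p) ^ k mod int CARD('p) ^ m"
  using residue_of_nat[of "CARD('p) ^ k" m] by simp

lemma residue_p_power_mult:
  "m \<le> k \<Longrightarrow> residue (padic_p ^ k * x) m = 0" for x :: "'p::prime_card padic_int"
  using residue_nonneg[of x m]
  by (simp add: times_padic_int.rep_eq residue_p_power le_imp_power_dvd mod_eq_0_iff_dvd[THEN iffD2])

text \<open>All residues from level \<open>k\<close> on are divisible by \<open>p^k\<close>, and the
  quotients, shifted by \<open>k\<close> levels, are again compatible and so define the
  cofactor.\<close>

lemma residue_eq_0_iff:
  fixes x :: "'p::prime_card padic_int"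
  shows "residue x k = 0 \<longleftrightarrow> (\<exists>y. x = padic_p ^ k * y)"
proof
  assume 0: "residue x k = 0"
  let ?p = "int CARD('p)"
  define f where "f m = residue x (m + k) div ?p ^ k" for m
  have dvd: "?p ^ k * f m = residue x (m + k)" for m
  proof -
    have "residue x (m + k) mod ?p ^ k = 0" using residue_mod[of k "m + k" x] 0 by simp
    then show ?thesis unfolding f_def by (simp add: mod_0_imp_dvd)
  qed
  have "0 \<le> f m \<and> f m < ?p ^ m \<and> f (Suc m) mod ?p ^ m = f m" for m
  proof (intro conjI)
    show "0 \<le> f m" using residue_nonneg[of x "m + k"] by (simp add: f_def pos_imp_zdiv_nonneg_iff)
    have "?p ^ k * f m < ?p ^ k * ?p ^ m"
      unfolding dvd using residue_less[of x "m + k"] by (simp add: power_add mult.commute)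
    then show less: "f m < ?p ^ m" by simp
    have "?p ^ k * (f (Suc m) mod ?p ^ m) = (?p ^ k * f (Suc m)) mod (?p ^ k * ?p ^ m)"
      by (simp add: mod_mult_mult1)
    also have "\<dots> = residue x (Suc (m + k)) mod ?p ^ (m + k)"
      unfolding dvd by (simp add: power_add mult.commute)
    also have "\<dots> = ?p ^ k * f m" unfolding dvd by (rule residue_Suc_mod)
    finally show "f (Suc m) mod ?p ^ m = f m" by simp
  qed
  then have r: "residue (Abs_padic_int f :: 'p padic_int) = f" by (simp add: Abs_padic_int_inverse)
  have "x = padic_p ^ k * (Abs_padic_int f :: 'p padic_int)"
  proof (rule padic_eqI)
    fix m
    have "residue (padic_p ^ k * Abs_padic_int f :: 'p padic_int) m = (?p ^ k * f m) mod ?p ^ m"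
      by (simp add: times_padic_int.rep_eq residue_p_power r mod_simps)
    also have "\<dots> = residue x m" unfolding dvd by (rule residue_mod) simp
    finally show "residue x m = residue (padic_p ^ k * (Abs_padic_int f :: 'p padic_int)) m" by (rule sym)
  qed
  then show "\<exists>y. x = padic_p ^ k * y" ..
qed (auto simp: residue_p_power_mult)

lemma residue_eq_iff:
  fixes x y :: "'p::prime_card padic_int"
  shows "residue x k = residue y k \<longleftrightarrow> (\<exists>z. x - y = padic_p ^ k * z)"
proof -
  have "residue x k = residue y k \<longleftrightarrow> residue (x - y) k = 0"
    using padic_cong_add[of "- y" x k y] by (simp add: zero_padic_int.rep_eq)
  then show ?thesis by (simp add: residue_eq_0_iff)
qed

text \<open>Level \<open>m\<close> of \<open>x\<close> can be read off from level
  \<open>Suc m\<close> of \<open>p x\<close>.\<close>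

lemma padic_p_mult_eq_0:
  fixes x :: "'p::prime_card padic_int"
  assumes "padic_p * x = 0"
  shows "x = 0"
proof (rule padic_eqI)
  fix m
  let ?p = "int CARD('p)"
  have "residue (padic_p ^ 1 * x) (Suc m) = 0" using assms by (simp add: zero_padic_int.rep_eq)
  then have "(?p * residue x (Suc m)) mod (?p * ?p ^ m) = 0"
    unfolding times_padic_int.rep_eq residue_p_power by (simp add: mod_simps)
  then have "?p * (residue x (Suc m) mod ?p ^ m) = 0" by (simp only: mod_mult_mult1)
  then show "residue x m = residue 0 m" by (simp add: residue_Suc_mod zero_padic_int.rep_eq)
qed

text \<open>The diagonal residues \<open>residue (s m) m\<close> are compatible because consecutive
  terms agree, and so they are the residues of a limit.\<close>

lemma padic_complete:
  fixes s :: "nat \<Rightarrow> 'p::prime_card padic_int"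
  assumes "\<And>m. residue (s (Suc m)) m = residue (s m) m"
  shows "\<exists>y :: 'p padic_int. \<forall>m. residue y m = residue (s m) m"
proof -
  let ?f = "\<lambda>m. residue (s m) m"
  have "residue (Abs_padic_int ?f :: 'p padic_int) = ?f"
    by (rule Abs_padic_int_inverse) (auto simp: residue_nonneg residue_less residue_Suc_mod assms)
  then show ?thesis by (intro exI[of _ "Abs_padic_int ?f"]) simp
qed

lemma of_int_mod_card: "(of_int (a mod int CARD('p)) :: 'p::prime_card mod_ring) = of_int a"
  using of_int_mod_CHAR[where 'a = "'p mod_ring", of a] by simp

lemma padic_reduce_of_int_residue: "padic_reduce x = of_int (residue x 1)"
  by (simp add: padic_reduce_def of_int_of_int_mod_ring)

interpretation padic_reduce: comm_ring_hom padic_reduce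
  by unfold_locales
    (simp_all add: padic_reduce_of_int_residue residue_rep_eqs of_int_mod_card
      of_int_mod_card[where a = 1, simplified])

interpretation reduce_poly: map_poly_comm_ring_hom padic_reduce ..

lemma padic_reduce_eq_0_iff:
  fixes x :: "'p::prime_card padic_int"
  shows "padic_reduce x = 0 \<longleftrightarrow> (\<exists>y. x = padic_p * y)"
proof -
  have "padic_reduce x = 0 \<longleftrightarrow> int CARD('p) dvd residue x 1"
    by (simp add: padic_reduce_of_int_residue of_int_eq_0_iff_char_dvd)
  also have "\<dots> \<longleftrightarrow> residue x 1 = 0"
    using residue_nonneg[of x 1] residue_less[of x 1] by (auto dest: zdvd_imp_le)
  finally show ?thesis by (simp add: residue_eq_0_iff)
qed

lemma padic_reduce_surj: "padic_reduce (of_int (to_int_mod_ring c)) = c"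
  by (simp add: padic_reduce.hom_of_int of_int_of_int_mod_ring)

text \<open>If \<open>b\<close> lifts the inverse modulo \<open>p\<close>, then
  \<open>u = 1 - b x\<close> is divisible by \<open>p\<close>, and the geometric series in
  \<open>u\<close> converges p-adically to an inverse of \<open>b x\<close>.\<close>

lemma padic_unit:
  fixes x :: "'p::prime_card padic_int"
  assumes "padic_reduce x \<noteq> 0"
  shows "\<exists>y. x * y = 1"
proof -
  define b :: "'p padic_int" where "b = of_int (to_int_mod_ring (inverse (padic_reduce x)))"
  have "padic_reduce (1 - b * x) = 0"
    using assms padic_reduce_surj[of "inverse (padic_reduce x)"]
    by (simp add: padic_reduce.hom_minus padic_reduce.hom_mult b_def)
  then obtain z where z: "1 - b * x = padic_p * z" unfolding padic_reduce_eq_0_iff ..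
  define u where "u = padic_p * z"
  have u_pow: "residue (u ^ m) m = 0" for m
    unfolding u_def power_mult_distrib by (rule residue_p_power_mult) simp
  have "residue (\<Sum>k<Suc m. u ^ k) m = residue (\<Sum>k<m. u ^ k) m" for m
    using residue_mod[of m m "\<Sum>k<m. u ^ k"] by (simp add: plus_padic_int.rep_eq u_pow)
  then obtain y :: "'p padic_int" where y: "\<And>m. residue y m = residue (\<Sum>k<m. u ^ k) m"
    using padic_complete[of "\<lambda>m. \<Sum>k<m. u ^ k"] by blast
  have "(1 - u) * y = 1"
  proof (rule padic_eqI)
    fix m
    have "residue ((1 - u) * y) m = residue ((1 - u) * (\<Sum>k<m. u ^ k)) m"
      by (simp add: times_padic_int.rep_eq y)
    also have "(1 - u) * (\<Sum>k<m. u ^ k) = 1 - u ^ m" by (simp add: one_diff_power_eq)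
    also have "residue (1 - u ^ m) m = residue (1 :: 'p padic_int) m"
    proof -
      obtain w where "u ^ m = padic_p ^ m * w" using u_pow[of m] unfolding residue_eq_0_iff ..
      then have "1 - u ^ m - 1 = padic_p ^ m * (- w)" by simp
      then show ?thesis by (intro residue_eq_iff[THEN iffD2] exI)
    qed
    finally show "residue ((1 - u) * y) m = residue (1 :: 'p padic_int) m" .
  qed
  moreover have "1 - u = b * x" using z by (simp add: u_def algebra_simps)
  ultimately have "x * (b * y) = 1" by (simp add: mult_ac)
  then show ?thesis ..
qed

section \<open>Integer representatives modulo p^M\<close>

definition padic_reps :: "nat \<Rightarrow> 'p::prime_card padic_int set" where
  "padic_reps M = of_int ` {0..<int CARD('p) ^ M}"

definition padic_red :: "nat \<Rightarrow> 'p::prime_card padic_int \<Rightarrow> 'p padic_int" where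
  "padic_red M x = of_int (residue x M)"

lemma padic_red_in_reps: "padic_red M x \<in> padic_reps M"
  using residue_nonneg[of x M] residue_less[of x M] by (auto simp: padic_red_def padic_reps_def)

lemma residue_padic_red: "residue (padic_red M x) M = residue x M"
  using residue_mod[of M M x] by (simp add: padic_red_def residue_of_int)

lemma padic_reps_unique:
  "x \<in> padic_reps M \<Longrightarrow> y \<in> padic_reps M \<Longrightarrow> residue x M = residue y M \<Longrightarrow> x = y"
  by (auto simp: padic_reps_def residue_of_int)

lemma finite_padic_reps: "finite (padic_reps M)"
  by (simp add: padic_reps_def)

lemma card_padic_reps: "card (padic_reps M :: 'p::prime_card padic_int set) = CARD('p) ^ M"
proof -
  have "inj_on (of_int :: int \<Rightarrow> 'p padic_int) {0..<int CARD('p) ^ M}"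
  proof (rule inj_onI)
    fix a b :: int
    assume *: "a \<in> {0..<int CARD('p) ^ M}" "b \<in> {0..<int CARD('p) ^ M}"
      and "(of_int a :: 'p padic_int) = of_int b"
    then have "a mod int CARD('p) ^ M = b mod int CARD('p) ^ M"
      by (metis residue_of_int)
    then show "a = b" using * by simp
  qed
  then have "card (padic_reps M :: 'p padic_int set) = card {0..<int CARD('p) ^ M}"
    unfolding padic_reps_def by (rule card_image)
  also have "\<dots> = CARD('p) ^ M" by (simp add: nat_power_eq)
  finally show ?thesis .
qed

lemma zero_padic_reps [simp]: "0 \<in> padic_reps M"
  unfolding padic_reps_def by (rule image_eqI[of _ _ 0]) auto

lemma padic_red_0 [simp]: "padic_red M 0 = 0"
  by (simp add: padic_red_def zero_padic_int.rep_eq)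

section \<open>Polynomials over the \<open>p\<close>-adic integers\<close>

abbreviation reduce_poly :: "'p::prime_card padic_int poly \<Rightarrow> 'p mod_ring poly" where
  "reduce_poly \<equiv> map_poly padic_reduce"

lemma coeffs_divisible:
  fixes f :: "'a::comm_ring_1 poly"
  assumes "\<And>k. \<exists>c. Polynomial.coeff f k = a * c"
  shows "\<exists>h. f = Polynomial.smult a h"
  using assms
proof (induction f)
  case (pCons b f)
  have "\<exists>c. Polynomial.coeff f k = a * c" for k using pCons.prems[of "Suc k"] by simp
  then obtain h where "f = Polynomial.smult a h" using pCons.IH by blast
  moreover obtain c where "b = a * c" using pCons.prems[of 0] by auto
  ultimately show ?case by (intro exI[of _ "pCons c h"]) simp
qed (auto intro: exI[of _ 0])

lemma reduce_poly_eq_0: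
  fixes f :: "'p::prime_card padic_int poly"
  assumes "reduce_poly f = 0"
  shows "\<exists>h. f = Polynomial.smult padic_p h"
proof (rule coeffs_divisible)
  fix k
  have "padic_reduce (Polynomial.coeff f k) = Polynomial.coeff (reduce_poly f) k" by simp
  then show "\<exists>c. Polynomial.coeff f k = padic_p * c" using assms by (simp add: padic_reduce_eq_0_iff)
qed

lemma reduce_poly_smult_p [simp]: "reduce_poly (Polynomial.smult padic_p h) = 0"
  by (rule poly_eqI) (simp add: padic_reduce.hom_mult, metis padic_reduce_eq_0_iff mult_zero_left mult.right_neutral)

lemma reduce_poly_surj: "\<exists>f. reduce_poly f = g"
proof
  show "reduce_poly (map_poly (\<lambda>c. of_int (to_int_mod_ring c)) g) = g"
    by (rule poly_eqI) (simp add: coeff_map_poly padic_reduce_surj)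
qed

text \<open>Degree below \<open>d\<close> is expressed by vanishing coefficients, so that 0 is no
  exception and \<open>d = 0\<close> leaves only the zero polynomial.\<close>

definition poly_reps :: "nat \<Rightarrow> nat \<Rightarrow> 'p::prime_card padic_int poly set" where
  "poly_reps M d = {f. \<forall>k. Polynomial.coeff f k \<in> padic_reps M \<and> (d \<le> k \<longrightarrow> Polynomial.coeff f k = 0)}"

lemma zero_poly_reps [simp]: "0 \<in> poly_reps M d"
  by (simp add: poly_reps_def)

lemma poly_reps_Suc: "(poly_reps M (Suc d) :: 'p::prime_card padic_int poly set) = (\<lambda>(a, f). pCons a f) ` (padic_reps M \<times> poly_reps M d)"
proof (intro equalityI subsetI)
  fix f :: "'p padic_int poly"
  assume f: "f \<in> poly_reps M (Suc d)"
  obtain a g where fg: "f = pCons a g" by (cases f)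
  have c: "Polynomial.coeff f k \<in> padic_reps M" "Suc d \<le> k \<Longrightarrow> Polynomial.coeff f k = 0" for k
    using f by (auto simp: poly_reps_def)
  have "a \<in> padic_reps M" using c(1)[of 0] by (simp add: fg)
  moreover have "g \<in> poly_reps M d"
    unfolding poly_reps_def using c(1)[of "Suc _"] c(2)[of "Suc _"] by (auto simp: fg)
  ultimately show "f \<in> (\<lambda>(a, f). pCons a f) ` (padic_reps M \<times> poly_reps M d)" using fg by auto
qed (auto simp: poly_reps_def coeff_pCons split: nat.splits)

lemma finite_card_poly_reps:
  "finite (poly_reps M d :: 'p::prime_card padic_int poly set) \<and>
   card (poly_reps M d :: 'p padic_int poly set) = (CARD('p) ^ M) ^ d"
proof (induction d)
  case 0
  have "poly_reps M 0 = {0 :: 'p padic_int poly}" by (auto simp: poly_reps_def poly_eq_iff)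
  then show ?case by simp
next
  case (Suc d)
  have "inj_on (\<lambda>(a, f). pCons a f) (padic_reps M \<times> (poly_reps M d :: 'p padic_int poly set))"
    by (auto simp: inj_on_def)
  then show ?case
    unfolding poly_reps_Suc using Suc
    by (simp add: card_image card_cartesian_product card_padic_reps finite_padic_reps)
qed

lemmas finite_poly_reps = finite_card_poly_reps[THEN conjunct1]
  and card_poly_reps = finite_card_poly_reps[THEN conjunct2]

definition poly_red :: "nat \<Rightarrow> 'p::prime_card padic_int poly \<Rightarrow> 'p padic_int poly" where
  "poly_red M f = map_poly (padic_red M) f"

lemma coeff_poly_red: "Polynomial.coeff (poly_red M f) k = padic_red M (Polynomial.coeff f k)"
  by (simp add: poly_red_def coeff_map_poly)

lemma poly_red_in_reps: "(\<And>k. d \<le> k \<Longrightarrow> Polynomial.coeff f k = 0) \<Longrightarrow> poly_red M f \<in> poly_reps M d"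
  by (auto simp: poly_reps_def coeff_poly_red padic_red_in_reps)

lemma poly_red_diff: "\<exists>h. f - poly_red M f = Polynomial.smult (padic_p ^ M) h"
  by (rule coeffs_divisible) (simp add: coeff_poly_red residue_eq_iff[symmetric] residue_padic_red)

lemma poly_reps_unique:
  assumes "f \<in> poly_reps M d" "g \<in> poly_reps M d" "f - g = Polynomial.smult (padic_p ^ M) h"
  shows "f = g"
proof (rule poly_eqI)
  fix k
  have "Polynomial.coeff f k - Polynomial.coeff g k = padic_p ^ M * Polynomial.coeff h k"
    using arg_cong[OF assms(3), of "\<lambda>f. Polynomial.coeff f k"] by simp
  then have "residue (Polynomial.coeff f k) M = residue (Polynomial.coeff g k) M" by (auto simp: residue_eq_iff)
  then show "Polynomial.coeff f k = Polynomial.coeff g k" using assms(1,2) by (intro padic_reps_unique) (auto simp: poly_reps_def)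
qed

text \<open>Pseudo-division scales the dividend by powers of the leading coefficient; as this is 1,
  it is genuine division over any commutative ring.\<close>

lemma monic_division:
  fixes P f :: "'a::comm_ring_1 poly"
  assumes "lead_coeff P = 1"
  shows "\<exists>q r. f = P * q + r \<and> (\<forall>k\<ge>Polynomial.degree P. Polynomial.coeff r k = 0)"
proof -
  obtain q r where qr: "pseudo_divmod f P = (q, r)" by force
  have "P \<noteq> 0" using assms by auto
  from pseudo_divmod[OF this qr] have "f = P * q + r" "r = 0 \<or> Polynomial.degree r < Polynomial.degree P"
    using assms by auto
  then show ?thesis by (intro exI[of _ q] exI[of _ r]) (auto intro: coeff_eq_0)
qed

text \<open>The coefficient of \<open>P * y\<close> in degree \<open>degree P + degree y\<close> is
  the leading coefficient of \<open>y\<close>. This is the uniqueness of remainders.\<close>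

lemma monic_mult_eq_0:
  fixes P y :: "'a::comm_ring_1 poly"
  assumes "lead_coeff P = 1" "\<And>k. Polynomial.degree P \<le> k \<Longrightarrow> Polynomial.coeff (P * y) k = 0"
  shows "y = 0"
  using assms(2)[of "Polynomial.degree P + Polynomial.degree y"] assms(1) by (simp add: coeff_mult_degree_sum)

lemma reduce_poly_monic:
  assumes "lead_coeff P = 1"
  shows "Polynomial.degree (reduce_poly P) = Polynomial.degree P" "lead_coeff (reduce_poly P) = 1"
proof -
  have "Polynomial.coeff (reduce_poly P) (Polynomial.degree P) = 1" using assms by simp
  then show "Polynomial.degree (reduce_poly P) = Polynomial.degree P"
    by (intro antisym degree_map_poly_le le_degree) simp
  then show "lead_coeff (reduce_poly P) = 1" using assms by simp
qed

lemma reduce_poly_monic_nonzero: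
  assumes "lead_coeff P = 1"
  shows "reduce_poly P \<noteq> 0"
proof
  assume "reduce_poly P = 0"
  moreover have "Polynomial.coeff (reduce_poly P) (Polynomial.degree P) = 1" using assms by simp
  ultimately show False by (metis coeff_0 zero_neq_one)
qed

section \<open>The maximal ideal (p, P) and its residue field\<close>

definition reduction_ideal :: "'p::prime_card padic_int poly \<Rightarrow> 'p padic_int poly set" where
  "reduction_ideal P = {f. reduce_poly P dvd reduce_poly f}"

text \<open>The cofactor of the divisibility modulo \<open>p\<close> is lifted; what remains reduces
  to 0 and is a multiple of \<open>p\<close>. So the ideal is generated by \<open>p\<close> and
  \<open>P\<close>.\<close>

lemma reduction_ideal_decomp:
  assumes "f \<in> reduction_ideal P"
  shows "\<exists>g h. f = P * g + Polynomial.smult padic_p h"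
proof -
  from assms obtain g' where g': "reduce_poly f = reduce_poly P * g'"
    unfolding reduction_ideal_def dvd_def by blast
  obtain g where "reduce_poly g = g'" using reduce_poly_surj by blast
  then have "reduce_poly (f - P * g) = 0" using g' by (simp add: reduce_poly.hom_minus reduce_poly.hom_mult)
  then obtain h where "f - P * g = Polynomial.smult padic_p h" using reduce_poly_eq_0 by blast
  then have "f = P * g + Polynomial.smult padic_p h" by (simp add: algebra_simps)
  then show ?thesis by blast
qed

text \<open>Bezout's identity over the prime field, with the coefficient lifted to the p-adic
  integers.\<close>

lemma reduction_ideal_inverse:
  assumes "irreducible (reduce_poly P)" "f \<notin> reduction_ideal P"
  shows "\<exists>a. a * f - 1 \<in> reduction_ideal P"
proof -
  let ?P = "reduce_poly P" and ?f = "reduce_poly f"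
  have "coprime ?P ?f"
    using assms
    by (intro prime_elem_imp_coprime irreducible_imp_prime_elem_gcd) (auto simp: reduction_ideal_def)
  then have "gcd ?P ?f = 1" by simp
  then obtain b c where bc: "b * ?P + c * ?f = 1" using bezout_coefficients_fst_snd[of ?P ?f] by metis
  obtain a where a: "reduce_poly a = c" using reduce_poly_surj by blast
  have "reduce_poly (a * f - 1) = ?P * (- b)"
    using bc by (simp add: reduce_poly.hom_minus reduce_poly.hom_mult a algebra_simps)
  then show ?thesis unfolding reduction_ideal_def mem_Collect_eq by (metis dvd_triv_left)
qed

lemma reduction_ideal_prime:
  assumes "irreducible (reduce_poly P)" "finite K" "prod f K \<in> reduction_ideal P"
  shows "\<exists>k\<in>K. f k \<in> reduction_ideal P"
proof -
  have "prime_elem (reduce_poly P)" by (rule irreducible_imp_prime_elem_gcd[OF assms(1)])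
  then have "\<not> reduce_poly P dvd 1" "\<And>a b. reduce_poly P dvd a * b \<longleftrightarrow> reduce_poly P dvd a \<or> reduce_poly P dvd b"
    by (auto simp: prime_elem_dvd_mult_iff prime_elem_def)
  with assms(2,3) show ?thesis
    by (induction K) (auto simp: reduction_ideal_def reduce_poly.hom_mult)
qed

text \<open>Of two irreducible polynomials, one divides the other only if they are associated, and
  monic associates are equal.\<close>

lemma reduction_ideal_other:
  assumes "irreducible (reduce_poly P)" "irreducible (reduce_poly Q)"
    and "lead_coeff P = 1" "lead_coeff Q = 1" "reduce_poly P \<noteq> reduce_poly Q"
  shows "Q \<notin> reduction_ideal P"
proof
  assume "Q \<in> reduction_ideal P"
  then have "reduce_poly P dvd reduce_poly Q" by (simp add: reduction_ideal_def)
  then obtain c where c: "reduce_poly Q = reduce_poly P * c" by (auto simp: dvd_def)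
  have "c dvd 1" using irreducibleD[OF assms(2) c] assms(1) by (auto simp: irreducible_def)
  then have "Polynomial.degree c = 0" using is_unit_iff_degree[of c] by (metis not_is_unit_0)
  then obtain a where a: "c = [:a:]" by (rule degree_eq_zeroE)
  have "lead_coeff (reduce_poly Q) = lead_coeff (reduce_poly P) * a"
    unfolding c a by (simp add: lead_coeff_mult)
  then have "a = 1" by (simp add: reduce_poly_monic assms)
  then show False using c a assms(5) by simp
qed

lemma irreducible_degree_pos:
  assumes "irreducible (reduce_poly P)" "lead_coeff P = 1"
  shows "0 < Polynomial.degree P"
proof (rule ccontr)
  assume "\<not> 0 < Polynomial.degree P"
  then have "Polynomial.degree (reduce_poly P) = 0" "reduce_poly P \<noteq> 0"
    using reduce_poly_monic(1)[OF assms(2)] reduce_poly_monic_nonzero[OF assms(2)] by auto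
  then have "is_unit (reduce_poly P)" using is_unit_iff_degree by blast
  then show False using assms(1) by (simp add: irreducible_def)
qed

text \<open>Division by \<open>P\<close>, then reduction of the coefficients. The residue field is
  thus represented by \<open>p ^ degree P\<close> polynomials, the origin of the field size
  \<open>q\<^sub>j\<close>.\<close>

lemma poly_reps_reduction_ideal:
  fixes f :: "'p::prime_card padic_int poly"
  assumes "lead_coeff P = 1"
  shows "\<exists>s\<in>poly_reps 1 (Polynomial.degree P). f - s \<in> reduction_ideal P"
    and "s \<in> poly_reps 1 (Polynomial.degree P) \<Longrightarrow> s' \<in> poly_reps 1 (Polynomial.degree P) \<Longrightarrow> s - s' \<in> reduction_ideal P \<Longrightarrow> s = s'"
proof -
  obtain q r where qr: "f = P * q + r" "\<And>k. Polynomial.degree P \<le> k \<Longrightarrow> Polynomial.coeff r k = 0"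
    using monic_division[OF assms, of f] by blast
  obtain h where h: "r - poly_red 1 r = Polynomial.smult padic_p h" 
    using poly_red_diff[of r 1] unfolding power_one_right by blast
  have "f - poly_red 1 r = P * q + Polynomial.smult padic_p h"
    unfolding h[symmetric] qr(1) by (rule add_diff_eq[symmetric])
  then have "f - poly_red 1 r \<in> reduction_ideal P"
    by (simp only: reduction_ideal_def mem_Collect_eq reduce_poly.hom_add reduce_poly.hom_mult
      reduce_poly_smult_p add_0_right dvd_triv_left)
  then show "\<exists>s\<in>poly_reps 1 (Polynomial.degree P). f - s \<in> reduction_ideal P"
    by (rule bexI) (rule poly_red_in_reps[OF qr(2)])
next
  assume s: "s \<in> poly_reps 1 (Polynomial.degree P)" "s' \<in> poly_reps 1 (Polynomial.degree P)" "s - s' \<in> reduction_ideal P"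
  let ?r = "reduce_poly (s - s')"
  have "?r = 0"
  proof (rule ccontr)
    assume nz: "?r \<noteq> 0"
    \<comment> \<open>A nonzero multiple of the reduction of \<open>P\<close> would have its leading
      term in a degree where both representatives have coefficient 0.\<close>
    then have "Polynomial.degree P \<le> Polynomial.degree ?r"
      using dvd_imp_degree_le[OF s(3)[unfolded reduction_ideal_def mem_Collect_eq]]
      by (simp only: reduce_poly_monic(1)[OF assms] simp_thms)
    then have "Polynomial.coeff s (Polynomial.degree ?r) = 0" "Polynomial.coeff s' (Polynomial.degree ?r) = 0"
      using s(1,2) unfolding poly_reps_def by auto
    then have "lead_coeff ?r = 0" by (simp only: coeff_map_poly padic_reduce.hom_zero coeff_diff diff_self)
    then show False using nz unfolding leading_coeff_0_iff by (rule notE[rotated])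
  qed
  then obtain h where "s - s' = Polynomial.smult padic_p h" using reduce_poly_eq_0[of "s - s'"] by blast
  then have "s - s' = Polynomial.smult (padic_p ^ 1) h" by (simp only: power_one_right)
  then show "s = s'" by (rule poly_reps_unique[OF s(1,2)])
qed

section \<open>Vectors of polynomials\<close>

type_synonym 'p pvec = "nat \<Rightarrow> 'p padic_int poly"

text \<open>Vectors are functions on the naturals supported below \<open>n\<close>; sums,
  differences and 0 are then those of the function type, the same for every
  \<open>n\<close>.\<close>

definition pvecs :: "nat \<Rightarrow> 'p::prime_card pvec set" where
  "pvecs n = {x. \<forall>i\<ge>n. x i = 0}"

definition vsmult :: "'a::comm_ring_1 \<Rightarrow> (nat \<Rightarrow> 'a) \<Rightarrow> nat \<Rightarrow> 'a" where
  "vsmult f x = (\<lambda>i. f * x i)"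

definition below_degree :: "nat \<Rightarrow> 'p::prime_card pvec set" where
  "below_degree d = {x. \<forall>i k. d \<le> k \<longrightarrow> Polynomial.coeff (x i) k = 0}"

definition submodule_set :: "'p::prime_card pvec set \<Rightarrow> bool" where
  "submodule_set U \<longleftrightarrow> additive_closed U \<and> (\<forall>f. \<forall>x\<in>U. vsmult f x \<in> U)"

definition pvec_reps :: "nat \<Rightarrow> nat \<Rightarrow> nat \<Rightarrow> 'p::prime_card pvec set" where
  "pvec_reps n M d = PiE_dflt {..<n} 0 (\<lambda>_. poly_reps M d)"

abbreviation pconst :: "nat \<Rightarrow> 'p::prime_card padic_int poly" where
  "pconst M \<equiv> [:padic_p ^ M:]"

lemma vsmult_apply [simp]: "vsmult f x i = f * x i"
  by (simp add: vsmult_def)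

lemma vsmult_add: "vsmult f (x + y) = vsmult f x + vsmult f y"
  by (simp add: fun_eq_iff distrib_left)

lemma vsmult_diff: "vsmult f (x - y) = vsmult f x - vsmult f y"
  by (simp add: fun_eq_iff right_diff_distrib)

lemma vsmult_add_left: "vsmult (f + g) x = vsmult f x + vsmult g x"
  by (simp add: fun_eq_iff distrib_right)

lemma vsmult_vsmult: "vsmult f (vsmult g x) = vsmult (f * g) x"
  by (simp add: fun_eq_iff mult.assoc)

lemma vsmult_one [simp]: "vsmult 1 x = x"
  by (simp add: fun_eq_iff)

lemma vsmult_zero [simp]: "vsmult f 0 = 0" "vsmult 0 x = 0"
  by (simp_all add: fun_eq_iff)

lemma submodule_pvecs: "submodule_set (pvecs n)"
  by (auto simp: submodule_set_def additive_closed_def pvecs_def)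

lemma submodule_setD:
  assumes "submodule_set U"
  shows "additive_closed U" "x \<in> U \<Longrightarrow> vsmult f x \<in> U"
  using assms by (auto simp: submodule_set_def)

lemma additive_closed_pvecs: "additive_closed (pvecs n)"
  by (rule submodule_setD(1)[OF submodule_pvecs])

lemma additive_closed_Int: "additive_closed A \<Longrightarrow> additive_closed B \<Longrightarrow> additive_closed (A \<inter> B)"
  by (auto simp: additive_closed_def)

lemma additive_closed_below_degree: "additive_closed (below_degree d)"
  by (auto simp: additive_closed_def below_degree_def)

lemma below_degree_mono: "d \<le> e \<Longrightarrow> below_degree d \<subseteq> below_degree e"
  by (auto simp: below_degree_def)

lemma finite_pvec_reps: "finite (pvec_reps n M d)"
  unfolding pvec_reps_def by (intro finite_PiE_dflt) (auto simp: finite_poly_reps)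

lemma card_pvec_reps: "card (pvec_reps n M d :: 'p::prime_card pvec set) = CARD('p) ^ (M * d * n)"
  unfolding pvec_reps_def by (subst card_PiE_dflt) (auto simp: finite_poly_reps card_poly_reps power_mult)

lemma pvec_reps_sub: "pvec_reps n M d \<subseteq> (pvecs n :: 'p::prime_card pvec set)"
  "pvec_reps n M d \<subseteq> (below_degree d :: 'p::prime_card pvec set)"
proof -
  show "pvec_reps n M d \<subseteq> (pvecs n :: 'p pvec set)"
  proof
    fix x :: "'p pvec" assume "x \<in> pvec_reps n M d"
    then have "\<forall>i. i \<notin> {..<n} \<longrightarrow> x i = 0" unfolding pvec_reps_def PiE_dflt_def by blast
    then show "x \<in> pvecs n" by (simp add: pvecs_def)
  qed
  show "pvec_reps n M d \<subseteq> (below_degree d :: 'p pvec set)"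
  proof
    fix x :: "'p pvec" assume x: "x \<in> pvec_reps n M d"
    have "Polynomial.coeff (x i) k = 0" if "d \<le> k" for i k
    proof (cases "i < n")
      case True
      then have "x i \<in> poly_reps M d" using x by (simp add: pvec_reps_def PiE_dflt_def)
      then show ?thesis using that unfolding poly_reps_def by blast
    next
      case False
      then have "x i = 0" using x by (simp add: pvec_reps_def PiE_dflt_def)
      then show ?thesis by simp
    qed
    then show "x \<in> below_degree d" by (simp add: below_degree_def)
  qed
qed

lemma pvec_repsI: "(\<And>i. i < n \<Longrightarrow> x i \<in> poly_reps M d) \<Longrightarrow> x \<in> pvecs n \<Longrightarrow> x \<in> pvec_reps n M d"
  by (auto simp: pvec_reps_def PiE_dflt_def pvecs_def)

lemma pvec_reps_unique:
  assumes "x \<in> pvec_reps n M d" "y \<in> pvec_reps n M d" "x - y = vsmult (pconst M) z"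
  shows "x = y"
proof
  fix i
  show "x i = y i"
  proof (cases "i < n")
    case True
    then have "x i \<in> poly_reps M d" "y i \<in> poly_reps M d"
      using assms by (auto simp: pvec_reps_def PiE_dflt_def)
    moreover have "x i - y i = Polynomial.smult (padic_p ^ M) (z i)"
      using fun_cong[OF assms(3), of i] by simp
    ultimately show ?thesis by (rule poly_reps_unique)
  next
    case False
    then show ?thesis using assms by (auto simp: pvec_reps_def PiE_dflt_def)
  qed
qed

definition pvec_red :: "nat \<Rightarrow> 'p::prime_card pvec \<Rightarrow> 'p pvec" where
  "pvec_red M x = (\<lambda>i. poly_red M (x i))"

lemma pvec_red_in_reps:
  assumes "x \<in> pvecs n" "x \<in> below_degree d"
  shows "pvec_red M x \<in> pvec_reps n M d"
proof (rule pvec_repsI)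
  show "pvec_red M x \<in> pvecs n"
    using assms by (auto simp: pvec_red_def pvecs_def poly_eq_iff coeff_poly_red)
  show "pvec_red M x i \<in> poly_reps M d" for i
    using assms unfolding pvec_red_def by (intro poly_red_in_reps) (auto simp: below_degree_def)
qed

text \<open>Multiplication by a power of \<open>p\<close> is injective on coefficients, so the
  cofactor inherits support and degree bound.\<close>

lemma below_degree_divisible:
  assumes "x \<in> pvecs n" "x \<in> below_degree d" "x = vsmult (pconst M) z"
  shows "\<exists>z'\<in>pvecs n \<inter> below_degree d. x = vsmult (pconst M) z'"
proof
  have pc: "padic_p ^ M * c = 0 \<longleftrightarrow> c = 0" for c :: "'a padic_int"
  proof (induction M)
    case (Suc M)
    then show ?case using padic_p_mult_eq_0[of "padic_p ^ M * c"] by (auto simp: mult.assoc)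
  qed simp
  have c: "Polynomial.coeff (x i) k = padic_p ^ M * Polynomial.coeff (z i) k" for i k
    using fun_cong[OF assms(3), of i] by simp
  show "x = vsmult (pconst M) z" by fact
  show "z \<in> pvecs n \<inter> below_degree d"
    using assms(1,2) c unfolding pvecs_def below_degree_def by (auto simp: poly_eq_iff pc)
qed

lemma pvec_red_diff:
  assumes "x \<in> pvecs n" "x \<in> below_degree d"
  shows "\<exists>z\<in>pvecs n \<inter> below_degree d. x - pvec_red M x = vsmult (pconst M) z"
proof -
  define z where "z i = (SOME h. x i - poly_red M (x i) = Polynomial.smult (padic_p ^ M) h)" for i
  have "x i - poly_red M (x i) = Polynomial.smult (padic_p ^ M) (z i)" for i
    unfolding z_def by (rule someI_ex[OF poly_red_diff])
  then have e: "x - pvec_red M x = vsmult (pconst M) z" by (simp add: fun_eq_iff pvec_red_def)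
  have r: "pvec_red M x \<in> pvecs n" "pvec_red M x \<in> below_degree d"
    by (rule subsetD[OF pvec_reps_sub(1) pvec_red_in_reps[OF assms]],
        rule subsetD[OF pvec_reps_sub(2) pvec_red_in_reps[OF assms]])
  show ?thesis
    by (rule below_degree_divisible[OF _ _ e])
      (rule additive_closedD(2)[OF additive_closed_pvecs assms(1) r(1)],
       rule additive_closedD(2)[OF additive_closed_below_degree assms(2) r(2)])
qed

definition pvec_multiples :: "nat \<Rightarrow> nat \<Rightarrow> nat \<Rightarrow> 'p::prime_card pvec set" where
  "pvec_multiples n M d = vsmult (pconst M) ` (pvecs n \<inter> below_degree d)"

text \<open>For \<open>d = 1\<close> this describes the constant vectors modulo \<open>p^M\<close>,
  from which the columns of a matrix are taken.\<close>

lemma coset_reps_below_degree: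
  "coset_reps (pvecs n \<inter> below_degree d :: 'p::prime_card pvec set) (pvec_multiples n M d) (pvec_reps n M d) (pvec_red M)"
proof
  let ?L = "pvecs n \<inter> below_degree d :: 'p pvec set"
  show L: "additive_closed ?L"
    by (intro additive_closed_Int additive_closed_pvecs additive_closed_below_degree)
  show "additive_closed (pvec_multiples n M d :: 'p pvec set)"
    unfolding additive_closed_def
  proof (intro conjI ballI)
    show "0 \<in> (pvec_multiples n M d :: 'p pvec set)"
      unfolding pvec_multiples_def using additive_closedD(1)[OF L] by (intro image_eqI[of _ _ 0]) auto
    fix x y :: "'p pvec" assume "x \<in> pvec_multiples n M d" "y \<in> pvec_multiples n M d"
    then obtain u v where "x = vsmult (pconst M) u" "y = vsmult (pconst M) v" "u \<in> ?L" "v \<in> ?L"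
      unfolding pvec_multiples_def by blast
    then have "x - y = vsmult (pconst M) (u - v)" "u - v \<in> ?L"
      using additive_closedD(2)[OF L] by (auto simp: vsmult_diff)
    then show "x - y \<in> pvec_multiples n M d" unfolding pvec_multiples_def by blast
  qed
  have "vsmult (pconst M) x \<in> below_degree d" if "x \<in> below_degree d" for x :: "'p pvec"
    using that by (simp add: below_degree_def)
  then show "pvec_multiples n M d \<subseteq> ?L"
    unfolding pvec_multiples_def using submodule_setD(2)[OF submodule_pvecs] by blast
  show "finite (pvec_reps n M d :: 'p pvec set)" by (rule finite_pvec_reps)
  show "pvec_reps n M d \<subseteq> ?L" using pvec_reps_sub by blast
  show "pvec_red M x \<in> pvec_reps n M d" "x - pvec_red M x \<in> pvec_multiples n M d" if "x \<in> ?L" for x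
    using that pvec_red_in_reps[of x n d M] pvec_red_diff[of x n d M] unfolding pvec_multiples_def by blast+
  show "x = y" if "x \<in> pvec_reps n M d" "y \<in> pvec_reps n M d" "x - y \<in> pvec_multiples n M d" for x y :: "'p pvec"
    using that pvec_reps_unique unfolding pvec_multiples_def by blast
qed

text \<open>A subgroup of index \<open>p\<close> avoiding \<open>x\<close> is found by Zorn's lemma.\<close>

lemma separating_character:
  fixes K :: "'p::prime_card pvec set"
  assumes K: "submodule_set K" and N: "additive_closed N" "N \<subseteq> K"
    and pK: "\<And>y. y \<in> K \<Longrightarrow> vsmult (of_nat CARD('p)) y \<in> N"
    and x: "x \<in> K" "x \<notin> N"
  shows "\<exists>\<psi> :: 'p pvec \<Rightarrow> 'p mod_ring. (\<forall>y\<in>K. \<forall>z\<in>K. \<psi> (y + z) = \<psi> y + \<psi> z) \<and>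
    (\<forall>y\<in>N. \<psi> y = 0) \<and> (\<forall>y. y \<notin> K \<longrightarrow> \<psi> y = 0) \<and> \<psi> x \<noteq> 0"
proof -
  let ?p = "int CARD('p)"
  define m :: "int \<Rightarrow> 'p pvec \<Rightarrow> 'p pvec" where "m k y = vsmult (of_int k) y" for k y
  have m_add: "m (k + l) y = m k y + m l y" for k l y
    by (simp add: m_def vsmult_add_left)
  have m_diff: "m (k - l) y = m k y - m l y" for k l y
    using m_add[of "k - l" l y] by simp
  have m_mult: "m (k * l) y = m k (m l y)" for k l y
    by (simp add: m_def vsmult_vsmult)
  have m_vadd: "m k (y + z) = m k y + m k z" for k y z by (simp add: m_def vsmult_add)
  have m_1: "m 1 y = y" for y by (simp add: m_def)
  have m_0: "m 0 y = 0" for y by (simp add: m_def fun_eq_iff)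
  have m_minus: "m (- k) y = - m k y" for k y by (simp add: m_def fun_eq_iff)
  have mK: "m k y \<in> K" if "y \<in> K" for k y unfolding m_def by (rule submodule_setD(2)[OF K that])
  note Kc = additive_closedD[OF submodule_setD(1)[OF K]]
  have mS: "m k y \<in> S" if "additive_closed S" "y \<in> S" for k y S
  proof -
    have *: "m (int k) y \<in> S" for k :: nat
    proof (induction k)
      case 0
      show ?case unfolding of_nat_0 m_0 by (rule additive_closedD(1)[OF that(1)])
    next
      case (Suc k)
      then show ?case unfolding of_nat_Suc m_add m_1 by (rule additive_closedD(4)[OF that(1) that(2)])
    qed
    have "m (- int k) y \<in> S" for k :: nat
      unfolding m_minus by (rule additive_closedD(3)[OF that(1) *])
    with * show ?thesis by (cases k rule: int_cases2) blast+
  qed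
  define \<A> where "\<A> = {S. additive_closed S \<and> N \<subseteq> S \<and> S \<subseteq> K \<and> x \<notin> S}"
  have "\<exists>S\<in>\<A>. \<forall>S'\<in>\<A>. S \<subseteq> S' \<longrightarrow> S' = S"
  proof (rule subset_Zorn_nonempty)
    show "\<A> \<noteq> {}" using N x by (auto simp: \<A>_def)
    fix C assume C: "C \<noteq> {}" "subset.chain \<A> C"
    have "additive_closed (\<Union>C)"
      unfolding additive_closed_def
    proof (intro conjI ballI)
      from C obtain S where "S \<in> C" "S \<in> \<A>" by (auto simp: subset_chain_def)
      then show "0 \<in> \<Union>C" unfolding \<A>_def using additive_closedD(1) by blast
      fix y z assume "y \<in> \<Union>C" "z \<in> \<Union>C"
      then obtain A B where AB: "A \<in> C" "B \<in> C" "y \<in> A" "z \<in> B" by blast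
      then have "A \<subseteq> B \<or> B \<subseteq> A" using C(2) by (simp add: subset_chain_def)
      then obtain S where S: "S \<in> C" "y \<in> S" "z \<in> S" using AB by blast
      then have "additive_closed S" using C(2) by (auto simp: subset_chain_def \<A>_def)
      then show "y - z \<in> \<Union>C" using S additive_closedD(2) by blast
    qed
    then show "\<Union>C \<in> \<A>" using C unfolding subset_chain_def \<A>_def by blast
  qed
  then obtain S where "S \<in> \<A>" and max: "\<And>S'. S' \<in> \<A> \<Longrightarrow> S \<subseteq> S' \<Longrightarrow> S' = S" by blast
  then have S: "additive_closed S" "N \<subseteq> S" "S \<subseteq> K" "x \<notin> S" by (auto simp: \<A>_def)
  note Sc = additive_closedD[OF S(1)]
  have pS: "m (?p * k) y \<in> S" if "y \<in> K" for k y
  proof -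
    have "m ?p (m k y) \<in> N" using pK[OF mK[OF that, of k]] by (simp add: m_def)
    then show ?thesis unfolding m_mult by (rule subsetD[OF S(2)])
  qed
  have inv: "\<exists>k' l. k' * k = 1 + ?p * l" if "\<not> ?p dvd k" for k :: int
  proof -
    have "coprime ?p k" using that prime_card_int[where 'a = 'p] by (intro prime_imp_coprime)
    then have "gcd k ?p = 1" by (metis coprime_imp_gcd_eq_1 gcd.commute)
    then obtain u v where "u * k + v * ?p = 1" using bezout_int[of k ?p] by auto
    then have "u * k = 1 + ?p * (- v)" by (simp add: algebra_simps)
    then show ?thesis by blast
  qed
  \<comment> \<open>A multiplier prime to \<open>p\<close> is invertible modulo \<open>p\<close>,
    and \<open>p K\<close> lies in \<open>N\<close>, so \<open>x\<close> itself would lie in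
    \<open>S\<close>.\<close>
  have div: "?p dvd k" if "m k x \<in> S" for k
  proof (rule ccontr)
    assume "\<not> ?p dvd k"
    then obtain k' l where kl: "k' * k = 1 + ?p * l" using inv by blast
    have "x + m (?p * l) x \<in> S"
      using mS[OF S(1) that, of k'] unfolding m_mult[symmetric] kl m_add m_1 .
    then have "x + m (?p * l) x - m (?p * l) x \<in> S" by (rule Sc(2)[OF _ pS[OF x(1)]])
    then show False using S(4) unfolding add_diff_cancel_right' by (rule notE[rotated])
  qed
  \<comment> \<open>By maximality, \<open>S\<close> together with a \<open>y\<close> outside it
    already contains \<open>x\<close>; solving for \<open>y\<close> shows that \<open>x\<close>
    generates \<open>K/S\<close>.\<close>
  have ex: "\<exists>k. y - m k x \<in> S" if y: "y \<in> K" for y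
  proof (cases "y \<in> S")
    case True
    then have "y - m 0 x \<in> S" unfolding m_0 diff_zero .
    then show ?thesis ..
  next
    case False
    define S' where "S' = {s + m k y | s k. s \<in> S}"
    have S_S': "S \<subseteq> S'"
    proof
      fix s assume "s \<in> S"
      moreover have "s = s + m 0 y" unfolding m_0 add_0_right ..
      ultimately show "s \<in> S'" unfolding S'_def by blast
    qed
    have "y = 0 + m 1 y" unfolding m_1 add_0_left ..
    then have yS': "y \<in> S'" unfolding S'_def using Sc(1) by blast
    have cl: "additive_closed S'"
      unfolding additive_closed_def
    proof (intro conjI ballI)
      show "0 \<in> S'" using S_S' Sc(1) by blast
      fix u v assume "u \<in> S'" "v \<in> S'"
      then obtain s k t l where *: "u = s + m k y" "v = t + m l y" "s \<in> S" "t \<in> S"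
        unfolding S'_def by blast
      have "u - v = (s - t) + m (k - l) y" unfolding *(1,2) m_diff by (rule add_diff_add)
      then show "u - v \<in> S'" unfolding S'_def using Sc(2)[OF *(3,4)] by blast
    qed
    have "S' \<subseteq> K" unfolding S'_def using S(3) mK[OF y] Kc(4) by blast
    have "S' \<notin> \<A>" using max[of S'] S_S' yS' False by blast
    then have "x \<in> S'" using cl S_S' S(2) \<open>S' \<subseteq> K\<close> unfolding \<A>_def by blast
    then obtain s k where sk: "x = s + m k y" "s \<in> S" unfolding S'_def by blast
    have "\<not> ?p dvd k"
    proof
      assume "?p dvd k"
      then obtain l where "k = ?p * l" ..
      then have "m k y \<in> S" using pS[OF y] by simp
      then show False using sk S(4) Sc(4) by blast
    qed
    then obtain k' l where kl: "k' * k = 1 + ?p * l" using inv by blast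
    have "m k' x = m k' s + (y + m (?p * l) y)"
      unfolding sk(1) m_vadd m_mult[symmetric] kl m_add m_1 ..
    then have "y - m k' x = - (m k' s + m (?p * l) y)" by (simp add: fun_eq_iff)
    moreover have "- (m k' s + m (?p * l) y) \<in> S"
      by (intro Sc(3) Sc(4) mS[OF S(1) sk(2)] pS[OF y])
    ultimately show ?thesis by metis
  qed
  \<comment> \<open>The coefficient of \<open>x\<close> is unique modulo \<open>p\<close> and hence
    well defined in the prime field.\<close>
  define \<psi> where "\<psi> y = (if y \<in> K then of_int (SOME k. y - m k x \<in> S) else 0 :: 'p mod_ring)" for y
  have \<psi>: "\<psi> y = of_int k" if y: "y \<in> K" "y - m k x \<in> S" for y k
  proof -
    let ?k = "SOME k. y - m k x \<in> S"
    have "y - m ?k x \<in> S" using ex[OF y(1)] by (rule someI_ex)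
    from Sc(2)[OF this y(2)] have "m (k - ?k) x \<in> S" by (simp add: m_diff)
    then have "?p dvd k - ?k" by (rule div)
    then have "(of_int (k - ?k) :: 'p mod_ring) = 0" by (simp only: of_int_eq_0_iff_char_dvd semiring_char_mod_ring)
    then show ?thesis using y by (simp add: \<psi>_def)
  qed
  show ?thesis
  proof (intro exI[of _ \<psi>] conjI ballI allI impI)
    fix y z assume yz: "y \<in> K" "z \<in> K"
    then obtain k l where kl: "y - m k x \<in> S" "z - m l x \<in> S" using ex by blast
    have "(y - m k x) + (z - m l x) \<in> S" by (rule Sc(4)[OF kl])
    then have "(y + z) - m (k + l) x \<in> S" unfolding m_add add_diff_add .
    then show "\<psi> (y + z) = \<psi> y + \<psi> z"
      using \<psi>[OF Kc(4)[OF yz], of "k + l"] \<psi>[OF yz(1) kl(1)] \<psi>[OF yz(2) kl(2)] by simp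
  next
    fix y assume "y \<in> N"
    then have "y - m 0 x \<in> S" "y \<in> K" unfolding m_0 diff_zero using S N by blast+
    then show "\<psi> y = 0" using \<psi>[of y 0] by simp
  next
    have "x - m 1 x \<in> S" unfolding m_1 diff_self by (rule Sc(1))
    then show "\<psi> x \<noteq> 0" using \<psi>[OF x(1), of 1] by simp
  qed (simp add: \<psi>_def)
qed

text \<open>The double sum of the character values is evaluated in both orders, the last two
  hypotheses being the orthogonality relations. In this way a dual is compared with its group
  without an isomorphism between them.\<close>

lemma root_of_unity_double_count:
  fixes c :: "'a \<Rightarrow> 'b \<Rightarrow> 'p::prime_card mod_ring"
  assumes "finite S" "finite D"
    and "\<And>\<psi>. \<psi> \<in> D \<Longrightarrow> (\<Sum>x\<in>S. root_of_unity (c \<psi> x)) = (if A \<psi> then of_nat (card S) else 0)"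
    and "\<And>x. x \<in> S \<Longrightarrow> (\<Sum>\<psi>\<in>D. root_of_unity (c \<psi> x)) = (if B x then of_nat (card D) else 0)"
  shows "card {\<psi> \<in> D. A \<psi>} * card S = card {x \<in> S. B x} * card D"
proof -
  have "of_nat (card {\<psi> \<in> D. A \<psi>} * card S) = (\<Sum>\<psi>\<in>D. if A \<psi> then of_nat (card S) else (0::complex))"
    using assms(2) by (simp add: sum.If_cases Int_def)
  also have "\<dots> = (\<Sum>\<psi>\<in>D. \<Sum>x\<in>S. root_of_unity (c \<psi> x))" using assms(3) by simp
  also have "\<dots> = (\<Sum>x\<in>S. \<Sum>\<psi>\<in>D. root_of_unity (c \<psi> x))" by (rule sum.swap)
  also have "\<dots> = (\<Sum>x\<in>S. if B x then of_nat (card D) else 0)" using assms(4) by simp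
  also have "\<dots> = of_nat (card {x \<in> S. B x} * card D)"
    using assms(1) by (simp add: sum.If_cases Int_def)
  finally show ?thesis by (simp only: of_nat_eq_iff)
qed

lemma pconst_add: "pconst (M + M') = pconst M * pconst M'"
  by (simp add: power_add)

lemma pconst_1: "(pconst 1 :: 'p::prime_card padic_int poly) = of_nat CARD('p)"
  by (simp add: of_nat_poly)

lemma vsmult_pconst_cancel:
  assumes "vsmult (pconst 1) x = vsmult (pconst 1) y"
  shows "x = y"
proof
  fix i
  show "x i = y i"
  proof (rule poly_eqI)
    fix k
    have "pconst 1 * x i = pconst 1 * y i" using fun_cong[OF assms, of i] by (simp only: vsmult_apply)
    then have "Polynomial.coeff (pconst 1 * x i) k = Polynomial.coeff (pconst 1 * y i) k" by (simp only:)
    then have "padic_p * (Polynomial.coeff (x i) k - Polynomial.coeff (y i) k) = 0"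
      by (simp add: right_diff_distrib)
    then show "Polynomial.coeff (x i) k = Polynomial.coeff (y i) k"
      using padic_p_mult_eq_0 by (metis eq_iff_diff_eq_0)
  qed
qed

lemma pvec_division:
  fixes x :: "'p::prime_card pvec"
  assumes "lead_coeff P = 1" "x \<in> pvecs n"
  shows "\<exists>q\<in>pvecs n. \<exists>r\<in>pvecs n \<inter> below_degree (Polynomial.degree P). x = vsmult P q + r"
proof -
  have "\<forall>i. \<exists>qr. x i = P * fst qr + snd qr \<and> (\<forall>k\<ge>Polynomial.degree P. Polynomial.coeff (snd qr) k = 0)
      \<and> (i \<ge> n \<longrightarrow> qr = (0, 0))"
  proof
    fix i
    show "\<exists>qr. x i = P * fst qr + snd qr \<and> (\<forall>k\<ge>Polynomial.degree P. Polynomial.coeff (snd qr) k = 0)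
      \<and> (i \<ge> n \<longrightarrow> qr = (0, 0))"
    proof (cases "i < n")
      case True
      obtain q r where "x i = P * q + r" "\<forall>k\<ge>Polynomial.degree P. Polynomial.coeff r k = 0"
        using monic_division[OF assms(1), of "x i"] by blast
      then show ?thesis using True by (intro exI[of _ "(q, r)"]) simp
    next
      case False
      then have "x i = 0" using assms(2) by (simp add: pvecs_def)
      then show ?thesis by (intro exI[of _ "(0, 0)"]) simp
    qed
  qed
  from choice[OF this] obtain f where f: "\<And>i. x i = P * fst (f i) + snd (f i)"
    "\<And>i k. Polynomial.degree P \<le> k \<Longrightarrow> Polynomial.coeff (snd (f i)) k = 0" "\<And>i. i \<ge> n \<Longrightarrow> f i = (0, 0)"
    by blast
  show ?thesis
  proof (intro bexI)
    show "x = vsmult P (\<lambda>i. fst (f i)) + (\<lambda>i. snd (f i))"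
      by (rule ext) (simp only: plus_fun_apply vsmult_apply f(1))
    show "(\<lambda>i. snd (f i)) \<in> pvecs n \<inter> below_degree (Polynomial.degree P)"
      using f(2,3) by (simp add: pvecs_def below_degree_def)
    show "(\<lambda>i. fst (f i)) \<in> pvecs n" using f(3) by (simp add: pvecs_def)
  qed
qed

lemma vsmult_monic_below_degree:
  fixes z :: "'p::prime_card pvec"
  assumes "lead_coeff P = 1" "vsmult P z \<in> below_degree (Polynomial.degree P)"
  shows "z = 0"
proof
  fix i
  show "z i = 0 i"
    using monic_mult_eq_0[OF assms(1), of "z i"] assms(2) by (simp add: below_degree_def)
qed

lemma additive_closed_neg_iff: "additive_closed U \<Longrightarrow> 0 - x \<in> U \<longleftrightarrow> x \<in> U"
  by (metis additive_closedD(3) diff_0 minus_minus)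

section \<open>Presentations of finite modules\<close>

text \<open>Polynomials act rather than their classes modulo \<open>P\<close>, so that entries of
  vectors of polynomials can be applied directly; \<open>p^e\<close> is a power annihilating the
  module.\<close>

locale quot_module = abelian_group H for H :: "('h, 'm) ring_scheme" (structure) +
  fixes act :: "'p::prime_card padic_int poly \<Rightarrow> 'h \<Rightarrow> 'h" and P :: "'p padic_int poly" and e :: nat
  assumes finite_H: "finite (carrier H)"
    and act_closed: "h \<in> carrier H \<Longrightarrow> act f h \<in> carrier H"
    and act_add_left: "h \<in> carrier H \<Longrightarrow> act (f + f') h = act f h \<oplus> act f' h"
    and act_add_right: "h \<in> carrier H \<Longrightarrow> k \<in> carrier H \<Longrightarrow> act f (h \<oplus> k) = act f h \<oplus> act f k"
    and act_mult: "h \<in> carrier H \<Longrightarrow> act (f * f') h = act f (act f' h)"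
    and act_one: "h \<in> carrier H \<Longrightarrow> act 1 h = h"
    and act_P: "h \<in> carrier H \<Longrightarrow> act P h = \<zero>"
    and act_p: "h \<in> carrier H \<Longrightarrow> act (pconst e) h = \<zero>"
    and monic: "lead_coeff P = 1"
    and irred: "irreducible (reduce_poly P)"
begin

lemma add_cancel_zero: "a \<in> carrier H \<Longrightarrow> b \<in> carrier H \<Longrightarrow> a \<oplus> b = b \<Longrightarrow> a = \<zero>"
  by (metis a_assoc r_neg r_zero a_inv_closed)

lemma act_zero_right: "act f \<zero> = \<zero>"
  by (metis act_add_right act_closed add_cancel_zero l_zero zero_closed)

lemma act_zero_left: "h \<in> carrier H \<Longrightarrow> act 0 h = \<zero>"
  by (metis act_add_left act_closed add_0_right add_cancel_zero)

lemma act_finsum: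
  assumes "finite A" "f \<in> A \<rightarrow> carrier H"
  shows "act a (finsum H f A) = finsum H (\<lambda>i. act a (f i)) A"
  using assms
proof (induction A)
  case (insert x A)
  then have "finsum H f A \<in> carrier H" "f x \<in> carrier H" "f \<in> A \<rightarrow> carrier H"
    "(\<lambda>i. act a (f i)) \<in> A \<rightarrow> carrier H" "act a (f x) \<in> carrier H"
    by (auto intro: act_closed)
  then show ?case using insert by (simp add: act_add_right)
qed (simp add: act_zero_right)

definition reps_modulus :: "nat \<Rightarrow> nat \<Rightarrow> 'p pvec set" where
  "reps_modulus n M = {vsmult (pconst M) y + vsmult P z | y z. y \<in> pvecs n \<and> z \<in> pvecs n}"

text \<open>Division by the monic \<open>P\<close> lowers the degree, after which coefficients are
  reduced modulo \<open>p^M\<close>. Uniqueness rests on the fact that a multiple of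
  \<open>P\<close> of degree below \<open>degree P\<close> is 0.\<close>

lemma coset_reps_modulus:
  "\<exists>rd. coset_reps (pvecs n :: 'p pvec set) (reps_modulus n M) (pvec_reps n M (Polynomial.degree P)) rd"
proof -
  let ?X = "pvec_reps n M (Polynomial.degree P) :: 'p pvec set"
  let ?d = "Polynomial.degree P"
  note pc = additive_closedD[OF additive_closed_pvecs[of n, where 'a = 'p]]
  note pv = submodule_setD(2)[OF submodule_pvecs[of n, where 'a = 'p]]
  have Z: "additive_closed (reps_modulus n M)"
    unfolding additive_closed_def
  proof (intro conjI ballI)
    have "0 = vsmult (pconst M) 0 + vsmult P 0" by simp
    then show "0 \<in> reps_modulus n M" unfolding reps_modulus_def using pc(1) by blast
    fix u v assume "u \<in> reps_modulus n M" "v \<in> reps_modulus n M"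
    then obtain y z y' z' where *: "u = vsmult (pconst M) y + vsmult P z" "v = vsmult (pconst M) y' + vsmult P z'"
      "y \<in> pvecs n" "z \<in> pvecs n" "y' \<in> pvecs n" "z' \<in> pvecs n"
      unfolding reps_modulus_def by blast
    have "u - v = vsmult (pconst M) (y - y') + vsmult P (z - z')"
      unfolding *(1,2) vsmult_diff by (rule add_diff_add)
    then show "u - v \<in> reps_modulus n M"
      unfolding reps_modulus_def using pc(2)[OF *(3) *(5)] pc(2)[OF *(4) *(6)] by blast
  qed
  have ZL: "reps_modulus n M \<subseteq> pvecs n" unfolding reps_modulus_def using pc(4) pv by blast
  have ex: "\<exists>x'. x' \<in> ?X \<and> x - x' \<in> reps_modulus n M" if x: "x \<in> pvecs n" for x
  proof -
    obtain q r where qr: "q \<in> pvecs n" "r \<in> pvecs n" "r \<in> below_degree ?d" "x = vsmult P q + r"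
      using pvec_division[OF monic x] by blast
    obtain z where z: "z \<in> pvecs n" "r - pvec_red M r = vsmult (pconst M) z"
      using pvec_red_diff[OF qr(2,3), of M] by blast
    have "x - pvec_red M r = vsmult (pconst M) z + vsmult P q"
      unfolding qr(4) z(2)[symmetric] by (rule ext) simp
    then have "x - pvec_red M r \<in> reps_modulus n M" unfolding reps_modulus_def using z(1) qr(1) by blast
    then show ?thesis using pvec_red_in_reps[OF qr(2,3)] by blast
  qed
  define rd where "rd x = (SOME x'. x' \<in> ?X \<and> x - x' \<in> reps_modulus n M)" for x
  have rd: "rd x \<in> ?X \<and> x - rd x \<in> reps_modulus n M" if "x \<in> pvecs n" for x
    unfolding rd_def by (rule someI_ex[OF ex[OF that]])
  have uniq: "x = x'" if x: "x \<in> ?X" "x' \<in> ?X" "x - x' \<in> reps_modulus n M" for x x'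
  proof -
    obtain y z where yz: "x - x' = vsmult (pconst M) y + vsmult P z" "y \<in> pvecs n" "z \<in> pvecs n"
      using x(3) unfolding reps_modulus_def by blast
    obtain q r where qr: "q \<in> pvecs n" "r \<in> pvecs n" "r \<in> below_degree ?d" "y = vsmult P q + r"
      using pvec_division[OF monic yz(2)] by blast
    \<comment> \<open>With \<open>y\<close> replaced by its remainder \<open>r\<close>, the left
      side has degree below \<open>degree P\<close> while the right side is a multiple of
      \<open>P\<close>; both therefore vanish.\<close>
    have eq: "x - x' - vsmult (pconst M) r = vsmult P (z + vsmult (pconst M) q)"
    proof
      fix i
      have "x i - x' i = pconst M * y i + P * z i" using fun_cong[OF yz(1), of i] by simp
      moreover have "y i = P * q i + r i" using fun_cong[OF qr(4), of i] by simp
      ultimately have "x i - x' i = pconst M * (P * q i + r i) + P * z i" by simp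
      then show "(x - x' - vsmult (pconst M) r) i = vsmult P (z + vsmult (pconst M) q) i"
        by (simp add: distrib_left mult.left_commute)
    qed
    have "vsmult (pconst M) r \<in> below_degree ?d" using qr(3) by (simp add: below_degree_def)
    moreover have "x \<in> below_degree ?d" "x' \<in> below_degree ?d"
      by (rule subsetD[OF pvec_reps_sub(2) x(1)], rule subsetD[OF pvec_reps_sub(2) x(2)])
    ultimately have "x - x' - vsmult (pconst M) r \<in> below_degree ?d"
      by (intro additive_closedD(2)[OF additive_closed_below_degree])
    then have "z + vsmult (pconst M) q = 0"
      unfolding eq by (rule vsmult_monic_below_degree[OF monic])
    then have "x - x' - vsmult (pconst M) r = 0" unfolding eq by (simp only: vsmult_zero)
    then have "x - x' = vsmult (pconst M) r" by (simp only: right_minus_eq)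
    then show ?thesis by (rule pvec_reps_unique[OF x(1,2)])
  qed
  show ?thesis
  proof (intro exI[of _ rd] coset_reps.intro)
    show "x = y" if "x \<in> ?X" "y \<in> ?X" "x - y \<in> reps_modulus n M" for x y by (rule uniq[OF that])
    show "rd x \<in> ?X" "x - rd x \<in> reps_modulus n M" if "x \<in> pvecs n" for x using rd[OF that] by simp_all
  qed (rule additive_closed_pvecs Z ZL finite_pvec_reps pvec_reps_sub(1))+
qed

end

locale presentation = quot_module H act P e
  for H :: "('h, 'm) ring_scheme" (structure) and act :: "'p::prime_card padic_int poly \<Rightarrow> 'h \<Rightarrow> 'h"
    and P :: "'p padic_int poly" and e :: nat +
  fixes n :: nat and g :: "nat \<Rightarrow> 'h"
  assumes g: "i < n \<Longrightarrow> g i \<in> carrier H"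
begin

definition lmap :: "'p pvec \<Rightarrow> 'h" where
  "lmap x = finsum H (\<lambda>i. act (x i) (g i)) {..<n}"

definition K :: "'p pvec set" where
  "K = {x \<in> pvecs n. lmap x = \<zero>}"

text \<open>All of \<open>P L\<close> is included, as the relations of a cokernel of
  \<open>P(A)\<close> are the columns of \<open>t - A\<close> and \<open>P L\<close>. Since
  \<open>p\<close> and \<open>P\<close> map \<open>K\<close> into it, \<open>K/N\<close> is a space
  over the residue field of \<open>P\<close>.\<close>

definition N :: "'p pvec set" where
  "N = {vsmult (pconst 1) k + vsmult P y | k y. k \<in> K \<and> y \<in> pvecs n}"

text \<open>The dual of \<open>K/N\<close> over the prime field. Fixing the value 0 outside
  \<open>K\<close> lets each element of the dual be exactly one function, so that the dual can be
  counted.\<close>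

definition D :: "('p pvec \<Rightarrow> 'p mod_ring) set" where
  "D = {\<psi>. (\<forall>x\<in>K. \<forall>y\<in>K. \<psi> (x + y) = \<psi> x + \<psi> y) \<and> (\<forall>x\<in>N. \<psi> x = 0) \<and> (\<forall>x. x \<notin> K \<longrightarrow> \<psi> x = 0)}"

text \<open>The transpose of multiplication by \<open>f\<close>. It makes \<open>D\<close> a space
  over the residue field of \<open>P\<close>, although its members take values in the prime field
  only.\<close>

definition dact :: "'p padic_int poly \<Rightarrow> ('p pvec \<Rightarrow> 'p mod_ring) \<Rightarrow> 'p pvec \<Rightarrow> 'p mod_ring" where
  "dact f \<psi> = (\<lambda>x. if x \<in> K then \<psi> (vsmult f x) else 0)"

text \<open>The quantifier over \<open>f\<close> makes this the annihilator of the submodule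
  generated by \<open>S\<close>, and so a subspace over the residue field.\<close>

definition ann :: "'p pvec set \<Rightarrow> ('p pvec \<Rightarrow> 'p mod_ring) set" where
  "ann S = {\<psi> \<in> D. \<forall>x\<in>S. \<forall>f. \<psi> (vsmult f x) = 0}"

lemma terms_closed: "(\<lambda>i. act (x i) (g i)) \<in> {..<n} \<rightarrow> carrier H"
  using g act_closed by auto

lemma lmap_closed: "lmap x \<in> carrier H"
  unfolding lmap_def by (rule finsum_closed[OF terms_closed])

lemma lmap_add: "lmap (x + y) = lmap x \<oplus> lmap y"
proof -
  have "lmap (x + y) = finsum H (\<lambda>i. act (x i) (g i) \<oplus> act (y i) (g i)) {..<n}"
    unfolding lmap_def using terms_closed[of x] terms_closed[of y] g act_add_left
    by (intro finsum_cong') auto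
  also have "\<dots> = lmap x \<oplus> lmap y"
    unfolding lmap_def by (rule finsum_addf[OF terms_closed terms_closed])
  finally show ?thesis .
qed

lemma lmap_vsmult: "lmap (vsmult f x) = act f (lmap x)"
proof -
  have "lmap (vsmult f x) = finsum H (\<lambda>i. act f (act (x i) (g i))) {..<n}"
    unfolding lmap_def using terms_closed[of x] g act_mult act_closed
    by (intro finsum_cong') auto
  also have "\<dots> = act f (lmap x)"
    unfolding lmap_def by (rule act_finsum[symmetric]) (auto simp: terms_closed)
  finally show ?thesis .
qed

lemma lmap_eq_iff: "lmap x = lmap y \<longleftrightarrow> lmap (x - y) = \<zero>"
proof -
  have "lmap x = lmap (x - y) \<oplus> lmap y" using lmap_add[of "x - y" y] by (simp only: diff_add_cancel)
  then show ?thesis using add_cancel_zero[OF lmap_closed lmap_closed, of "x - y" y] lmap_closed by auto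
qed

lemma lmap_0: "lmap 0 = \<zero>"
  by (metis lmap_add lmap_closed add_0_right add_cancel_zero)

lemma submodule_K: "submodule_set K"
  unfolding submodule_set_def additive_closed_def
proof (intro conjI ballI allI)
  note pc = additive_closedD[OF additive_closed_pvecs[of n, where 'a = 'p]]
  show "0 \<in> K" unfolding K_def using pc(1) lmap_0 by blast
  show "x - y \<in> K" if "x \<in> K" "y \<in> K" for x y
    using that pc(2) lmap_eq_iff[of x y] unfolding K_def by auto
  show "vsmult f x \<in> K" if "x \<in> K" for f x
    using that submodule_setD(2)[OF submodule_pvecs] unfolding K_def by (auto simp: lmap_vsmult act_zero_right)
qed

lemmas K_add = additive_closedD[OF submodule_setD(1)[OF submodule_K]]
  and K_smult = submodule_setD(2)[OF submodule_K]

lemma P_in_K: "y \<in> pvecs n \<Longrightarrow> vsmult P y \<in> K"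
  using submodule_setD(2)[OF submodule_pvecs] by (auto simp: K_def lmap_vsmult act_P lmap_closed)

lemma p_power_in_K: "y \<in> pvecs n \<Longrightarrow> vsmult (pconst e) y \<in> K"
  using submodule_setD(2)[OF submodule_pvecs] by (auto simp: K_def lmap_vsmult act_p lmap_closed)

lemma K_sub: "K \<subseteq> pvecs n"
  by (auto simp: K_def)

lemma NI: "k \<in> K \<Longrightarrow> y \<in> pvecs n \<Longrightarrow> vsmult (pconst 1) k + vsmult P y \<in> N"
  unfolding N_def by blast

lemma submodule_N: "submodule_set N"
  unfolding submodule_set_def additive_closed_def
proof (intro conjI ballI allI)
  note pc = additive_closedD[OF additive_closed_pvecs[of n, where 'a = 'p]]
  show "0 \<in> N" using NI[OF K_add(1) pc(1)] by simp
  fix u assume "u \<in> N"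
  then obtain k y where u: "u = vsmult (pconst 1) k + vsmult P y" "k \<in> K" "y \<in> pvecs n"
    unfolding N_def by blast
  have "vsmult f u = vsmult (pconst 1) (vsmult f k) + vsmult P (vsmult f y)" for f
    unfolding u(1) by (simp only: vsmult_add vsmult_vsmult mult.commute[of f])
  then show "vsmult f u \<in> N" for f
    using NI[OF K_smult[OF u(2)] submodule_setD(2)[OF submodule_pvecs u(3)]] by simp
  fix v assume "v \<in> N"
  then obtain k' y' where v: "v = vsmult (pconst 1) k' + vsmult P y'" "k' \<in> K" "y' \<in> pvecs n"
    unfolding N_def by blast
  have "u - v = vsmult (pconst 1) (k - k') + vsmult P (y - y')"
    unfolding u(1) v(1) vsmult_diff by (rule add_diff_add)
  then show "u - v \<in> N" using NI[OF K_add(2)[OF u(2) v(2)] pc(2)[OF u(3) v(3)]] by simp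
qed

lemmas N_add = additive_closedD[OF submodule_setD(1)[OF submodule_N]]
  and N_smult = submodule_setD(2)[OF submodule_N]

lemma N_sub: "N \<subseteq> K"
  unfolding N_def using K_add(4) K_smult P_in_K by blast

lemma pK_in_N: "k \<in> K \<Longrightarrow> vsmult (pconst 1) k \<in> N"
  using NI[OF _ additive_closedD(1)[OF additive_closed_pvecs], of k] by (simp only: vsmult_zero add_0_right)

lemma P_in_N: "y \<in> pvecs n \<Longrightarrow> vsmult P y \<in> N"
  using NI[OF K_add(1), of y] by simp

lemma p_power_in_N: "y \<in> pvecs n \<Longrightarrow> vsmult (pconst (Suc e)) y \<in> N"
  using pK_in_N[OF p_power_in_K[of y]] by (simp only: vsmult_vsmult pconst_add[symmetric]) simp

lemma modulus_sub_N: "reps_modulus n (Suc e) \<subseteq> N"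
  unfolding reps_modulus_def using N_add(4)[OF p_power_in_N P_in_N] by blast

lemma modulus_sub_K: "reps_modulus n e \<subseteq> K"
  unfolding reps_modulus_def using K_add(4)[OF p_power_in_K P_in_K] by blast

text \<open>In \<open>p k + P z\<close>, dividing \<open>k\<close> by \<open>P\<close> leaves
  \<open>p r\<close> plus a multiple of \<open>P\<close>, and this multiple must vanish for reasons
  of degree. It identifies \<open>N\<close> modulo \<open>p^(e+1)\<close> with \<open>K\<close>
  modulo \<open>p^e\<close>.\<close>

lemma N_below_degree:
  assumes "x \<in> N" "x \<in> below_degree (Polynomial.degree P)"
  shows "\<exists>y\<in>K \<inter> below_degree (Polynomial.degree P). x = vsmult (pconst 1) y"
proof -
  let ?d = "Polynomial.degree P"
  obtain k z where kz: "x = vsmult (pconst 1) k + vsmult P z" "k \<in> K" "z \<in> pvecs n"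
    using assms(1) unfolding N_def by blast
  obtain q r where qr: "q \<in> pvecs n" "r \<in> pvecs n" "r \<in> below_degree ?d" "k = vsmult P q + r"
    using pvec_division[OF monic subsetD[OF K_sub kz(2)]] by blast
  have "r = k - vsmult P q" unfolding qr(4) by (rule ext) simp
  then have rK: "r \<in> K" using K_add(2)[OF kz(2) P_in_K[OF qr(1)]] by simp
  have eq: "x - vsmult (pconst 1) r = vsmult P (z + vsmult (pconst 1) q)"
    unfolding kz(1) qr(4) by (rule ext) (simp add: distrib_left mult.left_commute)
  have "vsmult (pconst 1) r \<in> below_degree ?d" using qr(3) by (simp add: below_degree_def)
  then have "x - vsmult (pconst 1) r \<in> below_degree ?d"
    by (rule additive_closedD(2)[OF additive_closed_below_degree assms(2)])
  then have "z + vsmult (pconst 1) q = 0" unfolding eq by (rule vsmult_monic_below_degree[OF monic])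
  then have "x - vsmult (pconst 1) r = 0" unfolding eq by (simp only: vsmult_zero)
  then have "x = vsmult (pconst 1) r" by (simp only: right_minus_eq)
  then show ?thesis using rK qr(3) by blast
qed

lemma D_D:
  assumes "\<psi> \<in> D"
  shows "x \<in> K \<Longrightarrow> y \<in> K \<Longrightarrow> \<psi> (x + y) = \<psi> x + \<psi> y" "x \<in> N \<Longrightarrow> \<psi> x = 0" "x \<notin> K \<Longrightarrow> \<psi> x = 0"
  using assms by (auto simp: D_def)

lemma zero_in_D: "0 \<in> D"
  by (simp add: D_def)

lemma add_in_D: "\<psi> \<in> D \<Longrightarrow> \<psi>' \<in> D \<Longrightarrow> \<psi> + \<psi>' \<in> D"
  unfolding D_def by (simp add: algebra_simps)

lemma diff_in_D: "\<psi> \<in> D \<Longrightarrow> \<psi>' \<in> D \<Longrightarrow> \<psi> - \<psi>' \<in> D"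
  unfolding D_def by (simp add: algebra_simps)

text \<open>A functional is determined by its values on finitely many representatives, because
  \<open>p^(e+1) L + P L\<close> lies in \<open>N\<close>.\<close>

lemma finite_D: "finite D"
proof -
  obtain rd where "coset_reps (pvecs n :: 'p pvec set) (reps_modulus n (Suc e)) (pvec_reps n (Suc e) (Polynomial.degree P)) rd"
    using coset_reps_modulus by blast
  then interpret c: coset_reps "pvecs n :: 'p pvec set" "reps_modulus n (Suc e)"
    "pvec_reps n (Suc e) (Polynomial.degree P)" rd .
  let ?X = "pvec_reps n (Suc e) (Polynomial.degree P) :: 'p pvec set"
  have "inj_on (\<lambda>\<psi>. restrict \<psi> ?X) D"
  proof (rule inj_onI)
    fix \<psi> \<psi>' assume \<psi>: "\<psi> \<in> D" "\<psi>' \<in> D" and eq: "restrict \<psi> ?X = restrict \<psi>' ?X"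
    show "\<psi> = \<psi>'"
    proof
      fix x
      show "\<psi> x = \<psi>' x"
      proof (cases "x \<in> K")
        case True
        then have xL: "x \<in> pvecs n" using K_sub by blast
        define z where "z = x - rd x"
        have z: "z \<in> N" unfolding z_def by (rule subsetD[OF modulus_sub_N c.rd(2)[OF xL]])
        have e1: "x = rd x + z" and e2: "rd x = x - z" unfolding z_def by simp_all
        have "rd x \<in> K" unfolding e2 by (rule K_add(2)[OF True subsetD[OF N_sub z]])
        then have v: "\<phi> x = \<phi> (rd x)" if "\<phi> \<in> D" for \<phi>
          using D_D(1)[OF that _ subsetD[OF N_sub z], of "rd x"] D_D(2)[OF that z] e1 by simp
        have "\<psi> (rd x) = \<psi>' (rd x)" using fun_cong[OF eq, of "rd x"] c.rd(1)[OF xL] by simp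
        then show ?thesis using v[OF \<psi>(1)] v[OF \<psi>(2)] by simp
      qed (use \<psi> in \<open>simp add: D_D(3)\<close>)
    qed
  qed
  moreover have "(\<lambda>\<psi>. restrict \<psi> ?X) ` D \<subseteq> (\<Pi>\<^sub>E x\<in>?X. UNIV)" by auto
  moreover have "finite (\<Pi>\<^sub>E x\<in>?X. (UNIV :: 'p mod_ring set))"
    by (intro finite_PiE finite_pvec_reps) simp
  ultimately show ?thesis by (metis finite_imageD finite_subset)
qed

lemma D_separates:
  assumes "additive_closed U" "N \<subseteq> U" "U \<subseteq> K" "x \<in> K" "x \<notin> U"
  shows "\<exists>\<psi>\<in>D. (\<forall>y\<in>U. \<psi> y = 0) \<and> \<psi> x \<noteq> 0"
proof -
  have pU: "vsmult (of_nat CARD('p)) y \<in> U" if "y \<in> K" for y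
    using subsetD[OF assms(2) pK_in_N[OF that]] by (simp only: pconst_1)
  from separating_character[OF submodule_K assms(1,3) pU assms(4,5)]
  obtain \<psi> :: "'p pvec \<Rightarrow> 'p mod_ring" where \<psi>: "\<And>y z. y \<in> K \<Longrightarrow> z \<in> K \<Longrightarrow> \<psi> (y + z) = \<psi> y + \<psi> z"
    "\<And>y. y \<in> U \<Longrightarrow> \<psi> y = 0" "\<And>y. y \<notin> K \<Longrightarrow> \<psi> y = 0" "\<psi> x \<noteq> 0" by blast
  have "\<psi> \<in> D" unfolding D_def using \<psi>(1-3) assms(2) by blast
  then show ?thesis using \<psi>(2,4) by blast
qed

text \<open>Orthogonality: outside \<open>N\<close> some functional is nonzero at \<open>y\<close>,
  and translating \<open>D\<close> by it cancels the sum.\<close>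

lemma sum_over_D:
  assumes "y \<in> K"
  shows "(\<Sum>\<psi>\<in>D. root_of_unity (\<psi> y)) = (if y \<in> N then of_nat (card D) else 0)"
proof (cases "y \<in> N")
  case True
  then have "(\<Sum>\<psi>\<in>D. root_of_unity (\<psi> y)) = (\<Sum>\<psi>\<in>D. 1)"
    by (intro sum.cong refl) (simp add: D_D(2))
  then show ?thesis using True by simp
next
  case False
  then obtain \<psi>0 where \<psi>0: "\<psi>0 \<in> D" "\<psi>0 y \<noteq> 0"
    using D_separates[OF submodule_setD(1)[OF submodule_N] subset_refl N_sub assms] by blast
  have "(\<Sum>\<psi>\<in>D. root_of_unity (\<psi> y)) = 0"
  proof (rule sum_root_of_unity_eq_0[where \<tau> = "\<lambda>\<psi>. \<psi> + \<psi>0" and c = "\<psi>0 y", OF finite_D])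
    show "(\<lambda>\<psi>. \<psi> + \<psi>0) ` D \<subseteq> D" using add_in_D[OF _ \<psi>0(1)] by blast
    show "inj_on (\<lambda>\<psi>. \<psi> + \<psi>0) D" by (rule inj_onI) (simp only: add_right_cancel)
  qed (use \<psi>0 in simp_all)
  then show ?thesis using False by simp
qed

definition generates :: "'p pvec set \<Rightarrow> bool" where
  "generates S \<longleftrightarrow> (\<forall>U. submodule_set U \<and> S \<subseteq> U \<and> N \<subseteq> U \<longrightarrow> K \<subseteq> U)"

text \<open>Duality for \<open>K/N\<close>. A submodule that contains \<open>N\<close> but not
  \<open>K\<close> lies in the kernel of some nonzero functional; conversely the vectors all of
  whose multiples are killed by an annihilating functional form a submodule, so generation forces
  the functional to be 0.\<close>

lemma generates_iff_ann:
  assumes "S \<subseteq> K"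
  shows "generates S \<longleftrightarrow> ann S = {0}"
proof
  assume gen: "generates S"
  have "\<psi> = 0" if \<psi>: "\<psi> \<in> ann S" for \<psi>
  proof -
    have \<psi>D: "\<psi> \<in> D" using \<psi> by (simp add: ann_def)
    define U where "U = {x \<in> K. \<forall>f. \<psi> (vsmult f x) = 0}"
    have "submodule_set U"
      unfolding submodule_set_def additive_closed_def
    proof (intro conjI ballI allI)
      show "0 \<in> U" unfolding U_def using K_add(1) D_D(2)[OF \<psi>D N_add(1)] by simp
      fix x assume x: "x \<in> U"
      then show "vsmult f x \<in> U" for f unfolding U_def by (simp add: K_smult vsmult_vsmult)
      fix y assume y: "y \<in> U"
      have "\<psi> (vsmult f (x - y)) = 0" for f
      proof -
        have K: "vsmult f x - vsmult f y \<in> K" "vsmult f y \<in> K"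
          using x y unfolding U_def by (auto intro!: K_add(2) K_smult)
        have "\<psi> ((vsmult f x - vsmult f y) + vsmult f y) = \<psi> (vsmult f x - vsmult f y) + \<psi> (vsmult f y)"
          by (rule D_D(1)[OF \<psi>D K])
        then show ?thesis using x y unfolding U_def diff_add_cancel vsmult_diff by simp
      qed
      then show "x - y \<in> U" using x y K_add(2) unfolding U_def by blast
    qed
    moreover have "S \<subseteq> U" using assms \<psi> unfolding U_def ann_def by blast
    moreover have "N \<subseteq> U" unfolding U_def using N_sub N_smult D_D(2)[OF \<psi>D] by blast
    ultimately have "K \<subseteq> U" using gen unfolding generates_def by blast
    then have "\<psi> (vsmult 1 x) = 0" if "x \<in> K" for x using that unfolding U_def by blast
    then have "\<psi> x = 0" for x using D_D(3)[OF \<psi>D] by (cases "x \<in> K") simp_all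
    then show ?thesis by (simp add: fun_eq_iff)
  qed
  moreover have "0 \<in> ann S" using zero_in_D by (simp add: ann_def)
  ultimately show "ann S = {0}" by blast
next
  assume ann: "ann S = {0}"
  show "generates S"
    unfolding generates_def
  proof (intro allI impI subsetI, elim conjE, rule ccontr)
    fix U x assume U: "submodule_set U" "S \<subseteq> U" "N \<subseteq> U" and x: "x \<in> K" "x \<notin> U"
    have "additive_closed (U \<inter> K)"
      by (intro additive_closed_Int submodule_setD(1) U submodule_K)
    moreover have "N \<subseteq> U \<inter> K" "x \<notin> U \<inter> K" using U(3) N_sub x by blast+
    ultimately have "\<exists>\<psi>\<in>D. (\<forall>y\<in>U \<inter> K. \<psi> y = 0) \<and> \<psi> x \<noteq> 0"
      by (intro D_separates x(1)) simp_all
    then obtain \<psi> where \<psi>: "\<psi> \<in> D" "\<And>y. y \<in> U \<inter> K \<Longrightarrow> \<psi> y = 0" "\<psi> x \<noteq> 0" by blast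
    have "vsmult f y \<in> U \<inter> K" if "y \<in> S" for f y
      using that U(2) assms submodule_setD(2)[OF U(1)] K_smult by blast
    then have "\<psi> \<in> ann S" unfolding ann_def using \<psi>(1,2) by blast
    then show False using ann \<psi>(3) by auto
  qed
qed

text \<open>The ideal \<open>(p, P)\<close> maps \<open>K\<close> into \<open>N\<close>, so the
  action on functionals factors through the residue field. The abstract counting of independent
  lists becomes available for every annihilator.\<close>

lemma finite_space_ann:
  assumes "S \<subseteq> K"
  shows "finite_space dact (ann S) (reduction_ideal P) (poly_reps 1 (Polynomial.degree P))"
proof
  have annD: "\<psi> \<in> D" if "\<psi> \<in> ann S" for \<psi> using that by (simp add: ann_def)
  show "finite (ann S)" unfolding ann_def using finite_D by simp
  show "0 \<in> ann S" using zero_in_D by (simp add: ann_def)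
  show "\<psi> + \<psi>' \<in> ann S" if "\<psi> \<in> ann S" "\<psi>' \<in> ann S" for \<psi> \<psi>'
    using that add_in_D unfolding ann_def by simp
  show "dact f \<psi> \<in> ann S" if \<psi>: "\<psi> \<in> ann S" for f \<psi>
  proof -
    have "dact f \<psi> \<in> D"
      unfolding D_def mem_Collect_eq dact_def
      using K_add(4) K_smult D_D(1)[OF annD[OF \<psi>]] D_D(2)[OF annD[OF \<psi>] N_smult] by (simp add: vsmult_add)
    moreover have "dact f \<psi> (vsmult f' x) = 0" if "x \<in> S" for x f'
    proof -
      have "\<psi> (vsmult (f * f') x) = 0" using \<psi> that unfolding ann_def by blast
      then show ?thesis by (simp add: dact_def vsmult_vsmult)
    qed
    ultimately show ?thesis unfolding ann_def by blast
  qed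
  show "dact f (\<psi> + \<psi>') = dact f \<psi> + dact f \<psi>'" for f \<psi> \<psi>'
    by (rule ext) (simp add: dact_def)
  show "dact (f + f') \<psi> = dact f \<psi> + dact f' \<psi>" if "\<psi> \<in> ann S" for f f' \<psi>
    by (rule ext) (simp add: dact_def vsmult_add_left D_D(1)[OF annD[OF that]] K_smult)
  show "dact (f * f') \<psi> = dact f (dact f' \<psi>)" if "\<psi> \<in> ann S" for f f' \<psi>
    by (rule ext) (simp add: dact_def vsmult_vsmult K_smult mult.commute)
  show "dact 1 \<psi> = \<psi>" if "\<psi> \<in> ann S" for \<psi>
    by (rule ext) (simp add: dact_def D_D(3)[OF annD[OF that]])
  show "dact f \<psi> = 0" if \<psi>: "\<psi> \<in> ann S" and f: "f \<in> reduction_ideal P" for f \<psi>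
  proof
    fix x
    obtain a b where ab: "f = P * a + Polynomial.smult padic_p b" using reduction_ideal_decomp[OF f] by blast
    have "vsmult f x \<in> N" if "x \<in> K"
    proof -
      have "vsmult f x = vsmult (pconst 1) (vsmult b x) + vsmult P (vsmult a x)"
        unfolding ab by (rule ext) (simp add: distrib_right mult.assoc)
      then show ?thesis
        using NI[OF K_smult[OF that] submodule_setD(2)[OF submodule_pvecs subsetD[OF K_sub that]]] by simp
    qed
    then show "dact f \<psi> x = 0 x" using D_D(2)[OF annD[OF \<psi>]] by (simp add: dact_def)
  qed
  show "\<exists>a. a * f - 1 \<in> reduction_ideal P" if "f \<notin> reduction_ideal P" for f
    by (rule reduction_ideal_inverse[OF irred that])
  show "finite (poly_reps 1 (Polynomial.degree P) :: 'p padic_int poly set)" by (rule finite_poly_reps)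
  show "\<exists>s\<in>poly_reps 1 (Polynomial.degree P). f - s \<in> reduction_ideal P" for f
    by (rule poly_reps_reduction_ideal(1)[OF monic])
  show "s = s'" if "s \<in> poly_reps 1 (Polynomial.degree P)" "s' \<in> poly_reps 1 (Polynomial.degree P)"
    "s - s' \<in> reduction_ideal P" for s s'
    by (rule poly_reps_reduction_ideal(2)[OF monic that])
  have "2 ^ 1 \<le> CARD('p) ^ Polynomial.degree P"
    using irreducible_degree_pos[OF irred monic] prime_ge_2_nat[OF prime_card[where 'a = 'p]]
    by (intro order_trans[OF power_mono power_increasing]) auto
  then show "2 \<le> card (poly_reps 1 (Polynomial.degree P) :: 'p padic_int poly set)"
    by (simp add: card_poly_reps)
qed

lemma ann_empty: "ann {} = D"
  by (simp add: ann_def)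

lemma finite_space_D: "finite_space dact D (reduction_ideal P) (poly_reps 1 (Polynomial.degree P))"
  using finite_space_ann[of "{}"] by (simp add: ann_empty)

end

section \<open>The order of the dual of K/N, and functionals vanishing on constants\<close>

lemma padic_p_reps_mult:
  fixes c :: "'p::prime_card padic_int"
  assumes "c \<in> padic_reps M"
  shows "padic_p * c \<in> padic_reps (Suc M)"
proof -
  obtain a where a: "c = of_int a" "0 \<le> a" "a < int CARD('p) ^ M" using assms by (auto simp: padic_reps_def)
  have "padic_p * c = of_int (int CARD('p) * a)" by (simp add: a(1))
  moreover have "int CARD('p) * a < int CARD('p) * int CARD('p) ^ M"
    using a(3) by (intro mult_strict_left_mono) auto
  then have "int CARD('p) * a \<in> {0..<int CARD('p) ^ Suc M}" using a(2) by simp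
  ultimately show ?thesis unfolding padic_reps_def by (rule image_eqI)
qed

lemma vsmult_p_reps:
  fixes y :: "'p::prime_card pvec"
  assumes "y \<in> pvec_reps n M d"
  shows "vsmult (pconst 1) y \<in> pvec_reps n (Suc M) d"
proof (rule pvec_repsI)
  show "vsmult (pconst 1) y \<in> pvecs n"
    by (rule submodule_setD(2)[OF submodule_pvecs subsetD[OF pvec_reps_sub(1) assms]])
  fix i assume "i < n"
  then have "y i \<in> poly_reps M d" using assms by (simp add: pvec_reps_def PiE_dflt_def)
  then have "Polynomial.coeff (y i) k \<in> padic_reps M" "d \<le> k \<Longrightarrow> Polynomial.coeff (y i) k = 0" for k
    unfolding poly_reps_def by blast+
  then show "vsmult (pconst 1) y i \<in> poly_reps (Suc M) d"
    unfolding poly_reps_def by (auto intro: padic_p_reps_mult)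
qed

text \<open>Reduction modulo \<open>p\<close> has fibres of equal size on the representatives modulo
  \<open>p^M\<close>, and its image has \<open>p ^ (d * n)\<close> elements.\<close>

lemma card_pvec_reps_divisible:
  "card {x \<in> pvec_reps n M d. x \<in> (pvec_multiples n 1 d :: 'p::prime_card pvec set)} * CARD('p) ^ (d * n)
    = card (pvec_reps n M d :: 'p pvec set)" if M: "1 \<le> M"
proof -
  interpret c: coset_reps "pvecs n \<inter> below_degree d" "pvec_multiples n M d" "pvec_reps n M d" "pvec_red M :: 'p pvec \<Rightarrow> 'p pvec"
    by (rule coset_reps_below_degree)
  interpret r: coset_reps "pvecs n \<inter> below_degree d" "pvec_multiples n 1 d" "pvec_reps n 1 d" "pvec_red 1 :: 'p pvec \<Rightarrow> 'p pvec"
    by (rule coset_reps_below_degree)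
  let ?L = "pvecs n \<inter> below_degree d :: 'p pvec set"
  note Z = additive_closedD[OF r.Z(1)]
  have iff: "pvec_red 1 x = pvec_red 1 y \<longleftrightarrow> x - y \<in> pvec_multiples n 1 d" if "x \<in> ?L" "y \<in> ?L" for x y
  proof
    assume eq: "pvec_red 1 x = pvec_red 1 y"
    have "(x - pvec_red 1 x) - (y - pvec_red 1 y) \<in> pvec_multiples n 1 d"
      by (rule Z(2)[OF r.rd(2)[OF that(1)] r.rd(2)[OF that(2)]])
    moreover have "(x - pvec_red 1 x) - (y - pvec_red 1 y) = x - y" unfolding eq by (rule ext) simp
    ultimately show "x - y \<in> pvec_multiples n 1 d" by simp
  next
    assume xy: "x - y \<in> pvec_multiples n 1 d"
    have "(x - y) - ((x - pvec_red 1 x) - (y - pvec_red 1 y)) \<in> pvec_multiples n 1 d"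
      by (rule Z(2)[OF xy Z(2)[OF r.rd(2)[OF that(1)] r.rd(2)[OF that(2)]]])
    moreover have "(x - y) - ((x - pvec_red 1 x) - (y - pvec_red 1 y)) = pvec_red 1 x - pvec_red 1 y"
      by (rule ext) simp
    ultimately show "pvec_red 1 x = pvec_red 1 y"
      by (intro r.X_unique r.rd(1) that) simp
  qed
  have "pvec_red 1 ` ?L = (pvec_reps n 1 d :: 'p pvec set)"
  proof
    show "pvec_red 1 ` ?L \<subseteq> pvec_reps n 1 d" using r.rd(1) by blast
    show "pvec_reps n 1 d \<subseteq> pvec_red 1 ` ?L"
    proof
      fix x :: "'p pvec" assume x: "x \<in> pvec_reps n 1 d"
      then have xL: "x \<in> ?L" using r.X_subset by blast
      have "x = pvec_red 1 x" by (rule r.X_unique[OF x r.rd(1)[OF xL] r.rd(2)[OF xL]])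
      then show "x \<in> pvec_red 1 ` ?L" using xL by (rule image_eqI)
    qed
  qed
  then have im: "card (pvec_red 1 ` ?L) = CARD('p) ^ (d * n)" by (simp add: card_pvec_reps)
  have sub: "pvec_multiples n M d \<subseteq> (pvec_multiples n 1 d :: 'p pvec set)"
  proof
    fix x :: "'p pvec" assume "x \<in> pvec_multiples n M d"
    then obtain z where z: "x = vsmult (pconst M) z" "z \<in> ?L" unfolding pvec_multiples_def by blast
    obtain k where "M = 1 + k" using le_Suc_ex[OF M] by blast
    then have "x = vsmult (pconst 1) (vsmult (pconst k) z)"
      unfolding z(1) vsmult_vsmult by (simp only: pconst_add)
    moreover have "vsmult (pconst k) z \<in> ?L"
      using z(2) submodule_setD(2)[OF submodule_pvecs, of z n "pconst k"] by (simp add: below_degree_def)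
    ultimately show "x \<in> pvec_multiples n 1 d" unfolding pvec_multiples_def by blast
  qed
  have 0: "pvec_red 1 (0 :: 'p pvec) = 0" by (rule ext) (simp add: pvec_red_def poly_red_def)
  have 0: "(0 :: 'p pvec) \<in> pvec_red 1 ` ?L"
    using additive_closedD(1)[OF c.L] by (intro image_eqI[of _ _ 0]) (simp_all only: 0)
  have "card {x \<in> pvec_reps n M d. pvec_red 1 x = (0 :: 'p pvec)} * card (pvec_red 1 ` ?L) = card (pvec_reps n M d :: 'p pvec set)"
    by (rule c.card_fibre[OF r.Z(1) sub iff 0])
  moreover have "pvec_red 1 x = 0 \<longleftrightarrow> x \<in> pvec_multiples n 1 d" if "x \<in> pvec_reps n M d" for x :: "'p pvec"
    using iff[of x 0] that c.X_subset additive_closedD(1)[OF c.L] \<open>pvec_red 1 (0 :: 'p pvec) = 0\<close>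
    by (metis diff_zero subsetD)
  then have "{x \<in> pvec_reps n M d. pvec_red 1 x = (0 :: 'p pvec)} = {x \<in> pvec_reps n M d. x \<in> pvec_multiples n 1 d}"
    by blast
  ultimately show ?thesis unfolding im by simp
qed

text \<open>Surjectivity is asked of the constant vectors, the members of
  \<open>below_degree 1\<close>, because their classes exhaust a cokernel.\<close>

locale surj_presentation = presentation H act P e n g
  for H :: "('h, 'm) ring_scheme" (structure) and act :: "'p::prime_card padic_int poly \<Rightarrow> 'h \<Rightarrow> 'h"
    and P :: "'p padic_int poly" and e n :: nat and g :: "nat \<Rightarrow> 'h" +
  assumes surj: "h \<in> carrier H \<Longrightarrow> \<exists>x\<in>pvecs n \<inter> below_degree 1. lmap x = h"
begin

text \<open>\<open>K\<close> is a fibre of \<open>lmap\<close>, and the fibres over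
  \<open>carrier H\<close> are equally large.\<close>

lemma card_K_reps:
  assumes "reps_modulus n M \<subseteq> K"
  shows "card {x \<in> pvec_reps n M (Polynomial.degree P). lmap x = \<zero>} * card (carrier H)
    = CARD('p) ^ (M * Polynomial.degree P * n)"
proof -
  obtain rd where "coset_reps (pvecs n :: 'p pvec set) (reps_modulus n M) (pvec_reps n M (Polynomial.degree P)) rd"
    using coset_reps_modulus by blast
  then interpret c: coset_reps "pvecs n :: 'p pvec set" "reps_modulus n M" "pvec_reps n M (Polynomial.degree P)" rd .
  have im: "lmap ` pvecs n = carrier H"
    using surj lmap_closed by (auto simp: image_iff)
  have "lmap x = lmap y \<longleftrightarrow> x - y \<in> K" if "x \<in> pvecs n" "y \<in> pvecs n" for x y
    using lmap_eq_iff[of x y] additive_closedD(2)[OF additive_closed_pvecs that] by (simp add: K_def)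
  from c.card_fibre[OF submodule_setD(1)[OF submodule_K] assms this, of \<zero>]
  show ?thesis by (simp add: im card_pvec_reps)
qed

text \<open>Multiplication by \<open>p\<close> is a bijection between the two sets, since in degrees
  below \<open>degree P\<close> the elements of \<open>N\<close> are exactly \<open>p\<close> times
  elements of \<open>K\<close>.\<close>

lemma card_N_reps:
  "card {x \<in> pvec_reps n (Suc e) (Polynomial.degree P). x \<in> N}
    = card {x \<in> pvec_reps n e (Polynomial.degree P). lmap x = \<zero>}"
proof -
  let ?d = "Polynomial.degree P"
  have "bij_betw (vsmult (pconst 1)) {x \<in> pvec_reps n e ?d. lmap x = \<zero>} {x \<in> pvec_reps n (Suc e) ?d. x \<in> N}"
  proof (rule bij_betw_imageI)
    show "inj_on (vsmult (pconst 1)) {x \<in> pvec_reps n e ?d. lmap x = \<zero>}"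
      by (rule inj_onI) (rule vsmult_pconst_cancel)
    show "vsmult (pconst 1) ` {x \<in> pvec_reps n e ?d. lmap x = \<zero>} = {x \<in> pvec_reps n (Suc e) ?d. x \<in> N}"
    proof (intro equalityI subsetI)
      fix u assume "u \<in> vsmult (pconst 1) ` {x \<in> pvec_reps n e ?d. lmap x = \<zero>}"
      then obtain x where x: "u = vsmult (pconst 1) x" "x \<in> pvec_reps n e ?d" "lmap x = \<zero>" by blast
      then have "x \<in> K" using pvec_reps_sub(1) unfolding K_def by blast
      then show "u \<in> {x \<in> pvec_reps n (Suc e) ?d. x \<in> N}"
        unfolding x(1) using pK_in_N vsmult_p_reps[OF x(2)] by blast
    next
      fix u assume "u \<in> {x \<in> pvec_reps n (Suc e) ?d. x \<in> N}"
      then have u: "u \<in> pvec_reps n (Suc e) ?d" "u \<in> N" by auto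
      obtain y where y: "y \<in> K" "y \<in> below_degree ?d" "u = vsmult (pconst 1) y"
        using N_below_degree[OF u(2) subsetD[OF pvec_reps_sub(2) u(1)]] by blast
      have yL: "y \<in> pvecs n" using y(1) K_sub by blast
      let ?y = "pvec_red e y"
      obtain z where z: "z \<in> pvecs n" "y - ?y = vsmult (pconst e) z"
        using pvec_red_diff[OF yL y(2), of e] by blast
      have yr: "?y \<in> pvec_reps n e ?d" by (rule pvec_red_in_reps[OF yL y(2)])
      have "u - vsmult (pconst 1) ?y = vsmult (pconst 1) (vsmult (pconst e) z)"
        unfolding y(3) z(2)[symmetric] vsmult_diff ..
      also have "\<dots> = vsmult (pconst (Suc e)) z"
        by (simp only: vsmult_vsmult pconst_add[symmetric]) simp
      finally have eq: "u = vsmult (pconst 1) ?y"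
        by (rule pvec_reps_unique[OF u(1) vsmult_p_reps[OF yr]])
      have "?y = y - vsmult (pconst e) z" unfolding z(2)[symmetric] by (rule ext) simp
      then have "?y \<in> K" using K_add(2)[OF y(1) p_power_in_K[OF z(1)]] by simp
      then show "u \<in> vsmult (pconst 1) ` {x \<in> pvec_reps n e ?d. lmap x = \<zero>}"
        using yr eq unfolding K_def by blast
    qed
  qed
  then show ?thesis by (rule bij_betw_same_card[symmetric])
qed

text \<open>By orthogonality \<open>D\<close> has the order of \<open>K/N\<close>. With
  \<open>q = p ^ degree P\<close>, the representatives modulo \<open>p^(e+1)\<close> include
  \<open>q^((e+1)n) / |H|\<close> elements of \<open>K\<close> and \<open>q^(e n) / |H|\<close> of
  \<open>N\<close>; the order of \<open>H\<close> cancels, so the dimension is \<open>n\<close> for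
  every module.\<close>

lemma card_D: "card D = (CARD('p) ^ Polynomial.degree P) ^ n"
proof -
  let ?d = "Polynomial.degree P"
  let ?X = "pvec_reps n (Suc e) ?d :: 'p pvec set"
  obtain rd where "coset_reps (pvecs n :: 'p pvec set) (reps_modulus n (Suc e)) ?X rd"
    using coset_reps_modulus by blast
  then interpret c: coset_reps "pvecs n :: 'p pvec set" "reps_modulus n (Suc e)" ?X rd .
  \<comment> \<open>The form \<open>0 - x\<close> matches the character sum over a coset, here with
    base point 0.\<close>
  define S where "S = {x \<in> ?X. 0 - x \<in> K}"
  have fS: "finite S" unfolding S_def by (rule finite_subset[OF _ finite_pvec_reps]) blast
  have S1: "S = {x \<in> ?X. lmap x = \<zero>}"
    unfolding S_def additive_closed_neg_iff[OF submodule_setD(1)[OF submodule_K]] using pvec_reps_sub(1) unfolding K_def by blast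
  have S2: "{x \<in> S. 0 - x \<in> N} = {x \<in> ?X. x \<in> N}"
    unfolding S_def additive_closed_neg_iff[OF submodule_setD(1)[OF submodule_K]] additive_closed_neg_iff[OF submodule_setD(1)[OF submodule_N]]
    using N_sub by blast
  have "card {\<psi> \<in> D. \<psi> = 0} * card S = card {x \<in> S. 0 - x \<in> N} * card D"
  proof (rule root_of_unity_double_count[OF fS finite_D])
    fix \<psi> assume \<psi>: "\<psi> \<in> D"
    show "(\<Sum>x\<in>S. root_of_unity (\<psi> (0 - x))) = (if \<psi> = 0 then of_nat (card S) else 0)"
    proof (cases "\<psi> = 0")
      case False
      then obtain b where b: "\<psi> b \<noteq> 0" by (auto simp: fun_eq_iff)
      then have bK: "b \<in> K" using D_D(3)[OF \<psi>] by blast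
      have "(\<Sum>x\<in>S. root_of_unity (\<psi> (0 - x))) = 0"
        unfolding S_def
      proof (rule c.sum_character_eq_0[where K = K and b = b])
        show "additive_closed K" by (rule submodule_setD(1)[OF submodule_K])
        show "reps_modulus n (Suc e) \<subseteq> K" using modulus_sub_N N_sub by blast
        show "0 \<in> pvecs n" by (rule additive_closedD(1)[OF additive_closed_pvecs])
        show "\<psi> z = 0" if "z \<in> reps_modulus n (Suc e)" for z
          using D_D(2)[OF \<psi>] modulus_sub_N that by blast
      qed (rule K_sub bK b D_D(1)[OF \<psi>]; assumption?)+
      then show ?thesis using False by simp
    qed simp
  next
    fix x assume "x \<in> S"
    then show "(\<Sum>\<psi>\<in>D. root_of_unity (\<psi> (0 - x))) = (if 0 - x \<in> N then of_nat (card D) else 0)"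
      unfolding S_def by (intro sum_over_D) blast
  qed
  moreover have "{\<psi> \<in> D. \<psi> = 0} = {0}" using zero_in_D by blast
  ultimately have "card S = card {x \<in> ?X. x \<in> N} * card D" unfolding S2 by simp
  then have "card S * card (carrier H)
      = (card {x \<in> pvec_reps n e ?d. lmap x = \<zero>} * card (carrier H)) * card D"
    unfolding card_N_reps by simp
  moreover have "card S * card (carrier H) = CARD('p) ^ (Suc e * ?d * n)"
    unfolding S1 using modulus_sub_N N_sub by (intro card_K_reps) blast
  ultimately have "CARD('p) ^ (Suc e * ?d * n) = CARD('p) ^ (e * ?d * n) * card D"
    unfolding card_K_reps[OF modulus_sub_K] by simp
  moreover have "CARD('p) ^ (Suc e * ?d * n) = CARD('p) ^ (e * ?d * n) * CARD('p) ^ (?d * n)"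
    by (simp add: power_add[symmetric] algebra_simps)
  ultimately show ?thesis by (simp add: power_mult)
qed

text \<open>By orthogonality the functionals vanishing on \<open>B\<close> make up the share
  \<open>|B \<inter> N| / |B|\<close> of \<open>D\<close>, counted modulo \<open>p^(e+1)\<close>.
  Constants lying in \<open>N\<close> are multiples of \<open>p\<close>, and these are only a
  fraction \<open>p^-n\<close> of all constants.\<close>

lemma kernel_bound:
  assumes B: "additive_closed B" "B \<subseteq> K" "B \<subseteq> below_degree 1" "pvec_multiples n (Suc e) 1 \<subseteq> B"
  shows "card {\<psi> \<in> D. \<forall>b\<in>B. \<psi> b = 0} * card {x \<in> pvec_reps n (Suc e) 1. x \<in> B} * CARD('p) ^ n
    \<le> card D * CARD('p) ^ (Suc e * n)"
proof -
  let ?X = "pvec_reps n (Suc e) 1 :: 'p pvec set"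
  interpret c: coset_reps "pvecs n \<inter> below_degree 1 :: 'p pvec set" "pvec_multiples n (Suc e) 1" ?X "pvec_red (Suc e)"
    by (rule coset_reps_below_degree)
  define S where "S = {x \<in> ?X. 0 - x \<in> B}"
  have fS: "finite S" unfolding S_def by (rule finite_subset[OF _ finite_pvec_reps]) blast
  have S: "S = {x \<in> ?X. x \<in> B}" unfolding S_def additive_closed_neg_iff[OF B(1)] ..
  have "card {\<psi> \<in> D. \<forall>b\<in>B. \<psi> b = 0} * card S = card {x \<in> S. 0 - x \<in> N} * card D"
  proof (rule root_of_unity_double_count[OF fS finite_D])
    fix \<psi> assume \<psi>: "\<psi> \<in> D"
    show "(\<Sum>x\<in>S. root_of_unity (\<psi> (0 - x))) = (if \<forall>b\<in>B. \<psi> b = 0 then of_nat (card S) else 0)"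
    proof (cases "\<forall>b\<in>B. \<psi> b = 0")
      case True
      then have "(\<Sum>x\<in>S. root_of_unity (\<psi> (0 - x))) = (\<Sum>x\<in>S. 1)"
        unfolding S_def by (intro sum.cong refl) simp
      then show ?thesis using True by simp
    next
      case False
      then obtain b where b: "b \<in> B" "\<psi> b \<noteq> 0" by blast
      have "(\<Sum>x\<in>S. root_of_unity (\<psi> (0 - x))) = 0"
        unfolding S_def
      proof (rule c.sum_character_eq_0[where K = B and b = b])
        show "B \<subseteq> pvecs n \<inter> below_degree 1" using B(2,3) K_sub by blast
        show "(0 :: 'p pvec) \<in> pvecs n \<inter> below_degree 1" by (rule additive_closedD(1)[OF c.L])
        show "\<psi> (x + y) = \<psi> x + \<psi> y" if "x \<in> B" "y \<in> B" for x y
          using that B(2) D_D(1)[OF \<psi>] by blast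
        show "\<psi> z = 0" if "z \<in> pvec_multiples n (Suc e) 1" for z
          using that unfolding pvec_multiples_def using p_power_in_N D_D(2)[OF \<psi>] by blast
      qed (rule B b)+
      then show ?thesis unfolding if_not_P[OF False] .
    qed
  next
    fix x assume "x \<in> S"
    then show "(\<Sum>\<psi>\<in>D. root_of_unity (\<psi> (0 - x))) = (if 0 - x \<in> N then of_nat (card D) else 0)"
      unfolding S_def using B(2) by (intro sum_over_D) blast
  qed
  moreover have "card {x \<in> S. 0 - x \<in> N} \<le> card {x \<in> ?X. x \<in> pvec_multiples n 1 1}"
  proof (rule card_mono)
    show "finite {x \<in> ?X. x \<in> pvec_multiples n 1 1}"
      by (rule finite_subset[OF _ finite_pvec_reps]) blast
    show "{x \<in> S. 0 - x \<in> N} \<subseteq> {x \<in> ?X. x \<in> pvec_multiples n 1 1}"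
    proof
      fix x assume "x \<in> {x \<in> S. 0 - x \<in> N}"
      then have x: "x \<in> ?X" "x \<in> N" unfolding S additive_closed_neg_iff[OF submodule_setD(1)[OF submodule_N]] by blast+
      have x1: "x \<in> pvecs n" "x \<in> below_degree 1" using x(1) pvec_reps_sub by blast+
      \<comment> \<open>Irreducibility makes \<open>degree P\<close> positive, so constants fall
        under the description of the low-degree elements of \<open>N\<close>.\<close>
      have "below_degree 1 \<subseteq> (below_degree (Polynomial.degree P) :: 'p pvec set)"
        using irreducible_degree_pos[OF irred monic] by (intro below_degree_mono) simp
      then obtain y where y: "x = vsmult (pconst 1) y" using N_below_degree[OF x(2)] x1(2) by blast
      show "x \<in> {x \<in> ?X. x \<in> pvec_multiples n 1 1}"
        using below_degree_divisible[OF x1 y] x(1) unfolding pvec_multiples_def by blast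
    qed
  qed
  ultimately have "card {\<psi> \<in> D. \<forall>b\<in>B. \<psi> b = 0} * card S \<le> card {x \<in> ?X. x \<in> pvec_multiples n 1 1} * card D"
    by simp
  then have "card {\<psi> \<in> D. \<forall>b\<in>B. \<psi> b = 0} * card S * CARD('p) ^ (1 * n)
      \<le> card {x \<in> ?X. x \<in> pvec_multiples n 1 1} * card D * CARD('p) ^ (1 * n)"
    by (rule mult_right_mono) simp
  also have "\<dots> = (card {x \<in> ?X. x \<in> pvec_multiples n 1 1} * CARD('p) ^ (1 * n)) * card D"
    by (simp only: mult_ac)
  finally show ?thesis
    unfolding card_pvec_reps_divisible[of "Suc e" n 1, OF le_add1[of 1 e, unfolded plus_1_eq_Suc]] S
    by (simp add: card_pvec_reps mult.commute)
qed

end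

section \<open>Constant vectors and the columns of t - A\<close>

definition unit_vec_X :: "nat \<Rightarrow> 'p::prime_card pvec" where
  "unit_vec_X m = (\<lambda>i. if i = m then [:0, 1:] else 0)"

definition const_vecs :: "nat \<Rightarrow> 'p::prime_card pvec set" where
  "const_vecs n = pvecs n \<inter> below_degree 1"

lemma unit_vec_X_in: "m < n \<Longrightarrow> unit_vec_X m \<in> pvecs n"
  by (simp add: unit_vec_X_def pvecs_def)

lemma additive_closed_const_vecs: "additive_closed (const_vecs n)"
  unfolding const_vecs_def
  by (intro additive_closed_Int additive_closed_pvecs additive_closed_below_degree)

lemma const_vecs_const:
  assumes "x \<in> const_vecs n"
  shows "\<exists>a. x = (\<lambda>i. [:a i:])"
proof
  show "x = (\<lambda>i. [:Polynomial.coeff (x i) 0:])"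
  proof
    fix i
    have "Polynomial.coeff (x i) k = 0" if "1 \<le> k" for k
      using assms that unfolding const_vecs_def below_degree_def by blast
    then show "x i = [:Polynomial.coeff (x i) 0:]"
      by (intro poly_eqI) (auto simp: coeff_pCons split: nat.splits)
  qed
qed

lemma const_vecs_smult:
  "x \<in> const_vecs n \<Longrightarrow> vsmult [:c:] x \<in> const_vecs n"
  using submodule_setD(2)[OF submodule_pvecs, of x n "[:c:]"]
  by (simp add: const_vecs_def below_degree_def)

lemma sum_closed:
  fixes f :: "'i \<Rightarrow> 'b::comm_monoid_add"
  assumes "0 \<in> S" "\<And>x y. x \<in> S \<Longrightarrow> y \<in> S \<Longrightarrow> x + y \<in> S" "\<And>i. i \<in> I \<Longrightarrow> f i \<in> S"
  shows "(\<Sum>i\<in>I. f i) \<in> S"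
  using assms(3) by (induction I rule: infinite_finite_induct) (simp_all add: assms(1,2))

lemma fun_sum_apply: "(\<Sum>i\<in>I. f i) x = (\<Sum>i\<in>I. f i x)" for f :: "'i \<Rightarrow> 'a \<Rightarrow> 'b::comm_monoid_add"
  by (induction I rule: infinite_finite_induct) simp_all

text \<open>Modulo the columns of \<open>t - A\<close>, the indeterminate acts as \<open>A\<close>, so every vector becomes constant.\<close>

lemma const_vecs_modulo_columns:
  fixes a :: "nat \<Rightarrow> 'p::prime_card pvec"
  assumes a: "\<And>m. m < n \<Longrightarrow> a m \<in> const_vecs n"
    and U: "submodule_set U" "\<And>m. m < n \<Longrightarrow> unit_vec_X m - a m \<in> U"
    and x: "x \<in> pvecs n"
  shows "\<exists>v\<in>const_vecs n. x - v \<in> U"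
proof -
  note Ua = additive_closedD[OF submodule_setD(1)[OF U(1)]]
  note Ca = additive_closedD[OF additive_closed_const_vecs[of n, where 'a = 'p]]
  \<comment> \<open>It suffices that \<open>W\<close> contains the constants and is closed under
    addition and multiplication by \<open>t\<close>.\<close>
  define W where "W = {x :: 'p pvec. \<exists>v\<in>const_vecs n. x - v \<in> U}"
  have W_add: "x + y \<in> W" if xy: "x \<in> W" "y \<in> W" for x y
  proof -
    obtain v w where vw: "v \<in> const_vecs n" "x - v \<in> U" "w \<in> const_vecs n" "y - w \<in> U"
      using xy unfolding W_def by blast
    have "x + y - (v + w) \<in> U" using Ua(4)[OF vw(2,4)] by (simp only: add_diff_add)
    then show ?thesis unfolding W_def using Ca(4)[OF vw(1,3)] by blast
  qed
  have const_W: "v \<in> W" if v: "v \<in> const_vecs n" for v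
    unfolding W_def using v Ua(1) by (auto intro!: bexI[OF _ v])
  have X_W: "vsmult [:0, 1:] x \<in> W" if x: "x \<in> W" for x
  proof -
    obtain v where v: "v \<in> const_vecs n" "x - v \<in> U" using x unfolding W_def by blast
    obtain c where c: "v = (\<lambda>i. [:c i:])" using const_vecs_const[OF v(1)] by blast
    have c0: "c i = 0" if "n \<le> i" for i
    proof -
      have "v i = 0" using v(1) that by (auto simp: const_vecs_def pvecs_def)
      then show ?thesis by (simp add: c)
    qed
    \<comment> \<open>\<open>w\<close> is \<open>A v\<close>: every \<open>t e_m\<close> is replaced
      by the column \<open>a m\<close>.\<close>
    define w where "w = (\<Sum>m<n. vsmult [:c m:] (a m))"
    have wC: "w \<in> const_vecs n"
      unfolding w_def by (rule sum_closed[OF Ca(1) Ca(4)]) (simp_all only: const_vecs_smult a lessThan_iff)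
    have "vsmult [:0, 1:] v - w = (\<Sum>m<n. vsmult [:c m:] (unit_vec_X m - a m))"
    proof
      fix i
      have "(\<Sum>m<n. [:c m:] * (unit_vec_X m i - a m i)) = (\<Sum>m<n. [:c m:] * unit_vec_X m i) - (\<Sum>m<n. [:c m:] * a m i)"
        by (simp only: right_diff_distrib sum_subtractf)
      moreover have "(\<Sum>m<n. [:c m:] * unit_vec_X m i) = [:0, 1:] * [:c i:]"
      proof -
        have "(\<Sum>m<n. [:c m:] * unit_vec_X m i) = (\<Sum>m<n. if m = i then [:c i:] * [:0, 1:] else 0)"
          by (intro sum.cong refl) (auto simp: unit_vec_X_def)
        also have "\<dots> = [:0, 1:] * [:c i:]" using c0[of i] by (cases "i < n") auto
        finally show ?thesis .
      qed
      ultimately show "(vsmult [:0, 1:] v - w) i = (\<Sum>m<n. vsmult [:c m:] (unit_vec_X m - a m)) i"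
        unfolding w_def by (simp only: fun_sum_apply minus_apply vsmult_apply c)
    qed
    also have "\<dots> \<in> U" 
      by (rule sum_closed[OF Ua(1) Ua(4)]) (simp_all only: submodule_setD(2)[OF U(1)] U(2) lessThan_iff)
    finally have vw: "vsmult [:0, 1:] v - w \<in> U" .
    have "vsmult [:0, 1:] (x - v) + (vsmult [:0, 1:] v - w) \<in> U"
      by (rule Ua(4)[OF submodule_setD(2)[OF U(1) v(2)] vw])
    also have "vsmult [:0, 1:] (x - v) + (vsmult [:0, 1:] v - w) = vsmult [:0, 1:] x - w"
      unfolding vsmult_diff by (rule ext) simp
    finally show ?thesis unfolding W_def using wC by blast
  qed
  have poly_W: "vsmult f v \<in> W" if v: "v \<in> const_vecs n" for f v
  proof (induction f)
    case 0
    show ?case unfolding vsmult_zero by (rule const_W[OF Ca(1)])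
  next
    case (pCons b f)
    have "vsmult (pCons b f) v = vsmult [:b:] v + vsmult [:0, 1:] (vsmult f v)"
    proof
      fix i
      have "pCons b f = [:b:] + [:0, 1:] * f" by simp
      then show "vsmult (pCons b f) v i = (vsmult [:b:] v + vsmult [:0, 1:] (vsmult f v)) i"
        by (simp only: vsmult_apply plus_fun_apply distrib_right mult.assoc)
    qed
    then show ?case using W_add[OF const_W[OF const_vecs_smult[OF v]] X_W[OF pCons.IH]] by (simp only:)
  qed
  define E where "E m = (\<lambda>i. if i = m then 1 else 0 :: 'p padic_int poly)" for m :: nat
  have EC: "E m \<in> const_vecs n" if "m < n" for m
    using that by (auto simp: E_def const_vecs_def pvecs_def below_degree_def)
  have "x = (\<Sum>m<n. vsmult (x m) (E m))"
  proof
    fix i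
    have "(\<Sum>m<n. x m * E m i) = (\<Sum>m<n. if m = i then x i else 0)"
      by (intro sum.cong refl) (auto simp: E_def)
    also have "\<dots> = x i" using x by (cases "i < n") (auto simp: pvecs_def)
    finally show "x i = (\<Sum>m<n. vsmult (x m) (E m)) i" by (simp only: fun_sum_apply vsmult_apply)
  qed
  also have "\<dots> \<in> W"
    by (rule sum_closed[OF const_W[OF Ca(1)] W_add]) (simp_all only: poly_W EC lessThan_iff)
  finally show ?thesis unfolding W_def by blast
qed

section \<open>Counting columns\<close>

text \<open>One exponent \<open>e\<close> serves all modules, so a single modulus
  \<open>p^(e+1)\<close> does for the matrices. A single constant vector has to reach prescribed
  elements in all \<open>H j\<close> at once; this makes the choices for a column one coset of
  \<open>B\<close>.\<close>

locale joint_presentation =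
  fixes J :: "nat set" and H :: "nat \<Rightarrow> ('h, 'm) ring_scheme"
    and act :: "nat \<Rightarrow> 'p::prime_card padic_int poly \<Rightarrow> 'h \<Rightarrow> 'h"
    and P :: "nat \<Rightarrow> 'p padic_int poly" and e n :: nat and g :: "nat \<Rightarrow> nat \<Rightarrow> 'h"
  assumes finite_J: "finite J"
    and pres: "j \<in> J \<Longrightarrow> presentation (H j) (act j) (P j) e n (g j)"
    and inj_P: "inj_on (\<lambda>j. reduce_poly (P j)) J"
    and joint_surj: "h \<in> (\<Pi>\<^sub>E j\<in>J. carrier (H j)) \<Longrightarrow>
      \<exists>v\<in>const_vecs n. \<forall>j\<in>J. presentation.lmap (H j) (act j) n (g j) v = h j"
begin

abbreviation "lm j \<equiv> presentation.lmap (H j) (act j) n (g j)"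
abbreviation "K j \<equiv> presentation.K (H j) (act j) n (g j)"
abbreviation "N j \<equiv> presentation.N (H j) (act j) (P j) n (g j)"
abbreviation "D j \<equiv> presentation.D (H j) (act j) (P j) n (g j)"
abbreviation "dact j \<equiv> presentation.dact (H j) (act j) n (g j)"
abbreviation "ann j \<equiv> presentation.ann (H j) (act j) (P j) n (g j)"
abbreviation "I j \<equiv> reduction_ideal (P j)"
abbreviation "T j \<equiv> poly_reps 1 (Polynomial.degree (P j)) :: 'p padic_int poly set"
abbreviation "X \<equiv> pvec_reps n (Suc e) 1 :: 'p pvec set"

text \<open>The kernel of the map from the constants to the product of the
  \<open>H j\<close>.\<close>

definition B :: "'p pvec set" where
  "B = {v \<in> const_vecs n. \<forall>j\<in>J. v \<in> K j}"

definition order_H :: nat where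
  "order_H = (\<Prod>j\<in>J. card (carrier (H j)))"

text \<open>For \<open>y = unit_vec_X m\<close> these are the candidates modulo
  \<open>p^(e+1)\<close> for column \<open>m\<close> of \<open>A\<close> such that column
  \<open>m\<close> of \<open>t - A\<close> lies in all kernels.\<close>

definition colset :: "'p pvec \<Rightarrow> 'p pvec set" where
  "colset y = {a \<in> X. \<forall>j\<in>J. y - a \<in> K j}"

lemma quot_mod: "j \<in> J \<Longrightarrow> quot_module (H j) (act j) (P j) e"
  using pres by (simp add: presentation_def)

lemmas pK = presentation.submodule_K[OF pres]
  and pK_add = presentation.K_add[OF pres]
  and pN_sub = presentation.N_sub[OF pres]
  and pK_sub = presentation.K_sub[OF pres]

lemma card_H_pos: "j \<in> J \<Longrightarrow> 0 < card (carrier (H j))"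
proof -
  assume "j \<in> J"
  then interpret p: presentation "H j" "act j" "P j" e n "g j" by (rule pres)
  show ?thesis using p.finite_H p.zero_closed by (auto simp: card_gt_0_iff)
qed

lemma order_H_pos: "0 < order_H"
  unfolding order_H_def using card_H_pos by (intro prod_pos) auto

lemma surj_pres:
  assumes j: "j \<in> J"
  shows "surj_presentation (H j) (act j) (P j) e n (g j)"
proof -
  interpret p: presentation "H j" "act j" "P j" e n "g j" by (rule pres[OF j])
  show ?thesis
  proof
    fix h assume h: "h \<in> carrier (H j)"
    let ?h = "\<lambda>k\<in>J. if k = j then h else \<zero>\<^bsub>H k\<^esub>"
    have z: "\<zero>\<^bsub>H k\<^esub> \<in> carrier (H k)" if "k \<in> J" for k
    proof -
      interpret k: presentation "H k" "act k" "P k" e n "g k" by (rule pres[OF that])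
      show ?thesis by (rule k.zero_closed)
    qed
    have "?h \<in> (\<Pi>\<^sub>E j\<in>J. carrier (H j))" using h z by auto
    from joint_surj[OF this] obtain v where v: "v \<in> const_vecs n" "\<forall>k\<in>J. lm k v = ?h k" by blast
    have "p.lmap v = h" using bspec[OF v(2) j] j by simp
    then show "\<exists>x\<in>pvecs n \<inter> below_degree 1. p.lmap x = h"
      using v(1) unfolding const_vecs_def by blast
  qed
qed

lemma additive_B: "additive_closed B"
proof -
  have "B = const_vecs n \<inter> {v. \<forall>j\<in>J. v \<in> K j}" by (auto simp: B_def)
  moreover have "additive_closed {v. \<forall>j\<in>J. v \<in> K j}"
    using pK_add(1,2) by (auto simp: additive_closed_def)
  ultimately show ?thesis using additive_closed_Int[OF additive_closed_const_vecs] by simp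
qed

lemma multiples_sub_B: "pvec_multiples n (Suc e) 1 \<subseteq> B"
proof
  fix x :: "'p pvec" assume "x \<in> pvec_multiples n (Suc e) 1"
  then obtain z where z: "x = vsmult (pconst (Suc e)) z" "z \<in> const_vecs n"
    unfolding pvec_multiples_def const_vecs_def by blast
  have "x \<in> const_vecs n" unfolding z(1) by (rule const_vecs_smult[OF z(2)])
  moreover have "x \<in> K j" if "j \<in> J" for j
    using presentation.p_power_in_N[OF pres[OF that], of z] pN_sub[OF that] z
    unfolding const_vecs_def by blast
  ultimately show "x \<in> B" unfolding B_def by blast
qed

text \<open>Joint surjectivity provides a constant with the same image in the product.\<close>

lemma const_lift:
  assumes "y \<in> pvecs n"
  shows "\<exists>a0\<in>const_vecs n. \<forall>j\<in>J. y - a0 \<in> K j"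
proof -
  have "(\<lambda>j\<in>J. lm j y) \<in> (\<Pi>\<^sub>E j\<in>J. carrier (H j))" using presentation.lmap_closed[OF pres] by auto
  from joint_surj[OF this] obtain v where v: "v \<in> const_vecs n" "\<And>j. j \<in> J \<Longrightarrow> lm j v = lm j y" by auto
  have "y - v \<in> K j" if "j \<in> J" for j
  proof -
    have "lm j (y - v) = \<zero>\<^bsub>H j\<^esub>" using presentation.lmap_eq_iff[OF pres[OF that], of y v] v(2)[OF that] by simp
    moreover have "y - v \<in> pvecs n"
      using v(1) unfolding const_vecs_def by (intro additive_closedD(2)[OF additive_closed_pvecs assms]) blast
    ultimately show ?thesis using presentation.K_def[OF pres[OF that]] by blast
  qed
  then show ?thesis using v(1) by blast
qed

lemma colset_shift:
  assumes "a0 \<in> const_vecs n" "\<And>j. j \<in> J \<Longrightarrow> y - a0 \<in> K j"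
  shows "colset y = {a \<in> X. a0 - a \<in> B}"
proof -
  have "(\<forall>j\<in>J. y - a \<in> K j) \<longleftrightarrow> a0 - a \<in> B" if a: "a \<in> X" for a
  proof -
    have "a \<in> const_vecs n" using a pvec_reps_sub unfolding const_vecs_def by blast
    then have C: "a0 - a \<in> const_vecs n" by (rule additive_closedD(2)[OF additive_closed_const_vecs assms(1)])
    have "y - a \<in> K j \<longleftrightarrow> a0 - a \<in> K j" if j: "j \<in> J" for j
    proof -
      have e: "y - a = (y - a0) + (a0 - a)" "a0 - a = (y - a) - (y - a0)" by (rule ext, simp)+
      show ?thesis using pK_add(4)[OF j assms(2)[OF j], of "a0 - a"] pK_add(2)[OF j _ assms(2)[OF j], of "y - a"]
        e by metis
    qed
    then show ?thesis using C unfolding B_def by blast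
  qed
  then show ?thesis unfolding colset_def by blast
qed

lemma finite_colset: "finite (colset y)"
  unfolding colset_def by (rule finite_subset[OF _ finite_pvec_reps]) blast

text \<open>The constants map onto the product of the \<open>H j\<close> with equal fibres, and the
  candidates for a column are one of these fibres.\<close>

lemma card_colset:
  assumes y: "y \<in> pvecs n"
  shows "card (colset y) * order_H = CARD('p) ^ (Suc e * n)"
proof -
  interpret c: coset_reps "pvecs n \<inter> below_degree 1 :: 'p pvec set" "pvec_multiples n (Suc e) 1" X "pvec_red (Suc e)"
    by (rule coset_reps_below_degree)
  define \<phi> where "\<phi> v = (\<lambda>j\<in>J. lm j v)" for v
  have \<phi>: "\<phi> u = \<phi> v \<longleftrightarrow> u - v \<in> B" if uv: "u \<in> pvecs n \<inter> below_degree 1" "v \<in> pvecs n \<inter> below_degree 1" for u v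
  proof -
    have C: "u - v \<in> const_vecs n"
      using uv additive_closedD(2)[OF additive_closed_const_vecs] unfolding const_vecs_def by blast
    have "lm j u = lm j v \<longleftrightarrow> u - v \<in> K j" if j: "j \<in> J" for j
      using presentation.lmap_eq_iff[OF pres[OF j], of u v] presentation.K_def[OF pres[OF j]] C
      unfolding const_vecs_def by auto
    then show ?thesis using C by (auto simp: \<phi>_def B_def fun_eq_iff)
  qed
  have im: "\<phi> ` (pvecs n \<inter> below_degree 1) = (\<Pi>\<^sub>E j\<in>J. carrier (H j))"
  proof
    show "\<phi> ` (pvecs n \<inter> below_degree 1) \<subseteq> (\<Pi>\<^sub>E j\<in>J. carrier (H j))"
      using presentation.lmap_closed[OF pres] by (auto simp: \<phi>_def)
    show "(\<Pi>\<^sub>E j\<in>J. carrier (H j)) \<subseteq> \<phi> ` (pvecs n \<inter> below_degree 1)"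
    proof
      fix h assume h: "h \<in> (\<Pi>\<^sub>E j\<in>J. carrier (H j))"
      from joint_surj[OF this] obtain v where v: "v \<in> const_vecs n" "\<And>j. j \<in> J \<Longrightarrow> lm j v = h j" by blast
      have "h = \<phi> v" using h v(2) by (intro ext) (auto simp: \<phi>_def PiE_def extensional_def)
      then show "h \<in> \<phi> ` (pvecs n \<inter> below_degree 1)" using v(1) unfolding const_vecs_def by blast
    qed
  qed
  have c: "\<phi> y \<in> \<phi> ` (pvecs n \<inter> below_degree 1)"
    unfolding im using presentation.lmap_closed[OF pres] by (auto simp: \<phi>_def)
  have "card {a \<in> X. \<phi> a = \<phi> y} * card (\<phi> ` (pvecs n \<inter> below_degree 1)) = card X"
    by (rule c.card_fibre[OF additive_B multiples_sub_B \<phi> c])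
  moreover have "{a \<in> X. \<phi> a = \<phi> y} = colset y"
  proof -
    have "lm j a = lm j y \<longleftrightarrow> y - a \<in> K j" if j: "j \<in> J" and a: "a \<in> X" for j a
    proof -
      have "y - a \<in> pvecs n" using a pvec_reps_sub(1) by (intro additive_closedD(2)[OF additive_closed_pvecs y]) blast
      then have "y - a \<in> K j \<longleftrightarrow> lm j (y - a) = \<zero>\<^bsub>H j\<^esub>"
        unfolding presentation.K_def[OF pres[OF j]] by blast
      then show ?thesis
        unfolding eq_commute[of "lm j a"] presentation.lmap_eq_iff[OF pres[OF j], of y a] by (rule sym)
    qed
    then show ?thesis by (auto simp: \<phi>_def colset_def fun_eq_iff restrict_def)
  qed
  moreover have "card (\<phi> ` (pvecs n \<inter> below_degree 1)) = order_H"
    unfolding im order_H_def by (rule card_PiE[OF finite_J])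
  ultimately show ?thesis by (simp add: card_pvec_reps)
qed

end

section \<open>Lists of functionals that annihilate the columns\<close>

context joint_presentation
begin

definition families :: "(nat \<Rightarrow> ('p pvec \<Rightarrow> 'p mod_ring) list) \<Rightarrow> (nat \<Rightarrow> 'p pvec \<Rightarrow> 'p mod_ring) set" where
  "families Ls = PiE_dflt J 0 (\<lambda>j. list_span (dact j) (Ls j))"

text \<open>The sum map from the product of the spans to functionals on \<open>B\<close> is
  injective. Then the conditions imposed on a column by the different lists are independent.\<close>

definition good_lists :: "(nat \<Rightarrow> ('p pvec \<Rightarrow> 'p mod_ring) list) \<Rightarrow> bool" where
  "good_lists Ls \<longleftrightarrow> (\<forall>\<psi>\<in>families Ls. (\<forall>b\<in>B. (\<Sum>j\<in>J. \<psi> j b) = 0) \<longrightarrow> \<psi> = 0)"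

lemmas fs_D = presentation.finite_space_D[OF pres]
  and D_add = presentation.D_D(1)[OF pres]
  and D_N = presentation.D_D(2)[OF pres]
  and D_out = presentation.D_D(3)[OF pres]

lemma card_families:
  assumes "\<And>j. j \<in> J \<Longrightarrow> set (Ls j) \<subseteq> D j"
  shows "finite (families Ls)" "card (families Ls) = (\<Prod>j\<in>J. card (list_span (dact j) (Ls j)))"
proof -
  have fin: "finite (list_span (dact j) (Ls j))" if "j \<in> J" for j
    by (rule finite_space.finite_list_span[OF fs_D[OF that] assms[OF that]])
  show "finite (families Ls)" unfolding families_def by (intro finite_PiE_dflt finite_J fin)
  show "card (families Ls) = (\<Prod>j\<in>J. card (list_span (dact j) (Ls j)))"
    unfolding families_def by (rule card_PiE_dflt[OF finite_J fin])
qed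

lemma familiesD:
  assumes "\<psi> \<in> families Ls"
  shows "j \<in> J \<Longrightarrow> \<psi> j \<in> list_span (dact j) (Ls j)" "j \<notin> J \<Longrightarrow> \<psi> j = 0"
  using assms unfolding families_def PiE_dflt_def by blast+

lemma families_in_D:
  assumes "\<And>j. j \<in> J \<Longrightarrow> set (Ls j) \<subseteq> D j" "\<psi> \<in> families Ls" "j \<in> J"
  shows "\<psi> j \<in> D j"
  using finite_space.list_span_subset[OF fs_D[OF assms(3)] assms(1)[OF assms(3)]] familiesD(1)[OF assms(2,3)]
  by blast

lemma sum_family_add:
  assumes "\<And>j. j \<in> J \<Longrightarrow> \<psi> j \<in> D j" "\<And>j. j \<in> J \<Longrightarrow> x \<in> K j" "\<And>j. j \<in> J \<Longrightarrow> y \<in> K j"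
  shows "(\<Sum>j\<in>J. \<psi> j (x + y)) = (\<Sum>j\<in>J. \<psi> j x) + (\<Sum>j\<in>J. \<psi> j y)"
  unfolding sum.distrib[symmetric]
proof (rule sum.cong[OF refl])
  fix j assume j: "j \<in> J"
  show "\<psi> j (x + y) = \<psi> j x + \<psi> j y" by (rule D_add[OF j assms(1)[OF j] assms(2)[OF j] assms(3)[OF j]])
qed

lemma B_in_K: "b \<in> B \<Longrightarrow> j \<in> J \<Longrightarrow> b \<in> K j"
  unfolding B_def by blast

text \<open>Families are counted against columns by orthogonality. Since the lists are good, a
  nonzero family gives a character that is nontrivial on \<open>B\<close>, so its sum over the coset
  \<open>colset y\<close> vanishes and the probability that all spans vanish is exact.\<close>

lemma card_good_column:
  assumes Ls: "\<And>j. j \<in> J \<Longrightarrow> set (Ls j) \<subseteq> D j" and good: "good_lists Ls" and y: "y \<in> pvecs n"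
  shows "card {a \<in> colset y. \<forall>j\<in>J. \<forall>\<phi>\<in>list_span (dact j) (Ls j). \<phi> (y - a) = 0}
      * (\<Prod>j\<in>J. card (list_span (dact j) (Ls j))) = card (colset y)"
proof -
  let ?F = "families Ls"
  let ?s = "\<lambda>\<psi> x. \<Sum>j\<in>J. (\<psi> j x :: 'p mod_ring)"
  let ?A = "\<lambda>a. \<forall>j\<in>J. \<forall>\<phi>\<in>list_span (dact j) (Ls j). \<phi> (y - a) = 0"
  interpret c: coset_reps "pvecs n \<inter> below_degree 1 :: 'p pvec set" "pvec_multiples n (Suc e) 1" X "pvec_red (Suc e)"
    by (rule coset_reps_below_degree)
  obtain a0 where a0: "a0 \<in> const_vecs n" "\<And>j. j \<in> J \<Longrightarrow> y - a0 \<in> K j" using const_lift[OF y] by blast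
  have shift: "colset y = {a \<in> X. a0 - a \<in> B}" by (rule colset_shift[OF a0])
  have FD: "\<psi> j \<in> D j" if "\<psi> \<in> ?F" "j \<in> J" for \<psi> j by (rule families_in_D[OF Ls that])
  have zero_span: "0 \<in> list_span (dact j) (Ls j)" if "j \<in> J" for j
    by (rule finite_space.list_span_zero[OF fs_D[OF that] Ls[OF that]])
  have "card {\<psi> \<in> ?F. \<psi> = 0} * card (colset y) = card {a \<in> colset y. ?A a} * card ?F"
  proof (rule root_of_unity_double_count[OF finite_colset card_families(1)[OF Ls]])
    fix \<psi> assume \<psi>: "\<psi> \<in> ?F"
    show "(\<Sum>a\<in>colset y. root_of_unity (?s \<psi> (y - a))) = (if \<psi> = 0 then of_nat (card (colset y)) else 0)"
    proof (cases "\<psi> = 0")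
      case True
      then show ?thesis by simp
    next
      case False
      then obtain b where b: "b \<in> B" "?s \<psi> b \<noteq> 0" using good \<psi> unfolding good_lists_def by blast
      have z: "(\<Sum>a\<in>{a \<in> X. a0 - a \<in> B}. root_of_unity (?s \<psi> (a0 - a))) = 0"
      proof (rule c.sum_character_eq_0[where K = B and b = b and \<psi> = "?s \<psi>"])
        show "B \<subseteq> pvecs n \<inter> below_degree 1" unfolding B_def const_vecs_def by blast
        show "a0 \<in> pvecs n \<inter> below_degree 1" using a0(1) unfolding const_vecs_def .
        show "?s \<psi> (u + v) = ?s \<psi> u + ?s \<psi> v" if "u \<in> B" "v \<in> B" for u v
          by (rule sum_family_add[OF FD[OF \<psi>] B_in_K[OF that(1)] B_in_K[OF that(2)]])
        show "?s \<psi> z = 0" if z: "z \<in> pvec_multiples n (Suc e) 1" for z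
        proof (rule sum.neutral, rule ballI)
          fix j assume j: "j \<in> J"
          obtain w where w: "w \<in> pvecs n" "z = vsmult (pconst (Suc e)) w"
            using z unfolding pvec_multiples_def by blast
          show "\<psi> j z = 0"
            unfolding w(2) by (rule D_N[OF j FD[OF \<psi> j] presentation.p_power_in_N[OF pres[OF j] w(1)]])
        qed
      qed (rule additive_B multiples_sub_B b)+
      have "(\<Sum>a\<in>colset y. root_of_unity (?s \<psi> (y - a)))
          = (\<Sum>a\<in>{a \<in> X. a0 - a \<in> B}. root_of_unity (?s \<psi> (y - a0)) * root_of_unity (?s \<psi> (a0 - a)))"
        unfolding shift
      proof (rule sum.cong[OF refl])
        fix a assume a: "a \<in> {a \<in> X. a0 - a \<in> B}"
        then have aB: "a0 - a \<in> B" by blast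
        have "y - a = (y - a0) + (a0 - a)" by (rule ext) simp
        moreover have "?s \<psi> ((y - a0) + (a0 - a)) = ?s \<psi> (y - a0) + ?s \<psi> (a0 - a)"
          by (rule sum_family_add[OF FD[OF \<psi>] a0(2) B_in_K[OF aB]])
        ultimately show "root_of_unity (?s \<psi> (y - a)) = root_of_unity (?s \<psi> (y - a0)) * root_of_unity (?s \<psi> (a0 - a))"
          by (simp only: root_of_unity_add)
      qed
      also have "\<dots> = 0" unfolding sum_distrib_left[symmetric] z by simp
      finally show ?thesis unfolding if_not_P[OF False] .
    qed
  next
    fix a assume a: "a \<in> colset y"
    show "(\<Sum>\<psi>\<in>?F. root_of_unity (?s \<psi> (y - a))) = (if ?A a then of_nat (card ?F) else 0)"
    proof (cases "?A a")
      case True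
      have "root_of_unity (?s \<psi> (y - a)) = 1" if "\<psi> \<in> ?F" for \<psi>
      proof -
        have "?s \<psi> (y - a) = 0" using True familiesD(1)[OF that] by (intro sum.neutral) blast
        then show ?thesis by simp
      qed
      then show ?thesis unfolding if_P[OF True] by simp
    next
      case False
      then obtain k \<phi> where k: "k \<in> J" "\<phi> \<in> list_span (dact k) (Ls k)" "\<phi> (y - a) \<noteq> 0" by blast
      \<comment> \<open>A functional that does not vanish at \<open>y - a\<close>, placed at index
        \<open>k\<close>: translating the families by it cancels the sum.\<close>
      define \<tau> where "\<tau> = (\<lambda>j. if j = k then \<phi> else (0 :: 'p pvec \<Rightarrow> 'p mod_ring))"
      have "(\<Sum>\<psi>\<in>?F. root_of_unity (?s \<psi> (y - a))) = 0"
      proof (rule sum_root_of_unity_eq_0[where \<tau> = "\<lambda>\<psi>. \<psi> + \<tau>" and c = "\<phi> (y - a)"])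
        show "finite ?F" by (rule card_families(1)[OF Ls])
        show "(\<lambda>\<psi>. \<psi> + \<tau>) ` ?F \<subseteq> ?F"
        proof (rule image_subsetI)
          fix \<psi> assume \<psi>: "\<psi> \<in> ?F"
          have \<tau>: "\<tau> j \<in> list_span (dact j) (Ls j)" if "j \<in> J" for j
            using k(2) zero_span[OF that] unfolding \<tau>_def by (cases "j = k") (simp_all only: if_True if_False simp_thms)
          have span: "(\<psi> + \<tau>) j \<in> list_span (dact j) (Ls j)" if "j \<in> J" for j
          proof -
            have "\<psi> j + \<tau> j \<in> list_span (dact j) (Ls j)"
              by (rule finite_space.list_span_add[OF fs_D[OF that] Ls[OF that] familiesD(1)[OF \<psi> that] \<tau>[OF that]])
            then show ?thesis by (simp only: plus_fun_apply)
          qed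
          have "(\<psi> + \<tau>) j = 0" if "j \<notin> J" for j
          proof -
            have "\<tau> j = 0" using that k(1) unfolding \<tau>_def by auto
            then have "\<psi> j + \<tau> j = 0" unfolding familiesD(2)[OF \<psi> that] by (simp only: add_0_right)
            then show ?thesis by (rule trans[OF plus_fun_apply])
          qed
          with span show "\<psi> + \<tau> \<in> ?F" unfolding families_def PiE_dflt_def by blast
        qed
        show "inj_on (\<lambda>\<psi>. \<psi> + \<tau>) ?F" by (rule inj_onI) (simp only: add_right_cancel)
        show "\<phi> (y - a) \<noteq> 0" by (rule k(3))
        fix \<psi> assume "\<psi> \<in> ?F"
        have "?s \<tau> (y - a) = (\<Sum>j\<in>J. if j = k then \<phi> (y - a) else 0)"
          by (intro sum.cong refl) (simp add: \<tau>_def)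
        also have "\<dots> = \<phi> (y - a)" using k(1) finite_J by simp
        finally have "?s \<tau> (y - a) = \<phi> (y - a)" .
        then show "?s (\<psi> + \<tau>) (y - a) = ?s \<psi> (y - a) + \<phi> (y - a)"
          by (simp only: plus_fun_apply sum.distrib)
      qed
      then show ?thesis unfolding if_not_P[OF False] .
    qed
  qed
  moreover have z: "{\<psi> \<in> ?F. \<psi> = 0} = {0}"
    unfolding families_def PiE_dflt_def using zero_span by (auto simp only: zero_fun_apply)
  moreover have "card {\<psi> \<in> ?F. \<psi> = 0} = 1" unfolding z One_nat_def
    by (rule card_1_singleton_iff[THEN iffD2]) (rule exI, rule refl)
  ultimately have "card (colset y) = card {a \<in> colset y. ?A a} * card ?F" by (simp only: mult_1)
  then show ?thesis by (simp only: card_families(2)[OF Ls])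
qed

definition columns :: "(nat \<Rightarrow> 'p pvec) \<Rightarrow> 'p pvec set" where
  "columns a = (\<lambda>m. unit_vec_X m - a m) ` {..<n}"

lemma columns_sub_K:
  assumes "a \<in> (\<Pi>\<^sub>E m\<in>{..<n}. colset (unit_vec_X m))" "j \<in> J"
  shows "columns a \<subseteq> K j"
  using assms unfolding columns_def colset_def by blast

text \<open>Let a family from the spans sum to 0 on \<open>B\<close>. Modulo the columns every
  vector is constant, so the sum vanishes on all vectors lying in every \<open>K j\<close>.
  Multiplication by the product of the other \<open>P k\<close> sends \<open>K j\<close> there and
  into each other \<open>N k\<close>, which isolates \<open>\<psi> j\<close> and shows that it is 0.
  Hence lists that are not good annihilate no columns.\<close>

lemma bad_lists_empty:
  assumes Ls: "\<And>j. j \<in> J \<Longrightarrow> set (Ls j) \<subseteq> D j"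
    and a: "a \<in> (\<Pi>\<^sub>E m\<in>{..<n}. colset (unit_vec_X m))"
    and ann: "\<And>j. j \<in> J \<Longrightarrow> set (Ls j) \<subseteq> ann j (columns a)"
  shows "good_lists Ls"
  unfolding good_lists_def
proof (intro ballI impI)
  fix \<psi> assume \<psi>: "\<psi> \<in> families Ls" and zero: "\<forall>b\<in>B. (\<Sum>j\<in>J. \<psi> j b) = 0"
  have \<psi>D: "\<psi> j \<in> D j" if "j \<in> J" for j by (rule families_in_D[OF Ls \<psi> that])
  have fs_ann: "finite_space (dact j) (ann j (columns a)) (I j) (T j)" if "j \<in> J" for j
    by (rule presentation.finite_space_ann[OF pres[OF that] columns_sub_K[OF a that]])
  have \<psi>_ann: "\<psi> j \<in> ann j (columns a)" if "j \<in> J" for j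
    using finite_space.list_span_subset[OF fs_ann[OF that] ann[OF that]] familiesD(1)[OF \<psi> that] by blast
  \<comment> \<open>Requiring all multiples to be killed makes this a submodule, to which the
    reduction to constants applies.\<close>
  define U where "U = {s \<in> pvecs n. \<forall>j\<in>J. s \<in> K j \<and> (\<forall>f. \<psi> j (vsmult f s) = 0)}"
  have U: "submodule_set U"
    unfolding submodule_set_def additive_closed_def
  proof (intro conjI ballI allI)
    have "\<psi> j 0 = 0" if "j \<in> J" for j
      by (rule D_N[OF that \<psi>D[OF that] presentation.N_add(1)[OF pres[OF that]]])
    then show "0 \<in> U" unfolding U_def using pK_add(1) additive_closedD(1)[OF additive_closed_pvecs[of n, where 'a = 'p]] by simp
    fix x assume x: "x \<in> U"
    then show "vsmult f x \<in> U" for f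
      unfolding U_def using submodule_setD(2)[OF submodule_pvecs] submodule_setD(2)[OF pK]
      by (simp only: mem_Collect_eq vsmult_vsmult) blast
    fix y assume y: "y \<in> U"
    have "\<psi> j (vsmult f (x - y)) = 0" if j: "j \<in> J" for j f
    proof -
      have "vsmult f x \<in> K j" "vsmult f y \<in> K j" using x y j submodule_setD(2)[OF pK[OF j]] unfolding U_def by blast+
      from D_add[OF j \<psi>D[OF j] pK_add(2)[OF j this] this(2)]
      have "\<psi> j (vsmult f x) = \<psi> j (vsmult f x - vsmult f y) + \<psi> j (vsmult f y)" by (simp only: diff_add_cancel)
      moreover have "\<psi> j (vsmult f x) = 0" "\<psi> j (vsmult f y) = 0" using x y j unfolding U_def by blast+
      ultimately show ?thesis unfolding vsmult_diff by simp
    qed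
    then show "x - y \<in> U"
      using x y pK_add(2) additive_closedD(2)[OF additive_closed_pvecs] unfolding U_def by blast
  qed
  have col_U: "unit_vec_X m - a m \<in> U" if "m < n" for m
  proof -
    have c: "unit_vec_X m - a m \<in> columns a" unfolding columns_def using that by blast
    have "a m \<in> X" using a that unfolding colset_def by blast
    then have "a m \<in> pvecs n" using pvec_reps_sub(1) by blast
    then have "unit_vec_X m - a m \<in> pvecs n"
      by (rule additive_closedD(2)[OF additive_closed_pvecs unit_vec_X_in[OF that]])
    moreover have "unit_vec_X m - a m \<in> K j" if "j \<in> J" for j using columns_sub_K[OF a that] c by blast
    moreover have "\<psi> j (vsmult f (unit_vec_X m - a m)) = 0" if j: "j \<in> J" for j f
    proof -
      interpret p: presentation "H j" "act j" "P j" e n "g j" by (rule pres[OF j])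
      show ?thesis using \<psi>_ann[OF j] c unfolding p.ann_def by blast
    qed
    ultimately show ?thesis unfolding U_def by blast
  qed
  have aC: "a m \<in> const_vecs n" if "m < n" for m
  proof -
    have "a m \<in> X" using a that unfolding colset_def by blast
    then show ?thesis using pvec_reps_sub unfolding const_vecs_def by blast
  qed
  have sum_0: "(\<Sum>j\<in>J. \<psi> j x) = 0" if x: "\<And>j. j \<in> J \<Longrightarrow> x \<in> K j" "x \<in> pvecs n" for x
  proof -
    obtain v where v: "v \<in> const_vecs n" "x - v \<in> U"
      using const_vecs_modulo_columns[OF aC U col_U x(2)] by blast
    have vB: "v \<in> B"
    proof -
      have "v \<in> K j" if j: "j \<in> J" for j
      proof -
        have "x - v \<in> K j" using v(2) j unfolding U_def by blast
        then have "x - (x - v) \<in> K j" by (rule pK_add(2)[OF j x(1)[OF j]])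
        moreover have "x - (x - v) = v" by (rule ext) simp
        ultimately show ?thesis by (simp only:)
      qed
      then show ?thesis unfolding B_def using v(1) by blast
    qed
    have "(\<Sum>j\<in>J. \<psi> j (v + (x - v))) = (\<Sum>j\<in>J. \<psi> j v) + (\<Sum>j\<in>J. \<psi> j (x - v))"
    proof (rule sum_family_add[OF \<psi>D B_in_K[OF vB]])
      show "x - v \<in> K j" if "j \<in> J" for j using v(2) that unfolding U_def by blast
    qed
    moreover have "v + (x - v) = x" by (rule ext) simp
    moreover have "\<psi> j (x - v) = 0" if "j \<in> J" for j
    proof -
      have "\<psi> j (vsmult 1 (x - v)) = 0" using v(2) that unfolding U_def by blast
      then show ?thesis by (simp only: vsmult_one)
    qed
    moreover have "(\<Sum>j\<in>J. \<psi> j v) = 0" using zero vB by blast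
    ultimately show ?thesis by simp
  qed
  have "\<psi> j = 0" if j: "j \<in> J" for j
  proof -
    interpret p: presentation "H j" "act j" "P j" e n "g j" by (rule pres[OF j])
    interpret fs: finite_space "dact j" "D j" "I j" "T j" by (rule fs_D[OF j])
    \<comment> \<open>Because the reductions are distinct, \<open>u\<close> is a unit modulo
      \<open>(p, P j)\<close>, yet it maps every vector into \<open>N k\<close> for the other
      \<open>k\<close>.\<close>
    define u where "u = (\<Prod>k\<in>J - {j}. P k)"
    have "u \<notin> I j"
    proof
      assume "u \<in> I j"
      then obtain k where k: "k \<in> J" "k \<noteq> j" "P k \<in> I j"
        using reduction_ideal_prime[OF p.irred, of "J - {j}" P] finite_J unfolding u_def by blast
      have "reduce_poly (P j) \<noteq> reduce_poly (P k)" using inj_P j k unfolding inj_on_def by blast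
      then show False
        using reduction_ideal_other[OF p.irred quot_module.irred[OF quot_mod[OF k(1)]] p.monic
          quot_module.monic[OF quot_mod[OF k(1)]]] k(3) by blast
    qed
    have "\<psi> j (vsmult u x) = 0" if x: "x \<in> K j" for x
    proof -
      have xn: "x \<in> pvecs n" using x pK_sub[OF j] by blast
      have uN: "vsmult u x \<in> N k" if k: "k \<in> J" "k \<noteq> j" for k
      proof -
        have "u = P k * (\<Prod>k\<in>J - {j} - {k}. P k)"
          unfolding u_def using finite_J k by (intro prod.remove) auto
        then have "vsmult u x = vsmult (P k) (vsmult (\<Prod>k\<in>J - {j} - {k}. P k) x)"
          by (simp only: vsmult_vsmult)
        then show ?thesis
          using presentation.P_in_N[OF pres[OF k(1)] submodule_setD(2)[OF submodule_pvecs xn]] by simp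
      qed
      have "vsmult u x \<in> K k" if "k \<in> J" for k
      proof (cases "k = j")
        case True
        then show ?thesis using submodule_setD(2)[OF pK[OF j] x] by simp
      next
        case False
        then show ?thesis using uN[OF that] pN_sub[OF that] by blast
      qed
      then have "(\<Sum>k\<in>J. \<psi> k (vsmult u x)) = 0" by (rule sum_0[OF _ submodule_setD(2)[OF submodule_pvecs xn]])
      moreover have "(\<Sum>k\<in>J. \<psi> k (vsmult u x)) = \<psi> j (vsmult u x) + (\<Sum>k\<in>J - {j}. \<psi> k (vsmult u x))"
        by (rule sum.remove[OF finite_J j])
      moreover have "(\<Sum>k\<in>J - {j}. \<psi> k (vsmult u x)) = 0"
        by (rule sum.neutral) (use uN D_N \<psi>D in blast)
      ultimately show ?thesis by simp
    qed
    then have "dact j u (\<psi> j) = 0" unfolding p.dact_def by (auto simp only: zero_fun_apply fun_eq_iff if_True if_False split: if_splits)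
    moreover obtain b where "dact j b (dact j u (\<psi> j)) = \<psi> j"
      using fs.act_cancel[OF \<psi>D[OF j] \<open>u \<notin> I j\<close>] by blast
    ultimately show ?thesis using fs.act_zero_right[of b] by simp
  qed
  then show "\<psi> = 0" using familiesD(2)[OF \<psi>] by (intro ext) (metis zero_fun_apply)
qed

end

section \<open>Inclusion-exclusion and its error term\<close>

lemma card_filter_of_bool: "finite S \<Longrightarrow> real (card {x \<in> S. Q x}) = (\<Sum>x\<in>S. of_bool (Q x))"
  by (simp add: of_bool_def sum.If_cases Int_def)

context joint_presentation
begin

text \<open>Bounds the proportion of functionals in \<open>D j\<close> with a prescribed restriction
  to \<open>B\<close>. The order of the product of the \<open>H j\<close> is fixed while the number
  of constants modulo \<open>p\<close> grows, hence the decay.\<close>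

definition kappa :: real where
  "kappa = real order_H / real CARD('p) ^ n"

abbreviation "q j \<equiv> real CARD('p) ^ Polynomial.degree (P j)"

lemma card_T: "real (card (T j)) = q j"
  by (simp add: card_poly_reps)

lemma q_ge_2: "j \<in> J \<Longrightarrow> 2 \<le> q j"
  using finite_space.card_T[OF fs_D, of j] card_T[of j] by linarith

lemma card_D: "j \<in> J \<Longrightarrow> card (D j) = card (T j) ^ n"
  using surj_presentation.card_D[OF surj_pres] by (simp add: card_poly_reps)

text \<open>Two functionals with the same restriction to \<open>B\<close> differ by one that
  vanishes on \<open>B\<close>, which removes the shift \<open>c\<close>; the rest is
  \<open>kernel_bound\<close>, with the size of \<open>B\<close> obtained from the candidates for
  the zero column.\<close>

lemma kappa_bound:
  assumes j: "j \<in> J"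
  shows "real (card {\<psi> \<in> D j. \<forall>b\<in>B. (\<psi> + c) b = 0}) \<le> kappa * real (card (D j))"
proof -
  interpret p: surj_presentation "H j" "act j" "P j" e n "g j" by (rule surj_pres[OF j])
  let ?S = "{\<psi> \<in> D j. \<forall>b\<in>B. (\<psi> + c) b = 0}" and ?E = "{\<psi> \<in> D j. \<forall>b\<in>B. \<psi> b = 0}"
  have "card ?S \<le> card ?E"
  proof (cases "?S = {}")
    case True
    then show ?thesis by (simp only: card.empty zero_le)
  next
    case False
    then obtain \<psi>1 where \<psi>1: "\<psi>1 \<in> D j" "\<forall>b\<in>B. (\<psi>1 + c) b = 0" by blast
    show ?thesis
    proof (rule card_inj_on_le[of "\<lambda>\<psi>. \<psi> - \<psi>1"])
      show "inj_on (\<lambda>\<psi>. \<psi> - \<psi>1) ?S" by (rule inj_onI) (simp only: diff_left_imp_eq diff_eq_eq diff_add_cancel)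
      show "(\<lambda>\<psi>. \<psi> - \<psi>1) ` ?S \<subseteq> ?E"
      proof (rule image_subsetI)
        fix \<psi> assume \<psi>: "\<psi> \<in> ?S"
        have "(\<psi> - \<psi>1) b = 0" if "b \<in> B" for b
        proof -
          have "\<psi> b + c b = 0" "\<psi>1 b + c b = 0" using \<psi> \<psi>1(2) that by auto
          then have "\<psi> b = \<psi>1 b" by (metis add_right_imp_eq)
          then show ?thesis by simp
        qed
        moreover have "\<psi> - \<psi>1 \<in> D j" using \<psi> \<psi>1(1) by (intro p.diff_in_D) blast+
        ultimately show "\<psi> - \<psi>1 \<in> ?E" by blast
      qed
      show "finite ?E" by (rule finite_subset[OF _ p.finite_D]) blast
    qed
  qed
  moreover have "real (card ?E) \<le> kappa * real (card (D j))"
  proof -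
    let ?c = "card {x \<in> X. x \<in> B}"
    have "colset 0 = {a \<in> X. 0 - a \<in> B}"
    proof (rule colset_shift)
      show "0 \<in> const_vecs n" by (rule additive_closedD(1)[OF additive_closed_const_vecs])
      show "0 - 0 \<in> K k" if "k \<in> J" for k using pK_add(1)[OF that] by (simp only: diff_zero)
    qed
    also have "\<dots> = {a \<in> X. a \<in> B}" unfolding additive_closed_neg_iff[OF additive_B] ..
    finally have c: "?c * order_H = CARD('p) ^ (Suc e * n)"
      using card_colset[OF additive_closedD(1)[OF additive_closed_pvecs]] by (simp only:)
    have "card ?E * ?c * CARD('p) ^ n \<le> card (D j) * CARD('p) ^ (Suc e * n)"
    proof (rule p.kernel_bound[OF additive_B _ _ multiples_sub_B])
      show "B \<subseteq> K j" using B_in_K[OF _ j] by blast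
      show "B \<subseteq> below_degree 1" unfolding B_def const_vecs_def by blast
    qed
    then have "?c * (card ?E * CARD('p) ^ n) \<le> ?c * (card (D j) * order_H)"
      unfolding c[symmetric] by (simp only: mult_ac)
    moreover have "0 < ?c"
    proof (rule ccontr)
      assume "\<not> 0 < ?c"
      then have "CARD('p) ^ (Suc e * n) = 0" unfolding c[symmetric] by (simp only: not_gr_zero mult_0)
      then show False by simp
    qed
    ultimately have "card ?E * CARD('p) ^ n \<le> card (D j) * order_H" by (simp only: nat_mult_le_cancel1)
    then have "real (card ?E * CARD('p) ^ n) \<le> real (card (D j) * order_H)" by (simp only: of_nat_le_iff)
    then have "real (card ?E) * real CARD('p) ^ n \<le> real (card (D j)) * real order_H"
      by (simp only: of_nat_mult of_nat_power)
    then show ?thesis by (simp add: kappa_def field_simps)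
  qed
  ultimately show ?thesis by linarith
qed

lemma kappa_nonneg: "0 \<le> kappa"
  by (simp add: kappa_def)

text \<open>Fixing the lists at all indices other than \<open>k\<close> turns the relation on
  \<open>B\<close> into a shifted condition on one nontrivial combination in
  \<open>D k\<close>.\<close>

lemma card_dependent_combinations:
  assumes fs: "\<And>j. j \<in> J \<Longrightarrow> length (fs j) = ls j" and k: "k \<in> J" "\<not> set (fs k) \<subseteq> I k"
  shows "real (card {Ls \<in> (\<Pi>\<^sub>E j\<in>J. {xs. set xs \<subseteq> D j \<and> length xs = ls j}).
      \<forall>b\<in>B. (\<Sum>j\<in>J. list_comb (dact j) (fs j) (Ls j) b) = 0})
    \<le> kappa * (\<Prod>j\<in>J. real (card (D j)) ^ ls j)"
proof -
  interpret fsk: finite_space "dact k" "D k" "I k" "T k" by (rule fs_D[OF k(1)])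
  let ?C = "{Ls \<in> (\<Pi>\<^sub>E j\<in>J. {xs. set xs \<subseteq> D j \<and> length xs = ls j}).
      \<forall>b\<in>B. (\<Sum>j\<in>J. list_comb (dact j) (fs j) (Ls j) b) = 0}"
  let ?M = "\<Pi>\<^sub>E j\<in>J - {k}. {xs. set xs \<subseteq> D j \<and> length xs = ls j}"
  define c where "c M = (\<lambda>b. \<Sum>j\<in>J - {k}. list_comb (dact j) (fs j) (M j) b)" for M
  let ?Y = "\<lambda>M. {xs. set xs \<subseteq> D k \<and> length xs = length (fs k) \<and> (\<forall>b\<in>B. (list_comb (dact k) (fs k) xs + c M) b = 0)}"
  have fin: "finite {xs. set xs \<subseteq> D j \<and> length xs = ls j}"
    and card: "card {xs. set xs \<subseteq> D j \<and> length xs = ls j} = card (D j) ^ ls j" if "j \<in> J" for j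
    using finite_space.finite_D[OF fs_D[OF that]] finite_lists_length_eq card_lists_length_eq by blast+
  have finM: "finite ?M" using finite_J fin by (intro finite_PiE) auto
  have finY: "finite (?Y M)" for M
    by (rule finite_subset[OF _ fsk.finite_lists_D[of "length (fs k)"]]) blast
  have "card ?C \<le> card (SIGMA M : ?M. ?Y M)"
  proof (rule card_inj_on_le[of "\<lambda>Ls. (restrict Ls (J - {k}), Ls k)"])
    show "inj_on (\<lambda>Ls. (restrict Ls (J - {k}), Ls k)) ?C"
    proof (rule inj_onI)
      fix Ls Ls' assume *: "Ls \<in> ?C" "Ls' \<in> ?C" "(restrict Ls (J - {k}), Ls k) = (restrict Ls' (J - {k}), Ls' k)"
      then have r: "restrict Ls (J - {k}) = restrict Ls' (J - {k})" "Ls k = Ls' k" by auto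
      show "Ls = Ls'"
      proof (rule PiE_ext)
        show "Ls \<in> (\<Pi>\<^sub>E j\<in>J. {xs. set xs \<subseteq> D j \<and> length xs = ls j})"
          "Ls' \<in> (\<Pi>\<^sub>E j\<in>J. {xs. set xs \<subseteq> D j \<and> length xs = ls j})" using * by blast+
        fix j assume "j \<in> J"
        then show "Ls j = Ls' j" using fun_cong[OF r(1), of j] r(2) by (cases "j = k") auto
      qed
    qed
    show "(\<lambda>Ls. (restrict Ls (J - {k}), Ls k)) ` ?C \<subseteq> (SIGMA M : ?M. ?Y M)"
    proof (rule image_subsetI)
      fix Ls assume Ls: "Ls \<in> ?C"
      then have m: "set (Ls j) \<subseteq> D j" "length (Ls j) = ls j" if "j \<in> J" for j using that by auto
      have "(list_comb (dact k) (fs k) (Ls k) + c (restrict Ls (J - {k}))) b = 0" if b: "b \<in> B" for b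
      proof -
        have "(\<Sum>j\<in>J. list_comb (dact j) (fs j) (Ls j) b)
            = list_comb (dact k) (fs k) (Ls k) b + (\<Sum>j\<in>J - {k}. list_comb (dact j) (fs j) (Ls j) b)"
          by (rule sum.remove[OF finite_J k(1)])
        moreover have "c (restrict Ls (J - {k})) b = (\<Sum>j\<in>J - {k}. list_comb (dact j) (fs j) (Ls j) b)"
          unfolding c_def by (intro sum.cong refl) (simp only: restrict_apply if_True)
        ultimately show ?thesis using Ls b by simp
      qed
      then have "Ls k \<in> ?Y (restrict Ls (J - {k}))"
        using m[OF k(1)] fs[OF k(1)] by (intro CollectI conjI ballI) (simp_all only:)
      moreover have "restrict Ls (J - {k}) \<in> ?M" using m by auto
      ultimately show "(restrict Ls (J - {k}), Ls k) \<in> (SIGMA M : ?M. ?Y M)" by blast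
    qed
    show "finite (SIGMA M : ?M. ?Y M)" using finM finY by (intro finite_SigmaI)
  qed
  also have "\<dots> = (\<Sum>M\<in>?M. card (?Y M))" using finM finY by (intro card_SigmaI) blast+
  finally have "card ?C \<le> (\<Sum>M\<in>?M. card (?Y M))" .
  then have "real (card ?C) \<le> (\<Sum>M\<in>?M. real (card (?Y M)))"
    unfolding of_nat_sum[symmetric] of_nat_le_iff .
  also have "\<dots> \<le> (\<Sum>M\<in>?M. kappa * real (card (D k)) ^ length (fs k))"
    by (intro sum_mono fsk.card_list_comb_le[where R = "\<lambda>\<phi>. \<forall>b\<in>B. \<phi> b = 0"] kappa_bound k)
  also have "\<dots> = kappa * (real (card (D k)) ^ ls k * real (card ?M))"
    using fs[OF k(1)] by (simp only: sum_constant mult_ac)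
  also have "real (card ?M) = (\<Prod>j\<in>J - {k}. real (card (D j)) ^ ls j)"
    using finite_J card by (simp add: card_PiE of_nat_prod)
  also have "real (card (D k)) ^ ls k * (\<Prod>j\<in>J - {k}. real (card (D j)) ^ ls j) = (\<Prod>j\<in>J. real (card (D j)) ^ ls j)"
    by (rule prod.remove[OF finite_J k(1), symmetric])
  finally show ?thesis .
qed

definition all_lists :: "(nat \<Rightarrow> nat) \<Rightarrow> (nat \<Rightarrow> ('p pvec \<Rightarrow> 'p mod_ring) list) set" where
  "all_lists ls = (\<Pi>\<^sub>E j\<in>J. indep_lists (dact j) (D j) (ls j))"

lemma finite_all_lists: "finite (all_lists ls)"
  unfolding all_lists_def using finite_J finite_space.finite_indep_lists[OF fs_D] by (intro finite_PiE) auto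

lemma all_listsD:
  assumes "Ls \<in> all_lists ls" "j \<in> J"
  shows "set (Ls j) \<subseteq> D j" "length (Ls j) = ls j" "list_indep (dact j) (Ls j)"
  using assms unfolding all_lists_def indep_lists_def by auto

text \<open>Union bound: lists that are not good satisfy a relation on \<open>B\<close> with
  coefficients in the sets \<open>T j\<close>, not all in the ideals \<open>I j\<close>. The product
  of the \<open>q j ^ ls j\<close> counts the possible coefficients.\<close>

lemma card_bad_lists:
  "real (card {Ls \<in> all_lists ls. \<not> good_lists Ls})
    \<le> (\<Prod>j\<in>J. q j ^ ls j) * (kappa * (\<Prod>j\<in>J. real (card (D j)) ^ ls j))"
proof -
  let ?PF = "\<Pi>\<^sub>E j\<in>J. {fs. set fs \<subseteq> T j \<and> length fs = ls j}"
  define FS where "FS = {fs \<in> ?PF. \<exists>j\<in>J. \<not> set (fs j) \<subseteq> I j}"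
  define C where "C fs = {Ls \<in> (\<Pi>\<^sub>E j\<in>J. {xs. set xs \<subseteq> D j \<and> length xs = ls j}).
      \<forall>b\<in>B. (\<Sum>j\<in>J. list_comb (dact j) (fs j) (Ls j) b) = 0}" for fs
  have finPF: "finite ?PF"
    using finite_J finite_poly_reps by (intro finite_PiE finite_lists_length_eq) auto
  have finFS: "finite FS" unfolding FS_def by (rule finite_subset[OF _ finPF]) blast
  have finC: "finite (C fs)" for fs
  proof (rule finite_subset)
    show "C fs \<subseteq> (\<Pi>\<^sub>E j\<in>J. {xs. set xs \<subseteq> D j \<and> length xs = ls j})" unfolding C_def by blast
    show "finite (\<Pi>\<^sub>E j\<in>J. {xs. set xs \<subseteq> D j \<and> length xs = ls j})"
      using finite_J finite_space.finite_D[OF fs_D] by (intro finite_PiE finite_lists_length_eq) auto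
  qed
  have "{Ls \<in> all_lists ls. \<not> good_lists Ls} \<subseteq> (\<Union>fs\<in>FS. C fs)"
  proof
    fix Ls assume "Ls \<in> {Ls \<in> all_lists ls. \<not> good_lists Ls}"
    then have Ls: "Ls \<in> all_lists ls" "\<not> good_lists Ls" by auto
    note LD = all_listsD[OF Ls(1)]
    obtain \<psi> where \<psi>: "\<psi> \<in> families Ls" "\<forall>b\<in>B. (\<Sum>j\<in>J. \<psi> j b) = 0" "\<psi> \<noteq> 0"
      using Ls(2) unfolding good_lists_def by blast
    have "\<exists>fs. \<psi> j = list_comb (dact j) fs (Ls j) \<and> set fs \<subseteq> T j \<and> length fs = ls j" if j: "j \<in> J" for j
      using familiesD(1)[OF \<psi>(1) j] finite_space.list_span_eq_list_comb[OF fs_D[OF j] LD(1)[OF j]] LD(2)[OF j]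
      by auto
    then have "\<forall>j\<in>J. \<exists>fs. \<psi> j = list_comb (dact j) fs (Ls j) \<and> set fs \<subseteq> T j \<and> length fs = ls j" by blast
    from bchoice[OF this] obtain f0 where f0: "\<And>j. j \<in> J \<Longrightarrow>
      \<psi> j = list_comb (dact j) (f0 j) (Ls j) \<and> set (f0 j) \<subseteq> T j \<and> length (f0 j) = ls j" by blast
    define fs where "fs = restrict f0 J"
    have f: "\<psi> j = list_comb (dact j) (fs j) (Ls j)" "set (fs j) \<subseteq> T j" "length (fs j) = ls j" if "j \<in> J" for j
      using f0[OF that] that unfolding fs_def by simp_all
    have "fs \<in> ?PF" using f(2,3) unfolding fs_def by auto
    moreover have "\<exists>j\<in>J. \<not> set (fs j) \<subseteq> I j"
    proof (rule ccontr)
      assume neg: "\<not> (\<exists>j\<in>J. \<not> set (fs j) \<subseteq> I j)"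
      have "\<psi> j = 0" for j
      proof (cases "j \<in> J")
        case True
        have "list_comb (dact j) (fs j) (Ls j) = 0"
          using neg True by (intro finite_space.list_comb_ideal[OF fs_D[OF True] LD(1)[OF True]]) blast
        then show ?thesis using f(1)[OF True] by (simp only:)
      next
        case False
        then show ?thesis by (rule familiesD(2)[OF \<psi>(1)])
      qed
      then have "\<psi> = 0" by (intro ext) (simp only: zero_fun_apply)
      then show False using \<psi>(3) by contradiction
    qed
    ultimately have "fs \<in> FS" unfolding FS_def by blast
    moreover have "Ls \<in> C fs"
    proof -
      have "Ls \<in> (\<Pi>\<^sub>E j\<in>J. {xs. set xs \<subseteq> D j \<and> length xs = ls j})"
        using Ls(1) LD(1,2) unfolding all_lists_def by (auto simp: PiE_iff)
      moreover have "(\<Sum>j\<in>J. list_comb (dact j) (fs j) (Ls j) b) = (\<Sum>j\<in>J. \<psi> j b)" for b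
        by (intro sum.cong refl) (simp only: f(1))
      ultimately show ?thesis unfolding C_def using \<psi>(2) by simp
    qed
    ultimately show "Ls \<in> (\<Union>fs\<in>FS. C fs)" by blast
  qed
  then have "card {Ls \<in> all_lists ls. \<not> good_lists Ls} \<le> card (\<Union>fs\<in>FS. C fs)"
    by (intro card_mono finite_UN_I finFS finC)
  also have "\<dots> \<le> (\<Sum>fs\<in>FS. card (C fs))" by (rule card_UN_le[OF finFS])
  finally have "card {Ls \<in> all_lists ls. \<not> good_lists Ls} \<le> (\<Sum>fs\<in>FS. card (C fs))" .
  then have "real (card {Ls \<in> all_lists ls. \<not> good_lists Ls}) \<le> (\<Sum>fs\<in>FS. real (card (C fs)))"
    unfolding of_nat_sum[symmetric] of_nat_le_iff .
  also have "\<dots> \<le> (\<Sum>fs\<in>FS. kappa * (\<Prod>j\<in>J. real (card (D j)) ^ ls j))"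
  proof (rule sum_mono)
    fix fs assume "fs \<in> FS"
    then obtain k where k: "k \<in> J" "\<not> set (fs k) \<subseteq> I k" and fs: "fs \<in> ?PF" unfolding FS_def by blast
    have len: "length (fs j) = ls j" if "j \<in> J" for j using fs that by auto
    show "real (card (C fs)) \<le> kappa * (\<Prod>j\<in>J. real (card (D j)) ^ ls j)"
      unfolding C_def by (rule card_dependent_combinations[where fs = fs and ls = ls and k = k, OF len k])
  qed
  also have "\<dots> = real (card FS) * (kappa * (\<Prod>j\<in>J. real (card (D j)) ^ ls j))" by (simp only: sum_constant)
  also have "\<dots> \<le> (\<Prod>j\<in>J. q j ^ ls j) * (kappa * (\<Prod>j\<in>J. real (card (D j)) ^ ls j))"
  proof (rule mult_right_mono)
    have "card FS \<le> card ?PF" unfolding FS_def by (intro card_mono finPF) blast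
    also have "card ?PF = (\<Prod>j\<in>J. card (T j) ^ ls j)"
      by (simp only: card_PiE[OF finite_J] card_lists_length_eq[OF finite_poly_reps])
    finally have "real (card FS) \<le> real (\<Prod>j\<in>J. card (T j) ^ ls j)" by (simp only: of_nat_le_iff)
    then show "real (card FS) \<le> (\<Prod>j\<in>J. q j ^ ls j)" by (simp only: of_nat_prod of_nat_power card_T)
    show "0 \<le> kappa * (\<Prod>j\<in>J. real (card (D j)) ^ ls j)" by (intro mult_nonneg_nonneg kappa_nonneg prod_nonneg) auto
  qed
  finally show ?thesis .
qed

text \<open>The common size of the sets \<open>colset y\<close>.\<close>

definition col_count :: real where
  "col_count = real CARD('p) ^ (Suc e * n) / real order_H"

abbreviation "column_families \<equiv> \<Pi>\<^sub>E m\<in>{..<n}. colset (unit_vec_X m)"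

text \<open>The columns are chosen independently, and for good lists each one contributes the same
  exact factor; other lists annihilate no family of columns.\<close>

lemma card_column_families_lists:
  assumes Ls: "Ls \<in> all_lists ls"
  shows "real (card {a \<in> column_families. \<forall>j\<in>J. set (Ls j) \<subseteq> ann j (columns a)})
    = of_bool (good_lists Ls) * (col_count / (\<Prod>j\<in>J. q j ^ ls j)) ^ n"
proof (cases "good_lists Ls")
  case False
  then have "{a \<in> column_families. \<forall>j\<in>J. set (Ls j) \<subseteq> ann j (columns a)} = {}"
    using bad_lists_empty[OF all_listsD(1)[OF Ls]] by blast
  then show ?thesis using False by (simp only: card.empty of_nat_0 of_bool_eq mult_zero_left)
next
  case True
  note LD = all_listsD[OF Ls]
  let ?Q = "\<Prod>j\<in>J. q j ^ ls j"
  let ?A = "\<lambda>y a. \<forall>j\<in>J. \<forall>\<phi>\<in>list_span (dact j) (Ls j). \<phi> (y - a) = 0"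
  \<comment> \<open>Killing all multiples of the columns is the same as vanishing of the whole spans
    on the columns, since spans are closed under the action.\<close>
  have iff: "(\<forall>j\<in>J. set (Ls j) \<subseteq> ann j (columns a)) \<longleftrightarrow> (\<forall>m<n. ?A (unit_vec_X m) (a m))"
    if a: "a \<in> column_families" for a
  proof
    assume sub: "\<forall>j\<in>J. set (Ls j) \<subseteq> ann j (columns a)"
    show "\<forall>m<n. ?A (unit_vec_X m) (a m)"
    proof (intro allI impI ballI)
      fix m j \<phi> assume m: "m < n" and j: "j \<in> J" and \<phi>: "\<phi> \<in> list_span (dact j) (Ls j)"
      interpret p: presentation "H j" "act j" "P j" e n "g j" by (rule pres[OF j])
      have "\<phi> \<in> p.ann (columns a)"
        using finite_space.list_span_subset[OF p.finite_space_ann[OF columns_sub_K[OF a j]]] sub j \<phi> by blast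
      then have "\<phi> (vsmult 1 (unit_vec_X m - a m)) = 0" using m unfolding p.ann_def columns_def by blast
      then show "\<phi> (unit_vec_X m - a m) = 0" by (simp only: vsmult_one)
    qed
  next
    assume A: "\<forall>m<n. ?A (unit_vec_X m) (a m)"
    show "\<forall>j\<in>J. set (Ls j) \<subseteq> ann j (columns a)"
    proof (intro ballI subsetI)
      fix j \<phi> assume j: "j \<in> J" and \<phi>: "\<phi> \<in> set (Ls j)"
      interpret p: presentation "H j" "act j" "P j" e n "g j" by (rule pres[OF j])
      interpret fs: finite_space "dact j" "D j" "I j" "T j" by (rule fs_D[OF j])
      have "\<phi> (vsmult f x) = 0" if x: "x \<in> columns a" for x f
      proof -
        obtain m where m: "m < n" "x = unit_vec_X m - a m" using x unfolding columns_def by blast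
        have "dact j f \<phi> \<in> list_span (dact j) (Ls j)"
          using fs.list_span_act[OF LD(1)[OF j]] fs.set_subset_list_span[OF LD(1)[OF j]] \<phi> by blast
        then have "dact j f \<phi> x = 0" using A m j by blast
        moreover have xK: "x \<in> K j" using columns_sub_K[OF a j] x by blast
        have "dact j f \<phi> x = \<phi> (vsmult f x)" unfolding p.dact_def by (rule if_P[OF xK])
        ultimately show ?thesis by (rule trans[OF sym, rotated])
      qed
      moreover have "\<phi> \<in> D j" using LD(1)[OF j] \<phi> by blast
      ultimately show "\<phi> \<in> ann j (columns a)" unfolding p.ann_def by (intro CollectI conjI ballI allI)
    qed
  qed
  have "{a \<in> column_families. \<forall>j\<in>J. set (Ls j) \<subseteq> ann j (columns a)}
      = (\<Pi>\<^sub>E m\<in>{..<n}. {a \<in> colset (unit_vec_X m). ?A (unit_vec_X m) a})"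
  proof -
    have "{a \<in> column_families. \<forall>j\<in>J. set (Ls j) \<subseteq> ann j (columns a)}
        = {a \<in> column_families. \<forall>m<n. ?A (unit_vec_X m) (a m)}" using iff by blast
    also have "\<dots> = (\<Pi>\<^sub>E m\<in>{..<n}. {a \<in> colset (unit_vec_X m). ?A (unit_vec_X m) a})"
      by (intro Set.set_eqI) (simp only: mem_Collect_eq PiE_iff lessThan_iff, blast)
    finally show ?thesis .
  qed
  then have "real (card {a \<in> column_families. \<forall>j\<in>J. set (Ls j) \<subseteq> ann j (columns a)})
      = (\<Prod>m<n. real (card {a \<in> colset (unit_vec_X m). ?A (unit_vec_X m) a}))"
    by (simp only: card_PiE[OF finite_lessThan] of_nat_prod)
  also have "\<dots> = (\<Prod>m<n. col_count / ?Q)"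
  proof (rule prod.cong[OF refl])
    fix m assume "m \<in> {..<n}"
    then have u: "unit_vec_X m \<in> pvecs n" by (intro unit_vec_X_in) simp
    have "(\<Prod>j\<in>J. card (list_span (dact j) (Ls j))) = (\<Prod>j\<in>J. card (T j) ^ ls j)"
      using finite_space.card_list_span[OF fs_D LD(1) LD(3)] LD(2) by (intro prod.cong refl) simp
    then have "card {a \<in> colset (unit_vec_X m). ?A (unit_vec_X m) a} * (\<Prod>j\<in>J. card (T j) ^ ls j) * order_H
        = CARD('p) ^ (Suc e * n)"
      using card_good_column[OF LD(1) True u] card_colset[OF u] by (simp only:)
    from arg_cong[OF this, of real]
    have "real (card {a \<in> colset (unit_vec_X m). ?A (unit_vec_X m) a}) * ?Q * real order_H = real CARD('p) ^ (Suc e * n)"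
      by (simp only: of_nat_mult of_nat_prod of_nat_power card_T)
    moreover have "0 < ?Q"
      by (intro prod_pos zero_less_power ballI) (simp only: of_nat_0_less_iff zero_less_card_finite)
    then have "?Q \<noteq> 0" by linarith
    ultimately show "real (card {a \<in> colset (unit_vec_X m). ?A (unit_vec_X m) a}) = col_count / ?Q"
      using order_H_pos unfolding col_count_def by (simp add: field_simps)
  qed
  finally show ?thesis using True by simp
qed

text \<open>The indicator of \<open>ann j (columns a) = {0}\<close> is expanded by Moebius inversion
  for each \<open>j\<close>, and the sums are exchanged. If every list counted, the result would be
  the Euler product exactly; only the good ones do, and the right-hand side bounds what the others
  would have added.\<close>

theorem card_generating_columns:
  "\<bar>real (card {a \<in> column_families. \<forall>j\<in>J. ann j (columns a) = {0}})
      - col_count ^ n * (\<Prod>j\<in>J. \<Prod>k<n. 1 - 1 / q j ^ Suc k)\<bar>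
    \<le> col_count ^ n * kappa * (\<Prod>j\<in>J. \<Sum>i\<le>n. q j ^ i / q_fact (q j) i)"
proof -
  define IJ where "IJ = (\<Pi>\<^sub>E j\<in>J. {..n})"
  define w where "w j i = (- 1) ^ i / q_fact (q j) i" for j and i :: nat
  define W where "W ls = (\<Prod>j\<in>J. w j (ls j))" for ls
  define Q where "Q ls = (\<Prod>j\<in>J. q j ^ ls j)" for ls
  let ?A = "column_families"
  let ?ok = "\<lambda>a Ls. \<forall>j\<in>J. set (Ls j) \<subseteq> ann j (columns a)"
  have finA: "finite ?A" using finite_colset by (intro finite_PiE) auto
  have finIJ: "finite IJ" unfolding IJ_def using finite_J by (intro finite_PiE) auto
  have Q_pos: "0 < Q ls" for ls unfolding Q_def
    by (intro prod_pos zero_less_power ballI) (simp only: of_nat_0_less_iff zero_less_card_finite)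
  have psP: "(\<Prod>j\<in>J. \<Sum>i\<le>n. f j i) = (\<Sum>ls\<in>IJ. \<Prod>j\<in>J. f j (ls j))" for f :: "nat \<Rightarrow> nat \<Rightarrow> real"
    unfolding IJ_def using finite_J by (subst prod_sum_PiE) auto
  have ind: "of_bool (\<forall>j\<in>J. ann j (columns a) = {0}) = (\<Sum>ls\<in>IJ. W ls * (\<Sum>Ls\<in>all_lists ls. of_bool (?ok a Ls)))"
    if a: "a \<in> ?A" for a
  proof -
    have fs_ann: "finite_space (dact j) (ann j (columns a)) (I j) (T j)" if "j \<in> J" for j
      by (rule presentation.finite_space_ann[OF pres[OF that] columns_sub_K[OF a that]])
    have annD: "ann j (columns a) \<subseteq> D j" if j: "j \<in> J" for j
    proof -
      interpret p: presentation "H j" "act j" "P j" e n "g j" by (rule pres[OF j])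
      show ?thesis unfolding p.ann_def by blast
    qed
    have "of_bool (\<forall>j\<in>J. ann j (columns a) = {0}) = (\<Prod>j\<in>J. of_bool (ann j (columns a) = {0}) :: real)"
    proof (cases "\<forall>j\<in>J. ann j (columns a) = {0}")
      case True
      then have "(\<Prod>j\<in>J. of_bool (ann j (columns a) = {0}) :: real) = 1"
        by (intro prod.neutral ballI) (simp only: of_bool_eq simp_thms)
      then show ?thesis by (simp only: eqTrueI[OF True] of_bool_eq)
    next
      case False
      then obtain k where "k \<in> J" "ann k (columns a) \<noteq> {0}" by blast
      then have "(\<Prod>j\<in>J. of_bool (ann j (columns a) = {0}) :: real) = 0"
        by (intro prod_zero[OF finite_J] bexI[of _ k]) (simp_all only: of_bool_eq)
      then show ?thesis by (simp only: eq_False[THEN iffD2, OF False] of_bool_eq)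
    qed
    also have "\<dots> = (\<Prod>j\<in>J. \<Sum>i\<le>n. w j i * real (card (indep_lists (dact j) (ann j (columns a)) i)))"
    proof (rule prod.cong[OF refl])
      fix j assume j: "j \<in> J"
      have "card (ann j (columns a)) \<le> card (T j) ^ n"
        unfolding card_D[OF j, symmetric] by (intro card_mono annD j finite_space.finite_D[OF fs_D[OF j]])
      from finite_space.indep_lists_indicator[OF fs_ann[OF j] this]
      show "of_bool (ann j (columns a) = {0}) = (\<Sum>i\<le>n. w j i * real (card (indep_lists (dact j) (ann j (columns a)) i)))"
        unfolding w_def card_T by (rule sym)
    qed
    also have "\<dots> = (\<Sum>ls\<in>IJ. \<Prod>j\<in>J. w j (ls j) * real (card (indep_lists (dact j) (ann j (columns a)) (ls j))))"
      by (rule psP)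
    also have "\<dots> = (\<Sum>ls\<in>IJ. W ls * (\<Sum>Ls\<in>all_lists ls. of_bool (?ok a Ls)))"
    proof (rule sum.cong[OF refl])
      fix ls
      have "(\<Prod>j\<in>J. real (card (indep_lists (dact j) (ann j (columns a)) (ls j))))
          = real (card (\<Pi>\<^sub>E j\<in>J. indep_lists (dact j) (ann j (columns a)) (ls j)))"
        by (simp only: card_PiE[OF finite_J] of_nat_prod)
      also have "(\<Pi>\<^sub>E j\<in>J. indep_lists (dact j) (ann j (columns a)) (ls j)) = {Ls \<in> all_lists ls. ?ok a Ls}"
      proof -
        have "x \<in> indep_lists (dact j) (ann j (columns a)) i
            \<longleftrightarrow> x \<in> indep_lists (dact j) (D j) i \<and> set x \<subseteq> ann j (columns a)" if "j \<in> J" for j x i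
          unfolding indep_lists_def using annD[OF that] by blast
        then show ?thesis
          by (intro Set.set_eqI) (simp only: all_lists_def mem_Collect_eq PiE_iff cong: ball_cong, blast)
      qed
      also have "real (card {Ls \<in> all_lists ls. ?ok a Ls}) = (\<Sum>Ls\<in>all_lists ls. of_bool (?ok a Ls))"
        by (rule card_filter_of_bool[OF finite_all_lists])
      finally show "(\<Prod>j\<in>J. w j (ls j) * real (card (indep_lists (dact j) (ann j (columns a)) (ls j))))
          = W ls * (\<Sum>Ls\<in>all_lists ls. of_bool (?ok a Ls))"
        unfolding W_def by (simp only: prod.distrib)
    qed
    finally show ?thesis .
  qed
  have "real (card {a \<in> ?A. \<forall>j\<in>J. ann j (columns a) = {0}}) = (\<Sum>a\<in>?A. of_bool (\<forall>j\<in>J. ann j (columns a) = {0}))"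
    by (rule card_filter_of_bool[OF finA])
  also have "\<dots> = (\<Sum>a\<in>?A. \<Sum>ls\<in>IJ. W ls * (\<Sum>Ls\<in>all_lists ls. of_bool (?ok a Ls)))"
    by (rule sum.cong[OF refl ind])
  also have "\<dots> = (\<Sum>ls\<in>IJ. W ls * (\<Sum>a\<in>?A. \<Sum>Ls\<in>all_lists ls. of_bool (?ok a Ls)))"
    unfolding sum_distrib_left by (rule sum.swap)
  also have "\<dots> = (\<Sum>ls\<in>IJ. W ls * (real (card {Ls \<in> all_lists ls. good_lists Ls}) * (col_count / Q ls) ^ n))"
  proof (intro sum.cong refl arg_cong2[where f = "(*)"])
    fix ls
    have "(\<Sum>a\<in>?A. \<Sum>Ls\<in>all_lists ls. of_bool (?ok a Ls)) = (\<Sum>Ls\<in>all_lists ls. \<Sum>a\<in>?A. of_bool (?ok a Ls) :: real)"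
      by (rule sum.swap)
    also have "\<dots> = (\<Sum>Ls\<in>all_lists ls. of_bool (good_lists Ls) * (col_count / Q ls) ^ n)"
    proof (rule sum.cong[OF refl])
      fix Ls assume Ls: "Ls \<in> all_lists ls"
      have "(\<Sum>a\<in>?A. of_bool (?ok a Ls)) = real (card {a \<in> ?A. ?ok a Ls})"
        by (rule card_filter_of_bool[OF finA, symmetric])
      also have "\<dots> = of_bool (good_lists Ls) * (col_count / Q ls) ^ n"
        unfolding Q_def by (rule card_column_families_lists[OF Ls])
      finally show "(\<Sum>a\<in>?A. of_bool (?ok a Ls)) = of_bool (good_lists Ls) * (col_count / Q ls) ^ n" .
    qed
    also have "\<dots> = real (card {Ls \<in> all_lists ls. good_lists Ls}) * (col_count / Q ls) ^ n"
      unfolding sum_distrib_right[symmetric] card_filter_of_bool[OF finite_all_lists] ..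
    finally show "(\<Sum>a\<in>?A. \<Sum>Ls\<in>all_lists ls. of_bool (?ok a Ls))
        = real (card {Ls \<in> all_lists ls. good_lists Ls}) * (col_count / Q ls) ^ n" .
  qed
  finally have cnt: "real (card {a \<in> ?A. \<forall>j\<in>J. ann j (columns a) = {0}})
      = (\<Sum>ls\<in>IJ. W ls * (real (card {Ls \<in> all_lists ls. good_lists Ls}) * (col_count / Q ls) ^ n))" .
  have Dq: "real (card (D j)) = q j ^ n" if "j \<in> J" for j
    using card_D[OF that] card_T[of j] by (simp only: of_nat_power)
  have Qn: "Q ls ^ n = (\<Prod>j\<in>J. (q j ^ n) ^ ls j)" for ls
    unfolding Q_def prod_power_distrib by (intro prod.cong refl) (simp only: power_mult[symmetric] mult_ac)
  \<comment> \<open>The completed sum, over good and bad lists alike, is a product over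
    \<open>j\<close> of Euler's form of the q-binomial theorem.\<close>
  have main: "(\<Sum>ls\<in>IJ. W ls * (real (card (all_lists ls)) * (col_count / Q ls) ^ n))
      = col_count ^ n * (\<Prod>j\<in>J. \<Prod>k<n. 1 - 1 / q j ^ Suc k)"
  proof -
    have "(\<Prod>j\<in>J. \<Prod>k<n. 1 - 1 / q j ^ Suc k)
        = (\<Prod>j\<in>J. \<Sum>i\<le>n. w j i * ((\<Prod>k<i. q j ^ n - q j ^ k) / (q j ^ n) ^ i))"
      unfolding w_def using q_ge_2 by (intro prod.cong refl q_binomial_euler[symmetric]) fastforce
    also have "\<dots> = (\<Sum>ls\<in>IJ. \<Prod>j\<in>J. w j (ls j) * ((\<Prod>k<ls j. q j ^ n - q j ^ k) / (q j ^ n) ^ ls j))"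
      by (rule psP)
    also have "\<dots> = (\<Sum>ls\<in>IJ. W ls * (real (card (all_lists ls)) / Q ls ^ n))"
    proof (rule sum.cong[OF refl])
      fix ls
      have "real (card (all_lists ls)) = (\<Prod>j\<in>J. real (card (indep_lists (dact j) (D j) (ls j))))"
        unfolding all_lists_def by (simp only: card_PiE[OF finite_J] of_nat_prod)
      also have "\<dots> = (\<Prod>j\<in>J. \<Prod>k<ls j. q j ^ n - q j ^ k)"
        by (intro prod.cong refl) (simp only: finite_space.card_indep_lists[OF fs_D] Dq card_T)
      finally show "(\<Prod>j\<in>J. w j (ls j) * ((\<Prod>k<ls j. q j ^ n - q j ^ k) / (q j ^ n) ^ ls j))
          = W ls * (real (card (all_lists ls)) / Q ls ^ n)"
        unfolding W_def Qn by (simp only: prod.distrib prod_dividef)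
    qed
    finally show ?thesis by (simp add: sum_distrib_left power_divide mult_ac)
  qed
  have split: "real (card (all_lists ls)) - real (card {Ls \<in> all_lists ls. good_lists Ls})
      = real (card {Ls \<in> all_lists ls. \<not> good_lists Ls})" for ls
  proof -
    have "card (all_lists ls) = card ({Ls \<in> all_lists ls. good_lists Ls} \<union> {Ls \<in> all_lists ls. \<not> good_lists Ls})"
      by (rule arg_cong[where f = card]) blast
    also have "\<dots> = card {Ls \<in> all_lists ls. good_lists Ls} + card {Ls \<in> all_lists ls. \<not> good_lists Ls}"
      using finite_all_lists by (intro card_Un_disjoint) auto
    finally show ?thesis by simp
  qed
  have cc: "0 \<le> col_count" unfolding col_count_def by simp
  let ?bad = "\<lambda>ls. real (card {Ls \<in> all_lists ls. \<not> good_lists Ls})"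
  have "real (card {a \<in> ?A. \<forall>j\<in>J. ann j (columns a) = {0}})
      - col_count ^ n * (\<Prod>j\<in>J. \<Prod>k<n. 1 - 1 / q j ^ Suc k)
      = (\<Sum>ls\<in>IJ. W ls * (real (card {Ls \<in> all_lists ls. good_lists Ls}) * (col_count / Q ls) ^ n)
          - W ls * (real (card (all_lists ls)) * (col_count / Q ls) ^ n))"
    by (simp only: cnt main[symmetric] sum_subtractf)
  also have "\<dots> = (\<Sum>ls\<in>IJ. - (W ls * (?bad ls * (col_count / Q ls) ^ n)))"
  proof (rule sum.cong[OF refl])
    fix ls
    have "real (card (all_lists ls)) = real (card {Ls \<in> all_lists ls. good_lists Ls}) + ?bad ls"
      using split[of ls] by linarith
    then show "W ls * (real (card {Ls \<in> all_lists ls. good_lists Ls}) * (col_count / Q ls) ^ n)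
          - W ls * (real (card (all_lists ls)) * (col_count / Q ls) ^ n) = - (W ls * (?bad ls * (col_count / Q ls) ^ n))"
      by (simp only: distrib_left distrib_right)
  qed
  finally have "\<bar>real (card {a \<in> ?A. \<forall>j\<in>J. ann j (columns a) = {0}})
      - col_count ^ n * (\<Prod>j\<in>J. \<Prod>k<n. 1 - 1 / q j ^ Suc k)\<bar>
      = \<bar>\<Sum>ls\<in>IJ. W ls * (?bad ls * (col_count / Q ls) ^ n)\<bar>"
    by (simp only: sum_negf abs_minus_cancel)
  also have "\<dots> \<le> (\<Sum>ls\<in>IJ. \<bar>W ls * (real (card {Ls \<in> all_lists ls. \<not> good_lists Ls}) * (col_count / Q ls) ^ n)\<bar>)"
    by (rule sum_abs)
  also have "\<dots> \<le> (\<Sum>ls\<in>IJ. col_count ^ n * kappa * (\<Prod>j\<in>J. q j ^ ls j / q_fact (q j) (ls j)))"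
  proof (rule sum_mono)
    fix ls
    have "\<bar>w j (ls j)\<bar> = 1 / q_fact (q j) (ls j)" if "j \<in> J" for j
      using q_fact_pos[of "q j" "ls j"] q_ge_2[OF that] by (simp add: w_def abs_divide)
    then have W: "\<bar>W ls\<bar> = (\<Prod>j\<in>J. 1 / q_fact (q j) (ls j))"
      unfolding W_def abs_prod by (intro prod.cong refl)
    \<comment> \<open>The factor \<open>Q ls ^ n\<close> in the number of bad lists cancels against
      the chance \<open>Q ls ^ -n\<close> of annihilating \<open>n\<close> columns; one
      \<open>Q ls\<close> from the choice of coefficients remains.\<close>
    have "real (card {Ls \<in> all_lists ls. \<not> good_lists Ls}) \<le> Q ls * (kappa * Q ls ^ n)"
      using card_bad_lists[of ls] unfolding Q_def[symmetric] Qn by (simp only: Dq cong: prod.cong)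
    then have "real (card {Ls \<in> all_lists ls. \<not> good_lists Ls}) * (col_count / Q ls) ^ n
        \<le> Q ls * (kappa * Q ls ^ n) * (col_count / Q ls) ^ n"
      using cc Q_pos[of ls] by (intro mult_right_mono) auto
    also have "\<dots> = col_count ^ n * kappa * Q ls"
      using Q_pos[of ls] by (simp add: power_divide)
    finally have b: "real (card {Ls \<in> all_lists ls. \<not> good_lists Ls}) * (col_count / Q ls) ^ n \<le> col_count ^ n * kappa * Q ls" .
    have "\<bar>W ls * (real (card {Ls \<in> all_lists ls. \<not> good_lists Ls}) * (col_count / Q ls) ^ n)\<bar>
        = \<bar>W ls\<bar> * (real (card {Ls \<in> all_lists ls. \<not> good_lists Ls}) * (col_count / Q ls) ^ n)"
      using cc Q_pos[of ls] by (simp add: abs_mult)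
    also have "\<dots> \<le> \<bar>W ls\<bar> * (col_count ^ n * kappa * Q ls)" using b by (intro mult_left_mono) auto
    also have "\<dots> = col_count ^ n * kappa * (\<Prod>j\<in>J. q j ^ ls j / q_fact (q j) (ls j))"
      unfolding W Q_def by (simp add: prod_dividef mult_ac)
    finally show "\<bar>W ls * (real (card {Ls \<in> all_lists ls. \<not> good_lists Ls}) * (col_count / Q ls) ^ n)\<bar>
        \<le> col_count ^ n * kappa * (\<Prod>j\<in>J. q j ^ ls j / q_fact (q j) (ls j))" .
  qed
  also have "\<dots> = col_count ^ n * kappa * (\<Prod>j\<in>J. \<Sum>i\<le>n. q j ^ i / q_fact (q j) i)"
    by (simp only: psP[of "\<lambda>j i. q j ^ i / q_fact (q j) i"] sum_distrib_left)
  finally show ?thesis .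
qed

end

section \<open>Modules over \<open>R[t]/(P)\<close> as groups with an action of polynomials\<close>

definition pclass :: "'a::comm_ring_1 poly \<Rightarrow> 'a poly \<Rightarrow> 'a poly set" where
  "pclass P f = PIdl\<^bsub>class_ring\<^esub> P +>\<^bsub>class_ring\<^esub> f"

lemma poly_quot_simps:
  fixes P :: "'a::comm_ring_1 poly"
  shows "carrier (poly_quot P) = range (pclass P)" "\<one>\<^bsub>poly_quot P\<^esub> = pclass P 1"
    "pclass P f \<oplus>\<^bsub>poly_quot P\<^esub> pclass P g = pclass P (f + g)"
    "pclass P f \<otimes>\<^bsub>poly_quot P\<^esub> pclass P g = pclass P (f * g)"
    "pclass P P = \<zero>\<^bsub>poly_quot P\<^esub>"
proof -
  let ?J = "PIdl\<^bsub>class_ring\<^esub> P"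
  interpret J: ideal ?J "class_ring :: 'a poly ring"
    by (rule cring.cgenideal_ideal) (simp_all add: class_cring.cring_axioms)
  show "carrier (poly_quot P) = range (pclass P)" "\<one>\<^bsub>poly_quot P\<^esub> = pclass P 1"
    "pclass P f \<oplus>\<^bsub>poly_quot P\<^esub> pclass P g = pclass P (f + g)"
    "pclass P f \<otimes>\<^bsub>poly_quot P\<^esub> pclass P g = pclass P (f * g)"
    using J.a_rcos_sum[of f g] J.rcoset_mult_add[of f g]
    by (auto simp: pclass_def poly_quot_def FactRing_def A_RCOSETS_def RCOSETS_def a_r_coset_def)
  have "\<exists>x. P = x * P" by (rule exI[of _ 1]) simp
  then have "P \<in> ?J" by (simp add: cgenideal_def)
  then have "pclass P P = ?J" unfolding pclass_def by (rule J.a_rcos_const)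
  then show "pclass P P = \<zero>\<^bsub>poly_quot P\<^esub>" by (simp add: poly_quot_def FactRing_def)
qed

definition pact :: "'a::comm_ring_1 poly \<Rightarrow> ('a poly set, 'h) module \<Rightarrow> 'a poly \<Rightarrow> 'h \<Rightarrow> 'h" where
  "pact P H f h = pclass P f \<odot>\<^bsub>H\<^esub> h"

lemma pact_module:
  fixes H :: "('a::comm_ring_1 poly set, 'h) module"
  assumes "Module.module (poly_quot P) H" and h: "h \<in> carrier H"
  shows "pact P H f h \<in> carrier H"
    "pact P H (f + g) h = pact P H f h \<oplus>\<^bsub>H\<^esub> pact P H g h"
    "h' \<in> carrier H \<Longrightarrow> pact P H f (h \<oplus>\<^bsub>H\<^esub> h') = pact P H f h \<oplus>\<^bsub>H\<^esub> pact P H f h'"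
    "pact P H (f * g) h = pact P H f (pact P H g h)"
    "pact P H 1 h = h" "pact P H P h = \<zero>\<^bsub>H\<^esub>"
proof -
  interpret m: Module.module "poly_quot P" H by fact
  have c: "pclass P f \<in> carrier (poly_quot P)" for f by (simp add: poly_quot_simps(1))
  show "pact P H f h \<in> carrier H" unfolding pact_def by (rule m.smult_closed[OF c h])
  show "pact P H (f + g) h = pact P H f h \<oplus>\<^bsub>H\<^esub> pact P H g h"
    unfolding pact_def poly_quot_simps(3)[symmetric] by (rule m.smult_l_distr[OF c c h])
  show "pact P H f (h \<oplus>\<^bsub>H\<^esub> h') = pact P H f h \<oplus>\<^bsub>H\<^esub> pact P H f h'" if "h' \<in> carrier H"
    unfolding pact_def by (rule m.smult_r_distr[OF c h that])
  show "pact P H (f * g) h = pact P H f (pact P H g h)"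
    unfolding pact_def poly_quot_simps(4)[symmetric] by (rule m.smult_assoc1[OF c c h])
  show "pact P H 1 h = h" unfolding pact_def poly_quot_simps(2)[symmetric] by (rule m.smult_one[OF h])
  show "pact P H P h = \<zero>\<^bsub>H\<^esub>" unfolding pact_def poly_quot_simps(5) by (rule m.smult_l_null[OF h])
qed

text \<open>The order of a finite group annihilates it, and the factor of the order prime to
  \<open>p\<close> is a unit of the p-adic integers, so the \<open>p\<close>-part alone
  annihilates.\<close>

lemma pact_p_power:
  fixes H :: "('p::prime_card padic_int poly set, 'h) module"
  assumes M: "Module.module (poly_quot P) H" and fin: "finite (carrier H)"
  shows "\<exists>e0. \<forall>e\<ge>e0. \<forall>h\<in>carrier H. pact P H (pconst e) h = \<zero>\<^bsub>H\<^esub>"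
proof -
  interpret m: Module.module "poly_quot P" H by fact
  note pm = pact_module[OF M]
  have zero: "pact P H f \<zero>\<^bsub>H\<^esub> = \<zero>\<^bsub>H\<^esub>" for f
    unfolding pact_def by (rule m.smult_r_null) (simp add: poly_quot_simps(1))
  have nat: "pact P H (of_nat k) h = h [^]\<^bsub>add_monoid H\<^esub> k" if h: "h \<in> carrier H" for k :: nat and h
  proof (induction k)
    case 0
    have "pact P H 0 h \<oplus>\<^bsub>H\<^esub> pact P H 0 h = pact P H 0 h" using pm(2)[OF h, of 0 0] by simp
    then have "pact P H 0 h = \<zero>\<^bsub>H\<^esub>" using pm(1)[OF h, of 0] by (metis m.add.r_cancel_one)
    then show ?case by simp
  next
    case (Suc k)
    have "pact P H (of_nat k + 1) h = pact P H (of_nat k) h \<oplus>\<^bsub>H\<^esub> h"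
      unfolding pm(2)[OF h] pm(5)[OF h] ..
    then show ?case using Suc by (simp add: add.commute nat_pow_def)
  qed
  define k where "k = card (carrier H)"
  have kill: "pact P H (of_nat k) h = \<zero>\<^bsub>H\<^esub>" if "h \<in> carrier H" for h
    unfolding nat[OF that] k_def using group.pow_order_eq_1[OF m.a_group, of h] that by (simp add: order_def)
  have "k \<noteq> 0" unfolding k_def using fin m.zero_closed by auto
  then obtain e0 k' where k': "k = CARD('p) ^ e0 * k'" "\<not> CARD('p) dvd k'"
    using multiplicity_decompose'[of k "CARD('p)"] prime_card[where 'a = 'p] by (metis not_prime_unit)
  have "padic_reduce (of_nat k' :: 'p padic_int) \<noteq> 0"
    using k'(2) by (simp add: padic_reduce.hom_of_nat of_nat_eq_0_iff_char_dvd)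
  then obtain u :: "'p padic_int" where u: "of_nat k' * u = 1" using padic_unit by blast
  have "pact P H (pconst e) h = \<zero>\<^bsub>H\<^esub>" if e: "e0 \<le> e" and h: "h \<in> carrier H" for e h
  proof -
    have "(padic_p :: 'p padic_int) ^ e = padic_p ^ (e - e0) * u * of_nat k"
      unfolding k' of_nat_mult of_nat_power using u e
      by (metis (no_types, lifting) le_add_diff_inverse2 mult.commute mult.left_commute mult_1 power_add)
    then have "pconst e = [:padic_p ^ (e - e0) * u:] * of_nat k" by (simp add: of_nat_poly)
    then show ?thesis using pm(4)[OF h, of "[:padic_p ^ (e - e0) * u:]" "of_nat k"] kill[OF h] zero by simp
  qed
  then show ?thesis by blast
qed

lemma quot_module_pact:
  fixes H :: "('p::prime_card padic_int poly set, 'h) module"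
  assumes M: "Module.module (poly_quot P) H" and "finite (carrier H)"
    and "\<And>h. h \<in> carrier H \<Longrightarrow> pact P H (pconst e) h = \<zero>\<^bsub>H\<^esub>"
    and "lead_coeff P = 1" "irreducible (reduce_poly P)"
  shows "quot_module H (pact P H) P e"
proof -
  interpret m: Module.module "poly_quot P" H by fact
  show ?thesis
  proof (intro quot_module.intro quot_module_axioms.intro)
    show "abelian_group H" by (rule m.abelian_group_axioms)
  qed (rule assms(2-5) pact_module[OF M]; assumption)+
qed

section \<open>Cokernels via vectors of polynomials\<close>

lemma submodule_Int: "submodule_set U \<Longrightarrow> submodule_set V \<Longrightarrow> submodule_set (U \<inter> V)"
  unfolding submodule_set_def by (auto intro: additive_closed_Int)

definition const_pvec :: "nat \<Rightarrow> 'p::prime_card padic_int vec \<Rightarrow> 'p pvec" where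
  "const_pvec n v = (\<lambda>i. if i < n then [:v $ i:] else 0)"

text \<open>Substitution of \<open>A\<close> for \<open>t\<close>, that is, the sum of the
  \<open>x i (A) e_i\<close>. It identifies \<open>L\<close> modulo the columns of
  \<open>t - A\<close> with \<open>\<int>\<^sub>p^n\<close>, where \<open>t\<close> acts as
  \<open>A\<close>.\<close>

definition eval_pvec :: "'p::prime_card padic_int mat \<Rightarrow> 'p pvec \<Rightarrow> 'p padic_int vec" where
  "eval_pvec A x = Matrix.vec (dim_row A) (\<lambda>k. \<Sum>i<dim_row A. poly_mat_eval (x i) A $$ (k, i))"

definition mat_columns :: "nat \<Rightarrow> 'p::prime_card padic_int mat \<Rightarrow> nat \<Rightarrow> 'p pvec" where
  "mat_columns n A m = const_pvec n (Matrix.col A m)"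

lemma const_pvec_in: "const_pvec n v \<in> const_vecs n"
  by (auto simp: const_pvec_def const_vecs_def pvecs_def below_degree_def coeff_pCons split: nat.splits)

lemma const_pvec_diff:
  assumes "v \<in> carrier_vec n" "w \<in> carrier_vec n"
  shows "const_pvec n (v - w) = const_pvec n v - const_pvec n w"
  by (rule ext) (use assms in \<open>simp add: const_pvec_def\<close>)

lemma const_pvec_add:
  assumes "v \<in> carrier_vec n" "w \<in> carrier_vec n"
  shows "const_pvec n (v + w) = const_pvec n v + const_pvec n w"
  by (rule ext) (use assms in \<open>simp add: const_pvec_def\<close>)

lemma const_vecs_eq_image:
  assumes "x \<in> const_vecs n"
  shows "\<exists>v\<in>carrier_vec n. x = const_pvec n v"
proof -
  obtain a where a: "x = (\<lambda>i. [:a i:])" using const_vecs_const[OF assms] by blast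
  have "x = const_pvec n (Matrix.vec n a)"
  proof
    fix i
    show "x i = const_pvec n (Matrix.vec n a) i"
      using assms a by (cases "i < n") (auto simp: const_pvec_def const_vecs_def pvecs_def)
  qed
  then show ?thesis by (intro bexI[of _ "Matrix.vec n a"]) auto
qed

context
  fixes A :: "'p::prime_card padic_int mat" and n :: nat
  assumes A: "A \<in> carrier_mat n n"
begin

lemma eval_pvec_carrier: "eval_pvec A x \<in> carrier_vec n"
  using A by (simp add: eval_pvec_def)

lemma eval_pvec_index: "k < n \<Longrightarrow> eval_pvec A x $ k = (\<Sum>i<n. poly_mat_eval (x i) A $$ (k, i))"
  using A by (simp add: eval_pvec_def)

lemma eval_pvec_add: "eval_pvec A (x + y) = eval_pvec A x + eval_pvec A y"
proof (rule eq_vecI)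
  show "dim_vec (eval_pvec A (x + y)) = dim_vec (eval_pvec A x + eval_pvec A y)"
    by (simp add: eval_pvec_def)
  fix k assume "k < dim_vec (eval_pvec A x + eval_pvec A y)"
  then have k: "k < n" using eval_pvec_carrier[of y] by simp
  have "eval_pvec A (x + y) $ k = (\<Sum>i<n. poly_mat_eval (x i + y i) A $$ (k, i))"
    unfolding eval_pvec_index[OF k] by simp
  also have "\<dots> = (\<Sum>i<n. poly_mat_eval (x i) A $$ (k, i) + poly_mat_eval (y i) A $$ (k, i))"
    using k carrier_matD[OF poly_mat_eval_carrier[OF A]]
    by (intro sum.cong refl) (simp add: poly_mat_eval_add[OF A])
  also have "\<dots> = eval_pvec A x $ k + eval_pvec A y $ k"
    unfolding eval_pvec_index[OF k] by (rule sum.distrib)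
  finally show "eval_pvec A (x + y) $ k = (eval_pvec A x + eval_pvec A y) $ k"
    using k eval_pvec_carrier[of y] by simp
qed

lemma eval_pvec_vsmult: "eval_pvec A (vsmult f x) = poly_mat_eval f A *\<^sub>v eval_pvec A x"
proof (rule eq_vecI)
  have f: "poly_mat_eval f A \<in> carrier_mat n n" by (rule poly_mat_eval_carrier[OF A])
  show "dim_vec (eval_pvec A (vsmult f x)) = dim_vec (poly_mat_eval f A *\<^sub>v eval_pvec A x)"
    using f eval_pvec_carrier[of "vsmult f x"] by simp
  fix k assume "k < dim_vec (poly_mat_eval f A *\<^sub>v eval_pvec A x)"
  then have k: "k < n" using f by simp
  have e: "poly_mat_eval (f * x i) A $$ (k, i) = (\<Sum>l<n. poly_mat_eval f A $$ (k, l) * poly_mat_eval (x i) A $$ (l, i))"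
    if "i < n" for i
    unfolding poly_mat_eval_mult[OF A]
    using k that f poly_mat_eval_carrier[OF A, of "x i"] by (simp add: scalar_prod_def atLeast0LessThan)
  have "eval_pvec A (vsmult f x) $ k = (\<Sum>i<n. \<Sum>l<n. poly_mat_eval f A $$ (k, l) * poly_mat_eval (x i) A $$ (l, i))"
    unfolding eval_pvec_index[OF k] by (intro sum.cong refl) (simp add: e)
  also have "\<dots> = (\<Sum>l<n. poly_mat_eval f A $$ (k, l) * eval_pvec A x $ l)"
    by (subst sum.swap) (simp add: eval_pvec_index sum_distrib_left)
  also have "\<dots> = (poly_mat_eval f A *\<^sub>v eval_pvec A x) $ k"
    using k f eval_pvec_carrier[of x] by (simp add: scalar_prod_def atLeast0LessThan)
  finally show "eval_pvec A (vsmult f x) $ k = (poly_mat_eval f A *\<^sub>v eval_pvec A x) $ k" .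
qed

lemma eval_pvec_diff: "eval_pvec A (x - y) = eval_pvec A x - eval_pvec A y"
proof -
  have "eval_pvec A x = eval_pvec A (x - y) + eval_pvec A y"
    unfolding eval_pvec_add[symmetric] diff_add_cancel ..
  then show ?thesis using eval_pvec_carrier[of y] eval_pvec_carrier[of "x - y"] by (intro eq_vecI) auto
qed

lemma poly_mat_eval_const: "poly_mat_eval [:c:] A = c \<cdot>\<^sub>m 1\<^sub>m n"
proof -
  have "[:c:] = Polynomial.smult c 1" by simp
  then show ?thesis by (simp only: poly_mat_eval_smult[OF A] poly_mat_eval_1[OF A])
qed

lemma eval_pvec_const:
  assumes "v \<in> carrier_vec n"
  shows "eval_pvec A (const_pvec n v) = v"
proof (rule eq_vecI)
  fix k assume "k < dim_vec v"
  then have k: "k < n" using assms by simp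
  have "eval_pvec A (const_pvec n v) $ k = (\<Sum>i<n. if i = k then v $ k else 0)"
    unfolding eval_pvec_index[OF k]
    using k by (intro sum.cong refl) (auto simp: const_pvec_def poly_mat_eval_const)
  then show "eval_pvec A (const_pvec n v) $ k = v $ k" using k by simp
qed (use assms eval_pvec_carrier[of "const_pvec n v"] in simp)

lemma eval_pvec_unit:
  assumes m: "m < n"
  shows "eval_pvec A (unit_vec_X m) = Matrix.col A m"
proof (rule eq_vecI)
  fix k assume "k < dim_vec (Matrix.col A m)"
  then have k: "k < n" using A by simp
  have "eval_pvec A (unit_vec_X m) $ k = (\<Sum>i<n. if i = m then A $$ (k, m) else 0)"
    unfolding eval_pvec_index[OF k]
    using k by (intro sum.cong refl) (auto simp: unit_vec_X_def poly_mat_eval_X[OF A] poly_mat_eval_0[OF A])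
  then show "eval_pvec A (unit_vec_X m) $ k = Matrix.col A m $ k" using k m A by simp
qed (use A eval_pvec_carrier[of "unit_vec_X m"] in simp)

lemma mat_columns_in: "mat_columns n A m \<in> const_vecs n"
  unfolding mat_columns_def by (rule const_pvec_in)

lemma eval_pvec_columns:
  assumes "m < n"
  shows "eval_pvec A (unit_vec_X m - mat_columns n A m) = 0\<^sub>v n"
proof -
  have "Matrix.col A m \<in> carrier_vec n" using A assms by auto
  then show ?thesis
    unfolding eval_pvec_diff eval_pvec_unit[OF assms] mat_columns_def by (simp add: eval_pvec_const)
qed

lemma submodule_eval_kernel: "submodule_set {x. eval_pvec A x = 0\<^sub>v n}"
proof -
  have "eval_pvec A 0 = 0\<^sub>v n"
    using A by (intro eq_vecI) (auto simp: eval_pvec_def poly_mat_eval_0[OF A])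
  moreover have "poly_mat_eval f A *\<^sub>v 0\<^sub>v n = 0\<^sub>v n" for f
    using poly_mat_eval_carrier[OF A, of f] by (intro eq_vecI) auto
  ultimately show ?thesis
    by (simp add: submodule_set_def additive_closed_def eval_pvec_diff eval_pvec_vsmult)
qed

text \<open>All columns survive when \<open>U\<close> is cut down to the kernel of the substitution;
  modulo this smaller submodule the constant congruent to \<open>x\<close> can only be the value of
  \<open>x\<close> at \<open>A\<close>.\<close>

lemma reduce_to_const:
  assumes U: "submodule_set U" "\<And>m. m < n \<Longrightarrow> unit_vec_X m - mat_columns n A m \<in> U" and x: "x \<in> pvecs n"
  shows "x - const_pvec n (eval_pvec A x) \<in> U"
proof -
  let ?U = "U \<inter> {x. eval_pvec A x = 0\<^sub>v n}"
  have sub: "submodule_set ?U" by (rule submodule_Int[OF U(1) submodule_eval_kernel])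
  have col: "unit_vec_X m - mat_columns n A m \<in> ?U" if "m < n" for m
    using U(2)[OF that] eval_pvec_columns[OF that] by blast
  obtain v where v: "v \<in> const_vecs n" "x - v \<in> ?U"
    using const_vecs_modulo_columns[where n = n and a = "mat_columns n A", OF mat_columns_in sub col x] by blast
  obtain w where w: "w \<in> carrier_vec n" "v = const_pvec n w" using const_vecs_eq_image[OF v(1)] by blast
  have "eval_pvec A (x - v) = 0\<^sub>v n" using v(2) by blast
  then have "eval_pvec A x - eval_pvec A v = 0\<^sub>v n" by (simp only: eval_pvec_diff)
  then have e: "eval_pvec A x - w = 0\<^sub>v n" unfolding w(2) eval_pvec_const[OF w(1)] .
  have "eval_pvec A x = w"
  proof (rule eq_vecI)
    fix i assume "i < dim_vec w"
    then have i: "i < n" using w(1) by simp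
    then have "(eval_pvec A x - w) $ i = 0" unfolding e by simp
    then show "eval_pvec A x $ i = w $ i" using i w(1) eval_pvec_carrier[of x] by simp
  qed (use w(1) eval_pvec_carrier[of x] in simp)
  then show ?thesis using v(2) w(2) by blast
qed

end

section \<open>Nakayama's lemma for matrices over the p-adic integers\<close>

lemma mat_unit_mod_p:
  fixes C :: "'p::prime_card padic_int mat"
  assumes C: "C \<in> carrier_mat n n"
  shows "\<exists>W\<in>carrier_mat n n. (1\<^sub>m n - padic_p \<cdot>\<^sub>m C) * W = 1\<^sub>m n"
proof -
  let ?B = "1\<^sub>m n - padic_p \<cdot>\<^sub>m C"
  have B: "?B \<in> carrier_mat n n" using C by auto
  have p0: "padic_reduce (padic_p * c) = 0" for c :: "'p padic_int"
    unfolding padic_reduce_eq_0_iff by blast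
  have "map_mat padic_reduce ?B = 1\<^sub>m n"
    using C by (intro eq_matI) (auto simp: padic_reduce.hom_minus p0)
  \<comment> \<open>So the determinant is a unit, and the adjugate yields the inverse.\<close>
  then have "padic_reduce (det ?B) = 1" by (metis padic_reduce.hom_det det_one)
  then obtain y where y: "det ?B * y = 1" using padic_unit[of "det ?B"] by auto
  have "?B * (y \<cdot>\<^sub>m adj_mat ?B) = y \<cdot>\<^sub>m (?B * adj_mat ?B)"
    by (rule mult_smult_distrib[OF B adj_mat(1)[OF B]])
  also have "\<dots> = y \<cdot>\<^sub>m (det ?B \<cdot>\<^sub>m 1\<^sub>m n)" by (simp only: adj_mat(2)[OF B])
  also have "\<dots> = 1\<^sub>m n" using y by (intro eq_matI) (auto simp: mult.commute)
  finally show ?thesis using adj_mat(1)[OF B] by (intro bexI[of _ "y \<cdot>\<^sub>m adj_mat ?B"]) auto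
qed

text \<open>The error matrix \<open>C\<close> is absorbed by inverting \<open>1 - p C\<close>.\<close>

lemma nakayama_vec:
  fixes M :: "'p::prime_card padic_int mat"
  assumes M: "M \<in> carrier_mat n n"
    and step: "\<And>w. w \<in> carrier_vec n \<Longrightarrow> \<exists>u\<in>carrier_vec n. \<exists>c\<in>carrier_vec n.
      padic_p ^ e \<cdot>\<^sub>v w = M *\<^sub>v u + padic_p ^ Suc e \<cdot>\<^sub>v c"
    and w: "w \<in> carrier_vec n"
  shows "\<exists>u\<in>carrier_vec n. padic_p ^ e \<cdot>\<^sub>v w = M *\<^sub>v u"
proof -
  have "\<forall>m. \<exists>uc. m < n \<longrightarrow> fst uc \<in> carrier_vec n \<and> snd uc \<in> carrier_vec n \<and>
      padic_p ^ e \<cdot>\<^sub>v unit_vec n m = M *\<^sub>v fst uc + padic_p ^ Suc e \<cdot>\<^sub>v snd uc"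
    using step[OF unit_vec_carrier] by (metis fst_conv snd_conv)
  from choice[OF this] obtain f where f: "\<And>m. m < n \<Longrightarrow> fst (f m) \<in> carrier_vec n"
    "\<And>m. m < n \<Longrightarrow> snd (f m) \<in> carrier_vec n"
    "\<And>m. m < n \<Longrightarrow> padic_p ^ e \<cdot>\<^sub>v unit_vec n m = M *\<^sub>v fst (f m) + padic_p ^ Suc e \<cdot>\<^sub>v snd (f m)" by blast
  define U where "U = mat n n (\<lambda>(i, m). fst (f m) $ i)"
  define C where "C = mat n n (\<lambda>(i, m). snd (f m) $ i)"
  have UC: "U \<in> carrier_mat n n" "C \<in> carrier_mat n n" unfolding U_def C_def by auto
  have col: "Matrix.col U m = fst (f m)" "Matrix.col C m = snd (f m)" if "m < n" for m
    using f(1,2)[OF that] that by (auto simp: U_def C_def intro!: eq_vecI)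
  \<comment> \<open>The relations for the unit vectors are the columns of a single matrix
    equation.\<close>
  have eq: "padic_p ^ e \<cdot>\<^sub>m (1\<^sub>m n - padic_p \<cdot>\<^sub>m C) = M * U"
  proof (rule eq_matI)
    fix i m assume "i < dim_row (M * U)" "m < dim_col (M * U)"
    then have im: "i < n" "m < n" using M UC by auto
    have MU: "(M * U) $$ (i, m) = (M *\<^sub>v fst (f m)) $ i" using im M UC by (simp add: col)
    have "(padic_p ^ e \<cdot>\<^sub>v unit_vec n m :: 'p padic_int vec) $ i = (M *\<^sub>v fst (f m) + padic_p ^ Suc e \<cdot>\<^sub>v snd (f m)) $ i"
      by (simp only: f(3)[OF im(2)])
    then have "padic_p ^ e * (if i = m then 1 else 0) = (M *\<^sub>v fst (f m)) $ i + padic_p ^ Suc e * snd (f m) $ i"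
      using im f(2)[OF im(2)] M by (simp add: unit_vec_def)
    moreover have "C $$ (i, m) = snd (f m) $ i" using im by (simp add: C_def)
    ultimately show "(padic_p ^ e \<cdot>\<^sub>m (1\<^sub>m n - padic_p \<cdot>\<^sub>m C)) $$ (i, m) = (M * U) $$ (i, m)"
      unfolding MU using im UC by (simp add: right_diff_distrib mult.commute mult.left_commute)
  qed (use M UC in auto)
  obtain W where W: "W \<in> carrier_mat n n" "(1\<^sub>m n - padic_p \<cdot>\<^sub>m C) * W = 1\<^sub>m n"
    using mat_unit_mod_p[OF UC(2)] by blast
  have iC: "1\<^sub>m n - padic_p \<cdot>\<^sub>m C \<in> carrier_mat n n" using UC(2) by auto
  have "padic_p ^ e \<cdot>\<^sub>m 1\<^sub>m n = (padic_p ^ e \<cdot>\<^sub>m (1\<^sub>m n - padic_p \<cdot>\<^sub>m C)) * W"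
    unfolding mult_smult_assoc_mat[OF iC W(1)] W(2) ..
  also have "\<dots> = M * (U * W)" unfolding eq by (rule assoc_mult_mat[OF M UC(1) W(1)])
  finally have e1: "padic_p ^ e \<cdot>\<^sub>m 1\<^sub>m n = M * (U * W)" .
  have "padic_p ^ e \<cdot>\<^sub>v w = (padic_p ^ e \<cdot>\<^sub>m 1\<^sub>m n) *\<^sub>v w"
    using w by (intro eq_vecI) (auto simp: scalar_prod_smult_left)
  also have "\<dots> = M *\<^sub>v ((U * W) *\<^sub>v w)" unfolding e1 using M UC W w by (intro assoc_mult_mat_vec) auto
  finally show ?thesis using UC W w by (intro bexI[of _ "(U * W) *\<^sub>v w"]) auto
qed

section \<open>Tuples that present the cokernel\<close>

locale presented_cokernel =
  presentation H "pact P H" P e n g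
  for H :: "('p::prime_card padic_int poly set, 'h) module" (structure)
    and P :: "'p padic_int poly" and e n :: nat and g :: "nat \<Rightarrow> 'h" +
  fixes A :: "'p padic_int mat"
  assumes A: "A \<in> carrier_mat n n"
begin

abbreviation "pm f \<equiv> poly_mat_eval f A"
abbreviation "evA \<equiv> eval_pvec A"
abbreviation "cv \<equiv> const_pvec n"
abbreviation "colsA \<equiv> (\<lambda>m. unit_vec_X m - mat_columns n A m) ` {..<n}"

text \<open>In this order: the map given by \<open>g\<close> descends to the cokernel, it is onto,
  and it is injective, the last being expressed as generation modulo \<open>N\<close>.\<close>

definition solves :: bool where
  "solves \<longleftrightarrow> colsA \<subseteq> K \<and> carrier H \<subseteq> lmap ` const_vecs n \<and> generates colsA"

text \<open>The kernel of the map restricted to constants, seen in \<open>\<int>\<^sub>p^n\<close>;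
  it is to be identified with the range of \<open>P(A)\<close>.\<close>

definition Kv :: "'p padic_int vec set" where
  "Kv = {v \<in> carrier_vec n. lmap (cv v) = \<zero>}"

lemma pm_carrier: "pm f \<in> carrier_mat n n"
  by (rule poly_mat_eval_carrier[OF A])

lemma pm_smult: "v \<in> carrier_vec n \<Longrightarrow> pm f *\<^sub>v (c \<cdot>\<^sub>v v) = c \<cdot>\<^sub>v (pm f *\<^sub>v v)"
  using pm_carrier[of f] by (intro eq_vecI) auto

lemma pm_zero: "pm f *\<^sub>v 0\<^sub>v n = 0\<^sub>v n"
  using pm_carrier[of f] by (intro eq_vecI) auto

lemmas ev_simps = eval_pvec_add[OF A] eval_pvec_diff[OF A] eval_pvec_vsmult[OF A] eval_pvec_const[OF A]

lemma ev_carrier: "evA x \<in> carrier_vec n"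
  by (rule eval_pvec_carrier[OF A])

lemma cv_pvecs: "cv v \<in> pvecs n"
  using const_pvec_in unfolding const_vecs_def by blast

text \<open>A vector and its value at \<open>A\<close> are congruent modulo any submodule containing
  the columns, in particular modulo \<open>K\<close>.\<close>

lemma lmap_ev:
  assumes "colsA \<subseteq> K" "x \<in> pvecs n"
  shows "lmap (cv (evA x)) = lmap x"
proof -
  have "unit_vec_X m - mat_columns n A m \<in> K" if "m < n" for m using assms(1) that by blast
  then have "x - cv (evA x) \<in> K" by (rule reduce_to_const[OF A submodule_K _ assms(2)])
  then have "lmap (x - cv (evA x)) = \<zero>" unfolding K_def by blast
  then show ?thesis unfolding lmap_eq_iff[symmetric] by (rule sym)
qed

lemma lmap_pm:
  assumes "colsA \<subseteq> K" "v \<in> carrier_vec n"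
  shows "lmap (cv (pm f *\<^sub>v v)) = pact P H f (lmap (cv v))"
proof -
  have "evA (vsmult f (cv v)) = pm f *\<^sub>v v" by (simp only: ev_simps(3) ev_simps(4)[OF assms(2)])
  then have "lmap (cv (pm f *\<^sub>v v)) = lmap (vsmult f (cv v))"
    using lmap_ev[OF assms(1) submodule_setD(2)[OF submodule_pvecs cv_pvecs]] by metis
  then show ?thesis by (simp only: lmap_vsmult)
qed

text \<open>Generation gives \<open>Kv = P(A) \<int>\<^sub>p^n + p Kv\<close>, which iterates to
  every power of \<open>p\<close>. As \<open>p^e \<int>\<^sub>p^n\<close> lies in \<open>Kv\<close>,
  enough iterations express \<open>p^e w\<close> by the range of \<open>P(A)\<close> up to a
  multiple of \<open>p^(e+1)\<close>, and that error is absorbed by inverting a matrix congruent to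
  1 modulo \<open>p\<close>.\<close>

lemma Kv_iff_range:
  assumes "solves" "v \<in> carrier_vec n"
  shows "lmap (cv v) = \<zero> \<longleftrightarrow> (\<exists>u\<in>carrier_vec n. v = pm P *\<^sub>v u)"
proof
  have cK: "colsA \<subseteq> K" and gen: "generates colsA" using assms(1) unfolding solves_def by blast+
  show "lmap (cv v) = \<zero>" if "\<exists>u\<in>carrier_vec n. v = pm P *\<^sub>v u"
    using that lmap_pm[OF cK] act_P lmap_closed by auto
  have Kv_pm: "pm f *\<^sub>v k \<in> Kv" if "k \<in> Kv" for f k
    using that lmap_pm[OF cK, of k f] mult_mat_vec_carrier[OF pm_carrier] unfolding Kv_def
    by (auto simp: act_zero_right)
  have ev_Kv: "evA k \<in> Kv" if "k \<in> K" for k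
    using that lmap_ev[OF cK, of k] ev_carrier unfolding Kv_def K_def by auto
  have Kv_diff: "k - k' \<in> Kv" if "k \<in> Kv" "k' \<in> Kv" for k k'
  proof -
    have c: "k \<in> carrier_vec n" "k' \<in> carrier_vec n" and z: "lmap (cv k) = lmap (cv k')"
      using that unfolding Kv_def by auto
    have "lmap (cv (k - k')) = \<zero>" unfolding const_pvec_diff[OF c] using z lmap_eq_iff by blast
    then show ?thesis unfolding Kv_def using c by auto
  qed
  note dist = mult_add_distrib_mat_vec[OF pm_carrier]
  \<comment> \<open>Vectors whose value at \<open>A\<close> lies in the range of \<open>P(A)\<close>
    up to \<open>p Kv\<close>; the columns have value 0, so generation applies to this
    submodule.\<close>
  define U where "U = {x \<in> pvecs n. \<exists>u\<in>carrier_vec n. \<exists>k\<in>Kv. evA x = pm P *\<^sub>v u + padic_p \<cdot>\<^sub>v k}"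
  have KvC: "k \<in> carrier_vec n" if "k \<in> Kv" for k using that unfolding Kv_def by blast
  have zero_Kv: "0\<^sub>v n \<in> Kv" using ev_Kv[OF K_add(1)] ev_Kv[OF K_add(1)] Kv_diff[of "evA 0" "evA 0"] ev_carrier[of 0] by simp
  have zero_ev: "x \<in> U" if "x \<in> pvecs n" "evA x = 0\<^sub>v n" for x
  proof -
    have "evA x = pm P *\<^sub>v 0\<^sub>v n + padic_p \<cdot>\<^sub>v 0\<^sub>v n" unfolding that(2) pm_zero by (intro eq_vecI) auto
    then show ?thesis unfolding U_def using that(1) zero_Kv zero_carrier_vec by blast
  qed
  have "submodule_set U"
    unfolding submodule_set_def additive_closed_def
  proof (intro conjI ballI allI)
    show "0 \<in> U"
      using submodule_setD(1)[OF submodule_eval_kernel[OF A]] additive_closedD(1) additive_closedD(1)[OF additive_closed_pvecs]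
      by (intro zero_ev) blast+
    fix x assume "x \<in> U"
    then obtain u k where x: "x \<in> pvecs n" "u \<in> carrier_vec n" "k \<in> Kv" "evA x = pm P *\<^sub>v u + padic_p \<cdot>\<^sub>v k"
      unfolding U_def by blast
    show "vsmult f x \<in> U" for f
    proof -
      have "evA (vsmult f x) = pm f *\<^sub>v (pm P *\<^sub>v u) + pm f *\<^sub>v (padic_p \<cdot>\<^sub>v k)"
        unfolding ev_simps(3) x(4) using KvC[OF x(3)] by (intro dist mult_mat_vec_carrier[OF pm_carrier x(2)]) auto
      also have "pm f *\<^sub>v (pm P *\<^sub>v u) = pm P *\<^sub>v (pm f *\<^sub>v u)"
      proof -
        have "pm f * pm P = pm P * pm f" unfolding poly_mat_eval_mult[OF A, symmetric] by (simp only: mult.commute)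
        then show ?thesis
          using assoc_mult_mat_vec[OF pm_carrier pm_carrier x(2)] by metis
      qed
      also have "pm f *\<^sub>v (padic_p \<cdot>\<^sub>v k) = padic_p \<cdot>\<^sub>v (pm f *\<^sub>v k)"
        by (rule pm_smult[OF KvC[OF x(3)]])
      finally show ?thesis
        unfolding U_def using submodule_setD(2)[OF submodule_pvecs x(1)] Kv_pm[OF x(3)] mult_mat_vec_carrier[OF pm_carrier x(2)]
        by blast
    qed
    fix y assume "y \<in> U"
    then obtain u' k' where y: "y \<in> pvecs n" "u' \<in> carrier_vec n" "k' \<in> Kv" "evA y = pm P *\<^sub>v u' + padic_p \<cdot>\<^sub>v k'"
      unfolding U_def by blast
    have "evA (x - y) = pm P *\<^sub>v (u - u') + padic_p \<cdot>\<^sub>v (k - k')"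
    proof -
      have "pm P *\<^sub>v (u - u') = pm P *\<^sub>v u - pm P *\<^sub>v u'"
        by (rule mult_minus_distrib_mat_vec[OF pm_carrier x(2) y(2)])
      then show ?thesis
        unfolding ev_simps(2) x(4) y(4)
        using KvC[OF x(3)] KvC[OF y(3)] carrier_vecD[OF mult_mat_vec_carrier[OF pm_carrier x(2), of P]]
          carrier_vecD[OF mult_mat_vec_carrier[OF pm_carrier y(2), of P]]
        by (intro eq_vecI) (simp_all add: algebra_simps del: dim_mult_mat_vec index_mult_mat_vec)
    qed
    then show "x - y \<in> U"
      unfolding U_def using additive_closedD(2)[OF additive_closed_pvecs x(1) y(1)] Kv_diff[OF x(3) y(3)]
        minus_carrier_vec[OF x(2) y(2)] by blast
  qed
  moreover have "colsA \<subseteq> U"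
  proof (rule image_subsetI)
    fix m assume "m \<in> {..<n}"
    then have m: "m < n" by simp
    show "unit_vec_X m - mat_columns n A m \<in> U"
      using cK m K_sub by (intro zero_ev eval_pvec_columns[OF A m]) blast
  qed
  moreover have "N \<subseteq> U"
  proof
    fix x assume "x \<in> N"
    then obtain k y where x: "x = vsmult (pconst 1) k + vsmult P y" "k \<in> K" "y \<in> pvecs n" unfolding N_def by blast
    have "pm (pconst 1) *\<^sub>v evA k = padic_p \<cdot>\<^sub>v evA k"
    proof -
      have "pm (pconst 1) = padic_p \<cdot>\<^sub>m 1\<^sub>m n" using poly_mat_eval_const[OF A, of "padic_p ^ 1"] by simp
      then show ?thesis using ev_carrier[of k] by (intro eq_vecI) (auto simp: scalar_prod_smult_left)
    qed
    then have "evA x = pm P *\<^sub>v evA y + padic_p \<cdot>\<^sub>v evA k"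
      unfolding x(1) ev_simps(1,3)
      by (simp add: comm_add_vec[OF smult_carrier_vec[THEN iffD2, OF ev_carrier] mult_mat_vec_carrier[OF pm_carrier ev_carrier]])
    then show "x \<in> U" unfolding U_def using subsetD[OF N_sub \<open>x \<in> N\<close>] K_sub ev_Kv[OF x(2)] ev_carrier by blast
  qed
  ultimately have KU: "K \<subseteq> U" using gen unfolding generates_def by blast
  have step: "\<exists>u\<in>carrier_vec n. \<exists>k\<in>Kv. v = pm P *\<^sub>v u + padic_p \<cdot>\<^sub>v k" if "v \<in> Kv" for v
  proof -
    have "cv v \<in> U" using that KU cv_pvecs unfolding Kv_def K_def by blast
    then show ?thesis using ev_simps(4)[OF KvC[OF that]] unfolding U_def by auto
  qed
  have iter: "\<exists>u\<in>carrier_vec n. \<exists>k\<in>Kv. v = pm P *\<^sub>v u + padic_p ^ s \<cdot>\<^sub>v k" if "v \<in> Kv" for v s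
  proof (induction s)
    case 0
    have "v = pm P *\<^sub>v 0\<^sub>v n + padic_p ^ 0 \<cdot>\<^sub>v v" unfolding pm_zero using KvC[OF that] by (intro eq_vecI) auto
    then show ?case using that by (intro bexI[of _ "0\<^sub>v n"] bexI[of _ v]) auto
  next
    case (Suc s)
    then obtain u k where uk: "u \<in> carrier_vec n" "k \<in> Kv" "v = pm P *\<^sub>v u + padic_p ^ s \<cdot>\<^sub>v k" by blast
    obtain u' k' where uk': "u' \<in> carrier_vec n" "k' \<in> Kv" "k = pm P *\<^sub>v u' + padic_p \<cdot>\<^sub>v k'" using step[OF uk(2)] by blast
    have "pm P *\<^sub>v (u + padic_p ^ s \<cdot>\<^sub>v u') = pm P *\<^sub>v u + padic_p ^ s \<cdot>\<^sub>v (pm P *\<^sub>v u')"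
      using uk(1) uk'(1) by (simp add: dist pm_smult)
    then have "v = pm P *\<^sub>v (u + padic_p ^ s \<cdot>\<^sub>v u') + padic_p ^ Suc s \<cdot>\<^sub>v k'"
      unfolding uk(3) uk'(3)
      using KvC[OF uk'(2)] carrier_vecD[OF mult_mat_vec_carrier[OF pm_carrier uk(1), of P]]
        carrier_vecD[OF mult_mat_vec_carrier[OF pm_carrier uk'(1), of P]]
      by (intro eq_vecI) (simp_all add: algebra_simps del: dim_mult_mat_vec index_mult_mat_vec)
    then show ?case using uk(1) uk'(1,2) by (intro bexI[of _ "u + padic_p ^ s \<cdot>\<^sub>v u'"] bexI[of _ k']) auto
  qed
  have p_Kv: "padic_p ^ e \<cdot>\<^sub>v w \<in> Kv" if "w \<in> carrier_vec n" for w
  proof -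
    have "cv (padic_p ^ e \<cdot>\<^sub>v w) = vsmult (pconst e) (cv w)" by (rule ext) (use that in \<open>simp add: const_pvec_def\<close>)
    then have "cv (padic_p ^ e \<cdot>\<^sub>v w) \<in> K" using p_power_in_K[OF cv_pvecs] by simp
    then show ?thesis unfolding Kv_def K_def using that by auto
  qed
  have nak: "\<exists>u\<in>carrier_vec n. padic_p ^ e \<cdot>\<^sub>v w = pm P *\<^sub>v u" if "w \<in> carrier_vec n" for w
  proof (rule nakayama_vec[OF pm_carrier _ that])
    fix w :: "'p padic_int vec" assume "w \<in> carrier_vec n"
    \<comment> \<open>One iteration more than \<open>e\<close>, since the remainder has to be small
      compared with \<open>p^e w\<close>.\<close>
    from iter[OF p_Kv[OF this], of "Suc e"]
    show "\<exists>u\<in>carrier_vec n. \<exists>c\<in>carrier_vec n. padic_p ^ e \<cdot>\<^sub>v w = pm P *\<^sub>v u + padic_p ^ Suc e \<cdot>\<^sub>v c"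
      using KvC by blast
  qed
  assume "lmap (cv v) = \<zero>"
  then have "v \<in> Kv" unfolding Kv_def using assms(2) by blast
  from iter[OF this, of e] obtain u k where uk: "u \<in> carrier_vec n" "k \<in> Kv" "v = pm P *\<^sub>v u + padic_p ^ e \<cdot>\<^sub>v k" by blast
  obtain u' where u': "u' \<in> carrier_vec n" "padic_p ^ e \<cdot>\<^sub>v k = pm P *\<^sub>v u'" using nak[OF KvC[OF uk(2)]] by blast
  have "v = pm P *\<^sub>v (u + u')" unfolding uk(3) u'(2) by (rule dist[OF uk(1) u'(1), symmetric])
  then show "\<exists>u\<in>carrier_vec n. v = pm P *\<^sub>v u" using add_carrier_vec[OF uk(1) u'(1)] by blast
qed

end

section \<open>Isomorphisms from the cokernel, counted by tuples\<close>

definition module_isos :: "('r, 'c) ring_scheme \<Rightarrow> ('r, 'a, 'm) module_scheme \<Rightarrow> ('r, 'b, 'k) module_scheme \<Rightarrow> ('a \<Rightarrow> 'b) set" where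
  "module_isos R M N = {h \<in> LinearCombinations.module_hom R M N. h \<in> extensional (carrier M) \<and> bij_betw h (carrier M) (carrier N)}"

text \<open>Composition with one fixed isomorphism \<open>h\<close> matches automorphisms of
  \<open>N\<close> with isomorphisms onto \<open>N\<close>; extensionality on both sides makes this
  a bijection of functions.\<close>

lemma card_module_isos:
  fixes R :: "('r, 'c) ring_scheme" and M :: "('r, 'a, 'm) module_scheme" and N :: "('r, 'b, 'k) module_scheme"
  assumes M: "Module.module R M"
  shows "card (module_isos R M N) = (if module_isomorphic R M N then card (module_Aut R N) else 0)"
proof (cases "module_isomorphic R M N")
  case False
  then have "module_isos R M N = {}" unfolding module_isos_def module_isomorphic_def by blast
  then show ?thesis using False by simp
next
  case True
  interpret m: Module.module R M by fact
  note hd = LinearCombinations.module_hom_def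
  from True obtain h where h: "h \<in> LinearCombinations.module_hom R M N" "bij_betw h (carrier M) (carrier N)"
    unfolding module_isomorphic_def by blast
  define i where "i = inv_into (carrier M) h"
  have hc: "h x \<in> carrier N" if "x \<in> carrier M" for x using h(2) that by (rule bij_betwE[THEN bspec])
  have ic: "i y \<in> carrier M" "h (i y) = y" if "y \<in> carrier N" for y
    using bij_betw_inv_into[OF h(2)] bij_betw_inv_into_right[OF h(2)] that unfolding i_def
    by (auto dest: bij_betwE)
  have ih: "i (h x) = x" if "x \<in> carrier M" for x
    unfolding i_def by (rule bij_betw_inv_into_left[OF h(2) that])
  have h_add: "h (x \<oplus>\<^bsub>M\<^esub> x') = h x \<oplus>\<^bsub>N\<^esub> h x'" if "x \<in> carrier M" "x' \<in> carrier M" for x x'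
    using h(1) that unfolding hd by blast
  have h_smult: "h (r \<odot>\<^bsub>M\<^esub> x) = r \<odot>\<^bsub>N\<^esub> h x" if "r \<in> carrier R" "x \<in> carrier M" for r x
    using h(1) that unfolding hd by blast
  \<comment> \<open>Closure of the operations on \<open>N\<close> is transported from
    \<open>M\<close> along \<open>h\<close>.\<close>
  have N_closed: "y \<oplus>\<^bsub>N\<^esub> y' \<in> carrier N" if "y \<in> carrier N" "y' \<in> carrier N" for y y'
    using h_add[OF ic(1)[OF that(1)] ic(1)[OF that(2)]] hc[OF m.a_closed[OF ic(1)[OF that(1)] ic(1)[OF that(2)]]]
    by (simp add: ic that)
  have N_sclosed: "r \<odot>\<^bsub>N\<^esub> y \<in> carrier N" if "r \<in> carrier R" "y \<in> carrier N" for r y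
    using h_smult[OF that(1) ic(1)[OF that(2)]] hc[OF m.smult_closed[OF that(1) ic(1)[OF that(2)]]]
    by (simp add: ic that)
  have i_add: "i (y \<oplus>\<^bsub>N\<^esub> y') = i y \<oplus>\<^bsub>M\<^esub> i y'" if "y \<in> carrier N" "y' \<in> carrier N" for y y'
    using ih[OF m.a_closed[OF ic(1)[OF that(1)] ic(1)[OF that(2)]]] by (simp add: h_add ic that)
  have i_smult: "i (r \<odot>\<^bsub>N\<^esub> y) = r \<odot>\<^bsub>M\<^esub> i y" if "r \<in> carrier R" "y \<in> carrier N" for r y
    using ih[OF m.smult_closed[OF that(1) ic(1)[OF that(2)]]] by (simp add: h_smult ic that)
  have ib: "bij_betw i (carrier N) (carrier M)" unfolding i_def by (rule bij_betw_inv_into[OF h(2)])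
  have "bij_betw (\<lambda>a. restrict (a \<circ> h) (carrier M)) (module_Aut R N) (module_isos R M N)"
  proof (rule bij_betw_byWitness[where f' = "\<lambda>f. restrict (f \<circ> i) (carrier N)"])
    show "\<forall>a\<in>module_Aut R N. restrict (restrict (a \<circ> h) (carrier M) \<circ> i) (carrier N) = a"
    proof
      fix a assume "a \<in> module_Aut R N"
      then have "a \<in> extensional (carrier N)" unfolding module_Aut_def Bij_def by blast
      then show "restrict (restrict (a \<circ> h) (carrier M) \<circ> i) (carrier N) = a"
        by (intro extensionalityI[of _ "carrier N"]) (simp_all add: ic)
    qed
    show "\<forall>f\<in>module_isos R M N. restrict (restrict (f \<circ> i) (carrier N) \<circ> h) (carrier M) = f"
    proof
      fix f assume "f \<in> module_isos R M N"
      then have "f \<in> extensional (carrier M)" unfolding module_isos_def by blast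
      then show "restrict (restrict (f \<circ> i) (carrier N) \<circ> h) (carrier M) = f"
        by (intro extensionalityI[of _ "carrier M"]) (simp_all add: ih hc)
    qed
    show "(\<lambda>a. restrict (a \<circ> h) (carrier M)) ` module_Aut R N \<subseteq> module_isos R M N"
    proof (rule image_subsetI)
      fix a assume "a \<in> module_Aut R N"
      then have a: "a \<in> LinearCombinations.module_hom R N N" "bij_betw a (carrier N) (carrier N)"
        unfolding module_Aut_def Bij_def by blast+
      have "bij_betw (restrict (a \<circ> h) (carrier M)) (carrier M) (carrier N)"
        using bij_betw_trans[OF h(2) a(2)] by (subst bij_betw_cong[of _ _ "a \<circ> h"]) simp_all
      moreover have "restrict (a \<circ> h) (carrier M) \<in> LinearCombinations.module_hom R M N"
        using a(1) unfolding hd by (auto simp: h_add h_smult hc)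
      ultimately show "restrict (a \<circ> h) (carrier M) \<in> module_isos R M N" unfolding module_isos_def by auto
    qed
    show "(\<lambda>f. restrict (f \<circ> i) (carrier N)) ` module_isos R M N \<subseteq> module_Aut R N"
    proof (rule image_subsetI)
      fix f assume "f \<in> module_isos R M N"
      then have f: "f \<in> LinearCombinations.module_hom R M N" "bij_betw f (carrier M) (carrier N)"
        unfolding module_isos_def by blast+
      have "bij_betw (restrict (f \<circ> i) (carrier N)) (carrier N) (carrier N)"
        using bij_betw_trans[OF ib f(2)] by (subst bij_betw_cong[of _ _ "f \<circ> i"]) simp_all
      moreover have "restrict (f \<circ> i) (carrier N) \<in> LinearCombinations.module_hom R N N"
        using f(1) unfolding hd by (auto simp: i_add i_smult ic N_closed N_sclosed)
      ultimately show "restrict (f \<circ> i) (carrier N) \<in> module_Aut R N" unfolding module_Aut_def Bij_def by auto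
    qed
  qed
  then show ?thesis using True by (simp add: bij_betw_same_card)
qed

abbreviation cok_class :: "'a::comm_ring_1 poly \<Rightarrow> 'a mat \<Rightarrow> nat \<Rightarrow> 'a vec \<Rightarrow> 'a vec set" where
  "cok_class P A n x \<equiv> mat_range (poly_mat_eval P A) +>\<^bsub>module_vec TYPE('a) n\<^esub> x"

lemma cok_class_simps:
  fixes A :: "'a::comm_ring_1 mat"
  assumes A: "A \<in> carrier_mat n n"
  shows "carrier (cok_module P A) = cok_class P A n ` carrier_vec n"
    "x \<in> carrier_vec n \<Longrightarrow> y \<in> carrier_vec n \<Longrightarrow>
      cok_class P A n x \<oplus>\<^bsub>cok_module P A\<^esub> cok_class P A n y = cok_class P A n (x + y)"
    "x \<in> carrier_vec n \<Longrightarrow> y \<in> carrier_vec n \<Longrightarrow>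
      cok_class P A n x = cok_class P A n y \<longleftrightarrow> (\<exists>u\<in>carrier_vec n. x - y = poly_mat_eval P A *\<^sub>v u)"
proof -
  let ?V = "module_vec TYPE('a) n"
  let ?I = "mat_range (poly_mat_eval P A)"
  note ec = poly_mat_eval_carrier[OF A]
  interpret I: abelian_subgroup ?I ?V by (rule abelian_subgroup_mat_range[OF ec])
  have d: "dim_row (poly_mat_eval P A) = n" "dim_row A = n" "dim_col (poly_mat_eval P A) = n" using ec[of P] A by auto
  show "carrier (cok_module P A) = cok_class P A n ` carrier_vec n"
    by (auto simp: cok_module_def Let_def cok_def d A_FactGroup_def FactGroup_def RCOSETS_def
      a_r_coset_def set_add_def module_vec_simps)
  have addM0: "add (cok_module P A) = set_add ?V"
    by (auto simp: cok_module_def Let_def cok_def d A_FactGroup_def FactGroup_def RCOSETS_def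
      a_r_coset_def set_add_def module_vec_simps)
  show "cok_class P A n x \<oplus>\<^bsub>cok_module P A\<^esub> cok_class P A n y = cok_class P A n (x + y)"
    if "x \<in> carrier_vec n" "y \<in> carrier_vec n"
    using I.a_rcos_sum[of x y] that unfolding addM0 by (simp add: module_vec_simps)
  show "cok_class P A n x = cok_class P A n y \<longleftrightarrow> (\<exists>u\<in>carrier_vec n. x - y = poly_mat_eval P A *\<^sub>v u)"
    if xy: "x \<in> carrier_vec n" "y \<in> carrier_vec n"
  proof -
    have mem: "x \<in> cok_class P A n y \<longleftrightarrow> (\<exists>u\<in>carrier_vec n. x - y = poly_mat_eval P A *\<^sub>v u)"
    proof -
      have "x \<in> cok_class P A n y \<longleftrightarrow> (\<exists>u\<in>carrier_vec n. x = poly_mat_eval P A *\<^sub>v u + y)"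
        by (auto simp: a_r_coset_def r_coset_def mat_range_def module_vec_simps d)
      moreover have "x = w + y \<longleftrightarrow> x - y = w" if "w \<in> carrier_vec n" for w
      proof
        show "x - y = w" if e: "x = w + y"
          unfolding e using xy \<open>w \<in> carrier_vec n\<close> by (intro eq_vecI) auto
        show "x = w + y" if e: "x - y = w"
          unfolding e[symmetric] using xy by (intro eq_vecI) auto
      qed
      then have "x = poly_mat_eval P A *\<^sub>v u + y \<longleftrightarrow> x - y = poly_mat_eval P A *\<^sub>v u" if "u \<in> carrier_vec n" for u
        using mult_mat_vec_carrier[OF ec that] by blast
      ultimately show ?thesis by blast
    qed
    have "x \<in> cok_class P A n x" by (rule I.a_rcos_self) (simp add: module_vec_simps xy)
    moreover have "cok_class P A n y = cok_class P A n x" if "x \<in> cok_class P A n y"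
      by (rule I.a_repr_independence[OF that _ I.a_subgroup]) (simp add: module_vec_simps xy)
    ultimately show ?thesis unfolding mem[symmetric] by auto
  qed
qed

context presented_cokernel
begin

abbreviation "cl \<equiv> cok_class P A n"
abbreviation "CM \<equiv> cok_module P A"

lemmas cl_simps = cok_class_simps[OF A, where P = P]
lemmas cl_smult = cok_module_smult[OF A, where P = P, folded pclass_def]

lemma lmap_unit:
  assumes "i < n"
  shows "lmap (cv (unit_vec n i)) = g i"
proof -
  have "lmap (cv (unit_vec n i)) = finsum H (\<lambda>j. if i = j then g j else \<zero>) {..<n}"
    unfolding lmap_def using assms g
    by (intro finsum_cong' refl) (auto simp: const_pvec_def act_zero_left act_one[folded one_pCons] one_pCons[symmetric] act_one)
  also have "\<dots> = g i" using assms g by (intro add.finprod_singleton) auto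
  finally show ?thesis .
qed

text \<open>Since \<open>h\<close> is determined by the images of the unit vectors, its composite
  with substitution of \<open>A\<close> is \<open>lmap\<close>. A vector of \<open>K\<close>
  therefore has its value at \<open>A\<close> in the range of \<open>P(A)\<close>, and is congruent
  to a member of \<open>P L \<subseteq> N\<close> modulo the columns.\<close>

lemma iso_solves:
  assumes h: "h \<in> LinearCombinations.module_hom (poly_quot P) CM H" "bij_betw h (carrier CM) (carrier H)"
    and hg: "\<And>i. i < n \<Longrightarrow> h (cl (unit_vec n i)) = g i"
  shows "solves" "\<And>v. v \<in> carrier_vec n \<Longrightarrow> h (cl v) = lmap (cv v)"
proof -
  note hd = LinearCombinations.module_hom_def
  have clc: "cl v \<in> carrier CM" if "v \<in> carrier_vec n" for v using that unfolding cl_simps(1) by blast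
  have hc: "h (cl v) \<in> carrier H" if "v \<in> carrier_vec n" for v
    using bij_betwE[OF h(2)] clc[OF that] by blast
  have h_add: "h (cl (v + w)) = h (cl v) \<oplus> h (cl w)" if "v \<in> carrier_vec n" "w \<in> carrier_vec n" for v w
    using LinearCombinations.module_hom_add[OF h(1) clc[OF that(1)] clc[OF that(2)]]
    unfolding cl_simps(2)[OF that] .
  have h_sm: "h (cl (pm f *\<^sub>v v)) = pact P H f (h (cl v))" if "v \<in> carrier_vec n" for v f
  proof -
    have "h (pclass P f \<odot>\<^bsub>CM\<^esub> cl v) = pclass P f \<odot> h (cl v)"
      using h(1) clc[OF that] poly_quot_simps(1)[of P] unfolding hd by blast
    then show ?thesis unfolding cl_smult[OF that] pact_def .
  qed
  have h0: "h (cl (0\<^sub>v n)) = \<zero>"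
  proof -
    have "0\<^sub>v n + 0\<^sub>v n = (0\<^sub>v n :: 'p padic_int vec)" by simp
    then have "h (cl (0\<^sub>v n)) \<oplus> h (cl (0\<^sub>v n)) = h (cl (0\<^sub>v n))"
      using h_add[OF zero_carrier_vec zero_carrier_vec] by (simp only:)
    then show ?thesis by (rule add_cancel_zero[OF hc[OF zero_carrier_vec] hc[OF zero_carrier_vec]])
  qed
  \<comment> \<open>Induction on the number of coordinates in use, splitting off the last
    one.\<close>
  have Q: "h (cl (evA x)) = lmap x" if "x \<in> pvecs k" "k \<le> n" for x k
    using that
  proof (induction k arbitrary: x)
    case 0
    then have "x = 0" by (auto simp: pvecs_def)
    moreover have "evA 0 = 0\<^sub>v n"
      using submodule_setD(1)[OF submodule_eval_kernel[OF A]] additive_closedD(1) by blast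
    ultimately show ?case using h0 lmap_0 by (simp only:)
  next
    case (Suc k)
    let ?y = "x(k := 0)" and ?z = "vsmult (x k) (cv (unit_vec n k))"
    have k: "k < n" using Suc.prems by simp
    have x: "x = ?y + ?z"
      using k by (intro ext) (simp add: vsmult_def const_pvec_def unit_vec_def one_pCons[symmetric])
    have "?y i = 0" if "k \<le> i" for i
      using Suc.prems(1) that unfolding pvecs_def by (cases "i = k") simp_all
    then have "?y \<in> pvecs k" unfolding pvecs_def by blast
    then have y: "h (cl (evA ?y)) = lmap ?y" using Suc.IH k by simp
    have "evA ?z = pm (x k) *\<^sub>v unit_vec n k" by (simp only: ev_simps(3) ev_simps(4)[OF unit_vec_carrier])
    then have z: "h (cl (evA ?z)) = lmap ?z"
      using h_sm[OF unit_vec_carrier] hg[OF k] lmap_unit[OF k] by (simp only: lmap_vsmult)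
    have "h (cl (evA (?y + ?z))) = lmap (?y + ?z)"
      by (simp only: ev_simps(1) h_add[OF ev_carrier ev_carrier] y z lmap_add)
    then show ?case unfolding x[symmetric] .
  qed
  show hv: "h (cl v) = lmap (cv v)" if "v \<in> carrier_vec n" for v
    using Q[OF cv_pvecs order.refl, of v] by (simp only: ev_simps(4)[OF that])
  have colK: "colsA \<subseteq> K"
  proof (rule image_subsetI)
    fix m assume "m \<in> {..<n}"
    then have m: "m < n" by simp
    let ?x = "unit_vec_X m - mat_columns n A m"
    have x: "?x \<in> pvecs n"
      by (rule additive_closedD(2)[OF additive_closed_pvecs unit_vec_X_in[OF m]
        IntD1[OF mat_columns_in[OF A, unfolded const_vecs_def]]])
    have "lmap ?x = \<zero>" using Q[OF x order.refl] unfolding eval_pvec_columns[OF A m] h0 by simp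
    then show "?x \<in> K" unfolding K_def using x by blast
  qed
  have surj: "carrier H \<subseteq> lmap ` const_vecs n"
  proof
    fix y assume "y \<in> carrier H"
    then obtain v where "v \<in> carrier_vec n" "y = h (cl v)"
      using bij_betw_imp_surj_on[OF h(2)] unfolding cl_simps(1) by blast
    then show "y \<in> lmap ` const_vecs n" using hv const_pvec_in by blast
  qed
  have "K \<subseteq> U" if U: "submodule_set U" "colsA \<subseteq> U" "N \<subseteq> U" for U
  proof
    fix x assume "x \<in> K"
    then have x: "x \<in> pvecs n" "lmap x = \<zero>" unfolding K_def by blast+
    have "h (cl (evA x)) = h (cl (0\<^sub>v n))" using Q[OF x(1) order.refl] x(2) h0 by simp
    then have "cl (evA x) = cl (0\<^sub>v n)"
      using bij_betw_imp_inj_on[OF h(2)] clc[OF ev_carrier] clc[OF zero_carrier_vec] by (blast dest: inj_onD)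
    then obtain u where u: "u \<in> carrier_vec n" "evA x - 0\<^sub>v n = pm P *\<^sub>v u"
      unfolding cl_simps(3)[OF ev_carrier zero_carrier_vec] by blast
    have ex: "evA x = pm P *\<^sub>v u" using u(2) ev_carrier[of x] by simp
    let ?w = "vsmult P (cv u)"
    have w: "?w \<in> U" using U(3) P_in_N[OF cv_pvecs] by blast
    have wp: "?w \<in> pvecs n" by (rule submodule_setD(2)[OF submodule_pvecs cv_pvecs])
    have e0: "evA (x - ?w) = 0\<^sub>v n"
      unfolding ev_simps(2,3) ev_simps(4)[OF u(1)] ex
      by (rule minus_cancel_vec[OF mult_mat_vec_carrier[OF pm_carrier u(1)]])
    have cv0: "cv (0\<^sub>v n) = 0" by (rule ext) (simp add: const_pvec_def)
    have "(x - ?w) - cv (evA (x - ?w)) \<in> U"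
      by (rule reduce_to_const[OF A U(1) _ additive_closedD(2)[OF additive_closed_pvecs x(1) wp]]) (use U(2) in blast)
    then have "x - ?w \<in> U" unfolding e0 cv0 diff_zero .
    from additive_closedD(4)[OF submodule_setD(1)[OF U(1)] this w] show "x \<in> U" by simp
  qed
  then have "generates colsA" unfolding generates_def by blast
  then show "solves" unfolding solves_def using colK surj by blast
qed

text \<open>The map on classes is well defined and injective because its kernel on
  \<open>\<int>\<^sub>p^n\<close> is the range of \<open>P(A)\<close>.\<close>

lemma solves_iso:
  assumes "solves"
  shows "\<exists>h\<in>module_isos (poly_quot P) CM H. \<forall>v\<in>carrier_vec n. h (cl v) = lmap (cv v)"
proof -
  have cK: "colsA \<subseteq> K" and surj: "carrier H \<subseteq> lmap ` const_vecs n" using assms unfolding solves_def by blast+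
  have eq: "lmap (cv v) = lmap (cv w) \<longleftrightarrow> cl v = cl w" if "v \<in> carrier_vec n" "w \<in> carrier_vec n" for v w
    unfolding cl_simps(3)[OF that] lmap_eq_iff[of "cv v"] const_pvec_diff[OF that, symmetric]
    by (rule Kv_iff_range[OF assms minus_carrier_vec[OF that]])
  define h where "h = (\<lambda>Z\<in>carrier CM. lmap (cv (SOME v. v \<in> carrier_vec n \<and> cl v = Z)))"
  have hv: "h (cl v) = lmap (cv v)" if "v \<in> carrier_vec n" for v
  proof -
    let ?w = "SOME w. w \<in> carrier_vec n \<and> cl w = cl v"
    have w: "?w \<in> carrier_vec n \<and> cl ?w = cl v" by (rule someI[of _ v]) (simp add: that)
    have "h (cl v) = lmap (cv ?w)" unfolding h_def cl_simps(1) using that by simp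
    then show ?thesis unfolding eq[OF conjunct1[OF w] that, THEN iffD2, OF conjunct2[OF w]] .
  qed
  have add: "h (Z \<oplus>\<^bsub>CM\<^esub> Z') = h Z \<oplus> h Z'" if ZZ: "Z \<in> carrier CM" "Z' \<in> carrier CM" for Z Z'
  proof -
    obtain v w where vw: "v \<in> carrier_vec n" "w \<in> carrier_vec n" "Z = cl v" "Z' = cl w" using ZZ unfolding cl_simps(1) by blast
    show ?thesis unfolding vw(3,4) cl_simps(2)[OF vw(1,2)] hv[OF vw(1)] hv[OF vw(2)] hv[OF add_carrier_vec[OF vw(1,2)]]
      const_pvec_add[OF vw(1,2)] lmap_add ..
  qed
  have sm: "h (r \<odot>\<^bsub>CM\<^esub> Z) = r \<odot> h Z" if rZ: "r \<in> carrier (poly_quot P)" "Z \<in> carrier CM" for r Z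
  proof -
    obtain v f where vf: "v \<in> carrier_vec n" "Z = cl v" "r = pclass P f"
      using rZ unfolding cl_simps(1) poly_quot_simps(1) by blast
    show ?thesis unfolding vf(2,3) cl_smult[OF vf(1)] hv[OF vf(1)] hv[OF mult_mat_vec_carrier[OF pm_carrier vf(1)]]
      lmap_pm[OF cK vf(1)] pact_def ..
  qed
  have "h ` carrier CM = carrier H"
  proof
    show "h ` carrier CM \<subseteq> carrier H" unfolding cl_simps(1) using hv lmap_closed by auto
    show "carrier H \<subseteq> h ` carrier CM"
    proof
      fix y assume "y \<in> carrier H"
      then obtain x where x: "x \<in> const_vecs n" "y = lmap x" using surj by blast
      obtain v where v: "v \<in> carrier_vec n" "x = cv v" using const_vecs_eq_image[OF x(1)] by blast
      show "y \<in> h ` carrier CM"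
        by (rule image_eqI[of _ _ "cl v"]) (simp_all only: x v(2) hv[OF v(1)] cl_simps(1) imageI[OF v(1)])
    qed
  qed
  moreover have "inj_on h (carrier CM)" unfolding cl_simps(1) by (rule inj_onI) (auto simp: hv eq)
  ultimately have b: "bij_betw h (carrier CM) (carrier H)" unfolding bij_betw_def by blast
  have "h \<in> carrier CM \<rightarrow> carrier H" using bij_betwE[OF b] by blast
  then have "h \<in> LinearCombinations.module_hom (poly_quot P) CM H"
    unfolding LinearCombinations.module_hom_def using add sm by blast
  moreover have "h \<in> extensional (carrier CM)" unfolding h_def by simp
  ultimately show ?thesis unfolding module_isos_def using b hv by blast
qed

end

text \<open>Sending an isomorphism to its values on the unit vectors is a bijection onto the tuples
  that solve, and the isomorphisms form a torsor under the automorphisms if there are any.\<close>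

theorem card_solutions:
  fixes H :: "('p::prime_card padic_int poly set, 'h) module"
  assumes Q: "quot_module H (pact P H) P e" and A: "A \<in> carrier_mat n n"
  shows "card {g \<in> {..<n} \<rightarrow>\<^sub>E carrier H. presented_cokernel.solves H P n g A}
    = (if module_isomorphic (poly_quot P) (cok_module P A) H then card (module_Aut (poly_quot P) H) else 0)"
proof -
  let ?M = "cok_module P A" and ?cl = "cok_class P A n"
  let ?S = "{g \<in> {..<n} \<rightarrow>\<^sub>E carrier H. presented_cokernel.solves H P n g A}"
  let ?f = "\<lambda>h. \<lambda>i\<in>{..<n}. h (?cl (unit_vec n i))"
  have pc: "presented_cokernel H P e n g A" if "g \<in> {..<n} \<rightarrow>\<^sub>E carrier H" for g
    using that Q A by (auto simp: presented_cokernel_def presented_cokernel_axioms_def presentation_def presentation_axioms_def)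
  have clc: "?cl v \<in> carrier ?M" if "v \<in> carrier_vec n" for v using that unfolding cok_class_simps(1)[OF A] by blast
  have fE: "?f h \<in> {..<n} \<rightarrow>\<^sub>E carrier H" if "h \<in> module_isos (poly_quot P) ?M H" for h
  proof -
    have "bij_betw h (carrier ?M) (carrier H)" using that unfolding module_isos_def by blast
    from bij_betwE[OF this] have "h (?cl (unit_vec n i)) \<in> carrier H" for i using clc[OF unit_vec_carrier] by blast
    then show ?thesis by auto
  qed
  have sol: "presented_cokernel.solves H P n (?f h) A \<and>
      (\<forall>v\<in>carrier_vec n. h (?cl v) = presentation.lmap H (pact P H) n (?f h) (const_pvec n v))"
    if h: "h \<in> module_isos (poly_quot P) ?M H" for h
  proof -
    have h': "h \<in> LinearCombinations.module_hom (poly_quot P) ?M H" "bij_betw h (carrier ?M) (carrier H)"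
      using h unfolding module_isos_def by blast+
    have e: "h (?cl (unit_vec n i)) = ?f h i" if "i < n" for i using that by simp
    show ?thesis
      using presented_cokernel.iso_solves[OF pc[OF fE[OF h]] h' e] by blast
  qed
  have "bij_betw ?f (module_isos (poly_quot P) ?M H) ?S"
  proof (rule bij_betwI')
    fix h h' assume hh: "h \<in> module_isos (poly_quot P) ?M H" "h' \<in> module_isos (poly_quot P) ?M H"
    show "?f h = ?f h' \<longleftrightarrow> h = h'"
    proof
      assume e: "?f h = ?f h'"
      have "h Z = h' Z" if "Z \<in> carrier ?M" for Z
      proof -
        obtain v where v: "v \<in> carrier_vec n" "Z = ?cl v" using \<open>Z \<in> carrier ?M\<close> unfolding cok_class_simps(1)[OF A] by blast
        have "h (?cl v) = presentation.lmap H (pact P H) n (?f h) (const_pvec n v)"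
          by (rule sol[OF hh(1), THEN conjunct2, THEN bspec, OF v(1)])
        also have "\<dots> = presentation.lmap H (pact P H) n (?f h') (const_pvec n v)" by (simp only: e)
        also have "\<dots> = h' (?cl v)"
          by (rule sol[OF hh(2), THEN conjunct2, THEN bspec, OF v(1), symmetric])
        finally have "h (?cl v) = h' (?cl v)" .
        then show ?thesis unfolding v(2) .
      qed
      moreover have "h \<in> extensional (carrier ?M)" "h' \<in> extensional (carrier ?M)"
        using hh unfolding module_isos_def by blast+
      ultimately show "h = h'" by (intro extensionalityI)
    qed simp
  next
    fix h assume h: "h \<in> module_isos (poly_quot P) ?M H"
    show "?f h \<in> ?S" using fE[OF h] sol[OF h] by blast
  next
    fix g assume g: "g \<in> ?S"
    then have gE: "g \<in> {..<n} \<rightarrow>\<^sub>E carrier H" and s: "presented_cokernel.solves H P n g A" by blast+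
    note pcg = pc[OF gE]
    obtain h where h: "h \<in> module_isos (poly_quot P) ?M H"
      "\<forall>v\<in>carrier_vec n. h (?cl v) = presentation.lmap H (pact P H) n g (const_pvec n v)"
      using presented_cokernel.solves_iso[OF pcg s] by blast
    have "g = ?f h"
    proof (rule extensionalityI[of _ "{..<n}"])
      show "g \<in> extensional {..<n}" using gE unfolding PiE_def by blast
      fix i assume "i \<in> {..<n}"
      then show "g i = ?f h i" using h(2) presented_cokernel.lmap_unit[OF pcg, of i] by simp
    qed simp
    then show "\<exists>h\<in>module_isos (poly_quot P) ?M H. g = ?f h" using h(1) by blast
  qed
  then have "card ?S = card (module_isos (poly_quot P) ?M H)" by (rule bij_betw_same_card[symmetric])
  then show ?thesis unfolding card_module_isos[OF module_cok_module[OF A]] .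
qed

section \<open>From Haar measure to counting\<close>

definition rep_mat :: "nat \<Rightarrow> (nat \<Rightarrow> 'p::prime_card pvec) \<Rightarrow> 'p padic_int mat" where
  "rep_mat n a = mat n n (\<lambda>(i, m). Polynomial.coeff (a m i) 0)"

abbreviation rep_columns :: "nat \<Rightarrow> nat \<Rightarrow> (nat \<Rightarrow> 'p::prime_card pvec) set" where
  "rep_columns n k \<equiv> {..<n} \<rightarrow>\<^sub>E pvec_reps n k 1"

lemma rep_mat_carrier: "rep_mat n a \<in> carrier_mat n n"
  by (simp add: rep_mat_def)

lemma rep_columns_entry:
  fixes a :: "nat \<Rightarrow> 'p::prime_card pvec"
  assumes a: "a \<in> rep_columns n k" and m: "m < n"
  shows "a m i = (if i < n then [:Polynomial.coeff (a m i) 0:] else 0)" "Polynomial.coeff (a m i) 0 \<in> padic_reps k"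
proof -
  have am: "a m \<in> pvec_reps n k 1" using PiE_mem[OF a, of m] m by simp
  have 0: "a m i = 0" if "\<not> i < n" using am that unfolding pvec_reps_def PiE_dflt_def by auto
  have P: "a m i \<in> poly_reps k 1" if "i < n" using am that unfolding pvec_reps_def PiE_dflt_def by auto
  have "a m i = [:Polynomial.coeff (a m i) 0:]" if "i < n"
    using P[OF that] unfolding poly_reps_def by (intro poly_eqI) (auto simp: coeff_pCons split: nat.splits)
  then show "a m i = (if i < n then [:Polynomial.coeff (a m i) 0:] else 0)" using 0 by auto
  show "Polynomial.coeff (a m i) 0 \<in> padic_reps k"
    using P 0 zero_poly_reps[of k 1] unfolding poly_reps_def by (cases "i < n") auto
qed

lemma mat_columns_rep_mat:
  fixes a :: "nat \<Rightarrow> 'p::prime_card pvec"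
  assumes a: "a \<in> rep_columns n k" and m: "m < n"
  shows "mat_columns n (rep_mat n a) m = a m"
proof
  fix i
  show "mat_columns n (rep_mat n a) m i = a m i"
    unfolding mat_columns_def const_pvec_def rep_mat_def using m
    by (subst rep_columns_entry(1)[OF a m, of i]) simp
qed

lemma rep_mat_exists:
  fixes A :: "'p::prime_card padic_int mat"
  assumes A: "A \<in> carrier_mat n n"
  shows "\<exists>a\<in>rep_columns n k. A \<in> mball n k (rep_mat n a)"
proof
  let ?a = "\<lambda>m\<in>{..<n}. \<lambda>i. if i < n then [:padic_red k (A $$ (i, m)):] else 0"
  have "0 \<in> (padic_reps k :: 'p padic_int set)" using zero_poly_reps[of k 1] unfolding poly_reps_def by auto
  then show "?a \<in> rep_columns n k"
    unfolding pvec_reps_def PiE_dflt_def poly_reps_def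
    by (auto simp: coeff_pCons padic_red_in_reps split: nat.splits)
  show "A \<in> mball n k (rep_mat n ?a)"
    using A by (simp add: mball_def rep_mat_def residue_padic_red)
qed

lemma rep_mat_unique:
  fixes a a' :: "nat \<Rightarrow> 'p::prime_card pvec"
  assumes a: "a \<in> rep_columns n k" "a' \<in> rep_columns n k" and b: "rep_mat n a \<in> mball n k (rep_mat n a')"
  shows "a = a'"
proof (rule PiE_ext[OF a])
  fix m assume "m \<in> {..<n}"
  then have m: "m < n" by simp
  show "a m = a' m"
  proof
    fix i
    show "a m i = a' m i"
    proof (cases "i < n")
      case True
      have "residue (Polynomial.coeff (a m i) 0) k = residue (Polynomial.coeff (a' m i) 0) k"
        using b True m unfolding mball_def rep_mat_def by auto
      then have "Polynomial.coeff (a m i) 0 = Polynomial.coeff (a' m i) 0"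
        by (rule padic_reps_unique[OF rep_columns_entry(2)[OF a(1) m] rep_columns_entry(2)[OF a(2) m]])
      then show ?thesis using rep_columns_entry(1)[OF a(1) m, of i] rep_columns_entry(1)[OF a(2) m, of i] by metis
    next
      case False
      then show ?thesis using rep_columns_entry(1)[OF a(1) m, of i] rep_columns_entry(1)[OF a(2) m, of i] by metis
    qed
  qed
qed

lemma finite_rep_columns: "finite (rep_columns n k :: (nat \<Rightarrow> 'p::prime_card pvec) set)"
proof -
  have "0 < card (pvec_reps n k 1 :: 'p pvec set)" unfolding card_pvec_reps by (simp add: prime_gt_0_nat prime_card)
  then show ?thesis by (intro finite_PiE) (auto intro: card_ge_0_finite)
qed

lemma card_rep_columns: "card (rep_columns n k :: (nat \<Rightarrow> 'p::prime_card pvec) set) = (CARD('p) ^ (k * n)) ^ n"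
  by (simp add: card_PiE card_pvec_reps)

text \<open>The balls of level \<open>k\<close> around the representative matrices partition the
  space and have equal measure by translation invariance; a set stable under such balls is a finite
  union of them.\<close>

theorem haar_prob_eq_count:
  fixes E :: "'p::prime_card padic_int mat set"
  assumes E: "E \<subseteq> carrier_mat n n" and stable: "\<And>A. A \<in> E \<Longrightarrow> mball n k A \<subseteq> E"
  shows "measure (haar_prob n) E
    = real (card {a \<in> rep_columns n k. rep_mat n a \<in> E}) / real ((CARD('p) ^ (k * n)) ^ n)"
proof -
  let ?M = "haar_prob n :: 'p padic_int mat measure"
  let ?R = "rep_columns n k :: (nat \<Rightarrow> 'p pvec) set"
  let ?b = "\<lambda>a. mball n k (rep_mat n a)"
  let ?S = "{a \<in> ?R. rep_mat n a \<in> E}"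
  have haar: "is_haar_prob n ?M" unfolding is_haar_prob_iff ..
  then interpret prob_space ?M unfolding is_haar_prob_def by blast
  have balls: "{mball n k A | A. A \<in> carrier_mat n n} = ?b ` ?R"
  proof
    show "{mball n k A | A. A \<in> carrier_mat n n} \<subseteq> ?b ` ?R"
    proof
      fix b :: "'p padic_int mat set" assume "b \<in> {mball n k A | A. A \<in> carrier_mat n n}"
      then obtain A where A: "b = mball n k A" "A \<in> carrier_mat n n" by blast
      obtain a where a: "a \<in> ?R" "A \<in> ?b a" using rep_mat_exists[OF A(2), of k] by blast
      show "b \<in> ?b ` ?R" unfolding A(1) mball_eq[OF a(2)] by (rule imageI[OF a(1)])
    qed
    show "?b ` ?R \<subseteq> {mball n k A | A. A \<in> carrier_mat n n}" using rep_mat_carrier by blast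
  qed
  have inj: "a = a'" if "a \<in> ?R" "a' \<in> ?R" "A \<in> ?b a" "A \<in> ?b a'" for a a' A
  proof (rule rep_mat_unique[OF that(1,2)])
    have "?b a = ?b a'" using mball_eq[OF that(3)] mball_eq[OF that(4)] by simp
    then show "rep_mat n a \<in> ?b a'" using mball_self[OF rep_mat_carrier] by blast
  qed
  have "inj_on ?b ?R" by (rule inj_onI) (use inj mball_self[OF rep_mat_carrier] in blast)
  then have card: "card {mball n k A | A. A \<in> (carrier_mat n n :: 'p padic_int mat set)} = (CARD('p) ^ (k * n)) ^ n"
    unfolding balls by (simp only: card_image card_rep_columns)
  have meas: "?b a \<in> sets ?M" for a
  proof -
    have "?b a \<in> mballs n" unfolding mballs_def using rep_mat_carrier by blast
    then show ?thesis using haar mballs_open unfolding is_haar_prob_def by (blast intro: sigma_sets.Basic)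
  qed
  have one: "measure ?M (?b a) = 1 / real ((CARD('p) ^ (k * n)) ^ n)" for a
  proof -
    have "emeasure ?M (?b a) * of_nat ((CARD('p) ^ (k * n)) ^ n) = 1"
      using haar_prob_mball[OF haar rep_mat_carrier, of k a] unfolding card .
    then have "ennreal (measure ?M (?b a) * real ((CARD('p) ^ (k * n)) ^ n)) = 1"
      by (simp only: emeasure_eq_measure ennreal_mult' measure_nonneg of_nat_0_le_iff ennreal_of_nat_eq_real_of_nat)
    then have "measure ?M (?b a) * real ((CARD('p) ^ (k * n)) ^ n) = 1" by (simp only: ennreal_eq_1)
    then show ?thesis by (metis mult_zero_right nonzero_eq_divide_eq zero_neq_one)
  qed
  have "E = (\<Union>a\<in>?S. ?b a)"
  proof
    show "E \<subseteq> (\<Union>a\<in>?S. ?b a)"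
    proof
      fix A assume A: "A \<in> E"
      then obtain a where a: "a \<in> ?R" "A \<in> ?b a" using rep_mat_exists E by blast
      have "rep_mat n a \<in> mball n k A" using mball_eq[OF a(2)] mball_self[OF rep_mat_carrier] by blast
      then show "A \<in> (\<Union>a\<in>?S. ?b a)" using a stable[OF A] by blast
    qed
    show "(\<Union>a\<in>?S. ?b a) \<subseteq> E" using stable by blast
  qed
  then have "measure ?M E = measure ?M (\<Union>a\<in>?S. ?b a)" by simp
  also have "\<dots> = (\<Sum>a\<in>?S. measure ?M (?b a))"
    by (rule finite_measure_finite_Union)
      (use finite_rep_columns meas inj in \<open>auto simp: disjoint_family_on_def intro: finite_subset\<close>)
  also have "\<dots> = real (card ?S) / real ((CARD('p) ^ (k * n)) ^ n)" unfolding one by simp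
  finally show ?thesis .
qed

section \<open>Chinese remaindering\<close>

text \<open>If \<open>a u\<close> is 1 modulo \<open>(p, P)\<close>, then \<open>y = 1 - a u\<close>
  acts as a multiple of \<open>p\<close>, so \<open>y^e\<close> acts as 0 and
  \<open>1 - y^e\<close>, a multiple of \<open>u\<close>, acts as the identity.\<close>

lemma (in quot_module) separating_poly:
  assumes "u \<notin> reduction_ideal P"
  shows "\<exists>f. u dvd f \<and> (\<forall>h\<in>carrier H. act f h = h)"
proof -
  obtain a where "a * u - 1 \<in> reduction_ideal P" using reduction_ideal_inverse[OF irred assms] by blast
  then obtain c d where cd: "a * u - 1 = P * c + Polynomial.smult padic_p d" using reduction_ideal_decomp by blast
  define y where "y = 1 - a * u"
  define z where "z = pconst 1 * (- d)"
  have y: "y = P * (- c) + z" unfolding y_def z_def using cd by (simp add: algebra_simps)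
  have yz: "act y h = act z h" if "h \<in> carrier H" for h
    unfolding y act_add_left[OF that] act_mult[OF that] act_P[OF act_closed[OF that]] using that act_closed by simp
  have pow: "act (y ^ k) h = act (z ^ k) h" if "h \<in> carrier H" for h k
    using that by (induction k) (simp_all add: act_mult yz act_closed)
  have ye: "act (y ^ e) h = \<zero>" if "h \<in> carrier H" for h
  proof -
    have "(pconst 1 :: 'p padic_int poly) ^ k = pconst k" for k by (induction k) (simp_all add: one_pCons mult.commute)
    then have ze: "z ^ e = (- d) ^ e * pconst e" unfolding z_def power_mult_distrib by (simp only: mult.commute)
    show ?thesis unfolding pow[OF that] ze act_mult[OF that] act_p[OF that] by (rule act_zero_right)
  qed
  let ?f = "1 - y ^ e"
  have "act ?f h = h" if "h \<in> carrier H" for h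
  proof -
    have "act ?f h = act ?f h \<oplus> act (y ^ e) h" using that by (simp add: ye act_closed)
    also have "\<dots> = act (?f + y ^ e) h" by (rule act_add_left[OF that, symmetric])
    also have "\<dots> = h" using act_one[OF that] by simp
    finally show ?thesis .
  qed
  moreover have "u dvd ?f" unfolding one_diff_power_eq by (simp add: y_def)
  ultimately show ?thesis by blast
qed

text \<open>Polynomials acting as the identity on one \<open>H j\<close> and as 0 on the others
  combine preimages for the single components into one vector. This vector is no longer constant,
  but the columns lie in all kernels, and modulo them it becomes constant again.\<close>

lemma joint_surjI:
  fixes P :: "nat \<Rightarrow> 'p::prime_card padic_int poly" and a :: "nat \<Rightarrow> 'p pvec"
    and H :: "nat \<Rightarrow> ('h, 'm) ring_scheme"
  assumes J: "finite J" and pres: "\<And>j. j \<in> J \<Longrightarrow> presentation (H j) (act j) (P j) e n (g j)"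
    and inj: "inj_on (\<lambda>j. reduce_poly (P j)) J"
    and a: "\<And>m. m < n \<Longrightarrow> a m \<in> const_vecs n"
    and col: "\<And>m j. m < n \<Longrightarrow> j \<in> J \<Longrightarrow> unit_vec_X m - a m \<in> presentation.K (H j) (act j) n (g j)"
    and surj: "\<And>j. j \<in> J \<Longrightarrow> carrier (H j) \<subseteq> presentation.lmap (H j) (act j) n (g j) ` const_vecs n"
    and h: "h \<in> (\<Pi>\<^sub>E j\<in>J. carrier (H j))"
  shows "\<exists>v\<in>const_vecs n. \<forall>j\<in>J. presentation.lmap (H j) (act j) n (g j) v = h j"
proof -
  let ?lm = "\<lambda>j. presentation.lmap (H j) (act j) n (g j)"
  let ?K = "\<lambda>j. presentation.K (H j) (act j) n (g j)"
  have quot: "quot_module (H j) (act j) (P j) e" if "j \<in> J" for j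
    using pres[OF that] by (simp add: presentation_def)
  note irr = quot_module.irred[OF quot] and mon = quot_module.monic[OF quot]
  have "\<exists>f. \<forall>k\<in>J. \<forall>y\<in>carrier (H k). act k f y = (if k = j then y else \<zero>\<^bsub>H k\<^esub>)" if j: "j \<in> J" for j
  proof -
    have "prod P (J - {j}) \<notin> reduction_ideal (P j)"
    proof
      assume "prod P (J - {j}) \<in> reduction_ideal (P j)"
      then obtain k where k: "k \<in> J - {j}" "P k \<in> reduction_ideal (P j)"
        using reduction_ideal_prime[OF irr[OF j], of "J - {j}" P] J by blast
      then have "reduce_poly (P j) \<noteq> reduce_poly (P k)" using inj_onD[OF inj _ j, of k] by auto
      then show False using reduction_ideal_other[OF irr[OF j] irr mon[OF j] mon] k by blast
    qed
    then obtain f where f: "prod P (J - {j}) dvd f" "\<forall>y\<in>carrier (H j). act j f y = y"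
      using quot_module.separating_poly[OF quot[OF j]] by blast
    have "act k f y = \<zero>\<^bsub>H k\<^esub>" if k: "k \<in> J" "k \<noteq> j" "y \<in> carrier (H k)" for k y
    proof -
      interpret q: quot_module "H k" "act k" "P k" e by (rule quot[OF k(1)])
      have "P k dvd f" using dvd_trans[OF dvd_prodI[of "J - {j}" k P] f(1)] J k by simp
      then obtain c where "f = P k * c" by (auto simp: dvd_def)
      then show ?thesis using q.act_mult[OF k(3)] q.act_P[OF q.act_closed[OF k(3)]] by simp
    qed
    then show ?thesis using f(2) by (intro exI[of _ f]) auto
  qed
  then obtain f where f: "\<And>j k y. j \<in> J \<Longrightarrow> k \<in> J \<Longrightarrow> y \<in> carrier (H k) \<Longrightarrow>
      act k (f j) y = (if k = j then y else \<zero>\<^bsub>H k\<^esub>)" by metis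
  have "\<exists>x. x \<in> const_vecs n \<and> ?lm j x = h j" if "j \<in> J" for j
    using subsetD[OF surj[OF that] PiE_mem[OF h that]] by (auto simp: image_iff)
  then obtain x where x: "\<And>j. j \<in> J \<Longrightarrow> x j \<in> const_vecs n" "\<And>j. j \<in> J \<Longrightarrow> ?lm j (x j) = h j" by metis
  define w where "w = (\<Sum>j\<in>J. vsmult (f j) (x j))"
  have w: "w \<in> pvecs n"
    unfolding w_def
  proof (rule sum_closed)
    show "vsmult (f j) (x j) \<in> pvecs n" if "j \<in> J" for j
      using x(1)[OF that] submodule_setD(2)[OF submodule_pvecs] unfolding const_vecs_def by blast
  qed (use additive_closedD[OF additive_closed_pvecs] in blast)+
  have lw: "?lm k (\<Sum>j\<in>J'. vsmult (f j) (x j)) = (if k \<in> J' then h k else \<zero>\<^bsub>H k\<^esub>)" if "J' \<subseteq> J" "k \<in> J" for J' k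
  proof -
    interpret k: presentation "H k" "act k" "P k" e n "g k" by (rule pres[OF that(2)])
    have hk: "h k \<in> carrier (H k)" by (rule PiE_mem[OF h that(2)])
    have "finite J'" using that(1) J by (rule finite_subset)
    then show ?thesis using that(1)
    proof (induction J')
      case empty
      then show ?case using k.lmap_0 by (simp only: sum.empty empty_iff if_False)
    next
      case (insert j J')
      have j: "j \<in> J" using insert.prems by blast
      have "k.lmap (vsmult (f j) (x j)) = act k (f j) (k.lmap (x j))" by (rule k.lmap_vsmult)
      also have "\<dots> = (if k = j then k.lmap (x j) else \<zero>\<^bsub>H k\<^esub>)" by (rule f[OF j that(2) k.lmap_closed])
      also have "\<dots> = (if k = j then h k else \<zero>\<^bsub>H k\<^esub>)" using x(2)[OF j] by auto
      finally have t: "k.lmap (vsmult (f j) (x j)) = (if k = j then h k else \<zero>\<^bsub>H k\<^esub>)" .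
      have IH: "k.lmap (\<Sum>j\<in>J'. vsmult (f j) (x j)) = (if k \<in> J' then h k else \<zero>\<^bsub>H k\<^esub>)"
        using insert by blast
      show ?case unfolding sum.insert[OF insert.hyps] k.lmap_add t IH
      proof (cases "k = j")
        case True
        then have i: "k \<in> insert j J'" "k \<notin> J'" using insert.hyps(2) by blast+
        show "(if k = j then h k else \<zero>\<^bsub>H k\<^esub>) \<oplus>\<^bsub>H k\<^esub> (if k \<in> J' then h k else \<zero>\<^bsub>H k\<^esub>)
          = (if k \<in> insert j J' then h k else \<zero>\<^bsub>H k\<^esub>)"
          unfolding if_P[OF True] if_P[OF i(1)] if_not_P[OF i(2)] by (rule k.r_zero[OF hk])
      next
        case False
        then show "(if k = j then h k else \<zero>\<^bsub>H k\<^esub>) \<oplus>\<^bsub>H k\<^esub> (if k \<in> J' then h k else \<zero>\<^bsub>H k\<^esub>)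
          = (if k \<in> insert j J' then h k else \<zero>\<^bsub>H k\<^esub>)" using hk by simp
      qed
    qed
  qed
  have lk: "?lm k w = h k" if "k \<in> J" for k unfolding w_def using lw[OF subset_refl that] that by simp
  let ?U = "{y \<in> pvecs n. \<forall>j\<in>J. y \<in> ?K j}"
  have subK: "submodule_set (?K j)" if "j \<in> J" for j by (rule presentation.submodule_K[OF pres[OF that]])
  have U: "submodule_set ?U"
    unfolding submodule_set_def additive_closed_def
    using submodule_setD[OF subK] submodule_setD[OF submodule_pvecs] additive_closedD(1,2)
    by blast
  have colU: "unit_vec_X m - a m \<in> ?U" if "m < n" for m
    using col[OF that] additive_closedD(2)[OF additive_closed_pvecs unit_vec_X_in[OF that]] a[OF that]
    unfolding const_vecs_def by blast
  obtain v where v: "v \<in> const_vecs n" "w - v \<in> ?U"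
    using const_vecs_modulo_columns[OF a U colU w] by blast
  have "?lm j v = h j" if j: "j \<in> J" for j
  proof -
    interpret j: presentation "H j" "act j" "P j" e n "g j" by (rule pres[OF j])
    have "w - v \<in> j.K" using v(2) j by blast
    then have "j.lmap (w - v) = \<zero>\<^bsub>H j\<^esub>" unfolding j.K_def by blast
    then have "j.lmap w = j.lmap v" unfolding j.lmap_eq_iff[symmetric] .
    then show ?thesis using lk[OF j] by simp
  qed
  then show ?thesis using v(1) by blast
qed

section \<open>The limit\<close>

text \<open>Changing \<open>A\<close> by a multiple of \<open>p^(e+1)\<close> alters the columns by
  elements of \<open>N\<close>, which affects neither membership in \<open>K\<close> nor generation
  modulo \<open>N\<close>.\<close>

lemma (in presented_cokernel) solves_mball:
  assumes s: "solves" and A': "A' \<in> mball n (Suc e) A"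
  shows "presented_cokernel.solves H P n g A'"
proof -
  have A'c: "A' \<in> carrier_mat n n" using A' unfolding mball_def by blast
  have pc: "presented_cokernel H P e n g A'"
    by (intro presented_cokernel.intro presented_cokernel_axioms.intro presentation_axioms A'c)
  let ?c = "\<lambda>m. unit_vec_X m - mat_columns n A m" and ?c' = "\<lambda>m. unit_vec_X m - mat_columns n A' m"
  have dN: "?c' m - ?c m \<in> N" if m: "m < n" for m
  proof -
    have "\<exists>z. i < n \<longrightarrow> A $$ (i, m) - A' $$ (i, m) = padic_p ^ Suc e * z" for i
    proof (cases "i < n")
      case True
      then have "residue (A' $$ (i, m)) (Suc e) = residue (A $$ (i, m)) (Suc e)"
        using A' m unfolding mball_def by blast
      then show ?thesis using residue_eq_iff[THEN iffD1, OF sym] by blast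
    qed simp
    then obtain z where z: "\<And>i. i < n \<Longrightarrow> A $$ (i, m) - A' $$ (i, m) = padic_p ^ Suc e * z i"
      using choice[of "\<lambda>i z. i < n \<longrightarrow> A $$ (i, m) - A' $$ (i, m) = padic_p ^ Suc e * z"] by blast
    let ?z = "\<lambda>i. if i < n then [:z i:] else 0"
    have d: "?c' m - ?c m = mat_columns n A m - mat_columns n A' m"
      by (simp only: diff_diff_eq2 diff_add_cancel add_diff_cancel_left diff_add_eq algebra_simps)
    have e: "mat_columns n A m - mat_columns n A' m = vsmult (pconst (Suc e)) ?z"
    proof
      fix i
      show "(mat_columns n A m - mat_columns n A' m) i = vsmult (pconst (Suc e)) ?z i"
      proof (cases "i < n")
        case True
        have "(mat_columns n A m - mat_columns n A' m) i = [:A $$ (i, m) - A' $$ (i, m):]"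
          using True m A A'c by (simp add: mat_columns_def const_pvec_def)
        also have "\<dots> = vsmult (pconst (Suc e)) ?z i" unfolding z[OF True] vsmult_def using True by simp
        finally show ?thesis .
      next
        case False
        then show ?thesis by (simp add: mat_columns_def const_pvec_def)
      qed
    qed
    have "?z \<in> pvecs n" by (simp add: pvecs_def)
    from p_power_in_N[OF this] show ?thesis unfolding d e .
  qed
  have c': "?c' m \<in> K" if m: "m < n" for m
  proof -
    have "?c m \<in> K" using s m unfolding solves_def by blast
    from K_add(4)[OF subsetD[OF N_sub dN[OF m]] this] show ?thesis by simp
  qed
  have "K \<subseteq> U" if U: "submodule_set U" "?c' ` {..<n} \<subseteq> U" "N \<subseteq> U" for U
  proof -
    have "?c m \<in> U" if m: "m < n" for m
    proof -
      have "?c' m \<in> U" using U(2) m by blast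
      from additive_closedD(2)[OF submodule_setD(1)[OF U(1)] this subsetD[OF U(3) dN[OF m]]] show ?thesis by simp
    qed
    then have "?c ` {..<n} \<subseteq> U" by blast
    then show ?thesis using s U(1,3) unfolding solves_def generates_def by blast
  qed
  then have "generates (?c' ` {..<n})" unfolding generates_def by blast
  then show ?thesis
    unfolding presented_cokernel.solves_def[OF pc] using c' s unfolding solves_def by blast
qed

context joint_presentation
begin

lemma column_families_iff:
  assumes a: "a \<in> rep_columns n (Suc e)"
  shows "a \<in> column_families \<and> (\<forall>j\<in>J. ann j (columns a) = {0}) \<longleftrightarrow>
    (\<forall>j\<in>J. columns a \<subseteq> K j \<and> presentation.generates (H j) (act j) (P j) n (g j) (columns a))"
proof -
  have cf: "a \<in> column_families \<longleftrightarrow> (\<forall>j\<in>J. columns a \<subseteq> K j)"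
  proof
    show "\<forall>j\<in>J. columns a \<subseteq> K j" if "a \<in> column_families" by (rule ballI) (rule columns_sub_K[OF that])
    assume c: "\<forall>j\<in>J. columns a \<subseteq> K j"
    show "a \<in> column_families"
    proof (rule PiE_I)
      fix m assume m: "m \<in> {..<n}"
      have "unit_vec_X m - a m \<in> K j" if j: "j \<in> J" for j
        by (rule subsetD[OF bspec[OF c j]]) (unfold columns_def, rule imageI[OF m])
      then show "a m \<in> colset (unit_vec_X m)"
        unfolding colset_def using PiE_mem[OF a m] by (intro CollectI conjI ballI)
    next
      fix m assume "m \<notin> {..<n}"
      then show "a m = undefined" by (rule PiE_arb[OF a])
    qed
  qed
  have gen: "presentation.generates (H j) (act j) (P j) n (g j) (columns a) \<longleftrightarrow> ann j (columns a) = {0}"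
    if "columns a \<subseteq> K j" "j \<in> J" for j
    by (rule presentation.generates_iff_ann[OF pres[OF that(2)] that(1)])
  show ?thesis
  proof (intro iffI conjI ballI)
    assume *: "a \<in> column_families \<and> (\<forall>j\<in>J. ann j (columns a) = {0})"
    fix j assume j: "j \<in> J"
    show sub: "columns a \<subseteq> K j" by (rule columns_sub_K[OF conjunct1[OF *] j])
    show "presentation.generates (H j) (act j) (P j) n (g j) (columns a)"
      by (rule gen[OF sub j, THEN iffD2, OF bspec[OF conjunct2[OF *] j]])
  next
    assume *: "\<forall>j\<in>J. columns a \<subseteq> K j \<and> presentation.generates (H j) (act j) (P j) n (g j) (columns a)"
    show "a \<in> column_families" by (rule cf[THEN iffD2, OF ballI]) (rule conjunct1[OF bspec[OF *]])
    fix j assume j: "j \<in> J"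
    show "ann j (columns a) = {0}"
      by (rule gen[OF conjunct1[OF bspec[OF * j]] j, THEN iffD1, OF conjunct2[OF bspec[OF * j]]])
  qed
qed

lemma card_generating:
  "\<bar>real (card {a \<in> rep_columns n (Suc e). \<forall>j\<in>J. (\<lambda>m. unit_vec_X m - a m) ` {..<n} \<subseteq> K j \<and>
        presentation.generates (H j) (act j) (P j) n (g j) ((\<lambda>m. unit_vec_X m - a m) ` {..<n})})
      - col_count ^ n * (\<Prod>j\<in>J. \<Prod>k<n. 1 - 1 / (real CARD('p) ^ Polynomial.degree (P j)) ^ Suc k)\<bar>
    \<le> col_count ^ n * kappa * (\<Prod>j\<in>J. \<Sum>i\<le>n. (real CARD('p) ^ Polynomial.degree (P j)) ^ i
        / q_fact (real CARD('p) ^ Polynomial.degree (P j)) i)"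
proof -
  have "column_families \<subseteq> rep_columns n (Suc e)" unfolding colset_def by (intro PiE_mono Collect_subset) 
  note sub = this
  have eq: "{a \<in> column_families. \<forall>j\<in>J. ann j (columns a) = {0}}
    = {a \<in> rep_columns n (Suc e). \<forall>j\<in>J. columns a \<subseteq> K j \<and> presentation.generates (H j) (act j) (P j) n (g j) (columns a)}"
  proof (rule Set.set_eqI)
    fix a
    show "a \<in> {a \<in> column_families. \<forall>j\<in>J. ann j (columns a) = {0}} \<longleftrightarrow>
      a \<in> {a \<in> rep_columns n (Suc e). \<forall>j\<in>J. columns a \<subseteq> K j \<and> presentation.generates (H j) (act j) (P j) n (g j) (columns a)}"
    proof (cases "a \<in> rep_columns n (Suc e)")
      case True
      show ?thesis unfolding mem_Collect_eq column_families_iff[OF True] using True by (rule iffI[OF conjI conjunct2])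
    next
      case False
      then have "a \<notin> column_families" using subsetD[OF sub] by (rule contrapos_nn)
      then show ?thesis unfolding mem_Collect_eq using False by (simp only: simp_thms)
    qed
  qed
  show ?thesis using card_generating_columns unfolding eq unfolding columns_def .
qed

end

section \<open>The modules taken together, and tuples whose constants miss part of the
  product\<close>

locale cokernel_family =
  fixes J :: "nat set" and H :: "nat \<Rightarrow> ('p::prime_card padic_int poly set, 'h) module"
    and P :: "nat \<Rightarrow> 'p padic_int poly" and e :: nat
  assumes finite_J: "finite J"
    and quot: "j \<in> J \<Longrightarrow> quot_module (H j) (pact (P j) (H j)) (P j) e"
    and inj_P: "inj_on (\<lambda>j. reduce_poly (P j)) J"
begin

definition order_H :: nat where "order_H = (\<Prod>j\<in>J. card (carrier (H j)))"

abbreviation "act j \<equiv> pact (P j) (H j)"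
abbreviation "L n g j \<equiv> presentation.lmap (H j) (act j) n (g j)"
abbreviation "HJ \<equiv> \<Pi>\<^sub>E j\<in>J. carrier (H j)"

definition gens :: "nat \<Rightarrow> (nat \<Rightarrow> nat \<Rightarrow> 'h) set" where
  "gens n = (\<Pi>\<^sub>E j\<in>J. {..<n} \<rightarrow>\<^sub>E carrier (H j))"

text \<open>The tuples to which the counting of columns applies; every tuple that solves for some
  matrix will turn out to be among them.\<close>

definition surjs :: "nat \<Rightarrow> (nat \<Rightarrow> nat \<Rightarrow> 'h) set" where
  "surjs n = {g \<in> gens n. \<forall>h\<in>HJ. \<exists>v\<in>const_vecs n. \<forall>j\<in>J. L n g j v = h j}"

lemma gens_carrier: "g \<in> gens n \<Longrightarrow> j \<in> J \<Longrightarrow> i < n \<Longrightarrow> g j i \<in> carrier (H j)"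
  unfolding gens_def by (auto dest: PiE_mem)

lemma pres: "g \<in> gens n \<Longrightarrow> j \<in> J \<Longrightarrow> presentation (H j) (act j) (P j) e n (g j)"
  using quot gens_carrier by (auto simp: presentation_def presentation_axioms_def)

lemma finite_carrier: "j \<in> J \<Longrightarrow> finite (carrier (H j))"
  using quot_module.finite_H[OF quot] .

lemma carrier_nonempty: "j \<in> J \<Longrightarrow> carrier (H j) \<noteq> {}"
  using abelian_monoid.zero_closed[OF abelian_group.axioms(1)[OF quot_module.axioms(1)[OF quot]]] by blast

lemma order_H_pos: "0 < order_H"
  unfolding order_H_def using finite_carrier carrier_nonempty by (intro prod_pos) (auto simp: card_gt_0_iff)

lemma card_HJ: "card HJ = order_H" and finite_HJ: "finite HJ"
  unfolding order_H_def using finite_J finite_carrier by (auto simp: card_PiE intro!: finite_PiE)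

lemma finite_gens: "finite (gens n)"
  unfolding gens_def using finite_J finite_carrier by (intro finite_PiE) auto

lemma card_gens: "card (gens n) = order_H ^ n"
  unfolding gens_def order_H_def using finite_J
  by (simp add: card_PiE card_funcsetE prod_power_distrib)

lemma lmap_unit_vec:
  assumes "g \<in> gens n" "j \<in> J" "i < n"
  shows "L n g j (const_pvec n (unit_vec n i)) = g j i"
proof -
  have "presented_cokernel (H j) (P j) e n (g j) (0\<^sub>m n n)"
    by (intro presented_cokernel.intro presented_cokernel_axioms.intro pres assms zero_carrier_mat)
  then show ?thesis using assms(3) by (rule presented_cokernel.lmap_unit)
qed

text \<open>The image of the constants is a subgroup of the product. A missed element gives a
  translate disjoint from it, so it fills at most half of the product; and it contains the images of
  the unit vectors.\<close>

lemma not_surj_image: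
  assumes g: "g \<in> gens n" "g \<notin> surjs n"
  shows "\<exists>S. S \<subseteq> HJ \<and> 2 * card S \<le> order_H \<and> (\<forall>i<n. (\<lambda>j\<in>J. g j i) \<in> S)"
proof -
  let ?f = "\<lambda>v. \<lambda>j\<in>J. L n g j v"
  let ?S = "?f ` const_vecs n"
  have lc: "L n g j v \<in> carrier (H j)" if "j \<in> J" for j v by (rule presentation.lmap_closed[OF pres[OF g(1) that]])
  have S: "?S \<subseteq> HJ" using lc by auto
  have fS: "finite ?S" by (rule finite_subset[OF S finite_HJ])
  obtain y where y: "y \<in> HJ" "\<forall>v\<in>const_vecs n. \<exists>j\<in>J. L n g j v \<noteq> y j"
    using g unfolding surjs_def by blast
  let ?t = "\<lambda>s. \<lambda>j\<in>J. s j \<oplus>\<^bsub>H j\<^esub> y j"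
  have ab: "abelian_group (H j)" if "j \<in> J" for j by (rule quot_module.axioms(1)[OF quot[OF that]])
  have yc: "y j \<in> carrier (H j)" if "j \<in> J" for j using y(1) that by (rule PiE_mem)
  have inj: "inj_on ?t ?S"
  proof (rule inj_onI)
    fix s s' assume s: "s \<in> ?S" "s' \<in> ?S" "?t s = ?t s'"
    have sH: "s \<in> HJ" "s' \<in> HJ" using s(1,2) S by blast+
    show "s = s'"
    proof (rule PiE_ext[OF sH])
      fix j assume j: "j \<in> J"
      interpret a: abelian_group "H j" by (rule ab[OF j])
      have "s j \<oplus>\<^bsub>H j\<^esub> y j = s' j \<oplus>\<^bsub>H j\<^esub> y j" using fun_cong[OF s(3), of j] j by simp
      then show "s j = s' j"
        using a.add.right_cancel[OF yc[OF j] PiE_mem[OF sH(1) j] PiE_mem[OF sH(2) j]] by blast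
    qed
  qed
  have disj: "?t ` ?S \<inter> ?S = {}"
  proof (rule ccontr)
    assume "?t ` ?S \<inter> ?S \<noteq> {}"
    then obtain v v' where v: "v \<in> const_vecs n" "v' \<in> const_vecs n" "?t (?f v) = ?f v'" by blast
    have d: "v' - v \<in> const_vecs n" by (rule additive_closedD(2)[OF additive_closed_const_vecs v(2,1)])
    have "L n g j (v' - v) = y j" if j: "j \<in> J" for j
    proof -
      interpret p: presentation "H j" "act j" "P j" e n "g j" by (rule pres[OF g(1) j])
      have "p.lmap (v' - v) \<oplus>\<^bsub>H j\<^esub> p.lmap v = p.lmap (v' - v + v)" by (rule p.lmap_add[symmetric])
      also have "\<dots> = p.lmap v'" by (simp only: diff_add_cancel)
      also have "\<dots> = p.lmap v \<oplus>\<^bsub>H j\<^esub> y j" using fun_cong[OF v(3), of j] j by simp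
      also have "\<dots> = y j \<oplus>\<^bsub>H j\<^esub> p.lmap v" by (rule p.a_comm[OF p.lmap_closed yc[OF j]])
      finally show ?thesis using p.add.right_cancel[OF p.lmap_closed p.lmap_closed yc[OF j]] by blast
    qed
    then show False using y(2) d by blast
  qed
  have tS: "?t ` ?S \<subseteq> HJ"
  proof (rule image_subsetI)
    fix s assume "s \<in> ?S"
    then have s: "s \<in> HJ" using S by blast
    have "s j \<oplus>\<^bsub>H j\<^esub> y j \<in> carrier (H j)" if j: "j \<in> J" for j
    proof -
      interpret a: abelian_group "H j" by (rule ab[OF j])
      show ?thesis by (rule a.a_closed[OF PiE_mem[OF s j] yc[OF j]])
    qed
    then show "?t s \<in> HJ" by simp
  qed
  have "2 * card ?S = card (?t ` ?S) + card ?S" using card_image[OF inj] by simp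
  also have "\<dots> = card (?t ` ?S \<union> ?S)" using fS disj by (intro card_Un_disjoint[symmetric]) auto
  also have "\<dots> \<le> card HJ" using S tS finite_HJ by (intro card_mono) auto
  finally have "2 * card ?S \<le> order_H" by (simp only: card_HJ)
  moreover have "(\<lambda>j\<in>J. g j i) \<in> ?S" if "i < n" for i
  proof (rule image_eqI)
    show "const_pvec n (unit_vec n i) \<in> const_vecs n" by (rule const_pvec_in)
    show "(\<lambda>j\<in>J. g j i) = ?f (const_pvec n (unit_vec n i))" using lmap_unit_vec[OF g(1) _ that] by (intro restrict_ext) simp
  qed
  ultimately show ?thesis using S by blast
qed

text \<open>Union bound over all subsets of at most half size instead of subgroups: their number is
  bounded by a constant, and each confines \<open>n\<close> elements of the product to half of
  it.\<close>

lemma card_not_surjs: "real (card (gens n - surjs n)) \<le> 2 ^ order_H * (real order_H / 2) ^ n"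
proof -
  let ?F = "{S \<in> Pow HJ. 2 * card S \<le> order_H}"
  let ?G = "\<lambda>S. {g \<in> gens n. \<forall>i<n. (\<lambda>j\<in>J. g j i) \<in> S}"
  have finF: "finite ?F" using finite_HJ by simp
  have cS: "real (card (?G S)) \<le> (real order_H / 2) ^ n" if S: "S \<in> ?F" for S
  proof -
    have fS: "finite S" using S finite_HJ finite_subset by blast
    \<comment> \<open>Transposed indices: \<open>n\<close> elements of the product in place of one
      tuple for each \<open>j\<close>.\<close>
    let ?h = "\<lambda>g. \<lambda>i\<in>{..<n}. \<lambda>j\<in>J. g j i"
    have "inj_on ?h (?G S)"
    proof (rule inj_onI)
      fix g g' assume g: "g \<in> ?G S" "g' \<in> ?G S" "?h g = ?h g'"
      have gg: "g \<in> (\<Pi>\<^sub>E j\<in>J. {..<n} \<rightarrow>\<^sub>E carrier (H j))" "g' \<in> (\<Pi>\<^sub>E j\<in>J. {..<n} \<rightarrow>\<^sub>E carrier (H j))"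
        using g(1,2) unfolding gens_def by blast+
      show "g = g'"
      proof (rule PiE_ext[OF gg])
        fix j assume j: "j \<in> J"
        show "g j = g' j"
        proof (rule PiE_ext[OF PiE_mem[OF gg(1) j] PiE_mem[OF gg(2) j]])
          fix i assume i: "i \<in> {..<n}"
          have "?h g i j = ?h g' i j" by (simp only: g(3))
          then show "g j i = g' j i" using i j by simp
        qed
      qed
    qed
    moreover have "?h ` ?G S \<subseteq> {..<n} \<rightarrow>\<^sub>E S"
    proof (rule image_subsetI)
      fix g assume "g \<in> ?G S"
      then have "\<forall>i<n. (\<lambda>j\<in>J. g j i) \<in> S" by blast
      then show "?h g \<in> {..<n} \<rightarrow>\<^sub>E S" by (simp only: restrict_PiE_iff lessThan_iff) blast
    qed
    moreover have "finite ({..<n} \<rightarrow>\<^sub>E S)" using fS by (intro finite_PiE) auto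
    ultimately have "card (?G S) \<le> card ({..<n} \<rightarrow>\<^sub>E S)" by (rule card_inj_on_le)
    also have "\<dots> = card S ^ n" by (simp add: card_funcsetE)
    finally have "card (?G S) \<le> card S ^ n" .
    from of_nat_mono[OF this, where 'a = real] have "real (card (?G S)) \<le> real (card S) ^ n" by (simp only: of_nat_power)
    also have "\<dots> \<le> (real order_H / 2) ^ n" using S by (intro power_mono) (auto simp: of_nat_le_iff[symmetric] simp del: of_nat_le_iff)
    finally show ?thesis .
  qed
  have "gens n - surjs n \<subseteq> (\<Union>S\<in>?F. ?G S)"
  proof
    fix g assume "g \<in> gens n - surjs n"
    then have g: "g \<in> gens n" "g \<notin> surjs n" by blast+
    then show "g \<in> (\<Union>S\<in>?F. ?G S)" using not_surj_image[OF g] by blast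
  qed
  moreover have "finite (\<Union>S\<in>?F. ?G S)" using finF finite_gens by simp
  ultimately have "card (gens n - surjs n) \<le> card (\<Union>S\<in>?F. ?G S)" by (rule card_mono[rotated])
  also have "\<dots> \<le> (\<Sum>S\<in>?F. card (?G S))" by (rule card_UN_le[OF finF])
  finally have "card (gens n - surjs n) \<le> (\<Sum>S\<in>?F. card (?G S))" .
  from of_nat_mono[OF this, where 'a = real]
  have "real (card (gens n - surjs n)) \<le> (\<Sum>S\<in>?F. real (card (?G S)))" by (simp only: of_nat_sum)
  also have "\<dots> \<le> (\<Sum>S\<in>?F. (real order_H / 2) ^ n)" by (rule sum_mono[OF cS])
  also have "\<dots> = real (card ?F) * (real order_H / 2) ^ n" by simp
  also have "\<dots> \<le> 2 ^ order_H * (real order_H / 2) ^ n"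
  proof (rule mult_right_mono)
    have "card ?F \<le> card (Pow HJ)" by (rule card_mono[OF finite_Pow_iff[THEN iffD2, OF finite_HJ] Collect_subset])
    also have "\<dots> = 2 ^ order_H" using finite_HJ by (simp add: card_Pow card_HJ)
    finally have "card ?F \<le> 2 ^ order_H" .
    from of_nat_mono[OF this, where 'a = real] show "real (card ?F) \<le> 2 ^ order_H"
      by (simp only: of_nat_power of_nat_numeral)
  qed simp
  finally show ?thesis .
qed

end

section \<open>The event and its probability\<close>

context cokernel_family
begin

definition event :: "nat \<Rightarrow> 'p padic_int mat set" where
  "event n = {A \<in> carrier_mat n n. \<forall>j\<in>J. module_isomorphic (poly_quot (P j)) (cok_module (P j) A) (H j)}"

abbreviation "Aut j \<equiv> module_Aut (poly_quot (P j)) (H j)"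
abbreviation "solution n g A \<equiv> \<forall>j\<in>J. presented_cokernel.solves (H j) (P j) n (g j) A"
abbreviation "Q j \<equiv> real CARD('p) ^ Polynomial.degree (P j)"

lemma card_Aut_pos:
  assumes j: "j \<in> J"
  shows "0 < card (Aut j)"
proof -
  interpret q: quot_module "H j" "act j" "P j" e by (rule quot[OF j])
  let ?C = "carrier (H j)"
  have sm: "r \<odot>\<^bsub>H j\<^esub> h \<in> ?C" if r: "r \<in> carrier (poly_quot (P j))" and h: "h \<in> ?C" for r h
  proof -
    obtain f where f: "r = pclass (P j) f" using r unfolding poly_quot_simps(1) by blast
    show ?thesis using q.act_closed[OF h, of f] unfolding pact_def f .
  qed
  have "(\<lambda>x\<in>?C. x) \<in> LinearCombinations.module_hom (poly_quot (P j)) (H j) (H j)"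
    unfolding LinearCombinations.module_hom_def using sm by auto
  moreover have "(\<lambda>x\<in>?C. x) \<in> Bij ?C" unfolding Bij_def by (auto simp: bij_betw_def inj_on_def)
  ultimately have "(\<lambda>x\<in>?C. x) \<in> Aut j" unfolding module_Aut_def by blast
  moreover have "finite (Aut j)"
  proof (rule finite_subset)
    show "Aut j \<subseteq> ?C \<rightarrow>\<^sub>E ?C" unfolding module_Aut_def Bij_def bij_betw_def PiE_def by blast
    show "finite (?C \<rightarrow>\<^sub>E ?C)" using q.finite_H by (intro finite_PiE)
  qed
  ultimately show ?thesis by (auto simp: card_gt_0_iff)
qed

lemma presented:
  assumes "j \<in> J" "g \<in> {..<n} \<rightarrow>\<^sub>E carrier (H j)" "A \<in> carrier_mat n n"
  shows "presented_cokernel (H j) (P j) e n g A"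
proof (intro presented_cokernel.intro presentation.intro presentation_axioms.intro presented_cokernel_axioms.intro)
  show "quot_module (H j) (act j) (P j) e" by (rule quot[OF assms(1)])
  show "A \<in> carrier_mat n n" by (rule assms(3))
  show "g i \<in> carrier (H j)" if "i < n" for i using PiE_mem[OF assms(2), of i] that by simp
qed

lemma isomorphic_iff_solution:
  assumes j: "j \<in> J" and A: "A \<in> carrier_mat n n"
  shows "module_isomorphic (poly_quot (P j)) (cok_module (P j) A) (H j) \<longleftrightarrow>
    (\<exists>g\<in>{..<n} \<rightarrow>\<^sub>E carrier (H j). presented_cokernel.solves (H j) (P j) n g A)"
proof -
  let ?S = "{g \<in> {..<n} \<rightarrow>\<^sub>E carrier (H j). presented_cokernel.solves (H j) (P j) n g A}"
  have "finite ({..<n} \<rightarrow>\<^sub>E carrier (H j))" using finite_carrier[OF j] by (intro finite_PiE) auto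
  then have fin: "finite ?S" by simp
  have "module_isomorphic (poly_quot (P j)) (cok_module (P j) A) (H j) \<longleftrightarrow> card ?S \<noteq> 0"
    unfolding card_solutions[OF quot[OF j] A] using card_Aut_pos[OF j] by simp
  also have "\<dots> \<longleftrightarrow> ?S \<noteq> {}" unfolding card_eq_0_iff using fin by blast
  finally show ?thesis by blast
qed

text \<open>Isomorphism is witnessed by a tuple that solves, and the same tuple still solves after a
  change of the matrix modulo \<open>p^(e+1)\<close>.\<close>

lemma event_stable:
  assumes "A \<in> event n"
  shows "mball n (Suc e) A \<subseteq> event n"
proof
  fix B assume B: "B \<in> mball n (Suc e) A"
  have A: "A \<in> carrier_mat n n" using assms unfolding event_def by blast
  have Bc: "B \<in> carrier_mat n n" using B unfolding mball_def by blast
  have "module_isomorphic (poly_quot (P j)) (cok_module (P j) B) (H j)" if j: "j \<in> J" for j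
  proof -
    obtain g where g: "g \<in> {..<n} \<rightarrow>\<^sub>E carrier (H j)" "presented_cokernel.solves (H j) (P j) n g A"
      using assms j unfolding event_def using isomorphic_iff_solution[OF j A] by blast
    from presented_cokernel.solves_mball[OF presented[OF j g(1) A] g(2) B]
    show ?thesis unfolding isomorphic_iff_solution[OF j Bc] by (rule bexI[OF _ g(1)])
  qed
  then show "B \<in> event n" unfolding event_def using Bc by blast
qed

text \<open>The condition is separate for each \<open>j\<close>, so the tuples form a product, and
  one failing component contributes the factor 0.\<close>

lemma card_joint_solutions:
  assumes A: "A \<in> carrier_mat n n"
  shows "real (card {g \<in> gens n. solution n g A}) = of_bool (A \<in> event n) * (\<Prod>j\<in>J. real (card (Aut j)))"
proof -
  let ?iso = "\<lambda>j. module_isomorphic (poly_quot (P j)) (cok_module (P j) A) (H j)"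
  let ?S = "\<lambda>j. {g \<in> {..<n} \<rightarrow>\<^sub>E carrier (H j). presented_cokernel.solves (H j) (P j) n g A}"
  have "{g \<in> gens n. solution n g A} = (\<Pi>\<^sub>E j\<in>J. ?S j)"
    unfolding gens_def PiE_def Pi_def by blast
  then have "card {g \<in> gens n. solution n g A} = (\<Prod>j\<in>J. card (?S j))" by (simp only: card_PiE[OF finite_J])
  also have "\<dots> = (\<Prod>j\<in>J. if ?iso j then card (Aut j) else 0)"
    by (rule prod.cong[OF refl]) (rule card_solutions[OF quot A])
  finally have c: "card {g \<in> gens n. solution n g A} = (\<Prod>j\<in>J. if ?iso j then card (Aut j) else 0)" .
  show ?thesis
  proof (cases "A \<in> event n")
    case True
    then have "\<forall>j\<in>J. ?iso j" unfolding event_def by blast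
    then have "(\<Prod>j\<in>J. if ?iso j then card (Aut j) else 0) = (\<Prod>j\<in>J. card (Aut j))" by (intro prod.cong) auto
    then show ?thesis unfolding c using True by simp
  next
    case False
    then obtain j where "j \<in> J" "\<not> ?iso j" using A unfolding event_def by blast
    then have "(\<Prod>j\<in>J. if ?iso j then card (Aut j) else 0) = 0" using finite_J by (intro prod_zero) auto
    then show ?thesis unfolding c using False by simp
  qed
qed

lemma rep_columns_const: "a \<in> rep_columns n k \<Longrightarrow> m < n \<Longrightarrow> a m \<in> const_vecs n"
  for a :: "nat \<Rightarrow> 'p pvec"
proof -
  assume a: "a \<in> rep_columns n k" and m: "m < n"
  have "mat_columns n (rep_mat n a) m \<in> const_vecs n" unfolding mat_columns_def by (rule const_pvec_in)
  then show ?thesis unfolding mat_columns_rep_mat[OF a m] .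
qed

lemma solves_rep_mat:
  assumes j: "j \<in> J" and g: "g \<in> gens n" and a: "a \<in> rep_columns n k"
  shows "presented_cokernel.solves (H j) (P j) n (g j) (rep_mat n a) \<longleftrightarrow>
    (\<lambda>m. unit_vec_X m - a m) ` {..<n} \<subseteq> presentation.K (H j) (act j) n (g j) \<and>
    carrier (H j) \<subseteq> L n g j ` const_vecs n \<and>
    presentation.generates (H j) (act j) (P j) n (g j) ((\<lambda>m. unit_vec_X m - a m) ` {..<n})"
proof -
  have pc: "presented_cokernel (H j) (P j) e n (g j) (rep_mat n a)"
    by (rule presented[OF j _ rep_mat_carrier]) (rule PiE_mem[OF g[unfolded gens_def] j])
  have "(\<lambda>m. unit_vec_X m - mat_columns n (rep_mat n a) m) ` {..<n} = (\<lambda>m. unit_vec_X m - a m) ` {..<n}"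
    by (rule image_cong[OF refl]) (simp only: mat_columns_rep_mat[OF a] lessThan_iff)
  then show ?thesis unfolding presented_cokernel.solves_def[OF pc] by (simp only:)
qed

text \<open>Solving gives surjectivity on constants for each component; Chinese remaindering makes
  it joint.\<close>

lemma solution_surj:
  assumes g: "g \<in> gens n" and a: "a \<in> rep_columns n k" and s: "solution n g (rep_mat n a)"
  shows "g \<in> surjs n"
proof -
  have "\<exists>v\<in>const_vecs n. \<forall>j\<in>J. L n g j v = h j" if h: "h \<in> HJ" for h
  proof (rule joint_surjI[OF finite_J pres[OF g] inj_P rep_columns_const[OF a] _ _ h])
    fix j assume j: "j \<in> J"
    note sj = bspec[OF s j, unfolded solves_rep_mat[OF j g a]]
    show "unit_vec_X m - a m \<in> presentation.K (H j) (act j) n (g j)" if "m < n" for m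
      by (rule subsetD[OF conjunct1[OF sj] imageI]) (simp add: that)
    show "carrier (H j) \<subseteq> L n g j ` const_vecs n" by (rule conjunct1[OF conjunct2[OF sj]])
  qed
  then show ?thesis unfolding surjs_def using g by blast
qed

lemma joint:
  assumes "g \<in> surjs n"
  shows "joint_presentation J H act P e n g"
proof (rule joint_presentation.intro)
  have g: "g \<in> gens n" using assms unfolding surjs_def by blast
  show "finite J" by (rule finite_J)
  show "inj_on (\<lambda>j. reduce_poly (P j)) J" by (rule inj_P)
  show "presentation (H j) (act j) (P j) e n (g j)" if "j \<in> J" for j by (rule pres[OF g that])
  show "\<exists>v\<in>const_vecs n. \<forall>j\<in>J. L n g j v = h j" if "h \<in> HJ" for h using assms that unfolding surjs_def by blast
qed

lemma Q_ge_2: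
  assumes j: "j \<in> J"
  shows "2 \<le> Q j"
proof -
  have p: "2 \<le> real CARD('p)" using prime_ge_2_nat[OF prime_card[where 'a = 'p]] by simp
  have "0 < Polynomial.degree (P j)"
    by (rule irreducible_degree_pos[OF quot_module.irred[OF quot[OF j]] quot_module.monic[OF quot[OF j]]])
  then have "real CARD('p) \<le> Q j" using p by (intro self_le_power) auto
  then show ?thesis by (rule order_trans[OF p])
qed

abbreviation "\<theta> n \<equiv> \<Prod>j\<in>J. \<Prod>k<n. 1 - 1 / Q j ^ Suc k"
abbreviation "C0 \<equiv> \<Prod>j\<in>J. \<Sum>i. Q j ^ i / q_fact (Q j) i"
abbreviation "col_num n \<equiv> real CARD('p) ^ (Suc e * n) / real order_H"

text \<open>For such \<open>g\<close> surjectivity on constants is automatic, so solving means that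
  the columns lie in the kernels and generate. The partial sums are replaced by full series to make
  the error constant independent of \<open>n\<close>.\<close>

lemma card_solutions_surj:
  assumes g: "g \<in> surjs n"
  shows "\<bar>real (card {a \<in> rep_columns n (Suc e). solution n g (rep_mat n a)}) - col_num n ^ n * \<theta> n\<bar>
    \<le> col_num n ^ n * (real order_H / real CARD('p) ^ n) * C0"
proof -
  interpret jp: joint_presentation J H act P e n g by (rule joint[OF g])
  have gg: "g \<in> gens n" using g unfolding surjs_def by blast
  let ?c = "\<lambda>a :: nat \<Rightarrow> 'p pvec. (\<lambda>m. unit_vec_X m - a m) ` {..<n}"
  have sj: "carrier (H j) \<subseteq> L n g j ` const_vecs n" if "j \<in> J" for j
  proof
    fix h assume "h \<in> carrier (H j)"
    then show "h \<in> L n g j ` const_vecs n"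
      using surj_presentation.surj[OF jp.surj_pres[OF that]] unfolding const_vecs_def[symmetric] by blast
  qed
  have eq: "{a \<in> rep_columns n (Suc e). solution n g (rep_mat n a)}
    = {a \<in> rep_columns n (Suc e). \<forall>j\<in>J. ?c a \<subseteq> presentation.K (H j) (act j) n (g j) \<and>
        presentation.generates (H j) (act j) (P j) n (g j) (?c a)}"
  proof (rule Collect_cong, rule conj_cong[OF refl], rule ball_cong[OF refl])
    fix a :: "nat \<Rightarrow> 'p pvec" and j assume "a \<in> rep_columns n (Suc e)" "j \<in> J"
    then show "presented_cokernel.solves (H j) (P j) n (g j) (rep_mat n a) \<longleftrightarrow>
      (?c a \<subseteq> presentation.K (H j) (act j) n (g j) \<and> presentation.generates (H j) (act j) (P j) n (g j) (?c a))"
      using solves_rep_mat[OF _ gg] sj by (simp only: simp_thms)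
  qed
  have o: "jp.order_H = order_H" by (simp only: jp.order_H_def order_H_def)
  have "(\<Prod>j\<in>J. \<Sum>i\<le>n. Q j ^ i / q_fact (Q j) i) \<le> C0"
  proof (rule prod_mono)
    fix j assume j: "j \<in> J"
    have "0 < q_fact (Q j) i" for i using q_fact_pos Q_ge_2[OF j] by simp
    then have "0 \<le> (\<Sum>i\<le>n. Q j ^ i / q_fact (Q j) i)" by (intro sum_nonneg divide_nonneg_pos) auto
    then show "0 \<le> (\<Sum>i\<le>n. Q j ^ i / q_fact (Q j) i) \<and> (\<Sum>i\<le>n. Q j ^ i / q_fact (Q j) i) \<le> (\<Sum>i. Q j ^ i / q_fact (Q j) i)"
      using q_fact_inverse_sum_le[OF Q_ge_2[OF j]] by blast
  qed
  then have "col_num n ^ n * (real order_H / real CARD('p) ^ n) * (\<Prod>j\<in>J. \<Sum>i\<le>n. Q j ^ i / q_fact (Q j) i)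
    \<le> col_num n ^ n * (real order_H / real CARD('p) ^ n) * C0" by (rule mult_left_mono) simp
  with jp.card_generating show ?thesis unfolding eq jp.col_count_def jp.kappa_def o by (rule order_trans)
qed

lemma \<theta>_bounds: "0 \<le> \<theta> n" "\<theta> n \<le> 1"
proof -
  have "0 \<le> 1 - 1 / Q j ^ Suc k \<and> 1 - 1 / Q j ^ Suc k \<le> 1" if "j \<in> J" for j k
  proof -
    have "1 \<le> Q j ^ Suc k" using Q_ge_2[OF that] by (intro one_le_power) simp
    then show ?thesis by simp
  qed
  note b = this
  have "0 \<le> (\<Prod>k<n. 1 - 1 / Q j ^ Suc k) \<and> (\<Prod>k<n. 1 - 1 / Q j ^ Suc k) \<le> 1" if j: "j \<in> J" for j
    by (rule conjI[OF prod_nonneg[OF conjunct1[OF b[OF j]]] prod_le_1[OF b[OF j]]])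
  note b = this
  show "0 \<le> \<theta> n" by (rule prod_nonneg[OF conjunct1[OF b]])
  show "\<theta> n \<le> 1" by (rule prod_le_1[OF b])
qed

text \<open>\<open>T\<close> is the number of matrices and \<open>G\<close> that of tuples, of which
  \<open>s\<close> are considered; \<open>T / G * t\<close> approximates the count for one tuple
  with relative error \<open>b\<close>, and \<open>d\<close> bounds the fraction of tuples left
  out.\<close>

lemma density_estimate:
  fixes X T G s t b d :: real
  assumes "0 < T" "0 < G" "0 \<le> s" "s \<le> G" "0 \<le> t" "t \<le> 1" "0 \<le> b"
    and X: "\<bar>X - s * (T / G * t)\<bar> \<le> s * (T / G * b)" and d: "G - s \<le> d * G"
  shows "\<bar>X / T - t\<bar> \<le> b + d"
proof -
  have "X / T - s / G * t = (X - s * (T / G * t)) / T" using assms(1,2) by (simp add: field_simps)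
  then have "\<bar>X / T - s / G * t\<bar> = \<bar>X - s * (T / G * t)\<bar> / T" using assms(1) by simp
  also have "\<dots> \<le> s * (T / G * b) / T" using X assms(1) by (intro divide_right_mono) auto
  also have "\<dots> = s / G * b" using assms(1) by simp
  also have "\<dots> \<le> 1 * b" using assms(2,4,7) by (intro mult_right_mono) auto
  finally have 1: "\<bar>X / T - s / G * t\<bar> \<le> b" by simp
  have sd: "1 - s / G \<le> d" "0 \<le> 1 - s / G" using assms(2,4) d by (simp_all add: field_simps)
  have "\<bar>s / G * t - t\<bar> = \<bar>- ((1 - s / G) * t)\<bar>" by (simp only: left_diff_distrib mult_1 minus_diff_eq)
  also have "\<dots> = (1 - s / G) * t" using sd(2) assms(5) by (simp only: abs_minus_cancel abs_of_nonneg mult_nonneg_nonneg)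
  also have "\<dots> \<le> (1 - s / G) * 1" using sd(2) assms(6) by (intro mult_left_mono) auto
  finally have "\<bar>s / G * t - t\<bar> \<le> 1 - s / G" by (simp only: mult_1_right)
  from order_trans[OF this sd(1)] have "\<bar>s / G * t - t\<bar> \<le> d" .
  then show ?thesis using 1 by linarith
qed

lemma C0_nonneg: "0 \<le> C0"
proof (rule prod_nonneg)
  fix j assume j: "j \<in> J"
  have "0 \<le> (\<Sum>i\<le>0. Q j ^ i / q_fact (Q j) i)" using q_fact_pos[of "Q j" 0] Q_ge_2[OF j] by simp
  then show "0 \<le> (\<Sum>i. Q j ^ i / q_fact (Q j) i)"
    using q_fact_inverse_sum_le[OF Q_ge_2[OF j], of 0] by linarith
qed

text \<open>Pairs of a matrix modulo \<open>p^(e+1)\<close> and a tuple that solves are counted in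
  two ways: each matrix in the event has \<open>\<Prod>j\<in>J. card (Aut j)\<close> tuples, and
  each tuple in \<open>surjs n\<close> has about \<open>col_num n ^ n * \<theta> n\<close>
  matrices.\<close>

theorem event_bound:
  "\<bar>(\<Prod>j\<in>J. real (card (Aut j))) * measure (haar_prob n) (event n) - \<theta> n\<bar>
    \<le> real order_H * C0 / real CARD('p) ^ n + 2 ^ order_H / 2 ^ n"
proof -
  let ?A = "\<Prod>j\<in>J. real (card (Aut j))"
  let ?W = "rep_columns n (Suc e) :: (nat \<Rightarrow> 'p pvec) set"
  let ?N = "\<lambda>g. real (card {a \<in> ?W. solution n g (rep_mat n a)})"
  define T where "T = real ((CARD('p) ^ (Suc e * n)) ^ n)"
  define c where "c = col_num n ^ n"
  define k where "k = real order_H / real CARD('p) ^ n"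
  define s where "s = real (card (surjs n))"
  define G where "G = real order_H ^ n"
  have T: "0 < T" unfolding T_def by (simp add: prime_gt_0_nat prime_card)
  have G: "0 < G" unfolding G_def using order_H_pos by simp
  \<comment> \<open>The order of the product cancels between the candidates for \<open>n\<close>
    columns and the tuples of length \<open>n\<close>, leaving the number of matrices modulo
    \<open>p^(e+1)\<close>.\<close>
  have cG: "c * G = T" unfolding c_def G_def T_def using order_H_pos by (simp add: power_divide)
  have fS: "surjs n \<subseteq> gens n" unfolding surjs_def by blast
  have event_sub: "event n \<subseteq> carrier_mat n n" unfolding event_def by blast
  have "?A * real (card {a \<in> ?W. rep_mat n a \<in> event n}) = (\<Sum>a\<in>?W. of_bool (rep_mat n a \<in> event n) * ?A)"
    unfolding card_filter_of_bool[OF finite_rep_columns] by (simp only: sum_distrib_left mult.commute)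
  also have "\<dots> = (\<Sum>a\<in>?W. \<Sum>g\<in>gens n. of_bool (solution n g (rep_mat n a)))"
    unfolding card_joint_solutions[OF rep_mat_carrier, symmetric] card_filter_of_bool[OF finite_gens] ..
  also have "\<dots> = (\<Sum>g\<in>gens n. ?N g)"
    unfolding card_filter_of_bool[OF finite_rep_columns] by (rule sum.swap)
  also have "\<dots> = (\<Sum>g\<in>surjs n. ?N g)"
  proof (rule sum.mono_neutral_right[OF finite_gens fS])
    show "\<forall>g\<in>gens n - surjs n. ?N g = 0"
    proof
      fix g assume "g \<in> gens n - surjs n"
      then have "{a \<in> ?W. solution n g (rep_mat n a)} = {}" using solution_surj[of g n _ "Suc e"] by blast
      then show "?N g = 0" by (simp only: card.empty of_nat_0)
    qed
  qed
  finally have cnt: "?A * real (card {a \<in> ?W. rep_mat n a \<in> event n}) = (\<Sum>g\<in>surjs n. ?N g)" .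
  have haar: "measure (haar_prob n) (event n) = real (card {a \<in> ?W. rep_mat n a \<in> event n}) / T"
    unfolding T_def by (rule haar_prob_eq_count[OF event_sub event_stable])
  have m: "?A * measure (haar_prob n) (event n) = (\<Sum>g\<in>surjs n. ?N g) / T"
    unfolding haar cnt[symmetric] by (rule times_divide_eq_right)
  have "\<bar>(\<Sum>g\<in>surjs n. ?N g) - s * (c * \<theta> n)\<bar> = \<bar>\<Sum>g\<in>surjs n. ?N g - c * \<theta> n\<bar>"
    unfolding s_def by (simp only: sum_subtractf sum_constant)
  also have "\<dots> \<le> (\<Sum>g\<in>surjs n. \<bar>?N g - c * \<theta> n\<bar>)" by (rule sum_abs)
  also have "\<dots> \<le> (\<Sum>g\<in>surjs n. c * k * C0)"
    unfolding c_def k_def by (rule sum_mono) (rule card_solutions_surj)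
  also have "\<dots> = s * (c * k * C0)" unfolding s_def by (simp only: sum_constant)
  finally have b1: "\<bar>(\<Sum>g\<in>surjs n. ?N g) - s * (c * \<theta> n)\<bar> \<le> s * (c * k * C0)" .
  have sG: "s \<le> G"
    using card_mono[OF finite_gens fS] unfolding s_def G_def card_gens of_nat_power[symmetric] by (rule of_nat_mono)
  have kC: "0 \<le> k * C0"
    unfolding k_def by (rule mult_nonneg_nonneg[OF divide_nonneg_nonneg C0_nonneg]) simp_all
  have le: "card (surjs n) \<le> order_H ^ n" using card_mono[OF finite_gens fS] unfolding card_gens .
  have GS: "real (card (gens n - surjs n)) = G - s"
    unfolding G_def s_def card_Diff_subset[OF finite_subset[OF fS finite_gens] fS] card_gens of_nat_diff[OF le] of_nat_power ..
  have d: "G - s \<le> 2 ^ order_H / 2 ^ n * G"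
    using card_not_surjs[of n] unfolding GS unfolding G_def by (simp add: power_divide)
  have c: "c = T / G" using cG G by (simp add: eq_divide_eq)
  have b: "\<bar>(\<Sum>g\<in>surjs n. ?N g) - s * (T / G * \<theta> n)\<bar> \<le> s * (T / G * (k * C0))"
    using b1 unfolding c mult.assoc .
  have s0: "0 \<le> s" unfolding s_def by (rule of_nat_0_le_iff)
  have "k * C0 = real order_H * C0 / real CARD('p) ^ n" unfolding k_def by (rule times_divide_eq_left)
  with density_estimate[OF T G s0 sG \<theta>_bounds kC b d] show ?thesis unfolding m by (simp only:)
qed

text \<open>Of the two error terms, the first stems from bad lists and the second from tuples
  outside \<open>surjs n\<close>; both decay geometrically in \<open>n\<close>.\<close>

theorem event_limit:
  "(\<lambda>n. measure (haar_prob n) (event n)) \<longlonglongrightarrow> (\<Prod>j\<in>J. 1 / real (card (Aut j)) * (\<Prod>k. 1 - 1 / Q j ^ Suc k))"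
proof -
  let ?A = "\<Prod>j\<in>J. real (card (Aut j))"
  let ?m = "\<lambda>n. measure (haar_prob n) (event n)"
  let ?l = "\<Prod>j\<in>J. \<Prod>k. 1 - 1 / Q j ^ Suc k"
  have A: "?A \<noteq> 0" using finite_J card_Aut_pos by (simp add: prod_zero_iff)
  have "1 < real CARD('p)" using prime_gt_1_nat[OF prime_card[where 'a = 'p]] by simp
  then have "(\<lambda>n. real order_H * C0 / real CARD('p) ^ n + 2 ^ order_H / 2 ^ n) \<longlonglongrightarrow> 0 + 0"
    by (intro tendsto_add LIMSEQ_divide_realpow_zero) auto
  then have "(\<lambda>n. real order_H * C0 / real CARD('p) ^ n + 2 ^ order_H / 2 ^ n) \<longlonglongrightarrow> 0" by simp
  then have "(\<lambda>n. ?A * ?m n - \<theta> n) \<longlonglongrightarrow> 0"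
    by (rule Lim_null_comparison[rotated]) (simp only: real_norm_def event_bound eventually_True)
  moreover have "(\<lambda>n. \<theta> n) \<longlonglongrightarrow> ?l"
  proof (rule tendsto_prod)
    fix j assume j: "j \<in> J"
    have "1 < Q j" using Q_ge_2[OF j] by simp
    then show "(\<lambda>n. \<Prod>k<n. 1 - 1 / Q j ^ Suc k) \<longlonglongrightarrow> (\<Prod>k. 1 - 1 / Q j ^ Suc k)" by (rule q_pochhammer_LIMSEQ)
  qed
  ultimately have "(\<lambda>n. ?A * ?m n - \<theta> n + \<theta> n) \<longlonglongrightarrow> 0 + ?l" by (rule tendsto_add)
  then have "(\<lambda>n. ?A * ?m n) \<longlonglongrightarrow> ?l" by (simp only: diff_add_cancel add_0_left)
  then have "(\<lambda>n. ?A * ?m n / ?A) \<longlonglongrightarrow> ?l / ?A" using A by (intro tendsto_divide tendsto_const)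
  moreover have "?A * ?m n / ?A = ?m n" for n using A by simp
  moreover have "?l / ?A = (\<Prod>j\<in>J. 1 / real (card (Aut j)) * (\<Prod>k. 1 - 1 / Q j ^ Suc k))"
    unfolding prod.distrib prod_dividef by simp
  ultimately show ?thesis by (simp only:)
qed

end

theorem theorem1p2:
  fixes l :: nat
    and P :: "nat \<Rightarrow> 'p::prime_card padic_int poly"
    and H :: "nat \<Rightarrow> ('p padic_int poly set, 'h) module"
  assumes "l \<ge> 1"
    and "\<And>j. j \<in> {1..l} \<Longrightarrow> lead_coeff (P j) = 1"
    and "\<And>j. j \<in> {1..l} \<Longrightarrow> irreducible (map_poly padic_reduce (P j))"
    and "inj_on (\<lambda>j. map_poly padic_reduce (P j)) {1..l}"
    and "\<And>j. j \<in> {1..l} \<Longrightarrow> Module.module (poly_quot (P j)) (H j)"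
    and "\<And>j. j \<in> {1..l} \<Longrightarrow> finite (carrier (H j))"
  shows "(\<lambda>n. measure (haar_prob n)
            {A \<in> carrier_mat n n. \<forall>j\<in>{1..l}.
               module_isomorphic (poly_quot (P j)) (cok_module (P j) A) (H j)})
         \<longlonglongrightarrow> (\<Prod>j\<in>{1..l}. 1 / real (card (module_Aut (poly_quot (P j)) (H j)))
               * (\<Prod>i. 1 - 1 / real CARD('p) ^ (Suc i * Polynomial.degree (P j))))"
proof -
  have "\<exists>e0. \<forall>e\<ge>e0. \<forall>h\<in>carrier (H j). pact (P j) (H j) (pconst e) h = \<zero>\<^bsub>H j\<^esub>" if "j \<in> {1..l}" for j
    by (rule pact_p_power[OF assms(5)[OF that] assms(6)[OF that]])
  then obtain e0 where e0: "\<And>j e h. j \<in> {1..l} \<Longrightarrow> e0 j \<le> e \<Longrightarrow> h \<in> carrier (H j) \<Longrightarrow>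
      pact (P j) (H j) (pconst e) h = \<zero>\<^bsub>H j\<^esub>" by metis
  \<comment> \<open>A common exponent for the finitely many modules: larger powers of
    \<open>p\<close> still annihilate.\<close>
  define e where "e = Max (e0 ` {1..l})"
  have e: "e0 j \<le> e" if "j \<in> {1..l}" for j unfolding e_def using that by (intro Max_ge) auto
  interpret cokernel_family "{1..l}" H P e
  proof (rule cokernel_family.intro)
    show "quot_module (H j) (pact (P j) (H j)) (P j) e" if j: "j \<in> {1..l}" for j
      by (rule quot_module_pact[OF assms(5)[OF j] assms(6)[OF j] e0[OF j e[OF j]] assms(2)[OF j] assms(3)[OF j]])
  qed (rule finite_atLeastAtMost, rule assms(4))
  have "real CARD('p) ^ (Suc i * Polynomial.degree (P j)) = Q j ^ Suc i" for i j
    unfolding power_mult[symmetric] by (simp only: mult.commute)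
  then show ?thesis using event_limit unfolding event_def by (simp only:)
qed

end
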